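(* Let $W=(W_t)_{t\ge0}$ be a Markov-modulated Lévy process with Markov-modulator $J=(J_t)_{t\ge0}$ on $\mathcal N=\{1,\dots,N\}$, parametrized by $\varpi$, $\Pi$, $\Psi(z)$, $\Upsilon(z)$, and let $\Phi$, $V$, $T$, $\mathcal S$, $\mathcal I$, $\mathcal A(z)$ be as in the context. Suppose that $\Pr(T<\infty)=1$ and that $\Pi$ is irreducible. If the equation $\zeta(\mathcal A(s))=0$ admits a positive solution $s=\alpha$ in the interior of $\mathcal I$, then \[0<\liminf_{w\to\infty}e^{\alpha w}\Pr(W_T>w)\le\limsup_{w\to\infty}e^{\alpha w}\Pr(W_T>w)<\infty.\] Similarly, if the equation $\zeta(\mathcal A(s))=0$ admits a negative solution $s=-\beta$ in the interior of $\mathcal I$, then \[0<\liminf_{w\to\infty}e^{\beta w}\Pr(W_T<-w)\le\limsup_{w\to\infty}e^{\beta w}\Pr(W_T<-w)<\infty.\]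
   Context: For a real random variable $X$, its MGF $M_X(z)=E(e^{zX})$ has domain $\{z\in\mathbb C: E(e^{(\operatorname{Re}z)X})<\infty\}$. A Lévy exponent of a Lévy process $L$ is $\psi(z)=\log E(e^{zL_1})$ (principal branch), with domain that of the MGF of $L_1$. A Markov-modulated Lévy process $W$ with Markov-modulator $J$ (a càdlàg time-homogeneous Markov process on $\mathcal N=\{1,\dots,N\}$) is specified by: an $N\times1$ vector $\varpi$ of initial probabilities $\Pr(J_0=n)=\varpi_n$; an infinitesimal generator $\Pi=(\pi_{nn'})$ with nonnegative off-diagonal entries and zero row sums (transition rates $\pi_{nn'}$, $n\neq n'$); a diagonal matrix $\Psi(z)$ with Lévy exponents $\psi_n(z)$ on the diagonal; and a matrix $\Upsilon(z)$ with ones on the diagonal and MGFs $\upsilon_{nn'}(z)$ off the diagonal ($\upsilon_{nn'}\equiv1$ if $\pi_{nn'}=0$). Given $J$, with $t_0=0$ and $t_1,t_2,\dots$ the successive transition times of $J$, $W_0=0$ and $W$ evolves as a Lévy process with exponent $\psi_n$ on each interval $(t_k,t_{k+1})$ with $J_{t_k}=n$, and at a transition from $n$ to $n'$ it jumps by an independent amount with MGF $\upsilon_{nn'}$. Let $\Phi$ be diagonal with nonnegative entries $\phi_n$. Let $V$ be a process with $V_0=0$ which, given $J$, evolves as a Poisson process of intensity $\phi_n$ on each interval $(t_k,t_{k+1})$ with $J_{t_k}=n$, is a.s. continuous at the transition times, and is conditionally independent of $W$ given $J$. Let $T=\inf\{t\ge0:V_t>0\}$. Let $\mathcal S$ be the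 intersection of the domains of all $\psi_n$ and all $\upsilon_{nn'}$ (a vertical strip), and $\mathcal I=\{\operatorname{Re}z:z\in\mathcal S\}$ (an interval containing $0$). For $z\in\mathcal S$ set $\mathcal A(z)=\Psi(z)+\Pi\odot\Upsilon(z)-\Phi$, where $\odot$ is the entrywise product. For a square complex matrix $A$, $\zeta(A)$ (spectral abscissa) is the maximum real part of its eigenvalues. A matrix $(a_{nn'})$ is irreducible if for every nonempty proper subset $\mathcal M\subset\mathcal N$ there are $n\in\mathcal M$, $n'\notin\mathcal M$ with $a_{nn'}\neq0$. *)

theory Defs
  imports "HOL-Probability.Probability" "Jordan_Normal_Form.Char_Poly"
begin

(* States of the modulator are 0,...,N-1 (relabelling of 1,...,N). *)

definition cadlag :: "(real \<Rightarrow> 'b::topological_space) \<Rightarrow> bool" where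
  "cadlag f \<longleftrightarrow> (\<forall>t\<ge>0. continuous (at_right t) f) \<and> (\<forall>t>0. \<exists>l. (f \<longlongrightarrow> l) (at_left t))"

definition left_lim :: "(real \<Rightarrow> 'b::t2_space) \<Rightarrow> real \<Rightarrow> 'b" where
  "left_lim f t = Lim (at_left t) f"

definition trans_times :: "(real \<Rightarrow> nat) \<Rightarrow> real \<Rightarrow> real \<Rightarrow> real set" where
  "trans_times j a b = {tau \<in> {a<..b}. left_lim j tau \<noteq> j tau}"

definition mat_exp :: "real \<Rightarrow> real mat \<Rightarrow> real mat" where
  "mat_exp t A = mat (dim_row A) (dim_col A)
     (\<lambda>(i,j). (\<Sum>k. ((t \<cdot>\<^sub>m A) ^\<^sub>m k) $$ (i,j) / fact k))"

definition spectral_abscissa :: "complex mat \<Rightarrow> real" where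
  "spectral_abscissa A = Max (Re ` {l. eigenvalue A l})"

definition irreducible_mat :: "nat \<Rightarrow> 'a::zero mat \<Rightarrow> bool" where
  "irreducible_mat N A \<longleftrightarrow> (\<forall>S. S \<noteq> {} \<and> S \<subset> {0..<N} \<longrightarrow>
      (\<exists>n\<in>S. \<exists>n'\<in>{0..<N} - S. A $$ (n,n') \<noteq> 0))"

definition generator :: "nat \<Rightarrow> real mat \<Rightarrow> bool" where
  "generator N Gen \<longleftrightarrow> Gen \<in> carrier_mat N N \<and>
     (\<forall>n<N. \<forall>n'<N. n \<noteq> n' \<longrightarrow> Gen $$ (n,n') \<ge> 0) \<and>
     (\<forall>n<N. (\<Sum>n'<N. Gen $$ (n,n')) = 0)"

definition mgf :: "real measure \<Rightarrow> real \<Rightarrow> real" where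
  "mgf mu s = (\<integral>x. exp (s * x) \<partial>mu)"

text \<open>Real parts of the common strip S (the interval I): all MGFs finite.
  mu n is the law of L_1 for the Levy process in state n, nu n n' the jump law.\<close>
definition strip_I :: "nat \<Rightarrow> (nat \<Rightarrow> real measure) \<Rightarrow> (nat \<Rightarrow> nat \<Rightarrow> real measure) \<Rightarrow> real set" where
  "strip_I N mu nu = {s. (\<forall>n<N. integrable (mu n) (\<lambda>x. exp (s * x))) \<and>
      (\<forall>n<N. \<forall>n'<N. n \<noteq> n' \<longrightarrow> integrable (nu n n') (\<lambda>x. exp (s * x)))}"

text \<open>The matrix A(s) = Psi(s) + Gen o Upsilon(s) - Phi for real s, with
  psi_n(s) = ln (MGF of L_1 at s) (principal log of a positive real).\<close>
definition A_mat :: "nat \<Rightarrow> real mat \<Rightarrow> (nat \<Rightarrow> real measure) \<Rightarrow> (nat \<Rightarrow> nat \<Rightarrow> real measure)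
     \<Rightarrow> (nat \<Rightarrow> real) \<Rightarrow> real \<Rightarrow> real mat" where
  "A_mat N Gen mu nu phi s = mat N N (\<lambda>(n,n').
      if n = n' then ln (mgf (mu n) s) + Gen $$ (n,n) - phi n
      else Gen $$ (n,n') * mgf (nu n n') s)"

definition markov_chain :: "'a measure \<Rightarrow> nat \<Rightarrow> (nat \<Rightarrow> real) \<Rightarrow> real mat \<Rightarrow> (real \<Rightarrow> 'a \<Rightarrow> nat) \<Rightarrow> bool" where
  "markov_chain M N varpi Gen J \<longleftrightarrow>
     (\<forall>t. J t \<in> measurable M (count_space UNIV)) \<and>
     (\<forall>\<omega>\<in>space M. cadlag (\<lambda>t. J t \<omega>) \<and> (\<forall>t\<ge>0. J t \<omega> < N)) \<and>
     (\<forall>(k::nat) (t::nat \<Rightarrow> real) (c::nat \<Rightarrow> nat).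
        t 0 = 0 \<and> (\<forall>j<k. t j \<le> t (Suc j)) \<and> (\<forall>j\<le>k. c j < N) \<longrightarrow>
        measure M {\<omega>\<in>space M. \<forall>j\<le>k. J (t j) \<omega> = c j}
          = varpi (c 0) * (\<Prod>j\<in>{1..k}. mat_exp (t j - t (j - 1)) Gen $$ (c (j - 1), c j)))"

text \<open>Conditional law of (W,V) given J, stated through the joint conditional
  characteristic function of the increments of W and V over a grid
  0 = s_0 <= ... <= s_k, tested against the cylinder events of J (which
  generate sigma(J)). psi n th is the characteristic exponent psi_n(i th) of
  the Levy process in state n; nu n n' the law of the jump at a transition
  n -> n'; phi n the Poisson intensity of V in state n. The product form
  expresses that, given J, W and V are independent, have independent
  increments, W evolves as the Levy process psi_(J_t) between transitions
  and jumps with law nu at transitions, and V is a Poisson process with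
  intensity phi_(J_t).\<close>
definition mm_levy_cond :: "'a measure \<Rightarrow> (real \<Rightarrow> 'a \<Rightarrow> nat) \<Rightarrow> (real \<Rightarrow> 'a \<Rightarrow> real) \<Rightarrow> (real \<Rightarrow> 'a \<Rightarrow> real)
     \<Rightarrow> (nat \<Rightarrow> real \<Rightarrow> complex) \<Rightarrow> (nat \<Rightarrow> nat \<Rightarrow> real measure) \<Rightarrow> (nat \<Rightarrow> real) \<Rightarrow> bool" where
  "mm_levy_cond M J W V psi nu phi \<longleftrightarrow>
     (\<forall>(k::nat) (s::nat \<Rightarrow> real) (th::nat \<Rightarrow> real) (et::nat \<Rightarrow> real)
        (m::nat) (r::nat \<Rightarrow> real) (c::nat \<Rightarrow> nat).
        s 0 = 0 \<and> (\<forall>j<k. s j \<le> s (Suc j)) \<and> (\<forall>l<m. r l \<ge> 0) \<longrightarrow>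
        (let B = {\<omega>\<in>space M. \<forall>l<m. J (r l) \<omega> = c l} in
         (\<integral>\<omega>. indicator B \<omega> *
             exp (\<i> * complex_of_real (\<Sum>j\<in>{1..k}.
                th j * (W (s j) \<omega> - W (s (j - 1)) \<omega>) + et j * (V (s j) \<omega> - V (s (j - 1)) \<omega>))) \<partial>M)
         = (\<integral>\<omega>. indicator B \<omega> *
             (\<Prod>j\<in>{1..k}.
                exp (integral {s (j - 1)..s j}
                   (\<lambda>u. psi (J u \<omega>) (th j) + complex_of_real (phi (J u \<omega>)) * (exp (\<i> * complex_of_real (et j)) - 1)))
                * (\<Prod>tau\<in>trans_times (\<lambda>u. J u \<omega>) (s (j - 1)) (s j).
                     char (nu (left_lim (\<lambda>u. J u \<omega>) tau) (J tau \<omega>)) (th j))) \<partial>M)))"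

definition mm_model :: "'a measure \<Rightarrow> nat \<Rightarrow> (nat \<Rightarrow> real) \<Rightarrow> real mat \<Rightarrow> (nat \<Rightarrow> real measure)
     \<Rightarrow> (nat \<Rightarrow> real \<Rightarrow> complex) \<Rightarrow> (nat \<Rightarrow> nat \<Rightarrow> real measure) \<Rightarrow> (nat \<Rightarrow> real)
     \<Rightarrow> (real \<Rightarrow> 'a \<Rightarrow> nat) \<Rightarrow> (real \<Rightarrow> 'a \<Rightarrow> real) \<Rightarrow> (real \<Rightarrow> 'a \<Rightarrow> real) \<Rightarrow> bool" where
  "mm_model M N varpi Gen mu psi nu phi J W V \<longleftrightarrow>
     prob_space M \<and> generator N Gen \<and>
     (\<forall>n<N. varpi n \<ge> 0) \<and> (\<Sum>n<N. varpi n) = 1 \<and>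
     (\<forall>n<N. phi n \<ge> 0) \<and>
     (\<comment> \<open>Levy exponents: mu n is the law of L_1, psi n its continuous characteristic exponent\<close>
      \<forall>n<N. prob_space (mu n) \<and> sets (mu n) = sets borel \<and> continuous_on UNIV (psi n) \<and> psi n 0 = 0 \<and>
        (\<forall>th. char (mu n) th = exp (psi n th))) \<and>
     (\<forall>n<N. \<forall>n'<N. n \<noteq> n' \<longrightarrow> prob_space (nu n n') \<and> sets (nu n n') = sets borel \<and>
        (Gen $$ (n,n') = 0 \<longrightarrow> nu n n' = return borel 0)) \<and>
     markov_chain M N varpi Gen J \<and>
     (\<forall>t. W t \<in> borel_measurable M \<and> V t \<in> borel_measurable M) \<and>
     (\<forall>\<omega>\<in>space M. W 0 \<omega> = 0 \<and> V 0 \<omega> = 0 \<and> cadlag (\<lambda>t. W t \<omega>) \<and> cadlag (\<lambda>t. V t \<omega>)) \<and>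
     mm_levy_cond M J W V psi nu phi"

definition first_pos :: "(real \<Rightarrow> 'a \<Rightarrow> real) \<Rightarrow> 'a \<Rightarrow> ereal" where
  "first_pos V \<omega> = Inf {ereal t | t. t \<ge> 0 \<and> V t \<omega> > 0}"

end

theory Submission
  imports Defs
begin

text \<open>The law of \<open>W\<close> at \<open>T \<and> R\<close> is the weak limit, as \<open>h \<rightarrow> 0\<close>, of the laws of a discrete
  Markov-additive chain which in one step of length \<open>h\<close> is killed with probability \<open>h \<phi>\<^sub>n\<close>, jumps to
  \<open>n'\<close> with probability \<open>h \<pi>\<^sub>n\<^sub>n'\<close>, and otherwise moves by an \<open>h\<close>-th convolution root of the
  Levy law of state \<open>n\<close>. Its tail functions satisfy a positive linear recursion. By Perron-Frobenius
  theory \<open>A(\<alpha>)\<close> has a positive null vector \<open>v\<close>, so \<open>v\<^sub>n exp (\<alpha> x)\<close> is invariant under the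
  recursion up to a factor \<open>1 + O(h\<^sup>2)\<close>. Perturbing the exponent \<open>\<alpha>\<close> slightly (log-convexity of the
  entries of \<open>A\<close>) gives strict sub- and supersolutions, which correct this function to an upper and
  a lower barrier for the tails, uniformly in \<open>h\<close> and \<open>R\<close> apart from an error decaying
  exponentially in \<open>R\<close>. The left tail is the right tail of \<open>-W\<close>.\<close>

section \<open>Perron vectors of irreducible Metzler matrices\<close>

lemma metzler_strict_growth:
  fixes A :: "nat \<Rightarrow> nat \<Rightarrow> real" and x :: "nat \<Rightarrow> real"
  assumes metz: "\<And>i j. i < N \<Longrightarrow> j < N \<Longrightarrow> i \<noteq> j \<Longrightarrow> A i j \<ge> 0"
    and irr: "\<And>S. S \<noteq> {} \<Longrightarrow> S \<subset> {0..<N} \<Longrightarrow> \<exists>i\<in>S. \<exists>j\<in>{0..<N} - S. A i j \<noteq> 0"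
    and pos: "\<And>i. i < N \<Longrightarrow> x i > 0"
    and le: "\<And>i. i < N \<Longrightarrow> (\<Sum>j<N. A i j * x j) \<le> r * x i"
    and i0: "i0 < N" "(\<Sum>j<N. A i0 j * x j) < r * x i0"
  shows "\<exists>y. (\<forall>i<N. y i > 0) \<and> (\<forall>i<N. (\<Sum>j<N. A i j * y j) < r * y i)"
proof -
  define strict where "strict y = {i. i < N \<and> (\<Sum>j<N. A i j * y j) < r * y i}" for y
  define feas where "feas y \<longleftrightarrow> (\<forall>i<N. y i > 0) \<and> (\<forall>i<N. (\<Sum>j<N. A i j * y j) \<le> r * y i)" for y
  have fin: "finite (strict y)" for y unfolding strict_def by simp
  have card_le: "card (strict y) \<le> N" for y
    using card_mono[of "{..<N}" "strict y"] by (auto simp: strict_def)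
  define P where "P k \<longleftrightarrow> (\<exists>y. feas y \<and> card (strict y) = k)" for k
  have P0: "P (card (strict x))" unfolding P_def feas_def using pos le by auto
  have Pb: "\<forall>k. P k \<longrightarrow> k \<le> N" unfolding P_def using card_le by auto
  define k where "k = (GREATEST k. P k)"
  have "P k" unfolding k_def using P0 Pb by (metis GreatestI_nat)
  have kmax: "j \<le> k" if "P j" for j unfolding k_def using that Pb by (metis Greatest_le_nat)
  obtain y where y: "feas y" "card (strict y) = k" using \<open>P k\<close> unfolding P_def by auto
  have "i0 \<in> strict x" using i0 by (simp add: strict_def)
  hence "card (strict x) > 0" by (metis card_gt_0_iff empty_iff fin)
  hence "k > 0" using kmax[OF P0] by simp
  hence ne: "strict y \<noteq> {}" using y by auto
  define T where "T = strict y"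
  have TN: "T \<subseteq> {0..<N}" by (auto simp: T_def strict_def)
  show ?thesis
  proof (cases "T = {0..<N}")
    case True
    then have "\<forall>i<N. i \<in> strict y" unfolding T_def by simp
    hence "\<forall>i<N. (\<Sum>j<N. A i j * y j) < r * y i" by (simp add: strict_def)
    then show ?thesis using y(1) unfolding feas_def by blast
  next
    case False
    hence "{0..<N} - T \<noteq> {}" "{0..<N} - T \<subset> {0..<N}" using TN ne T_def by auto
    from irr[OF this] obtain i j where ij: "i \<in> {0..<N} - T" "j \<in> {0..<N} - ({0..<N} - T)" "A i j \<noteq> 0" by blast
    hence iN: "i < N" "i \<notin> T" and jT: "j \<in> T" "j < N" by auto
    hence Aij: "A i j > 0" using metz[of i j] ij by force
    define z where "z e l = (if l \<in> T then y l - e else y l)" for e :: real and l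
    have sumz: "(\<Sum>j<N. A l j * z e j) = (\<Sum>j<N. A l j * y j) - e * (\<Sum>j\<in>T. A l j)" for e l
    proof -
      have "(\<Sum>j<N. A l j * z e j) = (\<Sum>j<N. A l j * y j - (if j \<in> T then e * A l j else 0))"
        by (rule sum.cong) (auto simp: z_def algebra_simps)
      also have "\<dots> = (\<Sum>j<N. A l j * y j) - (\<Sum>j\<in>{..<N} \<inter> T. e * A l j)"
        by (simp add: sum_subtractf sum.inter_restrict)
      also have "{..<N} \<inter> T = T" using TN by auto
      finally show ?thesis by (simp add: sum_distrib_left)
    qed
    have ev: "\<forall>\<^sub>F e in at_right 0. \<forall>l\<in>T. z e l > 0 \<and> (\<Sum>j<N. A l j * z e j) < r * z e l"
    proof (rule eventually_ball_finite)
      show "finite T" using fin T_def by simp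
      show "\<forall>l\<in>T. \<forall>\<^sub>F e in at_right 0. z e l > 0 \<and> (\<Sum>j<N. A l j * z e j) < r * z e l"
      proof
        fix l assume l: "l \<in> T"
        hence lN: "l < N" and sl: "0 < r * y l - (\<Sum>j<N. A l j * y j)" using T_def strict_def by auto
        have "y l > 0" using y lN by (auto simp: feas_def)
        have t1: "((\<lambda>e. z e l) \<longlongrightarrow> y l - 0) (at_right 0)" unfolding z_def if_P[OF l]
          by (intro tendsto_intros)
        have t2: "((\<lambda>e. r * z e l - (\<Sum>j<N. A l j * z e j)) \<longlongrightarrow> r * (y l - 0) - ((\<Sum>j<N. A l j * y j) - 0 * (\<Sum>j\<in>T. A l j))) (at_right 0)"
          unfolding sumz by (intro tendsto_intros t1)
        have "\<forall>\<^sub>F e in at_right 0. z e l > 0" using order_tendstoD(1)[OF t1, of 0] \<open>y l > 0\<close> by simp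
        moreover have "\<forall>\<^sub>F e in at_right 0. r * z e l - (\<Sum>j<N. A l j * z e j) > 0"
          using order_tendstoD(1)[OF t2, of 0] sl by simp
        ultimately show "\<forall>\<^sub>F e in at_right 0. z e l > 0 \<and> (\<Sum>j<N. A l j * z e j) < r * z e l"
          by eventually_elim auto
      qed
    qed
    have "\<forall>\<^sub>F e in at_right (0::real). e > 0" by (simp add: eventually_at_right_less)
    with ev have "\<forall>\<^sub>F e in at_right 0. e > 0 \<and> (\<forall>l\<in>T. z e l > 0 \<and> (\<Sum>j<N. A l j * z e j) < r * z e l)"
      by eventually_elim auto
    from eventually_happens'[OF _ this]
    obtain e where e: "e > 0" "\<And>l. l \<in> T \<Longrightarrow> z e l > 0 \<and> (\<Sum>j<N. A l j * z e j) < r * z e l"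
      by auto
    have out: "(\<Sum>j<N. A l j * z e j) \<le> r * z e l" if "l < N" "l \<notin> T" for l
    proof -
      have "(\<Sum>j\<in>T. A l j) \<ge> 0" using that TN metz by (intro sum_nonneg) force
      hence "(\<Sum>j<N. A l j * z e j) \<le> (\<Sum>j<N. A l j * y j)" using sumz e(1) by simp
      also have "\<dots> \<le> r * y l" using y that by (auto simp: feas_def)
      finally show ?thesis using that by (simp add: z_def)
    qed
    have "(\<Sum>j\<in>T. A i j) > 0"
      using iN jT Aij TN metz by (intro sum_pos2[of T j]) (force simp: T_def fin)+
    hence "(\<Sum>j<N. A i j * z e j) < (\<Sum>j<N. A i j * y j)" using sumz e(1) by simp
    also have "\<dots> \<le> r * y i" using y iN by (auto simp: feas_def)
    finally have istr: "(\<Sum>j<N. A i j * z e j) < r * z e i" using iN by (simp add: z_def)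
    have fz: "feas (z e)"
      unfolding feas_def
    proof (intro conjI allI impI)
      fix l assume "l < N"
      then show "z e l > 0" using e(2)[of l] y(1) by (cases "l \<in> T") (auto simp: feas_def z_def)
      show "(\<Sum>j<N. A l j * z e j) \<le> r * z e l" using e(2)[of l] out[of l] \<open>l < N\<close> by (cases "l \<in> T") auto
    qed
    have "insert i T \<subseteq> strict (z e)" using e(2) istr iN TN by (auto simp: strict_def)
    hence "card (insert i T) \<le> card (strict (z e))" by (intro card_mono fin)
    moreover have "card (insert i T) = Suc k" using iN y T_def fin by simp
    ultimately have "Suc k \<le> card (strict (z e))" by simp
    moreover have "card (strict (z e)) \<le> k" using kmax fz P_def by auto
    ultimately show ?thesis by simp
  qed
qed

lemma bounded_family_convergent_subseq:
  fixes X :: "nat \<Rightarrow> nat \<Rightarrow> real"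
  assumes "\<And>k i. i < N \<Longrightarrow> X k i \<in> {0..1}"
  shows "\<exists>\<sigma> l. strict_mono (\<sigma> :: nat \<Rightarrow> nat) \<and> (\<forall>i<N. (\<lambda>k. X (\<sigma> k) i) \<longlonglongrightarrow> l i)"
  using assms
proof (induction N)
  case 0
  show ?case by (rule exI[of _ id]) (auto simp: strict_mono_def)
next
  case (Suc N)
  then obtain \<sigma> l where s: "strict_mono (\<sigma> :: nat \<Rightarrow> nat)" "\<forall>i<N. (\<lambda>k. X (\<sigma> k) i) \<longlonglongrightarrow> l i"
    using less_SucI by blast
  have "seq_compact {0..1::real}" by (simp add: compact_imp_seq_compact)
  moreover have "\<forall>k. X (\<sigma> k) N \<in> {0..1}" using Suc.prems by auto
  ultimately obtain a \<tau> where t: "strict_mono (\<tau> :: nat \<Rightarrow> nat)" "((\<lambda>k. X (\<sigma> k) N) \<circ> \<tau>) \<longlonglongrightarrow> a"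
    using seq_compactE[of "{0..1::real}" "\<lambda>k. X (\<sigma> k) N"] by metis
  have "(\<lambda>k. X ((\<sigma> \<circ> \<tau>) k) i) \<longlonglongrightarrow> (l(N := a)) i" if "i < Suc N" for i
  proof (cases "i = N")
    case True then show ?thesis using t(2) by (simp add: o_def)
  next
    case False
    hence "(\<lambda>k. X (\<sigma> k) i) \<longlonglongrightarrow> l i" using s that by auto
    from LIMSEQ_subseq_LIMSEQ[OF this t(1)] show ?thesis using False by (simp add: o_def)
  qed
  moreover have "strict_mono (\<sigma> \<circ> \<tau>)" using s t by (simp add: strict_mono_o)
  ultimately show ?case by blast
qed

lemma metzler_perron:
  fixes A :: "nat \<Rightarrow> nat \<Rightarrow> real"
  assumes N: "N > 0"
    and metz: "\<And>i j. i < N \<Longrightarrow> j < N \<Longrightarrow> i \<noteq> j \<Longrightarrow> A i j \<ge> 0"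
    and irr: "\<And>S. S \<noteq> {} \<Longrightarrow> S \<subset> {0..<N} \<Longrightarrow> \<exists>i\<in>S. \<exists>j\<in>{0..<N} - S. A i j \<noteq> 0"
  shows "\<exists>r x. (\<forall>i<N. x i > 0) \<and> (\<forall>i<N. (\<Sum>j<N. A i j * x j) = r * x i)"
proof -
  define Q where "Q r x \<longleftrightarrow> (\<forall>i<N. x i > 0) \<and> (\<Sum>i<N. x i) = 1 \<and> (\<forall>i<N. (\<Sum>j<N. A i j * x j) \<le> r * x i)"
    for r and x :: "nat \<Rightarrow> real"
  define F where "F = {r. \<exists>x. Q r x}"
  have normal: "\<exists>x. Q r x" if "\<forall>i<N. y i > 0" "\<forall>i<N. (\<Sum>j<N. A i j * y j) \<le> r * y i" for r y
  proof -
    define c where "c = (\<Sum>i<N. y i)"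
    have c: "c > 0" unfolding c_def using that N by (intro sum_pos) auto
    have "(\<Sum>j<N. A i j * (y j / c)) \<le> r * (y i / c)" if "i < N" for i
    proof -
      have "(\<Sum>j<N. A i j * (y j / c)) = (\<Sum>j<N. A i j * y j) / c" by (simp add: sum_divide_distrib)
      also have "\<dots> \<le> r * y i / c" using \<open>\<forall>i<N. (\<Sum>j<N. A i j * y j) \<le> r * y i\<close> that c
        by (intro divide_right_mono) auto
      finally show ?thesis by simp
    qed
    moreover have "(\<Sum>i<N. y i / c) = 1" using c by (simp add: sum_divide_distrib[symmetric] c_def[symmetric])
    ultimately have "Q r (\<lambda>i. y i / c)" using that c unfolding Q_def by auto
    then show ?thesis by blast
  qed
  have "(\<Sum>i<N. \<Sum>j<N. \<bar>A i j\<bar>) \<in> F"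
    unfolding F_def mem_Collect_eq
  proof (rule normal[of "\<lambda>_. 1"], safe)
    fix i assume "i < N"
    have "(\<Sum>j<N. A i j) \<le> (\<Sum>j<N. \<bar>A i j\<bar>)" by (intro sum_mono) auto
    also have "\<dots> \<le> (\<Sum>i<N. \<Sum>j<N. \<bar>A i j\<bar>)"
      using \<open>i < N\<close> by (intro member_le_sum[of i "{..<N}" "\<lambda>i. \<Sum>j<N. \<bar>A i j\<bar>"]) (auto intro: sum_nonneg)
    finally show "(\<Sum>j<N. A i j * 1) \<le> (\<Sum>i<N. \<Sum>j<N. \<bar>A i j\<bar>) * 1" by simp
  qed simp
  hence Fne: "F \<noteq> {}" by auto
  have lb: "A 0 0 \<le> r" if "r \<in> F" for r
  proof -
    from that obtain x where x: "Q r x" by (auto simp: F_def)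
    hence x0: "x 0 > 0" using N by (auto simp: Q_def)
    have "A 0 0 * x 0 = (\<Sum>j\<in>{0}. A 0 j * x j)" by simp
    also have "\<dots> \<le> (\<Sum>j<N. A 0 j * x j)"
      using N x metz by (intro sum_mono2) (auto simp: Q_def less_imp_le)
    also have "\<dots> \<le> r * x 0" using x N by (auto simp: Q_def)
    finally show ?thesis using x0 by simp
  qed
  have bdd: "bdd_below F" using lb by (meson bdd_belowI)
  define r where "r = Inf F"
  have "\<exists>rk. rk \<in> F \<and> rk < r + 1 / real (Suc k)" for k
  proof -
    have "Inf F < r + 1 / real (Suc k)" by (simp add: r_def)
    then show ?thesis using cInf_less_iff[OF Fne bdd] by auto
  qed
  then obtain rk where rk: "\<And>k. rk k \<in> F" "\<And>k. rk k < r + 1 / real (Suc k)" by metis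
  then obtain X where X: "\<And>k. Q (rk k) (X k)" using choice[of "\<lambda>k x. Q (rk k) x"] unfolding F_def by blast
  have rkr: "rk \<longlonglongrightarrow> r"
  proof (rule tendsto_sandwich[of "\<lambda>_. r" _ _ "\<lambda>k. r + 1 / real (Suc k)"])
    show "\<forall>\<^sub>F k in sequentially. r \<le> rk k" unfolding r_def by (intro always_eventually allI cInf_lower rk bdd)
    show "\<forall>\<^sub>F k in sequentially. rk k \<le> r + 1 / real (Suc k)" by (intro always_eventually allI less_imp_le rk)
    show "(\<lambda>k. r + 1 / real (Suc k)) \<longlonglongrightarrow> r" using LIMSEQ_inverse_real_of_nat_add[of r] by (simp add: field_simps inverse_eq_divide)
  qed simp
  have X01: "X k i \<in> {0..1}" if "i < N" for k i
  proof -
    have "X k i \<le> (\<Sum>i<N. X k i)"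
      using X[of k] that by (intro member_le_sum) (auto simp: Q_def less_imp_le)
    then show ?thesis using X[of k] that by (auto simp: Q_def less_imp_le)
  qed
  obtain \<sigma> x where s: "strict_mono (\<sigma> :: nat \<Rightarrow> nat)" "\<And>i. i < N \<Longrightarrow> (\<lambda>k. X (\<sigma> k) i) \<longlonglongrightarrow> x i"
    using bounded_family_convergent_subseq[of N X, OF X01] by blast
  have rs: "(\<lambda>k. rk (\<sigma> k)) \<longlonglongrightarrow> r" using LIMSEQ_subseq_LIMSEQ[OF rkr s(1)] by (simp add: o_def)
  have x_nonneg: "x i \<ge> 0" if "i < N" for i
    by (rule LIMSEQ_le_const[OF s(2)[OF that]]) (use X that in \<open>auto simp: Q_def less_imp_le\<close>)
  have "(\<lambda>k. \<Sum>i<N. X (\<sigma> k) i) \<longlonglongrightarrow> (\<Sum>i<N. x i)" by (intro tendsto_sum s) auto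
  moreover have "(\<lambda>k. \<Sum>i<N. X (\<sigma> k) i) = (\<lambda>k. 1)" using X by (auto simp: Q_def)
  ultimately have sumx: "(\<Sum>i<N. x i) = 1" using LIMSEQ_unique tendsto_const by metis
  have Ax: "(\<Sum>j<N. A i j * x j) \<le> r * x i" if "i < N" for i
  proof (rule LIMSEQ_le)
    show "(\<lambda>k. \<Sum>j<N. A i j * X (\<sigma> k) j) \<longlonglongrightarrow> (\<Sum>j<N. A i j * x j)"
      by (intro tendsto_sum tendsto_mult tendsto_const s) auto
    show "(\<lambda>k. rk (\<sigma> k) * X (\<sigma> k) i) \<longlonglongrightarrow> r * x i" by (intro tendsto_mult rs s that)
    show "\<exists>n0. \<forall>k\<ge>n0. (\<Sum>j<N. A i j * X (\<sigma> k) j) \<le> rk (\<sigma> k) * X (\<sigma> k) i" using X that by (auto simp: Q_def)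
  qed
  have x_pos: "x i > 0" if "i < N" for i
  proof (rule ccontr)
    assume "\<not> x i > 0"
    define S where "S = {i. i < N \<and> x i = 0}"
    have "i \<in> S" using that \<open>\<not> x i > 0\<close> x_nonneg[OF that] by (simp add: S_def)
    moreover have "S \<noteq> {0..<N}" 
    proof
      assume "S = {0..<N}"
      hence "\<forall>i\<in>{..<N}. x i = 0" by (auto simp: S_def set_eq_iff)
      hence "(\<Sum>i<N. x i) = 0" by simp
      thus False using sumx by simp
    qed
    ultimately have "S \<noteq> {}" "S \<subset> {0..<N}" by (auto simp: S_def)
    then obtain i j where ij: "i \<in> S" "j \<in> {0..<N} - S" "A i j \<noteq> 0" using irr by meson
    have nn: "A i l * x l \<ge> 0" if "l < N" for l
      using metz[of i l] x_nonneg[of l] ij that by (cases "i = l") (auto simp: S_def)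
    have "A i j > 0" using ij metz[of i j] by (force simp: S_def)
    moreover have "x j > 0" using ij x_nonneg[of j] by (auto simp: S_def)
    ultimately have "0 < A i j * x j" by simp
    also have "\<dots> \<le> (\<Sum>l<N. A i l * x l)" using ij nn by (intro member_le_sum) auto
    also have "\<dots> \<le> r * x i" using Ax[of i] ij(1) unfolding S_def by blast
    finally show False using ij by (simp add: S_def)
  qed
  have "(\<Sum>j<N. A i j * x j) = r * x i" if "i < N" for i
  proof (rule ccontr)
    assume "(\<Sum>j<N. A i j * x j) \<noteq> r * x i"
    hence "(\<Sum>j<N. A i j * x j) < r * x i" using Ax[OF that] by simp
    from metzler_strict_growth[OF metz irr x_pos Ax that this]
    obtain y where y: "\<forall>i<N. y i > 0" "\<forall>i<N. (\<Sum>j<N. A i j * y j) < r * y i" by blast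
    define r' where "r' = Max ((\<lambda>i. (\<Sum>j<N. A i j * y j) / y i) ` {..<N})"
    have "r' \<in> (\<lambda>i. (\<Sum>j<N. A i j * y j) / y i) ` {..<N}" unfolding r'_def using N by (intro Max_in) auto
    hence "r' < r" using y by (auto simp: divide_less_eq mult.commute)
    moreover have "(\<Sum>j<N. A i j * y j) \<le> r' * y i" if "i < N" for i
    proof -
      have "(\<Sum>j<N. A i j * y j) / y i \<le> r'" unfolding r'_def using that by (intro Max_ge) auto
      then show ?thesis using y that by (simp add: divide_le_eq mult.commute)
    qed
    hence "r' \<in> F" using normal[of y r'] y by (auto simp: F_def)
    hence "r \<le> r'" unfolding r_def using bdd by (rule cInf_lower)
    ultimately show False by simp
  qed
  then show ?thesis using x_pos by blast
qed

lemma metzler_eigenvalue_Re_le: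
  fixes A :: "nat \<Rightarrow> nat \<Rightarrow> real" and v :: "nat \<Rightarrow> complex"
  assumes metz: "\<And>i j. i < N \<Longrightarrow> j < N \<Longrightarrow> i \<noteq> j \<Longrightarrow> A i j \<ge> 0"
    and pos: "\<And>i. i < N \<Longrightarrow> x i > 0"
    and eq: "\<And>i. i < N \<Longrightarrow> (\<Sum>j<N. A i j * x j) = r * x i"
    and ev: "\<And>i. i < N \<Longrightarrow> (\<Sum>j<N. of_real (A i j) * v j) = l * v i"
    and nz: "k < N" "v k \<noteq> 0"
  shows "Re l \<le> r"
proof -
  have "finite ((\<lambda>i. cmod (v i) / x i) ` {..<N})" "(\<lambda>i. cmod (v i) / x i) ` {..<N} \<noteq> {}" using nz by auto
  from Max_in[OF this] obtain i where i: "i < N" "cmod (v i) / x i = Max ((\<lambda>i. cmod (v i) / x i) ` {..<N})"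
    by auto
  define t where "t = cmod (v i) / x i"
  have t: "cmod (v j) \<le> t * x j" if "j < N" for j
  proof -
    have "cmod (v j) / x j \<le> t" unfolding t_def i(2) using that by (intro Max_ge) auto
    then show ?thesis using pos[OF that] by (simp add: divide_le_eq)
  qed
  have "0 < cmod (v k) / x k" using nz pos by simp
  also have "\<dots> \<le> t" unfolding t_def i(2) using nz by (intro Max_ge) auto
  finally have "t > 0" .
  hence vi: "cmod (v i) > 0" using i pos[OF i(1)] by (auto simp: t_def)
  have "(l - of_real (A i i)) * v i = (\<Sum>j\<in>{..<N}-{i}. of_real (A i j) * v j)"
    using ev[OF i(1)] i(1) by (simp add: sum.remove[of "{..<N}" i] algebra_simps)
  hence "cmod (l - of_real (A i i)) * cmod (v i) \<le> (\<Sum>j\<in>{..<N}-{i}. cmod (of_real (A i j) * v j))"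
    by (metis norm_mult norm_sum)
  also have "\<dots> \<le> (\<Sum>j\<in>{..<N}-{i}. A i j * (t * x j))"
    using metz[OF i(1)] t by (intro sum_mono) (auto simp: norm_mult intro!: mult_mono)
  also have "\<dots> = t * ((\<Sum>j<N. A i j * x j) - A i i * x i)"
    using i(1) by (simp add: sum.remove[of "{..<N}" i] sum_distrib_left algebra_simps)
  also have "\<dots> = (r - A i i) * cmod (v i)"
    using eq[OF i(1)] pos[OF i(1)] by (simp add: t_def field_simps)
  finally have "cmod (l - of_real (A i i)) \<le> r - A i i" using vi by simp
  moreover have "Re l - A i i \<le> cmod (l - of_real (A i i))"
    using complex_Re_le_cmod[of "l - of_real (A i i)"] by simp
  ultimately show ?thesis by simp
qed

lemma spectral_abscissa_eq_perron:
  fixes A :: "real mat"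
  assumes A: "A \<in> carrier_mat N N" and N: "N > 0"
    and metz: "\<And>i j. i < N \<Longrightarrow> j < N \<Longrightarrow> i \<noteq> j \<Longrightarrow> A $$ (i,j) \<ge> 0"
    and pos: "\<And>i. i < N \<Longrightarrow> x i > 0"
    and eq: "\<And>i. i < N \<Longrightarrow> (\<Sum>j<N. A $$ (i,j) * x j) = r * x i"
  shows "spectral_abscissa (map_mat complex_of_real A) = r"
proof -
  let ?C = "map_mat complex_of_real A"
  have C: "?C \<in> carrier_mat N N" using A by simp
  have mv: "(?C *\<^sub>v v) $ i = (\<Sum>j<N. of_real (A $$ (i,j)) * v $ j)" if "i < N" "v \<in> carrier_vec N" for v i
    using that A by (auto simp: scalar_prod_def row_def intro!: sum.cong)
  have Re_le: "Re l \<le> r" if "eigenvalue ?C l" for l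
  proof -
    from that obtain v where v: "v \<in> carrier_vec N" "v \<noteq> 0\<^sub>v N" "?C *\<^sub>v v = l \<cdot>\<^sub>v v"
      using C by (auto simp: eigenvalue_def eigenvector_def)
    then obtain k where k: "k < N" "v $ k \<noteq> 0" by (metis carrier_vecD eq_vecI index_zero_vec)
    show ?thesis
    proof (rule metzler_eigenvalue_Re_le[where A="\<lambda>i j. A $$ (i,j)" and v="\<lambda>i. v $ i", OF metz pos eq _ k])
      fix i assume "i < N"
      then show "(\<Sum>j<N. of_real (A $$ (i,j)) * v $ j) = l * v $ i"
        using mv[OF \<open>i < N\<close> v(1)] v by simp
    qed
  qed
  let ?x = "vec N (\<lambda>i. complex_of_real (x i))"
  have "?C *\<^sub>v ?x = of_real r \<cdot>\<^sub>v ?x"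
  proof (rule eq_vecI)
    show "dim_vec (?C *\<^sub>v ?x) = dim_vec (of_real r \<cdot>\<^sub>v ?x)" using A by simp
    fix i assume "i < dim_vec (of_real r \<cdot>\<^sub>v ?x)"
    hence i: "i < N" by simp
    have "(?C *\<^sub>v ?x) $ i = of_real (\<Sum>j<N. A $$ (i,j) * x j)" using mv[OF i, of ?x] by simp
    then show "(?C *\<^sub>v ?x) $ i = (of_real r \<cdot>\<^sub>v ?x) $ i" using eq[OF i] i by simp
  qed
  moreover have "?x \<noteq> 0\<^sub>v N"
  proof
    assume "?x = 0\<^sub>v N"
    hence "?x $ 0 = 0\<^sub>v N $ 0" by simp
    thus False using pos[OF N] N by simp
  qed
  ultimately have r: "eigenvalue ?C (of_real r)" using A by (auto simp: eigenvalue_def eigenvector_def intro!: exI[of _ ?x])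
  have "char_poly ?C \<noteq> 0" using degree_monic_char_poly[OF C] by auto
  hence "finite {l. poly (char_poly ?C) l = 0}" by (rule poly_roots_finite)
  hence fin: "finite {l. eigenvalue ?C l}" using eigenvalue_root_char_poly[OF C] by simp
  show ?thesis unfolding spectral_abscissa_def
    using fin Re_le r by (intro Max_eqI) (auto intro!: image_eqI[of _ _ "complex_of_real r"])
qed

section \<open>Sub- and supersolutions of the exponent matrix\<close>

lemma real_distributionI:
  assumes "prob_space M" "sets M = sets borel"
  shows "real_distribution M"
proof -
  interpret prob_space M by fact
  show ?thesis using assms sets_eq_imp_space_eq[OF assms(2)] by unfold_locales auto
qed

lemma (in real_distribution) mgf_pos:
  assumes "integrable M (\<lambda>x. exp (s * x))"
  shows "mgf M s > 0"
  unfolding mgf_def using assms by (intro expectation_greater) auto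

lemma (in real_distribution) integrable_exp_between:
  assumes "integrable M (\<lambda>x. exp (s0 * x))" "integrable M (\<lambda>x. exp (s1 * x))" "0 \<le> l" "l \<le> 1"
  shows "integrable M (\<lambda>x. exp (((1-l) * s0 + l * s1) * x))"
proof (rule Bochner_Integration.integrable_bound)
  show "integrable M (\<lambda>x. (1-l) * exp (s0 * x) + l * exp (s1 * x))" using assms by auto
  show "(\<lambda>x. exp (((1-l) * s0 + l * s1) * x)) \<in> borel_measurable M" by measurable
  have "exp (((1-l) * s0 + l * s1) * x) \<le> (1-l) * exp (s0 * x) + l * exp (s1 * x)" for x
    using convex_onD[OF exp_convex, of l "s0 * x" "s1 * x"] assms by (simp add: algebra_simps)
  moreover have "(1-l) * exp (s0 * x) + l * exp (s1 * x) \<ge> 0" for x using assms by simp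
  ultimately show "AE x in M. norm (exp (((1-l) * s0 + l * s1) * x)) \<le> norm ((1-l) * exp (s0 * x) + l * exp (s1 * x))"
    by simp
qed

lemma (in real_distribution) mgf_weighted_convex:
  assumes "integrable M (\<lambda>x. exp (s0 * x))" "integrable M (\<lambda>x. exp (s1 * x))" "0 \<le> l" "l \<le> 1"
  shows "mgf M ((1-l) * s0 + l * s1) * exp ((1-l) * a + l * b)
    \<le> (1-l) * (exp a * mgf M s0) + l * (exp b * mgf M s1)"
proof -
  have "mgf M ((1-l) * s0 + l * s1) * exp ((1-l) * a + l * b)
    = (\<integral>x. exp (((1-l) * s0 + l * s1) * x) * exp ((1-l) * a + l * b) \<partial>M)" by (simp add: mgf_def)
  also have "\<dots> \<le> (\<integral>x. (1-l) * (exp a * exp (s0 * x)) + l * (exp b * exp (s1 * x)) \<partial>M)"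
  proof (rule integral_mono)
    show "integrable M (\<lambda>x. exp (((1-l) * s0 + l * s1) * x) * exp ((1-l) * a + l * b))"
      using integrable_exp_between[OF assms] by simp
    show "integrable M (\<lambda>x. (1-l) * (exp a * exp (s0 * x)) + l * (exp b * exp (s1 * x)))"
      using assms by auto
    fix x
    have "exp ((1-l) * (a + s0 * x) + l * (b + s1 * x)) \<le> (1-l) * exp (a + s0 * x) + l * exp (b + s1 * x)"
      using convex_onD[OF exp_convex, of l "a + s0 * x" "b + s1 * x"] assms by simp
    moreover have "exp ((1-l) * (a + s0 * x) + l * (b + s1 * x)) = exp (((1-l) * s0 + l * s1) * x) * exp ((1-l) * a + l * b)"
      by (simp add: algebra_simps flip: exp_add)
    ultimately show "exp (((1-l) * s0 + l * s1) * x) * exp ((1-l) * a + l * b) \<le> (1-l) * (exp a * exp (s0 * x)) + l * (exp b * exp (s1 * x))"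
      by (simp add: exp_add)
  qed
  also have "\<dots> = (1-l) * (exp a * mgf M s0) + l * (exp b * mgf M s1)"
    using assms by (simp add: mgf_def)
  finally show ?thesis .
qed

lemma (in real_distribution) ln_mgf_convex:
  assumes "integrable M (\<lambda>x. exp (s0 * x))" "integrable M (\<lambda>x. exp (s1 * x))" "0 \<le> l" "l \<le> 1"
  shows "ln (mgf M ((1-l) * s0 + l * s1)) \<le> (1-l) * ln (mgf M s0) + l * ln (mgf M s1)"
proof -
  have p: "mgf M s0 > 0" "mgf M s1 > 0" "mgf M ((1-l) * s0 + l * s1) > 0"
    using mgf_pos integrable_exp_between[OF assms] assms by blast+
  have "mgf M ((1-l) * s0 + l * s1) * exp ((1-l) * (- ln (mgf M s0)) + l * (- ln (mgf M s1))) \<le> 1"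
    using mgf_weighted_convex[OF assms, of "- ln (mgf M s0)" "- ln (mgf M s1)"] p by (simp add: exp_minus)
  hence "exp (ln (mgf M ((1-l) * s0 + l * s1)) + ((1-l) * (- ln (mgf M s0)) + l * (- ln (mgf M s1)))) \<le> 1"
    using p by (simp add: exp_add)
  then show ?thesis by simp
qed

locale mm_params =
  fixes N :: nat and Gen :: "real mat" and mu :: "nat \<Rightarrow> real measure"
    and nu :: "nat \<Rightarrow> nat \<Rightarrow> real measure" and phi :: "nat \<Rightarrow> real"
  assumes N_pos: "N > 0" and gen: "generator N Gen" and irred: "irreducible_mat N Gen"
    and phi_nonneg: "\<And>n. n < N \<Longrightarrow> phi n \<ge> 0"
    and mu_dist: "\<And>n. n < N \<Longrightarrow> real_distribution (mu n)"
    and nu_dist: "\<And>n n'. n < N \<Longrightarrow> n' < N \<Longrightarrow> n \<noteq> n' \<Longrightarrow> real_distribution (nu n n')"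
    and phi_nz: "\<exists>n<N. phi n > 0"
begin

abbreviation S where "S \<equiv> strip_I N mu nu"
definition A where "A s n n' = (if n = n' then ln (mgf (mu n) s) + Gen $$ (n,n) - phi n
      else Gen $$ (n,n') * mgf (nu n n') s)"

lemma Gen_nonneg: "n < N \<Longrightarrow> n' < N \<Longrightarrow> n \<noteq> n' \<Longrightarrow> Gen $$ (n,n') \<ge> 0"
  and Gen_rowsum: "n < N \<Longrightarrow> (\<Sum>n'<N. Gen $$ (n,n')) = 0"
  using gen by (auto simp: generator_def)

lemma S_mu: "s \<in> S \<Longrightarrow> n < N \<Longrightarrow> integrable (mu n) (\<lambda>x. exp (s * x))"
  and S_nu: "s \<in> S \<Longrightarrow> n < N \<Longrightarrow> n' < N \<Longrightarrow> n \<noteq> n' \<Longrightarrow> integrable (nu n n') (\<lambda>x. exp (s * x))"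
  by (auto simp: strip_I_def)

lemma nu_mgf_pos: "s \<in> S \<Longrightarrow> n < N \<Longrightarrow> n' < N \<Longrightarrow> n \<noteq> n' \<Longrightarrow> mgf (nu n n') s > 0"
  using S_nu nu_dist real_distribution.mgf_pos by blast

lemma mgf_0: "real_distribution M \<Longrightarrow> mgf M 0 = 1"
  by (simp add: mgf_def real_distribution_def prob_space.prob_space)

lemma zero_S: "0 \<in> S"
proof -
  have "integrable M (\<lambda>x. 1::real)" if "real_distribution M" for M
  proof -
    interpret real_distribution M by fact
    show ?thesis by simp
  qed
  then show ?thesis using mu_dist nu_dist by (auto simp: strip_I_def)
qed

lemma S_between:
  assumes "s0 \<in> S" "s1 \<in> S" "0 \<le> l" "l \<le> 1"
  shows "(1-l) * s0 + l * s1 \<in> S"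
  using assms real_distribution.integrable_exp_between[OF mu_dist] real_distribution.integrable_exp_between[OF nu_dist]
  by (auto simp: strip_I_def)

lemma A_metzler: "s \<in> S \<Longrightarrow> i < N \<Longrightarrow> j < N \<Longrightarrow> i \<noteq> j \<Longrightarrow> A s i j \<ge> 0"
  using Gen_nonneg[of i j] nu_mgf_pos[of s i j] by (simp add: A_def)

lemma A_irred:
  assumes "s \<in> S" "X \<noteq> {}" "X \<subset> {0..<N}"
  shows "\<exists>i\<in>X. \<exists>j\<in>{0..<N} - X. A s i j \<noteq> 0"
proof -
  obtain i j where ij: "i \<in> X" "j \<in> {0..<N} - X" "Gen $$ (i,j) \<noteq> 0"
    using irred assms unfolding irreducible_mat_def by blast
  then have "i \<noteq> j" "i < N" "j < N" using assms by auto
  then have "A s i j \<noteq> 0" using ij nu_mgf_pos[OF assms(1), of i j] by (auto simp: A_def)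
  then show ?thesis using ij by blast
qed

lemma A_log_convex:
  assumes s: "s0 \<in> S" "s1 \<in> S" and l: "0 \<le> l" "l \<le> 1"
    and f: "\<And>i. i < N \<Longrightarrow> fa i > 0" "\<And>i. i < N \<Longrightarrow> fb i > 0" and n: "n < N"
    and F: "\<And>i. F i = exp ((1-l) * ln (fa i) + l * ln (fb i))"
  shows "(\<Sum>j<N. A ((1-l) * s0 + l * s1) n j * F j) \<le>
    F n * ((1-l) * ((\<Sum>j<N. A s0 n j * fa j) / fa n) + l * ((\<Sum>j<N. A s1 n j * fb j) / fb n))"
proof -
  let ?s = "(1-l) * s0 + l * s1"
  have Fn: "F n > 0" using F by simp
  have tm: "A ?s n j * F j / F n \<le> (1-l) * (A s0 n j * fa j / fa n) + l * (A s1 n j * fb j / fb n)" if j: "j < N" for j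
  proof (cases "j = n")
    case True
    have "ln (mgf (mu n) ?s) \<le> (1-l) * ln (mgf (mu n) s0) + l * ln (mgf (mu n) s1)"
      using real_distribution.ln_mgf_convex[OF mu_dist[OF n] S_mu[OF s(1) n] S_mu[OF s(2) n] l] .
    hence "A ?s n n \<le> (1-l) * A s0 n n + l * A s1 n n"
      by (simp add: A_def algebra_simps)
    then show ?thesis using True Fn f[OF n] by simp
  next
    case False
    let ?a = "ln (fa j) - ln (fa n)" and ?b = "ln (fb j) - ln (fb n)"
    have e: "exp ?a = fa j / fa n" "exp ?b = fb j / fb n" using f[OF j] f[OF n] by (auto simp: exp_diff)
    have "F j / F n = exp ((1-l) * ?a + l * ?b)" by (simp add: F algebra_simps flip: exp_diff)
    hence "mgf (nu n j) ?s * (F j / F n) \<le> (1-l) * (fa j / fa n * mgf (nu n j) s0) + l * (fb j / fb n * mgf (nu n j) s1)"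
      using real_distribution.mgf_weighted_convex[OF nu_dist[of n j] S_nu[OF s(1), of n j] S_nu[OF s(2), of n j] l, of ?a ?b] n j False e by simp
    hence "Gen $$ (n,j) * (mgf (nu n j) ?s * (F j / F n)) \<le> Gen $$ (n,j) * ((1-l) * (fa j / fa n * mgf (nu n j) s0) + l * (fb j / fb n * mgf (nu n j) s1))"
      using Gen_nonneg n j False by (intro mult_left_mono) auto
    then show ?thesis using False by (simp add: A_def algebra_simps)
  qed
  have "(\<Sum>j<N. A ?s n j * F j) / F n = (\<Sum>j<N. A ?s n j * F j / F n)" by (simp add: sum_divide_distrib)
  also have "\<dots> \<le> (\<Sum>j<N. (1-l) * (A s0 n j * fa j / fa n) + l * (A s1 n j * fb j / fb n))"
    using tm by (intro sum_mono) auto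
  also have "\<dots> = (1-l) * ((\<Sum>j<N. A s0 n j * fa j) / fa n) + l * ((\<Sum>j<N. A s1 n j * fb j) / fb n)"
    by (simp add: sum.distrib sum_distrib_left sum_divide_distrib)
  finally show ?thesis using Fn by (simp add: divide_le_eq mult.commute)
qed

lemma uniform_rate:
  fixes a f :: "nat \<Rightarrow> real"
  assumes "\<And>i. i \<in> I \<Longrightarrow> a i < 0" "\<And>i. i \<in> I \<Longrightarrow> f i > 0" "finite I"
  shows "\<exists>c>0. \<forall>i\<in>I. a i \<le> - c * f i"
proof -
  define c where "c = Min (insert 1 ((\<lambda>i. - a i / f i) ` I))"
  have "c > 0" unfolding c_def using assms by (subst Min_gr_iff) (auto simp: divide_neg_pos)
  moreover have "a i \<le> - c * f i" if "i \<in> I" for i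
  proof -
    have "c \<le> - a i / f i" unfolding c_def using that assms by (intro Min_le) auto
    then show ?thesis using assms(2)[OF that] by (simp add: field_simps)
  qed
  ultimately show ?thesis by blast
qed

lemma A_0_rowsum: "n < N \<Longrightarrow> (\<Sum>j<N. A 0 n j) = - phi n"
proof -
  assume n: "n < N"
  have "(\<Sum>j<N. A 0 n j) = (\<Sum>j<N. Gen $$ (n,j) - (if j = n then phi n else 0))"
    using n mgf_0[OF mu_dist] mgf_0[OF nu_dist] by (intro sum.cong) (auto simp: A_def)
  also have "\<dots> = - phi n" using n Gen_rowsum by (simp add: sum_subtractf sum.delta)
  finally show ?thesis .
qed

lemma subsolution_0:
  "\<exists>g c. c > 0 \<and> (\<forall>i<N. g i > 0) \<and> (\<forall>i<N. (\<Sum>j<N. A 0 i j * g j) \<le> - c * g i)"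
proof -
  obtain n where n: "n < N" "phi n > 0" using phi_nz by blast
  have "\<exists>y. (\<forall>i<N. y i > 0) \<and> (\<forall>i<N. (\<Sum>j<N. A 0 i j * y j) < 0 * y i)"
    by (rule metzler_strict_growth[where x="\<lambda>_. 1", OF A_metzler[OF zero_S] A_irred[OF zero_S] _ _ n(1)])
      (use A_0_rowsum n phi_nonneg in auto)
  then obtain g where g: "\<And>i. i < N \<Longrightarrow> g i > 0" "\<And>i. i < N \<Longrightarrow> (\<Sum>j<N. A 0 i j * g j) < 0" by auto
  have "\<exists>c>0. \<forall>i\<in>{..<N}. (\<Sum>j<N. A 0 i j * g j) \<le> - c * g i" using g by (intro uniform_rate) auto
  then show ?thesis using g by blast
qed

lemma perron_zero:
  assumes s: "s \<in> S" and z: "spectral_abscissa (map_mat complex_of_real (A_mat N Gen mu nu phi s)) = 0"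
  shows "\<exists>h. (\<forall>i<N. h i > 0) \<and> (\<forall>i<N. (\<Sum>j<N. A s i j * h j) = 0)"
proof -
  obtain r x where x: "\<And>i. i < N \<Longrightarrow> x i > 0" "\<And>i. i < N \<Longrightarrow> (\<Sum>j<N. A s i j * x j) = r * x i"
    using metzler_perron[OF N_pos A_metzler[OF s] A_irred[OF s]] by blast
  have idx: "A_mat N Gen mu nu phi s $$ (i,j) = A s i j" if "i < N" "j < N" for i j
    using that by (auto simp: A_mat_def A_def)
  have "spectral_abscissa (map_mat complex_of_real (A_mat N Gen mu nu phi s)) = r"
    by (rule spectral_abscissa_eq_perron[OF _ N_pos, where x=x])
      (use x A_metzler[OF s] in \<open>auto simp: idx\<close>, simp add: A_mat_def)
  then show ?thesis using x z by auto
qed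

lemma subsolution_below:
  assumes a: "\<alpha> \<in> S" and h: "\<And>i. i < N \<Longrightarrow> h i > 0" "\<And>i. i < N \<Longrightarrow> (\<Sum>j<N. A \<alpha> i j * h j) = 0"
    and l: "0 \<le> l" "l < 1"
  shows "\<exists>g c. c > 0 \<and> (\<forall>i<N. g i > 0) \<and> (\<forall>i<N. (\<Sum>j<N. A (l * \<alpha>) i j * g j) \<le> - c * g i)"
proof -
  obtain g0 c where g0: "c > 0" "\<And>i. i < N \<Longrightarrow> g0 i > 0" "\<And>i. i < N \<Longrightarrow> (\<Sum>j<N. A 0 i j * g0 j) \<le> - c * g0 i"
    using subsolution_0 by blast
  define F where "F i = exp ((1-l) * ln (g0 i) + l * ln (h i))" for i
  have "(\<Sum>j<N. A (l * \<alpha>) i j * F j) \<le> - ((1-l) * c) * F i" if i: "i < N" for i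
  proof -
    have "(\<Sum>j<N. A (l * \<alpha>) i j * F j) \<le> F i * ((1-l) * ((\<Sum>j<N. A 0 i j * g0 j) / g0 i) + l * ((\<Sum>j<N. A \<alpha> i j * h j) / h i))"
      using A_log_convex[OF zero_S a _ _ g0(2) h(1) i F_def] l by simp
    also have "\<dots> = F i * ((1-l) * ((\<Sum>j<N. A 0 i j * g0 j) / g0 i))" using h(2)[OF i] by simp
    also have "\<dots> \<le> F i * ((1-l) * (- c))" using g0(2,3)[OF i] l
      by (intro mult_left_mono) (auto simp: F_def divide_le_eq)
    finally show ?thesis by (simp add: algebra_simps)
  qed
  moreover have "(1-l) * c > 0" using l g0 by simp
  moreover have "\<forall>i<N. F i > 0" by (simp add: F_def)
  ultimately show ?thesis by blast
qed

text \<open>A strictly negative subsolution excludes a positive null vector: compare both at the index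
  where their quotient is extremal.\<close>
lemma no_negative_image:
  assumes s: "s \<in> S" and h: "\<And>i. i < N \<Longrightarrow> h i > 0" "\<And>i. i < N \<Longrightarrow> (\<Sum>j<N. A s i j * h j) \<ge> 0"
    and f: "\<And>i. i < N \<Longrightarrow> f i > 0" "\<And>i. i < N \<Longrightarrow> (\<Sum>j<N. A s i j * f j) < 0"
  shows False
proof -
  have "finite ((\<lambda>i. h i / f i) ` {..<N})" "(\<lambda>i. h i / f i) ` {..<N} \<noteq> {}" using N_pos by auto
  from Max_in[OF this] obtain i where i: "i < N" "h i / f i = Max ((\<lambda>i. h i / f i) ` {..<N})" by auto
  define t where "t = h i / f i"
  have t: "h j \<le> t * f j" if "j < N" for j
  proof -
    have "h j / f j \<le> t" unfolding t_def i(2) using that by (intro Max_ge) auto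
    then show ?thesis using f(1)[OF that] by (simp add: divide_le_eq)
  qed
  have tp: "t > 0" unfolding t_def using h(1)[OF i(1)] f(1)[OF i(1)] by (rule divide_pos_pos)
  have "(\<Sum>j<N. A s i j * h j) \<le> (\<Sum>j<N. A s i j * (t * f j))"
  proof (rule sum_mono)
    fix j assume "j \<in> {..<N}"
    then show "A s i j * h j \<le> A s i j * (t * f j)"
      using t[of j] A_metzler[OF s i(1), of j] f(1)[OF i(1)] by (cases "i = j") (simp add: t_def, intro mult_left_mono, auto)
  qed
  also have "\<dots> = t * (\<Sum>j<N. A s i j * f j)" by (simp add: sum_distrib_left algebra_simps)
  also have "\<dots> < 0" using tp f(2)[OF i(1)] by (simp add: mult_pos_neg)
  finally show False using h(2)[OF i(1)] by simp
qed

lemma supersolution_above: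
  assumes a: "\<alpha> > 0" "\<alpha> \<in> S" and h: "\<And>i. i < N \<Longrightarrow> h i > 0" "\<And>i. i < N \<Longrightarrow> (\<Sum>j<N. A \<alpha> i j * h j) = 0"
    and s: "s \<in> S" "\<alpha> < s"
  shows "\<exists>g c. c > 0 \<and> (\<forall>i<N. g i > 0) \<and> (\<forall>i<N. (\<Sum>j<N. A s i j * g j) = c * g i)"
proof -
  obtain r x where x: "\<And>i. i < N \<Longrightarrow> x i > 0" "\<And>i. i < N \<Longrightarrow> (\<Sum>j<N. A s i j * x j) = r * x i"
    using metzler_perron[OF N_pos A_metzler[OF s(1)] A_irred[OF s(1)]] by blast
  obtain g0 c where g0: "c > 0" "\<And>i. i < N \<Longrightarrow> g0 i > 0" "\<And>i. i < N \<Longrightarrow> (\<Sum>j<N. A 0 i j * g0 j) \<le> - c * g0 i"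
    using subsolution_0 by blast
  define l where "l = \<alpha> / s"
  have l: "0 < l" "l < 1" "l * s = \<alpha>" using a s by (auto simp: l_def)
  define F where "F i = exp ((1-l) * ln (g0 i) + l * ln (x i))" for i
  have "r > 0"
  proof (rule ccontr)
    assume "\<not> r > 0"
    hence r: "r \<le> 0" by simp
    have "(\<Sum>j<N. A \<alpha> i j * F j) < 0" if i: "i < N" for i
    proof -
      have "(\<Sum>j<N. A \<alpha> i j * F j) \<le> F i * ((1-l) * ((\<Sum>j<N. A 0 i j * g0 j) / g0 i) + l * ((\<Sum>j<N. A s i j * x j) / x i))"
        using A_log_convex[OF zero_S s(1) _ _ g0(2) x(1) i F_def] l by simp
      also have "\<dots> = F i * ((1-l) * ((\<Sum>j<N. A 0 i j * g0 j) / g0 i) + l * r)" using x(1,2)[OF i] by simp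
      also have "\<dots> \<le> F i * ((1-l) * (- c) + l * r)" using g0(2,3)[OF i] l
        by (intro mult_left_mono add_right_mono) (auto simp: F_def divide_le_eq)
      also have "\<dots> < 0" using l r g0 by (intro mult_pos_neg add_neg_nonpos) (auto simp: F_def mult_le_0_iff)
      finally show ?thesis .
    qed
    then show False using no_negative_image[where s=\<alpha> and h=h and f=F] a h by (simp add: F_def)
  qed
  then show ?thesis using x by blast
qed

text \<open>Extra killing at the single state \<open>k\<close> makes the null vector a strict subsolution, and
  log-convexity carries the strict inequality away from \<open>k\<close> slightly past \<open>\<alpha>\<close>.\<close>
lemma subsolution_off_state:
  assumes a: "\<alpha> \<in> S" and h: "\<And>i. i < N \<Longrightarrow> h i > 0" "\<And>i. i < N \<Longrightarrow> (\<Sum>j<N. A \<alpha> i j * h j) = 0"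
    and s: "s \<in> S" "\<alpha> < s" and k: "k < N"
  shows "\<exists>t f c. \<alpha> < t \<and> t \<le> s \<and> t \<in> S \<and> c > 0 \<and> (\<forall>i<N. f i > 0) \<and>
     (\<forall>i<N. i \<noteq> k \<longrightarrow> (\<Sum>j<N. A t i j * f j) \<le> - c * f i)"
proof -
  define B where "B i j = A \<alpha> i j - (if i = k \<and> j = k then 1 else 0)" for i j
  have Bsum: "(\<Sum>j<N. B i j * y j) = (\<Sum>j<N. A \<alpha> i j * y j) - (if i = k then y k else 0)" for i y
  proof -
    have "(\<Sum>j<N. B i j * y j) = (\<Sum>j<N. A \<alpha> i j * y j - (if j = k then if i = k then y k else 0 else 0))"
      by (rule sum.cong) (auto simp: B_def algebra_simps)
    then show ?thesis using k by (simp add: sum_subtractf sum.delta)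
  qed
  have "\<exists>y. (\<forall>i<N. y i > 0) \<and> (\<forall>i<N. (\<Sum>j<N. B i j * y j) < 0 * y i)"
  proof (rule metzler_strict_growth[OF _ _ h(1) _ k])
    show "B i j \<ge> 0" if "i < N" "j < N" "i \<noteq> j" for i j using A_metzler[OF a that] that by (auto simp: B_def)
    show "\<exists>i\<in>X. \<exists>j\<in>{0..<N} - X. B i j \<noteq> 0" if X: "X \<noteq> {}" "X \<subset> {0..<N}" for X
    proof -
      obtain i j where ij: "i \<in> X" "j \<in> {0..<N} - X" "A \<alpha> i j \<noteq> 0" using A_irred[OF a X] by blast
      then have "i \<noteq> j" by auto
      then have "B i j \<noteq> 0" using ij by (simp add: B_def)
      then show ?thesis using ij by blast
    qed
    show "(\<Sum>j<N. B i j * h j) \<le> 0 * h i" if "i < N" for i using h that k by (simp add: Bsum less_imp_le)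
    show "(\<Sum>j<N. B k j * h j) < 0 * h k" using h k by (simp add: Bsum)
  qed
  then obtain y where y0: "\<forall>i<N. y i > 0" "\<forall>i<N. (\<Sum>j<N. B i j * y j) < 0 * y i" by blast
  have y: "\<And>i. i < N \<Longrightarrow> y i > 0" "\<And>i. i < N \<Longrightarrow> i \<noteq> k \<Longrightarrow> (\<Sum>j<N. A \<alpha> i j * y j) < 0"
    using y0 unfolding Bsum by auto
  have "\<exists>c>0. \<forall>i\<in>{..<N}-{k}. (\<Sum>j<N. A \<alpha> i j * y j) \<le> - c * y i" using y by (intro uniform_rate) auto
  then obtain c where c: "c > 0" "\<And>i. i < N \<Longrightarrow> i \<noteq> k \<Longrightarrow> (\<Sum>j<N. A \<alpha> i j * y j) \<le> - c * y i" by auto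
  define K where "K = (\<Sum>i<N. \<bar>\<Sum>j<N. A s i j\<bar>)"
  have K: "(\<Sum>j<N. A s i j) \<le> K" if "i < N" for i
  proof -
    have "\<bar>\<Sum>j<N. A s i j\<bar> \<le> K" unfolding K_def using that by (intro member_le_sum) auto
    then show ?thesis by simp
  qed
  have K0: "K \<ge> 0" unfolding K_def by (intro sum_nonneg) auto
  define l where "l = c / (2 * (c + K))"
  have l: "0 < l" "l \<le> 1/2" using c K0 by (auto simp: l_def field_simps)
  have "l * (c + K) = c / 2" using c K0 by (simp add: l_def field_simps)
  hence lc: "(1-l) * (- c) + l * K = - (c / 2)" by (simp add: algebra_simps)
  define t where "t = (1-l) * \<alpha> + l * s"
  have t: "\<alpha> < t" "t \<le> s" "t \<in> S"
  proof -
    have "t = \<alpha> + l * (s - \<alpha>)" by (simp add: t_def algebra_simps)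
    then show "\<alpha> < t" using l s by simp
    have "s - t = (1-l) * (s - \<alpha>)" by (simp add: t_def algebra_simps)
    moreover have "(1-l) * (s - \<alpha>) \<ge> 0" using l s by (intro mult_nonneg_nonneg) auto
    ultimately show "t \<le> s" by simp
    show "t \<in> S" unfolding t_def using l by (intro S_between a s) auto
  qed
  define F where "F i = exp ((1-l) * ln (y i) + l * ln ((\<lambda>_. 1) i))" for i :: nat
  have "(\<Sum>j<N. A t i j * F j) \<le> - (c/2) * F i" if i: "i < N" "i \<noteq> k" for i
  proof -
    have "(\<Sum>j<N. A t i j * F j) \<le> F i * ((1-l) * ((\<Sum>j<N. A \<alpha> i j * y j) / y i) + l * ((\<Sum>j<N. A s i j * 1) / 1))"
      unfolding t_def
      using A_log_convex[where l=l and fa=y and fb="\<lambda>_. 1" and F=F, OF a s(1) _ _ y(1) _ i(1)] l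
      by (simp add: F_def)
    also have "\<dots> \<le> F i * ((1-l) * (- c) + l * K)" using y(1)[OF i(1)] c(2)[OF i] K[OF i(1)] l
      by (intro mult_left_mono add_mono) (auto simp: F_def divide_le_eq)
    also have "\<dots> = - (c/2) * F i" unfolding lc by simp
    finally show ?thesis .
  qed
  moreover have "\<forall>i<N. F i > 0" by (simp add: F_def)
  moreover have "c / 2 > 0" using c by simp
  ultimately show ?thesis using t by blast
qed

end

section \<open>Exponential barriers for the discrete chain\<close>

lemma cmod_exp_minus_1_minus_le: "cmod (exp z - 1 - z) \<le> exp (cmod z) * (cmod z)\<^sup>2" for z :: complex
proof -
  have "cmod (exp z - (\<Sum>i\<le>1. z ^ i / fact i)) \<le> exp \<bar>Re z\<bar> * (cmod z ^ Suc 1) / fact 1"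
    by (rule Taylor_exp)
  also have "\<dots> \<le> exp (cmod z) * (cmod z ^ Suc 1) / fact 1"
    by (intro divide_right_mono mult_right_mono) (auto simp: abs_Re_le_cmod)
  finally show ?thesis by (simp add: power2_eq_square algebra_simps)
qed

lemma quadratic_expansion:
  fixes l p :: complex
  assumes "0 \<le> h" "h \<le> 1"
  shows "cmod ((1 - of_real h * l) * exp (of_real h * p) - 1 - of_real h * (p - l))
    \<le> ((1 + cmod l) * (exp (cmod p) * (cmod p)\<^sup>2) + cmod l * cmod p) * h\<^sup>2"
proof -
  let ?h = "complex_of_real h"
  have hp: "cmod (?h * p) \<le> cmod p" using assms by (simp add: norm_mult mult_left_le_one_le)
  have "(1 - ?h * l) * exp (?h * p) - 1 - ?h * (p - l)
    = (1 - ?h * l) * (exp (?h * p) - 1 - ?h * p) - ?h * ?h * (l * p)" by (simp add: algebra_simps)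
  also have "cmod \<dots> \<le> cmod (1 - ?h * l) * cmod (exp (?h * p) - 1 - ?h * p) + cmod (?h * ?h * (l * p))"
    by (metis norm_mult norm_triangle_ineq4)
  also have "\<dots> \<le> (1 + cmod l) * (exp (cmod p) * (cmod p)\<^sup>2 * h\<^sup>2) + cmod l * cmod p * h\<^sup>2"
  proof (intro add_mono mult_mono)
    have "cmod (1 - ?h * l) \<le> 1 + cmod (?h * l)" using norm_triangle_ineq4[of 1 "?h * l"] by simp
    also have "\<dots> \<le> 1 + cmod l" using assms by (simp add: norm_mult mult_left_le_one_le)
    finally show "cmod (1 - ?h * l) \<le> 1 + cmod l" .
    have "cmod (exp (?h * p) - 1 - ?h * p) \<le> exp (cmod (?h * p)) * (cmod (?h * p))\<^sup>2"
      by (rule cmod_exp_minus_1_minus_le)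
    also have "\<dots> \<le> exp (cmod p) * (cmod (?h * p))\<^sup>2" using hp by (intro mult_right_mono) auto
    also have "\<dots> = exp (cmod p) * (cmod p)\<^sup>2 * h\<^sup>2" using assms by (simp add: norm_mult power_mult_distrib)
    finally show "cmod (exp (?h * p) - 1 - ?h * p) \<le> exp (cmod p) * (cmod p)\<^sup>2 * h\<^sup>2" .
    show "cmod (?h * ?h * (l * p)) \<le> cmod l * cmod p * h\<^sup>2" using assms
      by (simp add: norm_mult power2_eq_square)
  qed auto
  finally show ?thesis by (simp add: algebra_simps)
qed

lemma quadratic_expansion_real:
  fixes l p :: real
  assumes "0 \<le> h" "h \<le> 1"
  shows "\<bar>(1 - h * l) * exp (h * p) - 1 - h * (p - l)\<bar>
    \<le> ((1 + \<bar>l\<bar>) * (exp \<bar>p\<bar> * p\<^sup>2) + \<bar>l\<bar> * \<bar>p\<bar>) * h\<^sup>2"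
proof -
  have "complex_of_real ((1 - h * l) * exp (h * p) - 1 - h * (p - l)) =
    (1 - of_real h * of_real l) * exp (of_real h * of_real p) - 1 - of_real h * (of_real p - of_real l)"
    by (simp flip: exp_of_real)
  hence "\<bar>(1 - h * l) * exp (h * p) - 1 - h * (p - l)\<bar> = cmod ((1 - of_real h * of_real l) * exp (of_real h * of_real p) - 1 - of_real h * (of_real p - of_real l))"
    by (metis norm_of_real)
  also have "\<dots> \<le> ((1 + cmod (of_real l)) * (exp (cmod (of_real p)) * (cmod (of_real p))\<^sup>2) + cmod (of_real l) * cmod (of_real p)) * h\<^sup>2"
    by (rule quadratic_expansion[OF assms])
  finally show ?thesis by simp
qed

context mm_params
begin

definition exit_rate where "exit_rate n = phi n - Gen $$ (n,n)"

definition step_factor where "step_factor h s f n = (1 - h * exit_rate n) * exp (h * ln (mgf (mu n) s)) * f n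
   + (\<Sum>j\<in>{..<N}-{n}. h * Gen $$ (n,j) * mgf (nu n j) s * f j)"

lemma step_factor_expansion:
  assumes f: "\<And>i. i < N \<Longrightarrow> f i > 0"
  shows "\<exists>K\<ge>0. \<forall>h n. 0 \<le> h \<longrightarrow> h \<le> 1 \<longrightarrow> n < N \<longrightarrow>
    \<bar>step_factor h s f n - (f n + h * (\<Sum>j<N. A s n j * f j))\<bar> \<le> K * h\<^sup>2 * f n"
proof -
  define p where "p n = ln (mgf (mu n) s)" for n
  define K0 where "K0 n = (1 + \<bar>exit_rate n\<bar>) * (exp \<bar>p n\<bar> * (p n)\<^sup>2) + \<bar>exit_rate n\<bar> * \<bar>p n\<bar>" for n
  have K0: "K0 n \<ge> 0" for n unfolding K0_def by simp
  define K where "K = (\<Sum>n<N. K0 n)"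
  have "\<bar>step_factor h s f n - (f n + h * (\<Sum>j<N. A s n j * f j))\<bar> \<le> K * h\<^sup>2 * f n"
    if h: "0 \<le> h" "h \<le> 1" and n: "n < N" for h n
  proof -
    have "(\<Sum>j<N. A s n j * f j) = A s n n * f n + (\<Sum>j\<in>{..<N}-{n}. A s n j * f j)"
      using n by (simp add: sum.remove)
    also have "(\<Sum>j\<in>{..<N}-{n}. A s n j * f j) = (\<Sum>j\<in>{..<N}-{n}. Gen $$ (n,j) * mgf (nu n j) s * f j)"
      by (rule sum.cong) (auto simp: A_def)
    also have "A s n n = p n - exit_rate n" by (simp add: A_def p_def exit_rate_def)
    finally have "step_factor h s f n - (f n + h * (\<Sum>j<N. A s n j * f j))
       = ((1 - h * exit_rate n) * exp (h * p n) - 1 - h * (p n - exit_rate n)) * f n"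
      by (simp add: step_factor_def p_def distrib_left left_diff_distrib right_diff_distrib sum_distrib_left mult.assoc)
    also have "\<bar>\<dots>\<bar> \<le> K0 n * h\<^sup>2 * f n"
      using quadratic_expansion_real[OF h, of "exit_rate n" "p n"] f[OF n]
      by (simp add: abs_mult K0_def mult_right_mono)
    also have "\<dots> \<le> K * h\<^sup>2 * f n"
      using n K0 f[OF n] unfolding K_def by (intro mult_right_mono member_le_sum) auto
    finally show ?thesis .
  qed
  moreover have "K \<ge> 0" unfolding K_def by (intro sum_nonneg K0)
  ultimately show ?thesis by blast
qed

definition roots :: "real \<Rightarrow> (nat \<Rightarrow> real measure) \<Rightarrow> bool" where
  "roots h M \<longleftrightarrow> 0 < h \<and> h \<le> 1 \<and> (\<forall>n<N. h * exit_rate n \<le> 1) \<and> (\<forall>n<N. real_distribution (M n) \<and>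
     (\<forall>s\<in>S. integrable (M n) (\<lambda>x. exp (s * x)) \<and> mgf (M n) s = exp (h * ln (mgf (mu n) s))))"

definition step_op :: "real \<Rightarrow> (nat \<Rightarrow> real measure) \<Rightarrow> (nat \<Rightarrow> real \<Rightarrow> real) \<Rightarrow> nat \<Rightarrow> real \<Rightarrow> real" where
  "step_op h M U n x = (1 - h * exit_rate n) * (\<integral>y. U n (x + y) \<partial>M n)
   + (\<Sum>j\<in>{..<N}-{n}. h * Gen $$ (n,j) * (\<integral>y. U j (x + y) \<partial>nu n j))"

definition step_integrable :: "(nat \<Rightarrow> real measure) \<Rightarrow> (nat \<Rightarrow> real \<Rightarrow> real) \<Rightarrow> bool" where
  "step_integrable M U \<longleftrightarrow> (\<forall>n<N. \<forall>x. integrable (M n) (\<lambda>y. U n (x + y)) \<and>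
     (\<forall>j\<in>{..<N}-{n}. integrable (nu n j) (\<lambda>y. U j (x + y))))"

lemma step_integrable_add: "step_integrable M U \<Longrightarrow> step_integrable M V \<Longrightarrow> step_integrable M (\<lambda>j x. U j x + V j x)"
  and step_integrable_cmult: "step_integrable M U \<Longrightarrow> step_integrable M (\<lambda>j x. c * U j x)"
  unfolding step_integrable_def by auto

lemma step_integrable_exp:
  assumes "roots h M" "s \<in> S"
  shows "step_integrable M (\<lambda>j x. exp (s * x) * f j)"
  unfolding step_integrable_def
proof (intro allI impI conjI ballI)
  fix n x assume n: "n < N"
  have "integrable (M n) (\<lambda>y. exp (s * x) * f n * exp (s * y))" using assms n unfolding roots_def by auto
  then show "integrable (M n) (\<lambda>y. exp (s * (x + y)) * f n)" by (simp add: distrib_left exp_add mult_ac)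
  fix j assume j: "j \<in> {..<N}-{n}"
  have "integrable (nu n j) (\<lambda>y. exp (s * x) * f j * exp (s * y))" using S_nu[OF assms(2) n, of j] j by auto
  then show "integrable (nu n j) (\<lambda>y. exp (s * (x + y)) * f j)" by (simp add: distrib_left exp_add mult_ac)
qed

lemma integrable_bounded_shift:
  assumes "real_distribution M" "U \<in> borel_measurable borel" "\<And>x. \<bar>U x\<bar> \<le> (B::real)"
  shows "integrable M (\<lambda>y. U (x + y))"
proof -
  interpret real_distribution M by fact
  show ?thesis
    by (rule integrable_const_bound[where B=B]) (use assms in auto)
qed

lemma step_integrable_bounded:
  assumes "roots h M" "\<And>j. j < N \<Longrightarrow> U j \<in> borel_measurable borel" "\<And>j x. j < N \<Longrightarrow> \<bar>U j x\<bar> \<le> B"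
  shows "step_integrable M U"
  unfolding step_integrable_def
  using assms nu_dist by (auto simp: roots_def intro!: integrable_bounded_shift[where B=B])

lemma step_op_exp:
  assumes "roots h M" "s \<in> S" "n < N"
  shows "step_op h M (\<lambda>j x. exp (s * x) * f j) n x = exp (s * x) * step_factor h s f n"
proof -
  have 1: "(\<integral>y. exp (s * (x + y)) * f j \<partial>Q) = exp (s * x) * (mgf Q s * f j)" for Q :: "real measure" and j
    by (simp add: distrib_left exp_add mgf_def mult_ac)
  have "mgf (M n) s = exp (h * ln (mgf (mu n) s))" using assms unfolding roots_def by blast
  then show ?thesis unfolding step_op_def step_factor_def 1 by (simp add: sum_distrib_left algebra_simps)
qed

lemma step_op_weights: "roots h M \<Longrightarrow> n < N \<Longrightarrow> 1 - h * exit_rate n \<ge> 0"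
  "roots h M \<Longrightarrow> n < N \<Longrightarrow> j \<in> {..<N}-{n} \<Longrightarrow> h * Gen $$ (n,j) \<ge> 0"
  using Gen_nonneg by (auto simp: roots_def)

lemma step_op_mono:
  assumes r: "roots h M" and i: "step_integrable M U" "step_integrable M V" and n: "n < N"
    and le: "\<And>j x. j < N \<Longrightarrow> U j x \<le> V j x"
  shows "step_op h M U n x \<le> step_op h M V n x"
  unfolding step_op_def using i n le step_op_weights[OF r n] unfolding step_integrable_def
  by (intro add_mono sum_mono mult_left_mono integral_mono) auto

lemma step_op_add:
  assumes i: "step_integrable M U" "step_integrable M V" and n: "n < N"
  shows "step_op h M (\<lambda>j x. U j x + V j x) n x = step_op h M U n x + step_op h M V n x"
proof -
  have "(\<integral>y. U n (x + y) + V n (x + y) \<partial>M n) = (\<integral>y. U n (x + y) \<partial>M n) + (\<integral>y. V n (x + y) \<partial>M n)"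
    using i n unfolding step_integrable_def by (intro Bochner_Integration.integral_add) auto
  moreover have "(\<Sum>j\<in>{..<N}-{n}. h * Gen $$ (n,j) * (\<integral>y. U j (x + y) + V j (x + y) \<partial>nu n j)) =
    (\<Sum>j\<in>{..<N}-{n}. h * Gen $$ (n,j) * (\<integral>y. U j (x + y) \<partial>nu n j) + h * Gen $$ (n,j) * (\<integral>y. V j (x + y) \<partial>nu n j))"
    using i n unfolding step_integrable_def
    by (intro sum.cong refl) (simp add: Bochner_Integration.integral_add distrib_left)
  ultimately show ?thesis unfolding step_op_def by (simp add: sum.distrib algebra_simps)
qed

lemma step_op_cmult: "step_op h M (\<lambda>j x. c * U j x) n x = c * step_op h M U n x"
  unfolding step_op_def by (simp add: sum_distrib_left algebra_simps)

definition tails :: "real \<Rightarrow> (nat \<Rightarrow> real measure) \<Rightarrow> (nat \<Rightarrow> nat \<Rightarrow> real \<Rightarrow> real) \<Rightarrow> bool" where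
  "tails h M u \<longleftrightarrow> roots h M \<and> (\<forall>j. \<forall>n<N. u j n \<in> borel_measurable borel \<and> (\<forall>x. 0 \<le> u j n x \<and> u j n x \<le> 1)) \<and>
    (\<forall>n<N. \<forall>x. u 0 n x = (if x > 0 then 1 else 0)) \<and>
    (\<forall>j. \<forall>n<N. \<forall>x. u (Suc j) n x = h * phi n * (if x > 0 then 1 else 0) + step_op h M (u j) n x)"

lemma tails_step_integrable: "tails h M u \<Longrightarrow> step_integrable M (u j)"
  unfolding tails_def by (intro step_integrable_bounded[where B=1]) auto

lemma vec_lower_bound:
  fixes g :: "nat \<Rightarrow> real"
  assumes "\<And>i. i < N \<Longrightarrow> g i > 0"
  shows "\<exists>c>0. \<forall>i<N. c \<le> g i"
proof (intro exI conjI allI impI)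
  show "Min (g ` {..<N}) > 0" using assms N_pos by (subst Min_gr_iff) auto
  show "Min (g ` {..<N}) \<le> g i" if "i < N" for i using that by (intro Min_le) auto
qed

lemma vec_upper_bound:
  fixes g :: "nat \<Rightarrow> real"
  shows "\<exists>c>0. \<forall>i<N. g i \<le> c"
proof (intro exI conjI allI impI)
  have "\<bar>g i\<bar> \<le> (\<Sum>i<N. \<bar>g i\<bar>)" if "i < N" for i using that by (intro member_le_sum) auto
  then show "g i \<le> 1 + (\<Sum>i<N. \<bar>g i\<bar>)" if "i < N" for i using that by fastforce
  show "1 + (\<Sum>i<N. \<bar>g i\<bar>) > 0" by (simp add: add_pos_nonneg sum_nonneg)
qed

theorem tails_upper:
  assumes a: "\<alpha> > 0" "\<alpha> \<in> S" and h: "\<And>i. i < N \<Longrightarrow> hv i > 0" "\<And>i. i < N \<Longrightarrow> (\<Sum>j<N. A \<alpha> i j * hv j) = 0"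
  shows "\<exists>C K h0. K \<ge> 0 \<and> h0 > 0 \<and> (\<forall>h M u j n x. tails h M u \<longrightarrow> h \<le> h0 \<longrightarrow> n < N \<longrightarrow>
     u j n x \<le> (1 + K * h\<^sup>2) ^ j * (C * exp (\<alpha> * x)))"
proof -
  obtain g0 c where g0: "c > 0" "\<And>i. i < N \<Longrightarrow> g0 i > 0" "\<And>i. i < N \<Longrightarrow> (\<Sum>j<N. A (1/2 * \<alpha>) i j * g0 j) \<le> - c * g0 i"
    using subsolution_below[OF a(2) h, of "1/2"] by auto
  define s where "s = 1/2 * \<alpha>"
  have sS: "s \<in> S" using S_between[OF zero_S a(2), of "1/2"] by (simp add: s_def)
  obtain hm where hm: "hm > 0" "\<And>i. i < N \<Longrightarrow> hm \<le> hv i" using vec_lower_bound[of hv] h(1) by blast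
  obtain gM where gM: "gM > 0" "\<And>i. i < N \<Longrightarrow> g0 i \<le> gM" using vec_upper_bound[of g0] by blast
  define g where "g i = hm / gM * g0 i" for i
  have g: "g i > 0" "(\<Sum>j<N. A s i j * g j) \<le> - c * g i" "g i \<le> hv i" if i: "i < N" for i
  proof -
    show "g i > 0" using hm gM g0(2)[OF i] by (simp add: g_def)
    have "(\<Sum>j<N. A s i j * g j) = hm / gM * (\<Sum>j<N. A s i j * g0 j)"
      by (simp add: g_def sum_distrib_left algebra_simps)
    also have "\<dots> \<le> hm / gM * (- c * g0 i)" using g0(3)[OF i] hm gM by (intro mult_left_mono) (auto simp: s_def)
    finally show "(\<Sum>j<N. A s i j * g j) \<le> - c * g i" by (simp add: g_def algebra_simps)
    have "g i \<le> hm / gM * gM" unfolding g_def using gM(2)[OF i] hm gM by (intro mult_left_mono) auto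
    also have "\<dots> \<le> hv i" using hm gM i by auto
    finally show "g i \<le> hv i" .
  qed
  obtain gm where gm: "gm > 0" "\<And>i. i < N \<Longrightarrow> gm \<le> g i" using vec_lower_bound[of g] g(1) by blast
  obtain K1 where K1: "K1 \<ge> 0" "\<And>h n. 0 \<le> h \<Longrightarrow> h \<le> 1 \<Longrightarrow> n < N \<Longrightarrow>
    \<bar>step_factor h \<alpha> hv n - (hv n + h * (\<Sum>j<N. A \<alpha> n j * hv j))\<bar> \<le> K1 * h\<^sup>2 * hv n"
    using step_factor_expansion[where f=hv and s=\<alpha>] h(1) by blast
  obtain K2 where K2: "K2 \<ge> 0" "\<And>h n. 0 \<le> h \<Longrightarrow> h \<le> 1 \<Longrightarrow> n < N \<Longrightarrow>
    \<bar>step_factor h s g n - (g n + h * (\<Sum>j<N. A s n j * g j))\<bar> \<le> K2 * h\<^sup>2 * g n"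
    using step_factor_expansion[where f=g and s=s] g(1) by blast
  define K where "K = K1 + K2"
  obtain pM where pM: "pM > 0" "\<And>i. i < N \<Longrightarrow> phi i \<le> pM" using vec_upper_bound[of phi] by blast
  define C where "C = max (1 / gm) (pM / (c * gm))"
  have C: "C * gm \<ge> 1" "C * (c * gm) \<ge> pM" "C > 0"
  proof -
    have "1 / gm \<le> C" "pM / (c * gm) \<le> C" by (auto simp: C_def)
    then show "C * gm \<ge> 1" "C * (c * gm) \<ge> pM" using gm g0 by (auto simp: divide_le_eq)
    have "1 / gm > 0" using gm by simp
    then show "C > 0" using \<open>1 / gm \<le> C\<close> by linarith
  qed
  have K: "K \<ge> 0" using K1 K2 by (simp add: K_def)
  have main: "u j n x \<le> (1 + K * h\<^sup>2) ^ j * C * (exp (\<alpha> * x) * hv n) \<and> u j n x \<le> (1 + K * h\<^sup>2) ^ j * C * (exp (s * x) * g n)"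
    if t: "tails h M u" and n: "n < N" for h M u j n x
    using n
  proof (induction j arbitrary: n x)
    case 0
    have u0: "u 0 n x = (if x > 0 then 1 else 0)" using t 0 by (auto simp: tails_def)
    have "u 0 n x \<le> C * (exp (s * x) * g n)"
    proof (cases "x > 0")
      case True
      have "1 \<le> C * gm" using C by simp
      also have "\<dots> \<le> C * (exp (s * x) * g n)"
      proof (intro mult_left_mono)
        have "gm \<le> g n" using gm 0 by auto
        also have "\<dots> \<le> exp (s * x) * g n" using True a g(1)[OF 0] by (simp add: s_def)
        finally show "gm \<le> exp (s * x) * g n" .
      qed (use C in auto)
      finally show ?thesis using True u0 by simp
    next
      case False then show ?thesis using u0 C g(1)[OF 0] by simp
    qed
    moreover have "u 0 n x \<le> C * (exp (\<alpha> * x) * hv n)"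
    proof (cases "x > 0")
      case True
      have "exp (s * x) * g n \<le> exp (\<alpha> * x) * hv n" using True a g[OF 0] by (intro mult_mono) (auto simp: s_def)
      then have "C * (exp (s * x) * g n) \<le> C * (exp (\<alpha> * x) * hv n)" using C by (intro mult_left_mono) auto
      then show ?thesis using \<open>u 0 n x \<le> C * (exp (s * x) * g n)\<close> by linarith
    next
      case False then show ?thesis using u0 C h(1)[OF 0] by simp
    qed
    ultimately show ?case by simp
  next
    case (Suc j)
    let ?b = "(1 + K * h\<^sup>2) ^ j * C"
    have r: "roots h M" and hh: "0 < h" "h \<le> 1" using t by (auto simp: tails_def roots_def)
    have b: "?b > 0" using C K by (intro mult_pos_pos zero_less_power add_pos_nonneg) auto
    have "step_op h M (u j) n x \<le> step_op h M (\<lambda>i x. ?b * (exp (\<alpha> * x) * hv i)) n x"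
      by (rule step_op_mono[OF r tails_step_integrable[OF t] step_integrable_cmult[OF step_integrable_exp[OF r a(2)]] Suc.prems]) (use Suc.IH in blast)
    also have "\<dots> = ?b * (exp (\<alpha> * x) * step_factor h \<alpha> hv n)"
      using step_op_cmult[of h M ?b "\<lambda>i x. exp (\<alpha> * x) * hv i"] step_op_exp[OF r a(2) Suc.prems] by simp
    finally have k0: "step_op h M (u j) n x \<le> ?b * (exp (\<alpha> * x) * step_factor h \<alpha> hv n)" .
    have "step_factor h \<alpha> hv n \<le> (1 + K * h\<^sup>2) * hv n"
    proof -
      have "step_factor h \<alpha> hv n \<le> hv n + K1 * h\<^sup>2 * hv n" using K1(2)[of h n] hh Suc.prems h(2)[OF Suc.prems] by auto
      also have "\<dots> \<le> hv n + K * h\<^sup>2 * hv n" using K2(1) h(1)[OF Suc.prems] by (auto simp: K_def intro!: mult_right_mono)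
      finally show ?thesis by (simp add: algebra_simps)
    qed
    then have "?b * (exp (\<alpha> * x) * step_factor h \<alpha> hv n) \<le> ?b * (exp (\<alpha> * x) * ((1 + K * h\<^sup>2) * hv n))"
      using b by (intro mult_left_mono) auto
    with k0 have k1: "step_op h M (u j) n x \<le> ?b * (exp (\<alpha> * x) * ((1 + K * h\<^sup>2) * hv n))" by linarith
    have "step_op h M (u j) n x \<le> step_op h M (\<lambda>i x. ?b * (exp (s * x) * g i)) n x"
      by (rule step_op_mono[OF r tails_step_integrable[OF t] step_integrable_cmult[OF step_integrable_exp[OF r sS]] Suc.prems]) (use Suc.IH in blast)
    also have "\<dots> = ?b * (exp (s * x) * step_factor h s g n)"
      using step_op_cmult[of h M ?b "\<lambda>i x. exp (s * x) * g i"] step_op_exp[OF r sS Suc.prems] by simp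
    finally have k0: "step_op h M (u j) n x \<le> ?b * (exp (s * x) * step_factor h s g n)" .
    have "step_factor h s g n \<le> (1 + K * h\<^sup>2) * g n - h * (c * g n)"
    proof -
      have "h * (\<Sum>j<N. A s n j * g j) \<le> h * (- c * g n)" using g(2)[OF Suc.prems] hh by (intro mult_left_mono) auto
      then have "step_factor h s g n \<le> g n - h * (c * g n) + K2 * h\<^sup>2 * g n" using K2(2)[of h n] hh Suc.prems by auto
      also have "\<dots> \<le> g n - h * (c * g n) + K * h\<^sup>2 * g n" using K1(1) g(1)[OF Suc.prems] by (auto simp: K_def intro!: mult_right_mono)
      finally show ?thesis by (simp add: algebra_simps)
    qed
    then have "?b * (exp (s * x) * step_factor h s g n) \<le> ?b * (exp (s * x) * ((1 + K * h\<^sup>2) * g n - h * (c * g n)))"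
      using b by (intro mult_left_mono) auto
    with k0 have k2: "step_op h M (u j) n x \<le> ?b * (exp (s * x) * ((1 + K * h\<^sup>2) * g n - h * (c * g n)))" by linarith
    have us: "u (Suc j) n x = h * phi n * (if x > 0 then 1 else 0) + step_op h M (u j) n x"
      using t Suc.prems by (auto simp: tails_def)
    have c2: "u (Suc j) n x \<le> (1 + K * h\<^sup>2) ^ Suc j * C * (exp (s * x) * g n)"
    proof (cases "x > 0")
      case True
      have "h * phi n \<le> h * (C * (c * gm))" using pM Suc.prems C hh by (intro mult_left_mono) fastforce+
      also have "\<dots> \<le> h * (?b * (c * (exp (s * x) * g n)))"
      proof (intro mult_left_mono mult_mono)
        have "1 \<le> (1 + K * h\<^sup>2) ^ j" using K by (intro one_le_power) auto
        then show "C \<le> ?b" using C by simp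
        have "gm \<le> g n" using gm Suc.prems by auto
        also have "\<dots> \<le> exp (s * x) * g n" using True a g(1)[OF Suc.prems] by (simp add: s_def)
        finally show "gm \<le> exp (s * x) * g n" .
      qed (use g0 gm b hh in auto)
      finally have "u (Suc j) n x \<le> h * (?b * (c * (exp (s * x) * g n))) + ?b * (exp (s * x) * ((1 + K * h\<^sup>2) * g n - h * (c * g n)))"
        using us k2 True by simp
      then show ?thesis by (simp add: algebra_simps)
    next
      case False
      have "?b * (exp (s * x) * ((1 + K * h\<^sup>2) * g n - h * (c * g n))) \<le> ?b * (exp (s * x) * ((1 + K * h\<^sup>2) * g n))"
        using b hh g0(1) g(1)[OF Suc.prems] by (intro mult_left_mono) auto
      then show ?thesis using us k2 False by (simp add: algebra_simps)
    qed
    have c1: "u (Suc j) n x \<le> (1 + K * h\<^sup>2) ^ Suc j * C * (exp (\<alpha> * x) * hv n)"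
    proof (cases "x > 0")
      case True
      have "exp (s * x) * g n \<le> exp (\<alpha> * x) * hv n" using True a g[OF Suc.prems] by (intro mult_mono) (auto simp: s_def)
      then have "(1 + K * h\<^sup>2) ^ Suc j * C * (exp (s * x) * g n) \<le> (1 + K * h\<^sup>2) ^ Suc j * C * (exp (\<alpha> * x) * hv n)"
        using C K by (intro mult_left_mono) auto
      then show ?thesis using c2 by linarith
    next
      case False
      then show ?thesis using us k1 by (simp add: algebra_simps)
    qed
    show ?case using c1 c2 by blast
  qed
  obtain hM where hM: "hM > 0" "\<And>i. i < N \<Longrightarrow> hv i \<le> hM" using vec_upper_bound[of hv] by blast
  have "u j n x \<le> (1 + K * h\<^sup>2) ^ j * (C * hM * exp (\<alpha> * x))" if "tails h M u" "n < N" for h M u j n x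
  proof -
    have "u j n x \<le> (1 + K * h\<^sup>2) ^ j * C * (exp (\<alpha> * x) * hv n)" using main[OF that] by blast
    also have "\<dots> \<le> (1 + K * h\<^sup>2) ^ j * C * (exp (\<alpha> * x) * hM)"
      using C K hM that by (intro mult_left_mono) auto
    finally show ?thesis by (simp add: algebra_simps)
  qed
  then show ?thesis using K
    by (intro exI[of _ "C * hM"] exI[of _ K] exI[of _ 1]) auto
qed


theorem tails_lower:
  assumes a: "\<alpha> > 0" "\<alpha> \<in> S" and h: "\<And>i. i < N \<Longrightarrow> hv i > 0" "\<And>i. i < N \<Longrightarrow> (\<Sum>j<N. A \<alpha> i j * hv j) = 0"
    and s: "s \<in> S" "\<alpha> < s"
  shows "\<exists>c B d K h0. c > 0 \<and> B \<ge> 0 \<and> d > 0 \<and> K \<ge> 0 \<and> h0 > 0 \<and>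
    (\<forall>h M u j n x. tails h M u \<longrightarrow> h \<le> h0 \<longrightarrow> n < N \<longrightarrow> x \<le> 0 \<longrightarrow> d * h \<le> 1 \<and>
     (1 - K * h\<^sup>2) ^ j * (c * exp (\<alpha> * x)) \<le> u j n x + B * (1 - d * h) ^ j)"
proof -
  obtain k where k: "k < N" "phi k > 0" using phi_nz by blast
  obtain s3 f c3 where s3: "\<alpha> < s3" "s3 \<in> S" "c3 > 0" and f: "\<And>i. i < N \<Longrightarrow> f i > 0"
    "\<And>i. i < N \<Longrightarrow> i \<noteq> k \<Longrightarrow> (\<Sum>j<N. A s3 i j * f j) \<le> - c3 * f i"
    using subsolution_off_state[where h=hv, OF a(2) h s k(1)] by blast
  define s2 where "s2 = 1/2 * \<alpha> + 1/2 * s3"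
  have s2: "\<alpha> < s2" "s2 < s3" "s2 \<in> S" using s3 a S_between[OF a(2) s3(2), of "1/2"] by (auto simp: s2_def)
  obtain g c2 where g: "c2 > 0" "\<And>i. i < N \<Longrightarrow> g i > 0" "\<And>i. i < N \<Longrightarrow> (\<Sum>j<N. A s2 i j * g j) = c2 * g i"
    using supersolution_above[where h=hv, OF a h s2(3) s2(1)] by blast
  obtain g00 c0 where g00: "c0 > 0" "\<And>i. i < N \<Longrightarrow> g00 i > 0" "\<And>i. i < N \<Longrightarrow> (\<Sum>j<N. A 0 i j * g00 j) \<le> - c0 * g00 i"
    using subsolution_0 by blast
  obtain gm where gm: "gm > 0" "\<And>i. i < N \<Longrightarrow> gm \<le> g00 i" using vec_lower_bound[of g00] g00(2) by blast
  define g0 where "g0 i = g00 i / gm" for i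
  have g0: "g0 i \<ge> 1" "(\<Sum>j<N. A 0 i j * g0 j) \<le> - c0 * g0 i" if i: "i < N" for i
  proof -
    show "g0 i \<ge> 1" using gm(1) gm(2)[OF i] by (simp add: g0_def)
    have "(\<Sum>j<N. A 0 i j * g0 j) = (\<Sum>j<N. A 0 i j * g00 j) / gm" by (simp add: g0_def sum_divide_distrib)
    also have "\<dots> \<le> (- c0 * g00 i) / gm" using g00(3)[OF i] gm by (intro divide_right_mono) auto
    finally show "(\<Sum>j<N. A 0 i j * g0 j) \<le> - c0 * g0 i" by (simp add: g0_def)
  qed
  have g0p: "g0 i > 0" if "i < N" for i using g0(1)[OF that] by simp
  obtain K1 where K1: "K1 \<ge> 0" "\<And>h n. 0 \<le> h \<Longrightarrow> h \<le> 1 \<Longrightarrow> n < N \<Longrightarrow>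
    \<bar>step_factor h \<alpha> hv n - (hv n + h * (\<Sum>j<N. A \<alpha> n j * hv j))\<bar> \<le> K1 * h\<^sup>2 * hv n"
    using step_factor_expansion[where f=hv and s=\<alpha>] h(1) by blast
  obtain K2 where K2: "K2 \<ge> 0" "\<And>h n. 0 \<le> h \<Longrightarrow> h \<le> 1 \<Longrightarrow> n < N \<Longrightarrow>
    \<bar>step_factor h s2 g n - (g n + h * (\<Sum>j<N. A s2 n j * g j))\<bar> \<le> K2 * h\<^sup>2 * g n"
    using step_factor_expansion[where f=g and s=s2] g(2) by blast
  obtain K3 where K3: "K3 \<ge> 0" "\<And>h n. 0 \<le> h \<Longrightarrow> h \<le> 1 \<Longrightarrow> n < N \<Longrightarrow>
    \<bar>step_factor h s3 f n - (f n + h * (\<Sum>j<N. A s3 n j * f j))\<bar> \<le> K3 * h\<^sup>2 * f n"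
    using step_factor_expansion[where f=f and s=s3] f(1) by blast
  obtain K4 where K4: "K4 \<ge> 0" "\<And>h n. 0 \<le> h \<Longrightarrow> h \<le> 1 \<Longrightarrow> n < N \<Longrightarrow>
    \<bar>step_factor h 0 g0 n - (g0 n + h * (\<Sum>j<N. A 0 n j * g0 j))\<bar> \<le> K4 * h\<^sup>2 * g0 n"
    using step_factor_expansion[where f=g0 and s=0] g0p by blast
  define K where "K = K1 + K2 + K3 + K4 + 1"
  have K: "K > 0" "K1 \<le> K" "K2 \<le> K" "K3 \<le> K" "K4 \<le> K" using K1 K2 K3 K4 by (auto simp: K_def)
  define C3 where "C3 = max 0 ((\<Sum>j<N. A s3 k j * f j) / f k)"
  have C3: "C3 \<ge> 0" "(\<Sum>j<N. A s3 k j * f j) \<le> C3 * f k"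
  proof -
    have "(\<Sum>j<N. A s3 k j * f j) / f k \<le> C3" by (simp add: C3_def)
    then show "(\<Sum>j<N. A s3 k j * f j) \<le> C3 * f k" using f(1)[OF k(1)] by (simp add: divide_le_eq)
  qed (simp add: C3_def)
  obtain a0 where a0: "a0 > 0" "\<And>i. i < N \<Longrightarrow> f i / g i \<le> a0" using vec_upper_bound[of "\<lambda>i. f i / g i"] by blast
  define b where "b = a0 + (C3 + 1) * a0 / c2"
  have b: "b > 0" "\<And>i. i < N \<Longrightarrow> f i \<le> b * g i" "\<And>i. i < N \<Longrightarrow> (C3 + 1) * f i \<le> b * c2 * g i"
  proof -
    show b0: "b > 0" using a0 C3 g(1) by (auto simp: b_def intro!: add_pos_nonneg)
    fix i assume i: "i < N"
    have fg: "f i \<le> a0 * g i" using a0(2)[OF i] g(2)[OF i] by (simp add: divide_le_eq)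
    have "a0 \<le> b" using a0 C3 g(1) by (simp add: b_def)
    then have "a0 * g i \<le> b * g i" using g(2)[OF i] by (intro mult_right_mono) auto
    then show "f i \<le> b * g i" using fg by linarith
    have "(C3 + 1) * f i \<le> (C3 + 1) * (a0 * g i)" using fg C3 by (intro mult_left_mono) auto
    also have "\<dots> = (C3 + 1) * a0 / c2 * c2 * g i" using g(1) by simp
    also have "\<dots> \<le> b * c2 * g i" using g(1) g(2)[OF i] a0 by (intro mult_right_mono) (auto simp: b_def)
    finally show "(C3 + 1) * f i \<le> b * c2 * g i" .
  qed
  define L where "L i x = exp (\<alpha> * x) * hv i + b * (exp (s2 * x) * g i) + (- 1) * (exp (s3 * x) * f i)" for i x
  define X where "X i = max 0 (ln ((hv i + b * g i) / f i) / (s3 - s2))" for i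
  have hbg: "hv i + b * g i > 0" if "i < N" for i using h(1)[OF that] b(1) g(2)[OF that] by (simp add: add_pos_pos)
  have LX: "x \<le> X i" if i: "i < N" and L: "L i x > 0" for i x
  proof (cases "x \<le> 0")
    case True then show ?thesis by (simp add: X_def)
  next
    case False
    have "exp (s3 * x) * f i < exp (\<alpha> * x) * hv i + b * (exp (s2 * x) * g i)" using L by (simp add: L_def)
    also have "\<dots> \<le> exp (s2 * x) * hv i + b * (exp (s2 * x) * g i)"
      using False s2 h(1)[OF i] by (intro add_right_mono mult_right_mono) auto
    also have "\<dots> = exp (s2 * x) * (hv i + b * g i)" by (simp add: algebra_simps)
    finally have "exp (s3 * x) / exp (s2 * x) < (hv i + b * g i) / f i" using f(1)[OF i] by (simp add: field_simps)
    then have "exp ((s3 - s2) * x) < (hv i + b * g i) / f i" by (simp add: left_diff_distrib exp_diff)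
    then have "(s3 - s2) * x < ln ((hv i + b * g i) / f i)" by (metis exp_gt_zero less_trans ln_exp ln_less_cancel_iff)
    then have "x < ln ((hv i + b * g i) / f i) / (s3 - s2)" using s2 by (simp add: field_simps)
    then show ?thesis by (simp add: X_def)
  qed
  have X0: "X i \<ge> 0" for i by (simp add: X_def)
  obtain B where B: "B > 0" "\<And>i. i < N \<Longrightarrow> exp (s2 * X i) * (hv i + b * g i) \<le> B"
    using vec_upper_bound[of "\<lambda>i. exp (s2 * X i) * (hv i + b * g i)"] by blast
  have LB: "max 0 (L i x) \<le> B" if i: "i < N" for i x
  proof (cases "L i x > 0")
    case True
    have x: "x \<le> X i" using LX[OF i True] .
    have e1: "exp (\<alpha> * x) \<le> exp (s2 * X i)"
    proof -
      have "\<alpha> * x \<le> \<alpha> * X i" using x a by (intro mult_left_mono) auto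
      also have "\<dots> \<le> s2 * X i" using s2 X0 by (intro mult_right_mono) auto
      finally show ?thesis by simp
    qed
    have e2: "exp (s2 * x) \<le> exp (s2 * X i)" using x a s2 by simp
    have "L i x \<le> exp (\<alpha> * x) * hv i + b * (exp (s2 * x) * g i)" using f(1)[OF i] by (simp add: L_def)
    also have "\<dots> \<le> exp (s2 * X i) * hv i + b * (exp (s2 * X i) * g i)"
      using e1 e2 h(1)[OF i] g(2)[OF i] b(1) by (intro add_mono mult_right_mono mult_left_mono) auto
    also have "\<dots> \<le> B" using B(2)[OF i] by (simp add: algebra_simps)
    finally show ?thesis using True B by simp
  next
    case False then show ?thesis using B by simp
  qed
  define G where "G = (C3 + 1) * (exp (s3 * X k) * f k)"
  have G: "G > 0" using C3 f(1)[OF k(1)] by (simp add: G_def)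
  define \<sigma> where "\<sigma> = phi k / G"
  have sg: "\<sigma> > 0" "\<sigma> * G = phi k" using G k by (auto simp: \<sigma>_def)
  define h0 where "h0 = min 1 (min (c3 / (2 * K)) (min (1 / (2 * K)) (min (c0 / (2 * K)) (1 / c0))))"
  have h0: "h0 > 0" using K s3 g00 by (simp add: h0_def)
  have h0': "h \<le> 1" "2 * K * h \<le> c3" "2 * K * h \<le> 1" "K * h \<le> c0 / 2" "c0 * h \<le> 1" if "h \<le> h0" for h
    using that K g00(1) by (auto simp: h0_def field_simps)
  define d where "d = c0 / 2"
  have claim: "\<sigma> * ((1 - K * h\<^sup>2) * L n x) \<le> h * phi n * (if x > 0 then 1 else 0) + \<sigma> * step_op h M L n x"
    if r: "roots h M" and hh: "h \<le> h0" and n: "n < N" and L0: "L n x > 0" for h M n x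
  proof -
    have hp: "0 < h" "h \<le> 1" using r by (auto simp: roots_def)
    have h2: "0 \<le> h\<^sup>2" by simp
    have i1: "step_integrable M (\<lambda>i x. exp (\<alpha> * x) * hv i)" and i2: "step_integrable M (\<lambda>i x. b * (exp (s2 * x) * g i))"
      and i3: "step_integrable M (\<lambda>i x. (-1) * (exp (s3 * x) * f i))"
      by (intro step_integrable_cmult step_integrable_exp[OF r] a s2 s3)+
    have "step_op h M L n x = step_op h M (\<lambda>i x. exp (\<alpha> * x) * hv i + b * (exp (s2 * x) * g i)) n x + step_op h M (\<lambda>i x. (-1) * (exp (s3 * x) * f i)) n x"
      unfolding L_def by (rule step_op_add[OF step_integrable_add[OF i1 i2] i3 n])
    also have "step_op h M (\<lambda>i x. exp (\<alpha> * x) * hv i + b * (exp (s2 * x) * g i)) n x =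
      step_op h M (\<lambda>i x. exp (\<alpha> * x) * hv i) n x + step_op h M (\<lambda>i x. b * (exp (s2 * x) * g i)) n x"
      by (rule step_op_add[OF i1 i2 n])
    finally have kL: "step_op h M L n x = exp (\<alpha> * x) * step_factor h \<alpha> hv n + b * (exp (s2 * x) * step_factor h s2 g n) - exp (s3 * x) * step_factor h s3 f n"
      unfolding step_op_cmult[of h M b] step_op_cmult[of h M "-1"] step_op_exp[OF r a(2) n] step_op_exp[OF r s2(3) n] step_op_exp[OF r s3(2) n] by simp
    have q1: "step_factor h \<alpha> hv n \<ge> (1 - K * h\<^sup>2) * hv n"
    proof -
      have "K1 * h\<^sup>2 * hv n \<le> K * h\<^sup>2 * hv n" using K h(1)[OF n] by (intro mult_right_mono) auto
      then show ?thesis using K1(2)[of h n] hp n h(2)[OF n] by (simp add: algebra_simps)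
    qed
    have q2: "step_factor h s2 g n \<ge> (1 + h * c2 - K * h\<^sup>2) * g n"
    proof -
      have "K2 * h\<^sup>2 * g n \<le> K * h\<^sup>2 * g n" using K g(2)[OF n] by (intro mult_right_mono) auto
      then show ?thesis using K2(2)[of h n] hp n g(3)[OF n] by (simp add: algebra_simps)
    qed
    define \<theta> where "\<theta> = (if n = k then C3 else - c3)"
    have q3: "step_factor h s3 f n \<le> (1 + h * \<theta> + K * h\<^sup>2) * f n"
    proof -
      have k3: "K3 * h\<^sup>2 * f n \<le> K * h\<^sup>2 * f n" using K f(1)[OF n] by (intro mult_right_mono) auto
      have "(\<Sum>j<N. A s3 n j * f j) \<le> \<theta> * f n" using f(2)[OF n] C3 by (auto simp: \<theta>_def)
      then have "h * (\<Sum>j<N. A s3 n j * f j) \<le> h * (\<theta> * f n)" using hp by (intro mult_left_mono) auto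
      moreover have "step_factor h s3 f n \<le> f n + h * (\<Sum>j<N. A s3 n j * f j) + K3 * h\<^sup>2 * f n"
        using K3(2)[of h n] hp n by linarith
      ultimately have "step_factor h s3 f n \<le> f n + h * (\<theta> * f n) + K * h\<^sup>2 * f n" using k3 by linarith
      then show ?thesis by (simp add: algebra_simps)
    qed
    have "exp (\<alpha> * x) * ((1 - K * h\<^sup>2) * hv n) + b * (exp (s2 * x) * ((1 + h * c2 - K * h\<^sup>2) * g n)) - exp (s3 * x) * ((1 + h * \<theta> + K * h\<^sup>2) * f n) \<le> step_op h M L n x"
      unfolding kL using q1 q2 q3 b(1) by (intro diff_mono add_mono mult_left_mono) auto
    then have diff: "b * (h * c2) * (exp (s2 * x) * g n) - (h * \<theta> + 2 * K * h\<^sup>2) * (exp (s3 * x) * f n) \<le> step_op h M L n x - (1 - K * h\<^sup>2) * L n x"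
      by (simp add: L_def algebra_simps)
    have gpos: "b * (h * c2) * (exp (s2 * x) * g n) \<ge> 0" using b(1) hp g(1) g(2)[OF n] by simp
    have h2K: "2 * K * h\<^sup>2 \<le> h * min 1 c3"
    proof -
      have "2 * K * h\<^sup>2 = h * (2 * K * h)" by (simp add: power2_eq_square)
      also have "\<dots> \<le> h * min 1 c3" using h0'[OF hh] hp by (intro mult_left_mono) auto
      finally show ?thesis .
    qed
    have fin: "step_op h M L n x - (1 - K * h\<^sup>2) * L n x \<ge> 0 \<Longrightarrow> ?thesis"
    proof -
      assume "step_op h M L n x - (1 - K * h\<^sup>2) * L n x \<ge> 0"
      then have "\<sigma> * ((1 - K * h\<^sup>2) * L n x) \<le> \<sigma> * step_op h M L n x" using sg by (intro mult_left_mono) auto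
      moreover have "h * phi n * (if x > 0 then 1 else 0) \<ge> 0" using hp phi_nonneg[OF n] by simp
      ultimately show ?thesis by linarith
    qed
    show ?thesis
    proof (cases "n = k")
      case False
      have "h * min 1 c3 \<le> h * c3" using hp by (intro mult_left_mono) auto
      then have "h * \<theta> + 2 * K * h\<^sup>2 \<le> 0" using h2K False by (simp add: \<theta>_def)
      then have "(h * \<theta> + 2 * K * h\<^sup>2) * (exp (s3 * x) * f n) \<le> 0"
        using f(1)[OF n] by (intro mult_nonpos_nonneg) auto
      then show ?thesis using diff gpos by (intro fin) linarith
    next
      case True
      have "h * min 1 c3 \<le> h * 1" using hp by (intro mult_left_mono) auto
      then have t1: "h * \<theta> + 2 * K * h\<^sup>2 \<le> h * (C3 + 1)" using h2K True by (simp add: \<theta>_def algebra_simps)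
      then have t2: "(h * \<theta> + 2 * K * h\<^sup>2) * (exp (s3 * x) * f n) \<le> h * (C3 + 1) * (exp (s3 * x) * f n)"
        using f(1)[OF n] by (intro mult_right_mono) auto
      show ?thesis
      proof (cases "x > 0")
        case False
        have "exp (s3 * x) * ((C3 + 1) * f n) \<le> exp (s2 * x) * (b * c2 * g n)"
        proof (rule mult_mono)
          have "s3 * x \<le> s2 * x" using False s2 by (intro mult_right_mono_neg) auto
          then show "exp (s3 * x) \<le> exp (s2 * x)" by simp
        qed (use b(3)[OF n] C3 f(1)[OF n] in auto)
        then have "h * (exp (s3 * x) * ((C3 + 1) * f n)) \<le> h * (exp (s2 * x) * (b * c2 * g n))"
          using hp by (intro mult_left_mono) auto
        moreover have "h * (exp (s3 * x) * ((C3 + 1) * f n)) = h * (C3 + 1) * (exp (s3 * x) * f n)"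
          "h * (exp (s2 * x) * (b * c2 * g n)) = b * (h * c2) * (exp (s2 * x) * g n)" by (auto simp: algebra_simps)
        ultimately show ?thesis using diff t2 by (intro fin) linarith
      next
        case x: True
        have "exp (s3 * x) \<le> exp (s3 * X k)" using LX[OF n L0] True a s3 by simp
        then have "h * (C3 + 1) * (exp (s3 * x) * f n) \<le> h * (C3 + 1) * (exp (s3 * X k) * f n)"
          using f(1)[OF n] C3 hp by (intro mult_left_mono mult_right_mono) auto
        also have "\<dots> = h * G" using True by (simp add: G_def)
        finally have "- (h * G) \<le> step_op h M L n x - (1 - K * h\<^sup>2) * L n x" using diff t2 gpos by linarith
        then have "\<sigma> * (- (h * G)) \<le> \<sigma> * (step_op h M L n x - (1 - K * h\<^sup>2) * L n x)"
          using sg by (intro mult_left_mono) auto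
        moreover have "\<sigma> * (- (h * G)) = - (h * phi n)" using sg True by (simp add: algebra_simps)
        moreover have "\<sigma> * (step_op h M L n x - (1 - K * h\<^sup>2) * L n x) = \<sigma> * step_op h M L n x - \<sigma> * ((1 - K * h\<^sup>2) * L n x)"
          by (simp add: right_diff_distrib)
        moreover have "h * phi n * (if x > 0 then 1 else 0) = h * phi n" using x by simp
        ultimately show ?thesis by linarith
      qed
    qed
  qed
  have main: "(1 - K * h\<^sup>2) ^ j * (\<sigma> * max 0 (L n x)) \<le> u j n x + \<sigma> * B * (1 - d * h) ^ j * g0 n"
    if t: "tails h M u" and hh: "h \<le> h0" and n: "n < N" for h M u j n x
    using n
  proof (induction j arbitrary: n x)
    case 0
    have "\<sigma> * max 0 (L n x) \<le> \<sigma> * (B * g0 n)"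
    proof (intro mult_left_mono)
      have "max 0 (L n x) \<le> B * 1" using LB[OF 0] by simp
      also have "\<dots> \<le> B * g0 n" using g0(1)[OF 0] B by (intro mult_left_mono) auto
      finally show "max 0 (L n x) \<le> B * g0 n" .
    qed (use sg in auto)
    moreover have "u 0 n x \<ge> 0" using t 0 by (auto simp: tails_def)
    ultimately show ?case by simp
  next
    case (Suc j)
    have r: "roots h M" and hp: "0 < h" "h \<le> 1" using t by (auto simp: tails_def roots_def)
    have Kh: "K * h\<^sup>2 \<le> 1/2"
    proof -
      have "K * h\<^sup>2 = (K * h) * h" by (simp add: power2_eq_square)
      also have "\<dots> \<le> (1/2) * 1" using h0'[OF hh] hp K by (intro mult_mono) auto
      finally show ?thesis by simp
    qed
    have p0: "0 \<le> (1 - K * h\<^sup>2) ^ j" "(1 - K * h\<^sup>2) ^ j \<le> 1" using Kh K by (auto intro: zero_le_power power_le_one)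
    have dh: "d * h \<le> 1/2" using h0'(5)[OF hh] by (simp add: d_def)
    have d0: "(1 - d * h) ^ j \<ge> 0" using dh by simp
    have us: "u (Suc j) n x = h * phi n * (if x > 0 then 1 else 0) + step_op h M (u j) n x" "u (Suc j) n x \<ge> 0"
      using t Suc.prems unfolding tails_def by blast+
    show ?case
    proof (cases "L n x > 0")
      case False
      then show ?thesis using us(2) sg B(1) g0p[OF Suc.prems] dh by simp
    next
      case True
      let ?D = "\<sigma> * B * (1 - d * h) ^ j"
      have D0: "?D \<ge> 0" using sg B d0 by simp
      have iL: "step_integrable M (\<lambda>i x. \<sigma> * ((1 - K * h\<^sup>2) ^ j * L i x))"
        unfolding L_def by (intro step_integrable_cmult step_integrable_add step_integrable_exp[OF r] a s2 s3)
      have iD: "step_integrable M (\<lambda>i x. ?D * (exp (0 * x) * g0 i))" by (intro step_integrable_cmult step_integrable_exp[OF r] zero_S)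
      have "step_op h M (\<lambda>i x. \<sigma> * ((1 - K * h\<^sup>2) ^ j * L i x)) n x \<le> step_op h M (\<lambda>i x. u j i x + ?D * (exp (0 * x) * g0 i)) n x"
      proof (rule step_op_mono[OF r iL step_integrable_add[OF tails_step_integrable[OF t] iD] Suc.prems])
        fix i x assume i: "i < N"
        have "\<sigma> * ((1 - K * h\<^sup>2) ^ j * L i x) = (1 - K * h\<^sup>2) ^ j * (\<sigma> * L i x)" by simp
        also have "\<dots> \<le> (1 - K * h\<^sup>2) ^ j * (\<sigma> * max 0 (L i x))" using p0 sg by (intro mult_left_mono) auto
        also have "\<dots> \<le> u j i x + ?D * (exp (0 * x) * g0 i)" using Suc.IH[OF i] by simp
        finally show "\<sigma> * ((1 - K * h\<^sup>2) ^ j * L i x) \<le> u j i x + ?D * (exp (0 * x) * g0 i)" .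
      qed
      also have "\<dots> = step_op h M (u j) n x + ?D * (exp (0 * x) * step_factor h 0 g0 n)"
        unfolding step_op_add[OF tails_step_integrable[OF t] iD Suc.prems] step_op_cmult[of h M ?D] step_op_exp[OF r zero_S Suc.prems] by simp
      also have "\<dots> \<le> step_op h M (u j) n x + ?D * ((1 - d * h) * g0 n)"
      proof -
        have "K4 * h\<^sup>2 * g0 n \<le> (K * h) * h * g0 n" using K hp g0p[OF Suc.prems]
          unfolding power2_eq_square mult.assoc[symmetric] by (intro mult_right_mono) auto
        also have "\<dots> \<le> (c0 / 2) * h * g0 n" using h0'(4)[OF hh] hp g0p[OF Suc.prems] by (intro mult_right_mono) auto
        finally have "K4 * h\<^sup>2 * g0 n \<le> (c0 / 2) * h * g0 n" .
        moreover have "h * (\<Sum>j<N. A 0 n j * g0 j) \<le> h * (- c0 * g0 n)" using g0(2)[OF Suc.prems] hp by (intro mult_left_mono) auto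
        ultimately have "step_factor h 0 g0 n \<le> (1 - d * h) * g0 n"
          using K4(2)[of h n] hp Suc.prems by (simp add: d_def algebra_simps)
        then show ?thesis using D0 by (simp add: mult_left_mono)
      qed
      finally have k1: "step_op h M (\<lambda>i x. \<sigma> * ((1 - K * h\<^sup>2) ^ j * L i x)) n x \<le> step_op h M (u j) n x + \<sigma> * B * (1 - d * h) ^ Suc j * g0 n"
        by (simp add: algebra_simps)
      have "step_op h M (\<lambda>i x. \<sigma> * ((1 - K * h\<^sup>2) ^ j * L i x)) n x = (1 - K * h\<^sup>2) ^ j * (\<sigma> * step_op h M L n x)"
        unfolding step_op_cmult[of h M \<sigma>] step_op_cmult[of h M "(1 - K * h\<^sup>2) ^ j"] by simp
      then have k2: "(1 - K * h\<^sup>2) ^ j * (\<sigma> * step_op h M L n x) \<le> step_op h M (u j) n x + \<sigma> * B * (1 - d * h) ^ Suc j * g0 n"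
        using k1 by simp
      have "(1 - K * h\<^sup>2) ^ Suc j * (\<sigma> * max 0 (L n x)) = (1 - K * h\<^sup>2) ^ j * (\<sigma> * ((1 - K * h\<^sup>2) * L n x))"
        using True by simp
      also have "\<dots> \<le> (1 - K * h\<^sup>2) ^ j * (h * phi n * (if x > 0 then 1 else 0) + \<sigma> * step_op h M L n x)"
        by (rule mult_left_mono[OF claim[OF r hh Suc.prems True] p0(1)])
      also have "\<dots> = (1 - K * h\<^sup>2) ^ j * (h * phi n * (if x > 0 then 1 else 0)) + (1 - K * h\<^sup>2) ^ j * (\<sigma> * step_op h M L n x)"
        by (simp add: distrib_left)
      also have "\<dots> \<le> h * phi n * (if x > 0 then 1 else 0) + (step_op h M (u j) n x + \<sigma> * B * (1 - d * h) ^ Suc j * g0 n)"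
      proof (rule add_mono[OF _ k2])
        have "h * phi n * (if x > 0 then 1 else 0) \<ge> 0" using hp phi_nonneg[OF Suc.prems] by simp
        then show "(1 - K * h\<^sup>2) ^ j * (h * phi n * (if x > 0 then 1 else 0)) \<le> h * phi n * (if x > 0 then 1 else 0)"
          using p0 by (simp add: mult_left_le_one_le)
      qed
      finally show ?thesis using us(1) by simp
    qed
  qed
  obtain hm where hm: "hm > 0" "\<And>i. i < N \<Longrightarrow> hm \<le> hv i" using vec_lower_bound[of hv] h(1) by blast
  obtain gM where gM: "gM > 0" "\<And>i. i < N \<Longrightarrow> g0 i \<le> gM" using vec_upper_bound[of g0] by blast
  have "d * h \<le> 1 \<and> (1 - K * h\<^sup>2) ^ j * (\<sigma> * hm * exp (\<alpha> * x)) \<le> u j n x + \<sigma> * B * gM * (1 - d * h) ^ j"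
    if t: "tails h M u" and hh: "h \<le> h0" and n: "n < N" and x: "x \<le> 0" for h M u j n x
  proof
    have hp: "0 < h" "h \<le> 1" using t by (auto simp: tails_def roots_def)
    have dh: "d * h \<le> 1/2" using h0'(5)[OF hh] by (simp add: d_def)
    then show "d * h \<le> 1" by simp
    have Kh: "K * h\<^sup>2 \<le> 1/2"
    proof -
      have "K * h\<^sup>2 = (K * h) * h" by (simp add: power2_eq_square)
      also have "\<dots> \<le> (1/2) * 1" using h0'[OF hh] hp K by (intro mult_mono) auto
      finally show ?thesis by simp
    qed
    have "exp (s3 * x) * f n \<le> exp (s2 * x) * (b * g n)"
    proof (rule mult_mono)
      have "s3 * x \<le> s2 * x" using x s2 by (intro mult_right_mono_neg) auto
      then show "exp (s3 * x) \<le> exp (s2 * x)" by simp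
    qed (use b(2)[OF n] f(1)[OF n] in auto)
    then have "exp (\<alpha> * x) * hv n \<le> L n x" by (simp add: L_def algebra_simps)
    moreover have "exp (\<alpha> * x) * hm \<le> exp (\<alpha> * x) * hv n" using hm(2)[OF n] by simp
    ultimately have "exp (\<alpha> * x) * hm \<le> max 0 (L n x)" by linarith
    then have "hm * exp (\<alpha> * x) \<le> max 0 (L n x)" by (simp only: mult.commute)
    then have "(1 - K * h\<^sup>2) ^ j * (\<sigma> * (hm * exp (\<alpha> * x))) \<le> (1 - K * h\<^sup>2) ^ j * (\<sigma> * max 0 (L n x))"
      using sg Kh by (intro mult_left_mono) auto
    also have "\<dots> \<le> u j n x + \<sigma> * B * (1 - d * h) ^ j * g0 n" by (rule main[OF t hh n])
    also have "\<dots> \<le> u j n x + \<sigma> * B * (1 - d * h) ^ j * gM"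
      using sg B(1) dh gM(2)[OF n] by (intro add_left_mono mult_left_mono) auto
    finally show "(1 - K * h\<^sup>2) ^ j * (\<sigma> * hm * exp (\<alpha> * x)) \<le> u j n x + \<sigma> * B * gM * (1 - d * h) ^ j"
      by (simp add: algebra_simps)
  qed
  moreover have "\<sigma> * hm > 0" "\<sigma> * B * gM \<ge> 0" "d > 0" "K \<ge> 0" using sg hm B gM g00 K by (auto simp: d_def)
  ultimately show ?thesis using h0
    by (intro exI[of _ "\<sigma> * hm"] exI[of _ "\<sigma> * B * gM"] exI[of _ d] exI[of _ K] exI[of _ h0]) blast
qed

end

section \<open>Laws of the discrete chain\<close>

lemma real_distribution_convolution:
  assumes "real_distribution M" "real_distribution N"
  shows "real_distribution (M \<star> N)"
proof -
  interpret M: real_distribution M by fact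
  interpret N: real_distribution N by fact
  interpret P: pair_prob_space M N ..
  show ?thesis
    by (rule real_distributionI) (auto simp: convolution_def intro!: P.prob_space_distr)
qed

lemma char_convolution:
  assumes "real_distribution M" "real_distribution N"
  shows "char (M \<star> N) t = char M t * char N t"
proof -
  interpret M: real_distribution M by fact
  interpret N: real_distribution N by fact
  interpret P: pair_prob_space M N ..
  have int: "integrable (M \<Otimes>\<^sub>M N) (\<lambda>(x,y). iexp (t * x) * iexp (t * y))"
    by (rule P.integrable_const_bound[where B=1]) (auto simp: norm_mult split_beta)
  have "char (M \<star> N) t = (\<integral>z. iexp (t * (fst z + snd z)) \<partial>(M \<Otimes>\<^sub>M N))"
    unfolding char_def convolution_def by (subst integral_distr) (auto simp: split_beta)
  also have "\<dots> = (\<integral>z. (case z of (x,y) \<Rightarrow> iexp (t * x) * iexp (t * y)) \<partial>(M \<Otimes>\<^sub>M N))"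
    by (intro Bochner_Integration.integral_cong) (auto simp: distrib_left exp_add split_beta)
  also have "\<dots> = (\<integral>x. (\<integral>y. iexp (t * x) * iexp (t * y) \<partial>N) \<partial>M)"
    using P.integral_fst'[OF int] by simp
  also have "\<dots> = char M t * char N t"
    by (simp add: char_def)
  finally show ?thesis .
qed

lemma measure_convolution_tail:
  assumes "real_distribution M" "real_distribution N"
  shows "measure (M \<star> N) {z. x + z > 0} = (\<integral>y. measure N {z. x + y + z > 0} \<partial>M)"
proof -
  interpret M: real_distribution M by fact
  interpret N: real_distribution N by fact
  interpret C: real_distribution "M \<star> N" using real_distribution_convolution assms .
  have meas: "(\<lambda>y. measure N {z. x + y + z > 0}) \<in> borel_measurable M"
  proof -
    have "(\<lambda>y. measure N {z \<in> space N. (y, z) \<in> {(y,z). x + y + z > 0}}) \<in> borel_measurable M"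
      by measurable
    then show ?thesis by simp
  qed
  have "emeasure (M \<star> N) {z. x + z > 0} = (\<integral>\<^sup>+y. emeasure N {a. a + y \<in> {z. x + z > 0}} \<partial>M)"
    by (rule convolution_emeasure) (auto simp: M.finite_measure_axioms N.finite_measure_axioms)
  also have "\<dots> = (\<integral>\<^sup>+y. ennreal (measure N {z. x + y + z > 0}) \<partial>M)"
    by (intro nn_integral_cong) (simp add: N.emeasure_eq_measure algebra_simps)
  also have "\<dots> = ennreal (\<integral>y. measure N {z. x + y + z > 0} \<partial>M)"
    by (rule nn_integral_eq_integral) (auto intro!: M.integrable_const_bound[where B=1] meas)
  finally show ?thesis by (simp add: C.emeasure_eq_measure)
qed

definition mixture :: "nat \<Rightarrow> (nat \<Rightarrow> real) \<Rightarrow> (nat \<Rightarrow> real measure) \<Rightarrow> real measure" where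
  "mixture N w R = measure_pmf (embed_pmf (\<lambda>i. if i \<le> N then w i else 0)) \<bind> (\<lambda>i. if i \<le> N then R i else return borel 0)"

lemma mixture_props:
  assumes w: "\<And>i. i \<le> N \<Longrightarrow> w i \<ge> 0" "(\<Sum>i\<le>N. w i) = 1"
    and R: "\<And>i. i \<le> N \<Longrightarrow> real_distribution (R i)"
  shows "real_distribution (mixture N w R)"
    "X \<in> sets borel \<Longrightarrow> measure (mixture N w R) X = (\<Sum>i\<le>N. w i * measure (R i) X)"
    "char (mixture N w R) t = (\<Sum>i\<le>N. of_real (w i) * char (R i) t)"
proof -
  define w' where "w' i = (if i \<le> N then w i else 0)" for i
  define R' where "R' i = (if i \<le> N then R i else return borel 0)" for i
  define p where "p = embed_pmf w'"
  have mix: "mixture N w R = measure_pmf p \<bind> R'" by (simp add: mixture_def p_def w'_def[abs_def] R'_def[abs_def])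
  have "(\<integral>\<^sup>+i. ennreal (w' i) \<partial>count_space UNIV) = (\<integral>\<^sup>+i. ennreal (w' i) * indicator {..N} i \<partial>count_space UNIV)"
    by (intro nn_integral_cong) (auto simp: w'_def indicator_def)
  also have "\<dots> = (\<integral>\<^sup>+i. ennreal (w' i) \<partial>count_space {..N})"
    by (simp add: nn_integral_count_space_indicator)
  also have "\<dots> = (\<Sum>i\<le>N. ennreal (w i))" by (simp add: nn_integral_count_space_finite w'_def)
  also have "\<dots> = ennreal (\<Sum>i\<le>N. w i)" using w by (intro sum_ennreal) auto
  also have "\<dots> = 1" using w by simp
  finally have pm: "pmf p i = w' i" for i
    unfolding p_def using w by (intro pmf_embed_pmf) (auto simp: w'_def)
  have R'd: "real_distribution (R' i)" for i
    using R by (auto simp: R'_def intro!: real_distributionI prob_space_return)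
  then have R's: "R' i \<in> space (subprob_algebra borel)" for i
    unfolding space_subprob_algebra real_distribution_def real_distribution_axioms_def
    by (auto intro: prob_space_imp_subprob_space)
  have Rm: "R' \<in> measurable (measure_pmf p) (subprob_algebra borel)" using R's by simp
  have Rpm: "R' \<in> measurable (measure_pmf p) (prob_algebra borel)"
    using R'd by (auto simp: space_prob_algebra real_distribution_def real_distribution_axioms_def)
  show rd: "real_distribution (mixture N w R)"
    unfolding mix
  proof (rule real_distributionI)
    show "prob_space (measure_pmf p \<bind> R')"
      by (rule prob_space_bind'[OF _ Rpm]) (simp add: space_prob_algebra measure_pmf.prob_space_axioms)
    show "sets (measure_pmf p \<bind> R') = sets borel"
      by (rule sets_bind) (use R's in \<open>auto simp: space_subprob_algebra\<close>)
  qed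
  interpret Q: real_distribution "mixture N w R" by fact
  have fin: "(\<integral>i. f i \<partial>measure_pmf p) = (\<Sum>i\<le>N. w i * f i)" for f :: "nat \<Rightarrow> real"
  proof -
    have "(\<integral>i. f i \<partial>measure_pmf p) = (\<Sum>i\<le>N. f i * pmf p i)"
      by (rule integral_measure_pmf_real) (auto simp: set_pmf_iff pm w'_def split: if_splits)
    then show ?thesis by (simp add: pm w'_def mult.commute)
  qed
  show "measure (mixture N w R) X = (\<Sum>i\<le>N. w i * measure (R i) X)" if "X \<in> sets borel"
  proof -
    have "measure (mixture N w R) X = (\<integral>i. measure (R' i) X \<partial>measure_pmf p)"
      unfolding mix by (rule measure_pmf.measure_bind[OF Rm that])
    then show ?thesis by (simp add: fin R'_def)
  qed
  have int: "(\<integral>x. f x \<partial>mixture N w R) = (\<Sum>i\<le>N. w i * (\<integral>x. f x \<partial>R i))"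
    if f: "f \<in> borel_measurable borel" "\<And>x. 0 \<le> f x" "\<And>x. f x \<le> 2" for f :: "real \<Rightarrow> real"
  proof -
    have fi: "integrable (R' i) f" for i
    proof -
      interpret real_distribution "R' i" using R'd .
      show ?thesis by (rule integrable_const_bound[where B=2]) (use f in auto)
    qed
    have i2: "0 \<le> (\<integral>x. f x \<partial>R' i)" "(\<integral>x. f x \<partial>R' i) \<le> 2" for i
    proof -
      interpret real_distribution "R' i" using R'd .
      show "0 \<le> (\<integral>x. f x \<partial>R' i)" using f by simp
      show "(\<integral>x. f x \<partial>R' i) \<le> 2" using f fi by (intro integral_le_const) auto
    qed
    have "(\<integral>\<^sup>+x. ennreal (f x) \<partial>mixture N w R) = (\<integral>\<^sup>+i. \<integral>\<^sup>+x. ennreal (f x) \<partial>R' i \<partial>measure_pmf p)"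
      unfolding mix by (rule nn_integral_bind[OF _ Rm]) (use f in auto)
    also have "\<dots> = (\<integral>\<^sup>+i. ennreal (\<integral>x. f x \<partial>R' i) \<partial>measure_pmf p)"
      by (intro nn_integral_cong nn_integral_eq_integral fi) (use f in auto)
    also have "\<dots> = ennreal (\<integral>i. (\<integral>x. f x \<partial>R' i) \<partial>measure_pmf p)"
      by (intro nn_integral_eq_integral measure_pmf.integrable_const_bound[where B=2]) (use i2 in auto)
    finally have "(\<integral>\<^sup>+x. ennreal (f x) \<partial>mixture N w R) = ennreal (\<Sum>i\<le>N. w i * (\<integral>x. f x \<partial>R' i))"
      by (simp add: fin)
    moreover have "(\<integral>x. f x \<partial>mixture N w R) = enn2real (\<integral>\<^sup>+x. ennreal (f x) \<partial>mixture N w R)"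
      by (rule integral_eq_nn_integral) (use f in auto)
    moreover have "(\<Sum>i\<le>N. w i * (\<integral>x. f x \<partial>R' i)) \<ge> 0" using w i2 by (intro sum_nonneg mult_nonneg_nonneg) auto
    ultimately show ?thesis by (simp add: R'_def)
  qed
  have trig: "(\<integral>x. 1 + g x \<partial>Q) = 1 + (\<integral>x. g x \<partial>Q)" if "real_distribution Q" "g \<in> borel_measurable borel" "\<And>x. \<bar>g x\<bar> \<le> 1"
    for Q :: "real measure" and g :: "real \<Rightarrow> real"
  proof -
    interpret real_distribution Q by fact
    have "integrable Q g" by (rule integrable_const_bound[where B=1]) (use that in auto)
    then show ?thesis using prob_space by simp
  qed
  have int': "(\<integral>x. g x \<partial>mixture N w R) = (\<Sum>i\<le>N. w i * (\<integral>x. g x \<partial>R i))"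
    if g: "g \<in> borel_measurable borel" "\<And>x. \<bar>g x\<bar> \<le> 1" for g :: "real \<Rightarrow> real"
  proof -
    have "(\<integral>x. 1 + g x \<partial>mixture N w R) = (\<Sum>i\<le>N. w i * (\<integral>x. 1 + g x \<partial>R i))"
    proof (rule int)
      fix x show "0 \<le> 1 + g x" "1 + g x \<le> 2" using g(2)[of x] by linarith+
    qed (use g in simp)
    then have "1 + (\<integral>x. g x \<partial>mixture N w R) = (\<Sum>i\<le>N. w i * (1 + (\<integral>x. g x \<partial>R i)))"
      using trig[OF rd g] trig[OF R g] by simp
    then show ?thesis using w by (simp add: distrib_left sum.distrib)
  qed
  have cs: "char Q t = of_real (\<integral>x. cos (t * x) \<partial>Q) + \<i> * of_real (\<integral>x. sin (t * x) \<partial>Q)" if "real_distribution Q" for Q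
  proof -
    interpret real_distribution Q by fact
    have i: "integrable Q (\<lambda>x. cos (t * x))" "integrable Q (\<lambda>x. sin (t * x))"
      by (rule integrable_const_bound[where B=1]; simp)+
    have "char Q t = (\<integral>x. of_real (cos (t * x)) + \<i> * of_real (sin (t * x)) \<partial>Q)"
      unfolding char_def by (intro Bochner_Integration.integral_cong) (auto simp: cis_conv_exp[symmetric] complex_eq_iff simp flip: of_real_mult)
    then show ?thesis using i by simp
  qed
  show "char (mixture N w R) t = (\<Sum>i\<le>N. of_real (w i) * char (R i) t)"
    using cs[OF rd] cs[OF R] int'[of "\<lambda>x. cos (t * x)"] int'[of "\<lambda>x. sin (t * x)"]
    by (simp add: distrib_left sum.distrib sum_distrib_left mult_ac)
qed

context mm_params
begin

definition step_weight where
  "step_weight h n i = (if i = N then h * phi n else if i = n then 1 - h * exit_rate n else h * Gen $$ (n,i))"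

text \<open>Index \<open>N\<close> stands for killing.\<close>
primrec rho :: "real \<Rightarrow> (nat \<Rightarrow> real measure) \<Rightarrow> nat \<Rightarrow> nat \<Rightarrow> real measure" where
  "rho h M 0 = (\<lambda>n. return borel 0)"
| "rho h M (Suc j) = (\<lambda>n. mixture N (step_weight h n)
     (\<lambda>i. if i = N then return borel 0 else if i = n then M n \<star> rho h M j n else nu n i \<star> rho h M j i))"

lemma step_weight_props:
  assumes r: "roots h M" and n: "n < N"
  shows "i \<le> N \<Longrightarrow> step_weight h n i \<ge> 0" "(\<Sum>i\<le>N. step_weight h n i) = 1"
    "(\<Sum>i\<le>N. of_real (step_weight h n i) * F i) = of_real (h * phi n) * F N + of_real (1 - h * exit_rate n) * F n +
       (\<Sum>j\<in>{..<N}-{n}. of_real (h * Gen $$ (n,j)) * (F j :: 'b :: real_normed_algebra_1))"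
proof -
  have h: "h > 0" "h * exit_rate n \<le> 1" using r n by (auto simp: roots_def)
  show "step_weight h n i \<ge> 0" if "i \<le> N" using h phi_nonneg[OF n] Gen_nonneg[OF n, of i] that
    by (auto simp: step_weight_def)
  have sp: "(\<Sum>i\<le>N. G i) = G N + G n + (\<Sum>j\<in>{..<N}-{n}. G j)" for G :: "nat \<Rightarrow> 'c :: comm_monoid_add"
  proof -
    have "{..N} = insert N {..<N}" by auto
    then have "(\<Sum>i\<le>N. G i) = G N + (\<Sum>i<N. G i)" by simp
    also have "(\<Sum>i<N. G i) = G n + (\<Sum>j\<in>{..<N}-{n}. G j)" using n by (simp add: sum.remove)
    finally show ?thesis by (simp add: add.assoc)
  qed
  have c: "(\<Sum>j\<in>{..<N}-{n}. step_weight h n j) = (\<Sum>j\<in>{..<N}-{n}. h * Gen $$ (n,j))"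
    by (rule sum.cong) (auto simp: step_weight_def)
  have "(\<Sum>i<N. Gen $$ (n,i)) = Gen $$ (n,n) + (\<Sum>j\<in>{..<N}-{n}. Gen $$ (n,j))" using n by (simp add: sum.remove)
  then have "(\<Sum>j\<in>{..<N}-{n}. h * Gen $$ (n,j)) = - h * Gen $$ (n,n)" using Gen_rowsum[OF n]
    by (simp add: sum_distrib_left[symmetric] add_eq_0_iff)
  then show "(\<Sum>i\<le>N. step_weight h n i) = 1"
    unfolding sp c using n by (simp add: step_weight_def exit_rate_def algebra_simps)
  have c2: "(\<Sum>j\<in>{..<N}-{n}. of_real (step_weight h n j) * F j) = (\<Sum>j\<in>{..<N}-{n}. of_real (h * Gen $$ (n,j)) * F j)"
    by (rule sum.cong) (auto simp: step_weight_def)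
  show "(\<Sum>i\<le>N. of_real (step_weight h n i) * F i) = of_real (h * phi n) * F N + of_real (1 - h * exit_rate n) * F n +
       (\<Sum>j\<in>{..<N}-{n}. of_real (h * Gen $$ (n,j)) * F j)"
    unfolding sp c2 using n by (simp add: step_weight_def)
qed

lemma real_distribution_return: "real_distribution (return borel (0::real))"
  by (auto intro!: real_distributionI prob_space_return)

lemma rho_dist:
  assumes r: "roots h M"
  shows "n < N \<Longrightarrow> real_distribution (rho h M j n)"
proof (induction j arbitrary: n)
  case 0 then show ?case using real_distribution_return by simp
next
  case (Suc j)
  have "real_distribution (if i = N then return borel 0 else if i = n then M n \<star> rho h M j n else nu n i \<star> rho h M j i)" if "i \<le> N" for i
    using that Suc r nu_dist real_distribution_return by (auto simp: roots_def intro!: real_distribution_convolution)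
  then show ?case using mixture_props(1)[OF step_weight_props(1,2)[OF r Suc.prems]] by simp
qed

lemma rho_char:
  assumes r: "roots h M" and n: "n < N"
  shows "char (rho h M 0 n) t = 1"
    "char (rho h M (Suc j) n) t = of_real (h * phi n) + of_real (1 - h * exit_rate n) * (char (M n) t * char (rho h M j n) t)
       + (\<Sum>i\<in>{..<N}-{n}. of_real (h * Gen $$ (n,i)) * (char (nu n i) t * char (rho h M j i) t))"
proof -
  show "char (rho h M 0 n) t = 1" by (simp add: char_def integral_return)
  have d: "real_distribution (if i = N then return borel 0 else if i = n then M n \<star> rho h M j n else nu n i \<star> rho h M j i)" if "i \<le> N" for i
    using that n r nu_dist rho_dist[OF r] real_distribution_return by (auto simp: roots_def intro!: real_distribution_convolution)
  have Mn: "real_distribution (M n)" using r n by (auto simp: roots_def)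
  have r0: "char (return borel (0::real)) t = 1" by (simp add: char_def integral_return)
  show "char (rho h M (Suc j) n) t = of_real (h * phi n) + of_real (1 - h * exit_rate n) * (char (M n) t * char (rho h M j n) t)
       + (\<Sum>i\<in>{..<N}-{n}. of_real (h * Gen $$ (n,i)) * (char (nu n i) t * char (rho h M j i) t))"
    using mixture_props(3)[OF step_weight_props(1,2)[OF r n] d] n
    by (simp add: step_weight_props(3)[OF r n] r0 char_convolution[OF Mn rho_dist[OF r]] char_convolution[OF nu_dist rho_dist[OF r]])
qed

lemma rho_tails:
  assumes r: "roots h M"
  shows "tails h M (\<lambda>j n x. measure (rho h M j n) {z. x + z > 0})"
  unfolding tails_def
proof (intro conjI allI impI)
  show "roots h M" by fact
  fix j n x assume n: "n < N"
  interpret R: real_distribution "rho h M j n" using rho_dist[OF r n] .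
  show "0 \<le> measure (rho h M j n) {z. x + z > 0}" "measure (rho h M j n) {z. x + z > 0} \<le> 1" by auto
  have "(\<lambda>x. measure (rho h M j n) {z \<in> space (rho h M j n). (x, z) \<in> {(y,z). y + z > 0}}) \<in> borel_measurable borel"
    by measurable
  then show "(\<lambda>x. measure (rho h M j n) {z. x + z > 0}) \<in> borel_measurable borel" by simp
  have r0: "measure (return borel (0::real)) {z. x + z > 0} = (if x > 0 then 1 else 0)"
    by (subst measure_return) (auto simp: indicator_def)
  then show "measure (rho h M 0 n) {z. x + z > 0} = (if x > 0 then 1 else 0)" by simp
  have d: "real_distribution (if i = N then return borel 0 else if i = n then M n \<star> rho h M j n else nu n i \<star> rho h M j i)" if "i \<le> N" for i
    using that n r nu_dist rho_dist[OF r] real_distribution_return by (auto simp: roots_def intro!: real_distribution_convolution)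
  have Mn: "real_distribution (M n)" using r n by (auto simp: roots_def)
  have "measure (rho h M (Suc j) n) {z. x + z > 0} = (\<Sum>i\<le>N. of_real (step_weight h n i) * measure (if i = N then return borel 0 else if i = n then M n \<star> rho h M j n else nu n i \<star> rho h M j i) {z. x + z > 0})"
    using mixture_props(2)[OF step_weight_props(1,2)[OF r n] d, where X="{z. x + z > 0}"] by simp
  then show "measure (rho h M (Suc j) n) {z. x + z > 0} = h * phi n * (if x > 0 then 1 else 0) + step_op h M (\<lambda>n x. measure (rho h M j n) {z. x + z > 0}) n x"
    unfolding step_weight_props(3)[OF r n] step_op_def using n
    by (simp add: r0 measure_convolution_tail[OF Mn rho_dist[OF r]] measure_convolution_tail[OF nu_dist rho_dist[OF r]])
qed

end

section \<open>Piecewise constant paths\<close>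

lemma cadlag_nat_right:
  fixes j :: "real \<Rightarrow> nat"
  assumes "cadlag j" "t \<ge> 0"
  shows "\<exists>d>0. \<forall>u. t \<le> u \<and> u < t + d \<longrightarrow> j u = j t"
proof -
  have "(j \<longlongrightarrow> j t) (at_right t)" using assms by (auto simp: cadlag_def continuous_within)
  then have "\<forall>\<^sub>F u in at_right t. j u = j t" by (simp add: tendsto_discrete)
  then obtain b where b: "b > t" "\<And>u. t < u \<Longrightarrow> u < b \<Longrightarrow> j u = j t" by (auto simp: eventually_at_right_field)
  have "j u = j t" if "t \<le> u" "u < t + (b - t)" for u using b(2)[of u] that by (cases "u = t") auto
  moreover have "b - t > 0" using b(1) by simp
  ultimately show ?thesis by blast
qed

lemma left_limI:
  fixes j :: "real \<Rightarrow> nat"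
  assumes "e > 0" "\<And>u. t - e < u \<Longrightarrow> u < t \<Longrightarrow> j u = c"
  shows "left_lim j t = c"
proof -
  have "\<forall>\<^sub>F u in at_left t. j u = c" unfolding eventually_at_left_field using assms by (intro exI[of _ "t - e"]) auto
  then have "(j \<longlongrightarrow> c) (at_left t)" by (simp add: tendsto_discrete)
  then show ?thesis unfolding left_lim_def by (intro tendsto_Lim) auto
qed

lemma cadlag_nat_left:
  fixes j :: "real \<Rightarrow> nat"
  assumes "cadlag j" "t > 0"
  shows "\<exists>d>0. d \<le> t \<and> (\<forall>u. t - d < u \<and> u < t \<longrightarrow> j u = left_lim j t)"
proof -
  obtain l where "(j \<longlongrightarrow> l) (at_left t)" using assms by (auto simp: cadlag_def)
  then have "\<forall>\<^sub>F u in at_left t. j u = l" by (simp add: tendsto_discrete)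
  then obtain b where b: "b < t" "\<And>u. b < u \<Longrightarrow> u < t \<Longrightarrow> j u = l" by (auto simp: eventually_at_left_field)
  define d where "d = min t (t - b)"
  have d: "d > 0" "d \<le> t" using b assms by (auto simp: d_def)
  have "j u = l" if "t - d < u" "u < t" for u using that b(2)[of u] by (auto simp: d_def)
  moreover from this have "left_lim j t = l" using d(1) left_limI by blast
  ultimately show ?thesis using d by blast
qed

lemma cadlag_nat_left0:
  fixes j :: "real \<Rightarrow> nat"
  assumes "cadlag j" "t \<ge> 0"
  shows "\<exists>d>0. \<forall>u. 0 \<le> u \<and> t - d < u \<and> u < t \<longrightarrow> j u = left_lim j t"
proof (cases "t > 0")
  case True
  obtain d where "d > 0" "\<forall>u. t - d < u \<and> u < t \<longrightarrow> j u = left_lim j t" using cadlag_nat_left[OF assms(1) True] by auto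
  then show ?thesis by (intro exI[of _ d]) auto
next
  case False
  then show ?thesis using assms by (intro exI[of _ 1]) auto
qed

lemma trans_times_split:
  assumes "a \<le> b" "b \<le> c"
  shows "trans_times j a c = trans_times j a b \<union> trans_times j b c" "trans_times j a b \<inter> trans_times j b c = {}"
  using assms by (auto simp: trans_times_def)

lemma trans_times_mono: "a \<le> a' \<Longrightarrow> b' \<le> b \<Longrightarrow> trans_times j a' b' \<subseteq> trans_times j a b"
  by (auto simp: trans_times_def)

lemma trans_timesD: "tau \<in> trans_times j a b \<Longrightarrow> a < tau \<and> tau \<le> b"
  by (auto simp: trans_times_def)

lemma finite_trans_times:
  assumes c: "cadlag j" and ab: "0 \<le> a" "a \<le> b"
  shows "finite (trans_times j a b)"
proof -
  have "0 \<le> a \<longrightarrow> finite (trans_times j a b)"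
    using ab(2)
  proof (induction rule: Bolzano)
    case (trans a b c)
    then show ?case by (auto simp: trans_times_split(1)[of a b c])
  next
    case (local x)
    show ?case
    proof (cases "x \<ge> 0")
      case False
      then show ?thesis by (intro exI[of _ 1]) auto
    next
      case True
      obtain d1 where d1: "d1 > 0" "\<And>u. x \<le> u \<Longrightarrow> u < x + d1 \<Longrightarrow> j u = j x"
        using cadlag_nat_right[OF c True] by blast
      obtain d2 where d2: "d2 > 0" "\<And>u. 0 \<le> u \<Longrightarrow> x - d2 < u \<Longrightarrow> u < x \<Longrightarrow> j u = left_lim j x"
        using cadlag_nat_left0[OF c True] by blast
      have sub: "trans_times j a b \<subseteq> {x}" if "0 \<le> a" "a \<le> x" "x \<le> b" "b - a < min d1 d2" for a b
      proof
        fix tau assume t: "tau \<in> trans_times j a b"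
        then have tt: "a < tau" "tau \<le> b" "left_lim j tau \<noteq> j tau" by (auto simp: trans_times_def)
        show "tau \<in> {x}"
        proof (rule ccontr)
          assume "tau \<notin> {x}"
          then consider "tau < x" | "tau > x" by fastforce
          then show False
          proof cases
            case 1
            have "left_lim j tau = left_lim j x"
              by (rule left_limI[of "tau - a"]) (use tt 1 that in \<open>auto intro!: d2(2)\<close>)
            moreover have "j tau = left_lim j x" using tt 1 that by (intro d2(2)) auto
            ultimately show False using tt by simp
          next
            case 2
            have "left_lim j tau = j x"
              by (rule left_limI[of "tau - x"]) (use tt 2 that in \<open>auto intro!: d1(2)\<close>)
            moreover have "j tau = j x" using tt 2 that by (intro d1(2)) auto
            ultimately show False using tt by simp
          qed
        qed
      qed
      show ?thesis
      proof (intro exI[of _ "min d1 d2"] conjI allI impI)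
        show "min d1 d2 > 0" using d1 d2 by simp
        fix a b :: real assume "a \<le> x \<and> x \<le> b \<and> b - a < min d1 d2" "0 \<le> a"
        then show "finite (trans_times j a b)" using sub[of a b] finite_subset by blast
      qed
    qed
  qed
  then show ?thesis using ab by blast
qed

lemma no_trans_const:
  assumes c: "cadlag j" and ab: "0 \<le> a" "a \<le> b" and e: "trans_times j a b = {}" and u: "a \<le> u" "u \<le> b"
  shows "j u = j a"
proof -
  have "0 \<le> a \<and> trans_times j a b = {} \<longrightarrow> (\<forall>u. a \<le> u \<and> u \<le> b \<longrightarrow> j u = j a)"
    using ab(2)
  proof (induction rule: Bolzano)
    case (trans a b c)
    show ?case
    proof (intro impI allI)
      fix u assume A: "0 \<le> a \<and> trans_times j a c = {}" "a \<le> u \<and> u \<le> c"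
      then have e: "trans_times j a b = {}" "trans_times j b c = {}" "0 \<le> b" using trans_times_split(1)[OF trans(3,4), of j] trans(3) by auto
      have 1: "\<And>u. a \<le> u \<Longrightarrow> u \<le> b \<Longrightarrow> j u = j a" using trans(1) e A by blast
      have 2: "\<And>u. b \<le> u \<Longrightarrow> u \<le> c \<Longrightarrow> j u = j b" using trans(2) e by blast
      show "j u = j a" using 1[of u] 1[of b] 2[of u] trans(3) A(2) by (cases "u \<le> b") simp_all
    qed
  next
    case (local x)
    show ?case
    proof (cases "x \<ge> 0")
      case False
      then show ?thesis by (intro exI[of _ 1]) auto
    next
      case True
      obtain d1 where d1: "d1 > 0" "\<And>u. x \<le> u \<Longrightarrow> u < x + d1 \<Longrightarrow> j u = j x"
        using cadlag_nat_right[OF c True] by blast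
      obtain d2 where d2: "d2 > 0" "\<And>u. 0 \<le> u \<Longrightarrow> x - d2 < u \<Longrightarrow> u < x \<Longrightarrow> j u = left_lim j x"
        using cadlag_nat_left0[OF c True] by blast
      have main: "j u = j x" if A: "0 \<le> a" "a \<le> x" "x \<le> b" "b - a < min d1 d2" "trans_times j a b = {}" "a \<le> u" "u \<le> b" for a b u
      proof (cases "x \<le> u")
        case True then show ?thesis using A by (intro d1(2)) auto
      next
        case False
        then have "x \<in> {a<..b}" using A by auto
        then have "left_lim j x = j x" using A(5) by (auto simp: trans_times_def)
        moreover have "j u = left_lim j x" using False A by (intro d2(2)) auto
        ultimately show ?thesis by simp
      qed
      show ?thesis
      proof (intro exI[of _ "min d1 d2"] conjI allI impI)
        show "min d1 d2 > 0" using d1 d2 by simp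
        fix a b u :: real assume A: "a \<le> x \<and> x \<le> b \<and> b - a < min d1 d2" "0 \<le> a \<and> trans_times j a b = {}" "a \<le> u \<and> u \<le> b"
        then show "j u = j a" using main[of a b u] main[of a b a] by auto
      qed
    qed
  qed
  then show ?thesis using ab e u by blast
qed

lemma single_trans:
  assumes c: "cadlag j" and ab: "0 \<le> a" "a \<le> b" and e: "trans_times j a b = {t}"
  shows "left_lim j t = j a" "j t = j b" "j a \<noteq> j b"
proof -
  have t: "a < t" "t \<le> b" "left_lim j t \<noteq> j t" using e by (auto simp: trans_times_def)
  have m: "tau = t" if "tau \<in> trans_times j a' b'" "a \<le> a'" "b' \<le> b" for tau a' b'
    using that trans_times_mono[OF that(2,3), of j] e by blast
  have "trans_times j a u = {}" if "a \<le> u" "u < t" for u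
    using m[of _ a u] that t trans_timesD[of _ j a u] by fastforce
  then have "j u = j a" if "a < u" "u < t" for u using no_trans_const[OF c ab(1), of u u] that by simp
  then show 1: "left_lim j t = j a" using t by (intro left_limI[of "t - a"]) auto
  have "trans_times j t b = {}" using m[of _ t b] t trans_timesD[of _ j t b] by fastforce
  then show 2: "j t = j b" using no_trans_const[OF c, of t b b] t ab by simp
  show "j a \<noteq> j b" using 1 2 t by simp
qed

lemma cadlag_nat_integrable:
  fixes q :: "nat \<Rightarrow> 'b :: euclidean_space"
  assumes c: "cadlag j" and ab: "0 \<le> a" "a \<le> b"
  shows "(\<lambda>u. q (j u)) integrable_on {a..b}"
proof -
  have "0 \<le> a \<longrightarrow> (\<lambda>u. q (j u)) integrable_on {a..b}"
    using ab(2)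
  proof (induction rule: Bolzano)
    case (trans a b c)
    then show ?case using Henstock_Kurzweil_Integration.integrable_combine[of a b c] by auto
  next
    case (local x)
    show ?case
    proof (cases "x \<ge> 0")
      case False
      then show ?thesis by (intro exI[of _ 1]) auto
    next
      case True
      obtain d1 where d1: "d1 > 0" "\<And>u. x \<le> u \<Longrightarrow> u < x + d1 \<Longrightarrow> j u = j x"
        using cadlag_nat_right[OF c True] by blast
      obtain d2 where d2: "d2 > 0" "\<And>u. 0 \<le> u \<Longrightarrow> x - d2 < u \<Longrightarrow> u < x \<Longrightarrow> j u = left_lim j x"
        using cadlag_nat_left0[OF c True] by blast
      show ?thesis
      proof (intro exI[of _ "min d1 d2"] conjI allI impI)
        show "min d1 d2 > 0" using d1 d2 by simp
        fix a b :: real assume A: "a \<le> x \<and> x \<le> b \<and> b - a < min d1 d2" "0 \<le> a"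
        have "(\<lambda>u. q (j u)) integrable_on {a..x}"
          by (rule integrable_spike_finite[of "{x}" _ _ "\<lambda>_. q (left_lim j x)"]) (use A in \<open>auto intro!: arg_cong[where f=q] d2(2)\<close>)
        moreover have "(\<lambda>u. q (j u)) integrable_on {x..b}"
          by (rule integrable_spike_finite[of "{}" _ _ "\<lambda>_. q (j x)"]) (use A in \<open>auto intro!: arg_cong[where f=q] d1(2)\<close>)
        ultimately show "(\<lambda>u. q (j u)) integrable_on {a..b}"
          using Henstock_Kurzweil_Integration.integrable_combine[of a x b] A by auto
      qed
    qed
  qed
  then show ?thesis using ab by blast
qed

lemma cmod_exp_diff_le:
  assumes "Re z \<le> 0" "Re w \<le> 0"
  shows "cmod (exp z - exp w) \<le> cmod (z - w)"
proof -
  have "cmod (exp z - exp w) \<le> 1 * cmod (z - w)"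
  proof (rule field_differentiable_bound[where S="{z. Re z \<le> 0}" and f'="exp"])
    show "convex {z. Re z \<le> 0}" by (simp add: convex_halfspace_Re_le)
    show "(exp has_field_derivative exp z) (at z within {z. Re z \<le> 0})" for z :: complex
      by (auto intro!: derivative_eq_intros)
    show "cmod (exp z) \<le> 1" if "z \<in> {z. Re z \<le> 0}" for z using that by simp
  qed (use assms in auto)
  then show ?thesis by simp
qed

text \<open>Here \<open>y i\<close> and \<open>d i\<close> are the characteristic factor and the survival probability of the
  \<open>i\<close>-th grid cell; a killing inside a cell takes effect at its right end. The second recursion
  is the first-order version, where \<open>p i\<close> is the killing probability and the killing takes effect
  at the left end.\<close>
primrec grid_killed :: "(nat \<Rightarrow> complex) \<Rightarrow> (nat \<Rightarrow> real) \<Rightarrow> nat \<Rightarrow> nat \<Rightarrow> complex" where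
  "grid_killed y d i 0 = 1"
| "grid_killed y d i (Suc k) = y i * (1 - of_real (d i)) + y i * of_real (d i) * grid_killed y d (Suc i) k"

primrec grid_euler :: "(nat \<Rightarrow> complex) \<Rightarrow> (nat \<Rightarrow> real) \<Rightarrow> nat \<Rightarrow> nat \<Rightarrow> complex" where
  "grid_euler F p i 0 = 1"
| "grid_euler F p i (Suc k) = of_real (p i) + F i * grid_euler F p (Suc i) k"

lemma grid_killed_le_1:
  assumes "\<And>i. cmod (y i) \<le> 1" "\<And>i. 0 \<le> d i \<and> d i \<le> 1"
  shows "cmod (grid_killed y d i k) \<le> 1"
proof (induction k arbitrary: i)
  case (Suc k)
  have "cmod (grid_killed y d i (Suc k)) = cmod (y i) * cmod ((1 - of_real (d i)) + of_real (d i) * grid_killed y d (Suc i) k)"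
    by (simp add: norm_mult[symmetric] algebra_simps)
  also have "\<dots> \<le> 1 * (cmod (of_real (1 - d i)) + cmod (of_real (d i) * grid_killed y d (Suc i) k))"
    using assms by (intro mult_mono) (auto intro!: norm_triangle_ineq order_trans[OF norm_triangle_ineq])
  also have "\<dots> \<le> (1 - d i) + d i * 1"
    unfolding norm_mult norm_of_real using assms(2)[of i] Suc[of "Suc i"] by (auto intro!: mult_left_le)
  finally show ?case by simp
qed simp

lemma grid_killed_grid_euler_diff:
  assumes "\<And>i. cmod (y i) \<le> 1" "\<And>i. 0 \<le> d i \<and> d i \<le> 1" "\<And>i. cmod (F i) \<le> 1"
  shows "cmod (grid_killed y d i k - grid_euler F p i k) \<le> (\<Sum>l\<in>{i..<i+k}. cmod (y l * of_real (d l) - F l) + cmod (y l * (1 - of_real (d l)) - of_real (p l)))"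
proof (induction k arbitrary: i)
  case (Suc k)
  let ?e = "\<lambda>l. cmod (y l * of_real (d l) - F l) + cmod (y l * (1 - of_real (d l)) - of_real (p l))"
  have "grid_killed y d i (Suc k) - grid_euler F p i (Suc k) = F i * (grid_killed y d (Suc i) k - grid_euler F p (Suc i) k)
     + ((y i * of_real (d i) - F i) * grid_killed y d (Suc i) k + (y i * (1 - of_real (d i)) - of_real (p i)))"
    by (simp add: algebra_simps)
  also have "cmod \<dots> \<le> cmod (F i) * cmod (grid_killed y d (Suc i) k - grid_euler F p (Suc i) k)
     + (cmod (y i * of_real (d i) - F i) * cmod (grid_killed y d (Suc i) k) + cmod (y i * (1 - of_real (d i)) - of_real (p i)))"
    unfolding norm_mult[symmetric] by (intro order_trans[OF norm_triangle_ineq] add_mono norm_triangle_ineq order_refl)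
  also have "\<dots> \<le> 1 * (\<Sum>l\<in>{Suc i..<Suc i+k}. ?e l) + (cmod (y i * of_real (d i) - F i) * 1 + cmod (y i * (1 - of_real (d i)) - of_real (p i)))"
    using assms Suc[of "Suc i"] grid_killed_le_1[of y d, OF assms(1,2)]
    by (intro add_mono mult_mono) (auto intro!: sum_nonneg)
  also have "\<dots> = (\<Sum>l\<in>{i..<i+Suc k}. ?e l)"
    by (subst sum.atLeast_Suc_lessThan[of i]) auto
  finally show ?case .
qed simp

lemma grid_killed_closed_form:
  "grid_killed y d 0 J = (\<Sum>k<J. (\<Prod>i<Suc k. y i) * of_real ((\<Prod>i<k. d i) - (\<Prod>i<Suc k. d i))) + (\<Prod>i<J. y i) * of_real (\<Prod>i<J. d i)"
proof -
  have "k \<le> J \<Longrightarrow> grid_killed y d 0 J = (\<Sum>l<k. (\<Prod>i<Suc l. y i) * of_real ((\<Prod>i<l. d i) - (\<Prod>i<Suc l. d i)))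
      + (\<Prod>i<k. y i) * of_real (\<Prod>i<k. d i) * grid_killed y d k (J - k)" for k
  proof (induction k)
    case (Suc k)
    have e: "J - k = Suc (J - Suc k)" using Suc.prems by simp
    have "grid_killed y d 0 J = (\<Sum>l<k. (\<Prod>i<Suc l. y i) * of_real ((\<Prod>i<l. d i) - (\<Prod>i<Suc l. d i)))
      + (\<Prod>i<k. y i) * of_real (\<Prod>i<k. d i) * grid_killed y d k (J - k)" using Suc by simp
    also have "(\<Prod>i<k. y i) * of_real (\<Prod>i<k. d i) * grid_killed y d k (J - k) = (\<Prod>i<Suc k. y i) * of_real ((\<Prod>i<k. d i) - (\<Prod>i<Suc k. d i))
      + (\<Prod>i<Suc k. y i) * of_real (\<Prod>i<Suc k. d i) * grid_killed y d (Suc k) (J - Suc k)"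
      unfolding e by (simp add: algebra_simps)
    finally show ?case by simp
  qed simp
  from this[of J] show ?thesis by simp
qed

text \<open>For a transition-free step both expressions agree up to \<open>h\<^sup>2\<close>; a step with a single
  transition costs \<open>O(h)\<close>.\<close>
lemma step_error:
  fixes q :: "nat \<Rightarrow> complex" and phi :: "nat \<Rightarrow> real" and a :: "nat \<Rightarrow> nat \<Rightarrow> complex"
  assumes c: "cadlag j" and j: "\<And>t. t \<ge> 0 \<Longrightarrow> j t < N" and s: "0 \<le> s" "0 < h" "h \<le> 1"
    and q: "\<And>n. n < N \<Longrightarrow> Re (q n) \<le> 0" "\<And>n. n < N \<Longrightarrow> cmod (q n) \<le> Q"
    and p: "\<And>n. n < N \<Longrightarrow> 0 \<le> phi n" "\<And>n. n < N \<Longrightarrow> phi n \<le> P"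
    and a: "\<And>n n'. n < N \<Longrightarrow> n' < N \<Longrightarrow> cmod (a n n') \<le> 1" "\<And>n. a n n = 1"
    and card: "card (trans_times j s (s + h)) \<le> 1"
  defines "y \<equiv> exp (integral {s..s+h} (\<lambda>u. q (j u))) * (\<Prod>tau\<in>trans_times j s (s+h). a (left_lim j tau) (j tau))"
    and "d \<equiv> exp (- integral {s..s+h} (\<lambda>u. phi (j u)))"
    and "F \<equiv> exp (of_real h * (q (j s) - of_real (phi (j s)))) * a (j s) (j (s+h))"
  shows "cmod y \<le> 1" "0 \<le> d" "d \<le> 1" "cmod F \<le> 1"
    "cmod (y * of_real d - F) + cmod (y * (1 - of_real d) - of_real (h * phi (j s)))
      \<le> (exp Q * Q\<^sup>2 + exp P * P\<^sup>2 + Q * P) * h\<^sup>2 + (2 * Q + 4 * P) * h * card (trans_times j s (s+h))"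
proof -
  let ?T = "trans_times j s (s+h)"
  have sh: "s \<le> s + h" using s by simp
  have Q0: "Q \<ge> 0" by (rule order_trans[OF norm_ge_zero q(2)[OF j[OF s(1)]]])
  have P0: "P \<ge> 0" using p[OF j[OF s(1)]] by linarith
  have iq: "(\<lambda>u. q (j u)) integrable_on {s..s+h}" by (rule cadlag_nat_integrable[OF c s(1) sh])
  have ip: "(\<lambda>u. phi (j u)) integrable_on {s..s+h}" by (rule cadlag_nat_integrable[OF c s(1) sh])
  have jN: "j u < N" if "u \<in> {s..s+h}" for u using that s j by auto
  have Re_int: "Re (integral {s..s+h} (\<lambda>u. q (j u))) \<le> 0"
  proof -
    have "Re (integral {s..s+h} (\<lambda>u. q (j u))) = integral {s..s+h} (\<lambda>u. Re (q (j u)))"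
      using integral_linear[OF iq bounded_linear_Re] by (simp add: o_def)
    also have "\<dots> \<le> integral {s..s+h} (\<lambda>u. 0)"
      using integrable_linear[OF iq bounded_linear_Re] q(1)[OF jN] by (intro integral_le) (auto simp: o_def)
    finally show ?thesis by simp
  qed
  have p_int: "0 \<le> integral {s..s+h} (\<lambda>u. phi (j u))" "integral {s..s+h} (\<lambda>u. phi (j u)) \<le> h * P"
  proof -
    show "0 \<le> integral {s..s+h} (\<lambda>u. phi (j u))" using p(1)[OF jN] by (intro integral_nonneg ip) auto
    have "integral {s..s+h} (\<lambda>u. phi (j u)) \<le> integral {s..s+h} (\<lambda>u. P)"
      using p(2)[OF jN] by (intro integral_le ip) auto
    then show "integral {s..s+h} (\<lambda>u. phi (j u)) \<le> h * P" using s by simp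
  qed
  have q_int: "cmod (integral {s..s+h} (\<lambda>u. q (j u))) \<le> h * Q"
  proof -
    have "cmod (integral {s..s+h} (\<lambda>u. q (j u))) \<le> integral {s..s+h} (\<lambda>u. Q)"
      using q(2)[OF jN] by (intro integral_norm_bound_integral iq) auto
    then show ?thesis using s by simp
  qed
  show d: "0 \<le> d" "d \<le> 1" using p_int by (auto simp: d_def)
  have finT: "finite ?T" by (rule finite_trans_times[OF c s(1) sh])
  have jr: "j (s + h) < N" "j s < N" using j s by auto
  have hphi: "0 \<le> h * phi (j s)" "h * phi (j s) \<le> h * P"
    using p[OF jr(2)] s by (auto intro!: mult_left_mono)
  have dl: "1 - d \<le> h * P" using exp_ge_add_one_self[of "- integral {s..s+h} (\<lambda>u. phi (j u))"] p_int
    unfolding d_def by linarith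
  have F1: "cmod (exp (of_real h * (q (j s) - of_real (phi (j s))))) \<le> 1"
    using q(1)[OF jr(2)] p(1)[OF jr(2)] s by (simp add: mult_nonneg_nonpos)
  show F: "cmod F \<le> 1" unfolding F_def norm_mult using F1 a(1)[OF jr(2,1)] by (intro mult_le_one) auto
  define E where "E = exp (integral {s..s+h} (\<lambda>u. q (j u)))"
  have E: "cmod E \<le> 1" using Re_int by (simp add: E_def)
  have K0: "exp Q * Q\<^sup>2 + exp P * P\<^sup>2 + Q * P \<ge> 0" using Q0 P0 by simp
  have ch: "cmod (1 - of_real d) = 1 - d"
  proof -
    have "1 - complex_of_real d = of_real (1 - d)" by simp
    then show ?thesis using d by (metis abs_of_nonneg diff_ge_0_iff_ge norm_of_real)
  qed
  consider "?T = {}" | t where "?T = {t}"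
    using card finT by (metis One_nat_def card_1_singletonE card_0_eq le_Suc_eq le_zero_eq)
  then have "cmod y \<le> 1 \<and> cmod (y * of_real d - F) + cmod (y * (1 - of_real d) - of_real (h * phi (j s)))
      \<le> (exp Q * Q\<^sup>2 + exp P * P\<^sup>2 + Q * P) * h\<^sup>2 + (2 * Q + 4 * P) * h * card ?T"
  proof cases
    case 1
    have const: "j u = j s" if "u \<in> {s..s+h}" for u using that by (intro no_trans_const[OF c s(1) sh 1]) auto
    have "integral {s..s+h} (\<lambda>u. q (j u)) = integral {s..s+h} (\<lambda>u. q (j s))"
      by (intro integral_cong arg_cong[where f=q] const)
    then have Iq: "integral {s..s+h} (\<lambda>u. q (j u)) = of_real h * q (j s)" using s by (simp add: scaleR_conv_of_real)
    have "integral {s..s+h} (\<lambda>u. phi (j u)) = integral {s..s+h} (\<lambda>u. phi (j s))"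
      by (intro integral_cong arg_cong[where f=phi] const)
    then have Ip: "integral {s..s+h} (\<lambda>u. phi (j u)) = h * phi (j s)" using s by simp
    have y: "y = exp (of_real h * q (j s))" using 1 Iq by (simp add: y_def)
    have dd: "complex_of_real d = exp (- (of_real h * of_real (phi (j s))))" unfolding d_def Ip by (simp flip: exp_of_real)
    have "y * of_real d = F" unfolding y dd F_def using const[of "s+h"] s a(2)
      by (simp add: right_diff_distrib exp_diff exp_minus divide_inverse)
    moreover have "cmod y \<le> 1" unfolding y using q(1)[OF jr(2)] s by (simp add: mult_nonneg_nonpos)
    moreover have "cmod (y * (1 - of_real d) - of_real (h * phi (j s))) \<le> (exp Q * Q\<^sup>2 + exp P * P\<^sup>2 + Q * P) * h\<^sup>2"
    proof -
      let ?z = "of_real h * of_real (phi (j s)) :: complex"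
      have "y * (1 - of_real d) - of_real (h * phi (j s)) = y * (1 - of_real d - ?z) + (y - 1) * ?z"
        by (simp add: algebra_simps)
      also have "cmod \<dots> \<le> cmod y * cmod (1 - of_real d - ?z) + cmod (y - 1) * cmod ?z"
        unfolding norm_mult[symmetric] by (rule norm_triangle_ineq)
      also have "\<dots> \<le> 1 * (exp P * (h * P)\<^sup>2) + (h * Q) * (h * P)"
      proof (intro add_mono mult_mono)
        have "1 - of_real d - ?z = - (exp (- ?z) - 1 - (- ?z))" unfolding dd by simp
        then have "cmod (1 - of_real d - ?z) = cmod (exp (- ?z) - 1 - (- ?z))" by (metis norm_minus_cancel)
        also have "\<dots> \<le> exp (cmod (- ?z)) * (cmod (- ?z))\<^sup>2" by (rule cmod_exp_minus_1_minus_le)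
        also have "cmod (- ?z) = h * phi (j s)" using hphi by (simp add: norm_mult flip: of_real_mult)
        also have "exp (h * phi (j s)) * (h * phi (j s))\<^sup>2 \<le> exp P * (h * P)\<^sup>2"
        proof (intro mult_mono power_mono)
          have "h * phi (j s) \<le> 1 * P" using s p[OF jr(2)] by (intro mult_mono) auto
          then show "exp (h * phi (j s)) \<le> exp P" by simp
        qed (use hphi s p[OF jr(2)] in auto)
        finally show "cmod (1 - of_real d - ?z) \<le> exp P * (h * P)\<^sup>2" .
        have "cmod (y - 1) = cmod (exp (of_real h * q (j s)) - exp 0)" by (simp add: y)
        also have "\<dots> \<le> cmod (of_real h * q (j s) - 0)"
          using q(1)[OF jr(2)] s by (intro cmod_exp_diff_le) (auto simp: mult_nonneg_nonpos)
        also have "\<dots> \<le> h * Q" using q(2)[OF jr(2)] s by (simp add: norm_mult)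
        finally show "cmod (y - 1) \<le> h * Q" .
        show "cmod ?z \<le> h * P" using hphi by (simp add: norm_mult flip: of_real_mult)
        show "cmod y \<le> 1" by fact
      qed (use s Q0 P0 in auto)
      also have "\<dots> = (exp P * P\<^sup>2 + Q * P) * h\<^sup>2" by (simp add: power2_eq_square algebra_simps)
      also have "\<dots> \<le> (exp Q * Q\<^sup>2 + exp P * P\<^sup>2 + Q * P) * h\<^sup>2" by (intro mult_right_mono) auto
      finally show ?thesis .
    qed
    ultimately show ?thesis using 1 by simp
  next
    case (2 t)
    have st: "left_lim j t = j s" "j t = j (s+h)" using single_trans[OF c s(1) sh 2] by auto
    have y: "y = E * a (j s) (j (s+h))" using 2 st by (simp add: y_def E_def)
    have y1: "cmod y \<le> 1" unfolding y norm_mult using E a(1)[OF jr(2,1)] by (intro mult_le_one) auto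
    let ?w = "integral {s..s+h} (\<lambda>u. q (j u)) - of_real (integral {s..s+h} (\<lambda>u. phi (j u)))"
    let ?v = "of_real h * (q (j s) - of_real (phi (j s)))"
    have "E * of_real d = exp ?w" by (simp add: E_def d_def exp_diff exp_minus divide_inverse flip: exp_of_real)
    then have "y * of_real d - F = (exp ?w - exp ?v) * a (j s) (j (s+h))" unfolding y F_def
      by (simp add: algebra_simps)
    then have "cmod (y * of_real d - F) \<le> cmod (exp ?w - exp ?v) * 1"
      using a(1)[OF jr(2,1)] by (simp add: norm_mult mult_left_le)
    also have "cmod (exp ?w - exp ?v) \<le> cmod (?w - ?v)"
      using Re_int p_int(1) q(1)[OF jr(2)] p(1)[OF jr(2)] s by (intro cmod_exp_diff_le) (auto simp: mult_nonneg_nonpos)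
    also have "cmod (?w - ?v) \<le> cmod ?w + cmod ?v" by (rule norm_triangle_ineq4)
    also have "cmod ?w \<le> h * Q + h * P" using q_int p_int by (intro order_trans[OF norm_triangle_ineq4] add_mono) auto
    also have "cmod ?v \<le> h * (Q + P)" unfolding norm_mult using s q(2)[OF jr(2)] p[OF jr(2)]
      by (auto intro!: mult_left_mono order_trans[OF norm_triangle_ineq4] add_mono)
    finally have 1: "cmod (y * of_real d - F) \<le> 2 * h * (Q + P)" by (simp add: algebra_simps)
    have "cmod (y * (1 - of_real d) - of_real (h * phi (j s))) \<le> cmod y * cmod (1 - of_real d) + cmod (complex_of_real (h * phi (j s)))"
      unfolding norm_mult[symmetric] by (rule norm_triangle_ineq4)
    also have "\<dots> = cmod y * (1 - d) + h * phi (j s)" unfolding ch norm_of_real abs_of_nonneg[OF hphi(1)] ..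
    also have "\<dots> \<le> 1 * (h * P) + h * P"
      using y1 dl d s P0 by (intro add_mono hphi(2) mult_mono) simp_all
    finally have "cmod (y * (1 - of_real d) - of_real (h * phi (j s))) \<le> 2 * (h * P)" by linarith
    with 1 have "cmod (y * of_real d - F) + cmod (y * (1 - of_real d) - of_real (h * phi (j s))) \<le> (2 * Q + 4 * P) * h * card ?T"
      using 2 by (simp add: algebra_simps)
    moreover have "(exp Q * Q\<^sup>2 + exp P * P\<^sup>2 + Q * P) * h\<^sup>2 \<ge> 0" using K0 by simp
    ultimately show ?thesis using y1 by (intro conjI) linarith+
  qed
  then show "cmod y \<le> 1" and "cmod (y * of_real d - F) + cmod (y * (1 - of_real d) - of_real (h * phi (j s)))
      \<le> (exp Q * Q\<^sup>2 + exp P * P\<^sup>2 + Q * P) * h\<^sup>2 + (2 * Q + 4 * P) * h * card ?T" by auto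
qed

lemma trans_times_sum_card:
  assumes c: "cadlag j" and h: "h \<ge> 0" and a: "a \<ge> 0"
  shows "(\<Sum>i<k. card (trans_times j (a + real i * h) (a + real i * h + h))) = card (trans_times j a (a + real k * h))"
proof (induction k)
  case 0 show ?case by (simp add: trans_times_def)
next
  case (Suc k)
  have e: "a + real (Suc k) * h = a + real k * h + h" by (simp add: algebra_simps)
  have "card (trans_times j a (a + real (Suc k) * h)) = card (trans_times j a (a + real k * h)) + card (trans_times j (a + real k * h) (a + real k * h + h))"
    unfolding e using h a
    by (subst trans_times_split(1)[of a "a + real k * h"])
      (auto intro!: card_Un_disjoint finite_trans_times[OF c] trans_times_split(2))
  then show ?case using Suc by simp
qed

lemma finite_set_separated:
  fixes T :: "real set"
  assumes "finite T"
  shows "\<exists>e>0. \<forall>x\<in>T. \<forall>y\<in>T. x \<noteq> y \<longrightarrow> e \<le> \<bar>x - y\<bar>"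
proof -
  define D where "D = insert 1 ((\<lambda>(x,y). \<bar>x - y\<bar>) ` {(x,y) \<in> T \<times> T. x \<noteq> y})"
  have fin: "finite D" unfolding D_def using assms
    by (auto intro!: finite_imageI intro: finite_subset[OF _ finite_cartesian_product[OF assms assms]])
  have "Min D > 0" using fin by (subst Min_gr_iff) (auto simp: D_def)
  moreover have "Min D \<le> \<bar>x - y\<bar>" if "x \<in> T" "y \<in> T" "x \<noteq> y" for x y
    using that fin by (intro Min_le) (auto simp: D_def)
  ultimately show ?thesis by blast
qed

lemma eventually_single_trans:
  assumes c: "cadlag j" and a: "a \<ge> 0" and L: "L > 0"
  shows "\<forall>\<^sub>F m in sequentially. \<forall>i < m. card (trans_times j (a + real i * (L / real m)) (a + real i * (L / real m) + L / real m)) \<le> 1"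
proof -
  let ?T = "trans_times j a (a + L)"
  have "finite ?T" by (rule finite_trans_times[OF c]) (use a L in auto)
  from finite_set_separated[OF this] obtain e where e: "e > 0" "\<And>x y. x \<in> ?T \<Longrightarrow> y \<in> ?T \<Longrightarrow> x \<noteq> y \<Longrightarrow> e \<le> \<bar>x - y\<bar>" by blast
  obtain m0 :: nat where m0: "L / e < real m0" using reals_Archimedean2 by blast
  show ?thesis unfolding eventually_sequentially
  proof (intro exI[of _ "Suc m0"] allI impI)
    fix m i assume m: "Suc m0 \<le> m" and i: "i < m"
    let ?U = "trans_times j (a + real i * (L / real m)) (a + real i * (L / real m) + L / real m)"
    have mp: "real m > 0" using m by simp
    have me: "L / real m < e"
    proof -
      have "L / e < real m" using m0 m by linarith
      then show ?thesis using e mp by (simp add: field_simps)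
    qed
    have "(real i + 1) * L \<le> real m * L" using i L by (intro mult_right_mono) auto
    then have "real i * (L / real m) + L / real m \<le> L" using mp by (simp add: field_simps)
    then have sub: "?U \<subseteq> ?T" using mp L by (intro trans_times_mono) auto
    have "x = y" if "x \<in> ?U" "y \<in> ?U" for x y
    proof (rule ccontr)
      assume "x \<noteq> y"
      then have "e \<le> \<bar>x - y\<bar>" using e(2) that sub by auto
      moreover have "\<bar>x - y\<bar> < L / real m" using trans_timesD[OF that(1)] trans_timesD[OF that(2)] by linarith
      ultimately show False using me by simp
    qed
    then have "?U = {} \<or> (\<exists>x. ?U = {x})" by blast
    then show "card ?U \<le> 1" by auto
  qed
qed

definition path_char :: "(nat \<Rightarrow> complex) \<Rightarrow> (nat \<Rightarrow> nat \<Rightarrow> complex) \<Rightarrow> (real \<Rightarrow> nat) \<Rightarrow> real \<Rightarrow> real \<Rightarrow> complex" where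
  "path_char q a j s t = exp (integral {s..t} (\<lambda>u. q (j u))) * (\<Prod>tau\<in>trans_times j s t. a (left_lim j tau) (j tau))"

definition path_survival :: "(nat \<Rightarrow> real) \<Rightarrow> (real \<Rightarrow> nat) \<Rightarrow> real \<Rightarrow> real \<Rightarrow> real" where
  "path_survival phi j s t = exp (- integral {s..t} (\<lambda>u. phi (j u)))"

lemma path_char_split:
  assumes c: "cadlag j" and st: "0 \<le> s" "s \<le> t" "t \<le> u"
  shows "path_char q a j s u = path_char q a j s t * path_char q a j t u"
proof -
  have "integral {s..u} (\<lambda>u. q (j u)) = integral {s..t} (\<lambda>u. q (j u)) + integral {t..u} (\<lambda>u. q (j u))"
    using st by (subst Henstock_Kurzweil_Integration.integral_combine) (auto intro!: cadlag_nat_integrable[OF c])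
  moreover have "(\<Prod>tau\<in>trans_times j s u. a (left_lim j tau) (j tau)) = (\<Prod>tau\<in>trans_times j s t. a (left_lim j tau) (j tau)) * (\<Prod>tau\<in>trans_times j t u. a (left_lim j tau) (j tau))"
    unfolding trans_times_split(1)[OF st(2,3)] using st
    by (intro prod.union_disjoint finite_trans_times[OF c] trans_times_split(2)) auto
  ultimately show ?thesis by (simp add: path_char_def exp_add)
qed

lemma path_survival_split:
  assumes c: "cadlag j" and st: "0 \<le> s" "s \<le> t" "t \<le> u"
  shows "path_survival phi j s u = path_survival phi j s t * path_survival phi j t u"
proof -
  have "integral {s..u} (\<lambda>u. phi (j u)) = integral {s..t} (\<lambda>u. phi (j u)) + integral {t..u} (\<lambda>u. phi (j u))"
    using st by (subst Henstock_Kurzweil_Integration.integral_combine) (auto intro!: cadlag_nat_integrable[OF c])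
  then show ?thesis by (simp add: path_survival_def exp_diff exp_minus divide_inverse)
qed

lemma path_char_path_survival_refl: "path_char q a j s s = 1" "path_survival phi j s s = 1"
  by (auto simp: path_char_def path_survival_def trans_times_def)

lemma path_char_prod:
  assumes c: "cadlag j" and "0 \<le> s" "0 \<le> h"
  shows "(\<Prod>i<k. path_char q a j (s + real i * h) (s + real i * h + h)) = path_char q a j s (s + real k * h)"
    "(\<Prod>i<k. path_survival phi j (s + real i * h) (s + real i * h + h)) = path_survival phi j s (s + real k * h)"
proof -
  have e: "s + real (Suc k) * h = s + real k * h + h" for k by (simp add: algebra_simps)
  show "(\<Prod>i<k. path_char q a j (s + real i * h) (s + real i * h + h)) = path_char q a j s (s + real k * h)"
  proof (induction k)
    case (Suc k)
    show ?case unfolding prod.lessThan_Suc Suc e by (rule path_char_split[OF c, symmetric]) (use assms in auto)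
  qed (simp add: path_char_path_survival_refl)
  show "(\<Prod>i<k. path_survival phi j (s + real i * h) (s + real i * h + h)) = path_survival phi j s (s + real k * h)"
  proof (induction k)
    case (Suc k)
    show ?case unfolding prod.lessThan_Suc Suc e by (rule path_survival_split[OF c, symmetric]) (use assms in auto)
  qed (simp add: path_char_path_survival_refl)
qed

context
  fixes j :: "real \<Rightarrow> nat" and N :: nat and q :: "nat \<Rightarrow> complex" and phi :: "nat \<Rightarrow> real"
    and a :: "nat \<Rightarrow> nat \<Rightarrow> complex" and Q P :: real
  assumes c: "cadlag j" and j: "\<And>t. t \<ge> 0 \<Longrightarrow> j t < N"
    and q: "\<And>n. n < N \<Longrightarrow> Re (q n) \<le> 0" "\<And>n. n < N \<Longrightarrow> cmod (q n) \<le> Q"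
    and p: "\<And>n. n < N \<Longrightarrow> 0 \<le> phi n" "\<And>n. n < N \<Longrightarrow> phi n \<le> P"
    and a: "\<And>n n'. n < N \<Longrightarrow> n' < N \<Longrightarrow> cmod (a n n') \<le> 1" "\<And>n. a n n = 1"
begin

lemma left_lim_less: "t > 0 \<Longrightarrow> left_lim j t < N"
proof -
  assume "t > 0"
  then obtain d where d: "d > 0" "d \<le> t" "\<forall>u. t - d < u \<and> u < t \<longrightarrow> j u = left_lim j t"
    using cadlag_nat_left[OF c] by blast
  then have "j (t - d/2) = left_lim j t" by simp
  then show ?thesis using j[of "t - d/2"] d by simp
qed

lemma path_char_path_survival_bounds:
  assumes "0 \<le> s" "s \<le> t"
  shows "cmod (path_char q a j s t) \<le> 1" "0 < path_survival phi j s t" "path_survival phi j s t \<le> 1"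
proof -
  have jN: "j u < N" if "u \<in> {s..t}" for u using that assms j by auto
  have iq: "(\<lambda>u. q (j u)) integrable_on {s..t}" by (rule cadlag_nat_integrable[OF c assms])
  have ip: "(\<lambda>u. phi (j u)) integrable_on {s..t}" by (rule cadlag_nat_integrable[OF c assms])
  have "Re (integral {s..t} (\<lambda>u. q (j u))) = integral {s..t} (\<lambda>u. Re (q (j u)))"
    using integral_linear[OF iq bounded_linear_Re] by (simp add: o_def)
  also have "\<dots> \<le> integral {s..t} (\<lambda>u. 0)"
    using integrable_linear[OF iq bounded_linear_Re] q(1)[OF jN] by (intro integral_le) (auto simp: o_def)
  finally have 1: "cmod (exp (integral {s..t} (\<lambda>u. q (j u)))) \<le> 1" by simp
  have "cmod (\<Prod>tau\<in>trans_times j s t. a (left_lim j tau) (j tau)) \<le> 1"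
    unfolding prod_norm[symmetric]
  proof (intro prod_le_1 conjI a norm_ge_zero)
    fix tau assume "tau \<in> trans_times j s t"
    then have "tau > 0" using trans_timesD assms by fastforce
    then show "left_lim j tau < N" "j tau < N" using left_lim_less j by auto
  qed
  then show "cmod (path_char q a j s t) \<le> 1" unfolding path_char_def norm_mult using 1 by (intro mult_le_one) auto
  have "integral {s..t} (\<lambda>u. phi (j u)) \<ge> 0" using p(1)[OF jN] by (intro integral_nonneg ip) auto
  then show "path_survival phi j s t \<le> 1" by (simp add: path_survival_def)
qed (simp add: path_survival_def)

lemma discretised_limit:
  assumes s: "0 \<le> s" and L: "L > 0"
  shows "(\<lambda>m. grid_killed (\<lambda>i. path_char q a j (s + real i * (L / real m)) (s + real i * (L / real m) + L / real m))
               (\<lambda>i. path_survival phi j (s + real i * (L / real m)) (s + real i * (L / real m) + L / real m)) 0 m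
           - grid_euler (\<lambda>i. exp (of_real (L / real m) * (q (j (s + real i * (L / real m))) - of_real (phi (j (s + real i * (L / real m))))))
                * a (j (s + real i * (L / real m))) (j (s + real i * (L / real m) + L / real m)))
               (\<lambda>i. L / real m * phi (j (s + real i * (L / real m)))) 0 m) \<longlonglongrightarrow> 0"
    and "(\<lambda>m. \<Prod>i<m. exp (of_real (L / real m) * (q (j (s + real i * (L / real m)))))
                * a (j (s + real i * (L / real m))) (j (s + real i * (L / real m) + L / real m))) \<longlonglongrightarrow> path_char q a j s (s + L)"
proof -
  define K1 where "K1 = exp Q * Q\<^sup>2 + exp P * P\<^sup>2 + Q * P"
  define K2 where "K2 = 2 * Q + 4 * P"
  define c0 where "c0 = real (card (trans_times j s (s + L)))"
  define h where "h m = L / real m" for m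
  define tt where "tt m i = s + real i * h m" for m i
  define y where "y m i = path_char q a j (tt m i) (tt m i + h m)" for m i
  define d where "d m i = path_survival phi j (tt m i) (tt m i + h m)" for m i
  define F where "F m i = exp (of_real (h m) * (q (j (tt m i)) - of_real (phi (j (tt m i))))) * a (j (tt m i)) (j (tt m i + h m))" for m i
  define G where "G m i = exp (of_real (h m) * (q (j (tt m i)))) * a (j (tt m i)) (j (tt m i + h m))" for m i
  have hlim: "h \<longlonglongrightarrow> 0" unfolding h_def by (rule lim_const_over_n)
  have ev1: "\<forall>\<^sub>F m in sequentially. h m < 1" using order_tendstoD(2)[OF hlim, of 1] by simp
  have ev2: "\<forall>\<^sub>F m in sequentially. \<forall>i<m. card (trans_times j (tt m i) (tt m i + h m)) \<le> 1"
    using eventually_single_trans[OF c s L] by (simp add: tt_def h_def)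
  have ev: "\<forall>\<^sub>F m in sequentially. m > 0 \<and> h m < 1 \<and> (\<forall>i<m. card (trans_times j (tt m i) (tt m i + h m)) \<le> 1)"
    using ev1 ev2 eventually_gt_at_top[of 0] by eventually_elim auto
  have h0: "h m \<ge> 0" for m using L by (simp add: h_def)
  have t0: "tt m i \<ge> 0" for m i using s h0 by (simp add: tt_def)
  have y1: "cmod (y m i) \<le> 1" for m i unfolding y_def using t0 h0 by (intro path_char_path_survival_bounds) auto
  have d1: "0 \<le> d m i \<and> d m i \<le> 1" for m i unfolding d_def using path_char_path_survival_bounds(2,3)[of "tt m i" "tt m i + h m"] t0 h0 by (simp add: less_imp_le)
  have jt: "j (tt m i) < N" "j (tt m i + h m) < N" for m i using j t0 h0 by (auto simp: add_nonneg_nonneg)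
  have F1: "cmod (F m i) \<le> 1" "cmod (G m i) \<le> 1" for m i
  proof -
    have e: "cmod (exp (of_real (h m) * z)) \<le> 1" if "Re z \<le> 0" for z using that h0[of m] by (simp add: mult_nonneg_nonpos)
    have r: "Re (q (j (tt m i))) \<le> 0" by (rule q(1)[OF jt(1)])
    have r2: "Re (q (j (tt m i)) - of_real (phi (j (tt m i)))) \<le> 0" using r p(1)[OF jt(1)[of m i]] by simp
    have r3: "cmod (a (j (tt m i)) (j (tt m i + h m))) \<le> 1" by (rule a(1)[OF jt])
    show "cmod (F m i) \<le> 1" unfolding F_def norm_mult
      by (rule mult_le_one[OF e[OF r2] norm_ge_zero r3])
    show "cmod (G m i) \<le> 1" unfolding G_def norm_mult
      by (rule mult_le_one[OF e[OF r] norm_ge_zero r3])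
  qed
  have bnd: "cmod (y m i * of_real (d m i) - F m i) + cmod (y m i * (1 - of_real (d m i)) - of_real (h m * phi (j (tt m i))))
      \<le> K1 * (h m)\<^sup>2 + K2 * h m * card (trans_times j (tt m i) (tt m i + h m))"
    if "m > 0" "h m < 1" "card (trans_times j (tt m i) (tt m i + h m)) \<le> 1" for m i
    unfolding y_def d_def F_def K1_def K2_def path_char_def path_survival_def
    by (rule step_error(5)[OF c j t0 _ _ q p a that(3)]) (use that L in \<open>auto simp: h_def\<close>)
  have sumbnd: "(\<Sum>i<m. K1 * (h m)\<^sup>2 + K2 * h m * card (trans_times j (tt m i) (tt m i + h m))) = (K1 * L + K2 * c0) * h m" if "m > 0" for m
  proof -
    have e: "real m * h m = L" using that by (simp add: h_def)
    have "(\<Sum>i<m. K1 * (h m)\<^sup>2 + K2 * h m * card (trans_times j (tt m i) (tt m i + h m)))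
      = real m * h m * K1 * h m + K2 * h m * real (\<Sum>i<m. card (trans_times j (tt m i) (tt m i + h m)))"
      by (simp add: sum.distrib sum_distrib_left power2_eq_square)
    also have "(\<Sum>i<m. card (trans_times j (tt m i) (tt m i + h m))) = card (trans_times j s (s + L))"
      unfolding tt_def using trans_times_sum_card[OF c h0 s, of m m] e by simp
    finally have "(\<Sum>i<m. K1 * (h m)\<^sup>2 + K2 * h m * card (trans_times j (tt m i) (tt m i + h m))) = L * K1 * h m + K2 * h m * c0"
      unfolding e c0_def .
    then show ?thesis by (simp add: algebra_simps)
  qed
  have lim0: "(\<lambda>m. (K1 * L + K2 * c0) * h m) \<longlonglongrightarrow> 0" using tendsto_mult_left[OF hlim, of "K1 * L + K2 * c0"] by simp
  have "(\<lambda>m. grid_killed (y m) (d m) 0 m - grid_euler (F m) (\<lambda>i. h m * phi (j (tt m i))) 0 m) \<longlonglongrightarrow> 0"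
  proof (rule Lim_null_comparison[OF _ lim0])
    show "\<forall>\<^sub>F m in sequentially. cmod (grid_killed (y m) (d m) 0 m - grid_euler (F m) (\<lambda>i. h m * phi (j (tt m i))) 0 m) \<le> (K1 * L + K2 * c0) * h m"
      using ev
    proof eventually_elim
      case (elim m)
      have "cmod (grid_killed (y m) (d m) 0 m - grid_euler (F m) (\<lambda>i. h m * phi (j (tt m i))) 0 m) \<le>
        (\<Sum>i\<in>{0..<0+m}. cmod (y m i * of_real (d m i) - F m i) + cmod (y m i * (1 - of_real (d m i)) - of_real (h m * phi (j (tt m i)))))"
        by (rule grid_killed_grid_euler_diff[OF y1 d1 F1(1)])
      also have "\<dots> \<le> (\<Sum>i<m. K1 * (h m)\<^sup>2 + K2 * h m * card (trans_times j (tt m i) (tt m i + h m)))"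
        unfolding add_0 atLeast0LessThan using elim by (intro sum_mono bnd) auto
      finally show ?case using sumbnd elim by simp
    qed
  qed
  then show "(\<lambda>m. grid_killed (\<lambda>i. path_char q a j (s + real i * (L / real m)) (s + real i * (L / real m) + L / real m))
               (\<lambda>i. path_survival phi j (s + real i * (L / real m)) (s + real i * (L / real m) + L / real m)) 0 m
           - grid_euler (\<lambda>i. exp (of_real (L / real m) * (q (j (s + real i * (L / real m))) - of_real (phi (j (s + real i * (L / real m))))))
                * a (j (s + real i * (L / real m))) (j (s + real i * (L / real m) + L / real m)))
               (\<lambda>i. L / real m * phi (j (s + real i * (L / real m)))) 0 m) \<longlonglongrightarrow> 0"
    unfolding y_def[abs_def] d_def[abs_def] F_def[abs_def] tt_def h_def .
  have Q0: "Q \<ge> 0" by (rule order_trans[OF norm_ge_zero q(2)[OF j[OF s]]])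
  have bnd2: "cmod (y m i - G m i) \<le> (exp Q * Q\<^sup>2) * (h m)\<^sup>2 + 2 * Q * h m * card (trans_times j (tt m i) (tt m i + h m))"
    if "m > 0" "h m < 1" "card (trans_times j (tt m i) (tt m i + h m)) \<le> 1" for m i
  proof -
    have hp: "0 < h m" "h m \<le> 1" using that L by (auto simp: h_def)
    have "cmod (y m i * of_real (exp (- integral {tt m i..tt m i + h m} (\<lambda>u. 0))) - exp (of_real (h m) * (q (j (tt m i)) - of_real 0)) * a (j (tt m i)) (j (tt m i + h m)))
        + cmod (y m i * (1 - of_real (exp (- integral {tt m i..tt m i + h m} (\<lambda>u. 0)))) - of_real (h m * 0))
      \<le> (exp Q * Q\<^sup>2 + exp 0 * 0\<^sup>2 + Q * 0) * (h m)\<^sup>2 + (2 * Q + 4 * 0) * h m * card (trans_times j (tt m i) (tt m i + h m))"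
      unfolding y_def path_char_def
      by (rule step_error(5)[where phi="\<lambda>_. 0" and P=0 and N=N]) (rule order_refl | fact c j t0 hp q a that)+
    then have "cmod (y m i - G m i) \<le> exp Q * Q\<^sup>2 * (h m)\<^sup>2 + 2 * Q * h m * card (trans_times j (tt m i) (tt m i + h m))"
      by (simp add: G_def)
    then show ?thesis by simp
  qed
  have lim1: "(\<lambda>m. (exp Q * Q\<^sup>2 * L + 2 * Q * c0) * h m) \<longlonglongrightarrow> 0" using tendsto_mult_left[OF hlim, of "exp Q * Q\<^sup>2 * L + 2 * Q * c0"] by simp
  have "(\<lambda>m. (\<Prod>i<m. G m i) - path_char q a j s (s + L)) \<longlonglongrightarrow> 0"
  proof (rule Lim_null_comparison[OF _ lim1])
    show "\<forall>\<^sub>F m in sequentially. cmod ((\<Prod>i<m. G m i) - path_char q a j s (s + L)) \<le> (exp Q * Q\<^sup>2 * L + 2 * Q * c0) * h m"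
      using ev
    proof eventually_elim
      case (elim m)
      have e: "real m * h m = L" using elim by (simp add: h_def)
      have "path_char q a j s (s + L) = (\<Prod>i<m. y m i)" unfolding y_def tt_def path_char_prod(1)[OF c s h0] e ..
      then have "cmod ((\<Prod>i<m. G m i) - path_char q a j s (s + L)) = cmod ((\<Prod>i<m. y m i) - (\<Prod>i<m. G m i))"
        by (simp add: norm_minus_commute)
      also have "\<dots> \<le> (\<Sum>i<m. cmod (y m i - G m i))" by (rule norm_prod_diff) (use y1 F1 in auto)
      also have "\<dots> \<le> (\<Sum>i<m. (exp Q * Q\<^sup>2) * (h m)\<^sup>2 + 2 * Q * h m * card (trans_times j (tt m i) (tt m i + h m)))"
        using elim by (intro sum_mono bnd2) auto
      also have "\<dots> = real m * h m * (exp Q * Q\<^sup>2) * h m + 2 * Q * h m * real (\<Sum>i<m. card (trans_times j (tt m i) (tt m i + h m)))"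
        by (simp add: sum.distrib sum_distrib_left power2_eq_square)
      also have "(\<Sum>i<m. card (trans_times j (tt m i) (tt m i + h m))) = card (trans_times j s (s + L))"
        unfolding tt_def using trans_times_sum_card[OF c h0 s, of m m] e by simp
      finally show ?case unfolding e c0_def by (simp add: algebra_simps)
    qed
  qed
  then have "(\<lambda>m. \<Prod>i<m. G m i) \<longlonglongrightarrow> path_char q a j s (s + L)" by (rule LIM_zero_cancel)
  then show "(\<lambda>m. \<Prod>i<m. exp (of_real (L / real m) * (q (j (s + real i * (L / real m)))))
                * a (j (s + real i * (L / real m))) (j (s + real i * (L / real m) + L / real m))) \<longlonglongrightarrow> path_char q a j s (s + L)"
    by (simp add: G_def tt_def h_def)
qed

end

section \<open>The modulated process\<close>

lemma pow_mat_entry_bound: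
  fixes B :: "real mat"
  assumes B: "B \<in> carrier_mat N N" and c: "\<And>j. j < N \<Longrightarrow> (\<Sum>l<N. \<bar>B $$ (l,j)\<bar>) \<le> c" and c0: "c \<ge> 0"
    and ij: "i < N" "j < N"
  shows "\<bar>(B ^\<^sub>m k) $$ (i,j)\<bar> \<le> c ^ k"
  using ij
proof (induction k arbitrary: j)
  case 0 then show ?case using B by auto
next
  case (Suc k)
  have Bk: "B ^\<^sub>m k \<in> carrier_mat N N" using B by simp
  have "(B ^\<^sub>m Suc k) $$ (i,j) = (\<Sum>l<N. (B ^\<^sub>m k) $$ (i,l) * B $$ (l,j))"
    using Suc.prems B Bk by (auto simp: scalar_prod_def row_def col_def lessThan_atLeast0 intro!: sum.cong)
  then have "\<bar>(B ^\<^sub>m Suc k) $$ (i,j)\<bar> \<le> (\<Sum>l<N. \<bar>(B ^\<^sub>m k) $$ (i,l)\<bar> * \<bar>B $$ (l,j)\<bar>)"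
    by (metis (no_types, lifting) abs_mult sum.cong sum_abs)
  also have "\<dots> \<le> (\<Sum>l<N. c ^ k * \<bar>B $$ (l,j)\<bar>)" using Suc by (intro sum_mono mult_right_mono) auto
  also have "\<dots> = c ^ k * (\<Sum>l<N. \<bar>B $$ (l,j)\<bar>)" by (simp add: sum_distrib_left)
  also have "\<dots> \<le> c ^ k * c" using c[OF Suc.prems(2)] c0 by (intro mult_left_mono) auto
  finally show ?case by (simp add: mult.commute)
qed

lemma mat_exp_expansion:
  fixes G :: "real mat"
  assumes G: "G \<in> carrier_mat N N"
  shows "\<exists>K\<ge>0. \<forall>h i j. 0 \<le> h \<longrightarrow> h \<le> 1 \<longrightarrow> i < N \<longrightarrow> j < N \<longrightarrow>
    \<bar>mat_exp h G $$ (i,j) - ((if i = j then 1 else 0) + h * G $$ (i,j))\<bar> \<le> K * h\<^sup>2"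
proof -
  define c where "c = (\<Sum>j<N. \<Sum>l<N. \<bar>G $$ (l,j)\<bar>)"
  have c0: "c \<ge> 0" unfolding c_def by (intro sum_nonneg) auto
  have cj: "(\<Sum>l<N. \<bar>G $$ (l,j)\<bar>) \<le> c" if "j < N" for j
    unfolding c_def using that by (intro member_le_sum[of j "{..<N}" "\<lambda>j. \<Sum>l<N. \<bar>G $$ (l,j)\<bar>"]) (auto intro: sum_nonneg)
  have "\<bar>mat_exp h G $$ (i,j) - ((if i = j then 1 else 0) + h * G $$ (i,j))\<bar> \<le> c\<^sup>2 * exp c * h\<^sup>2"
    if h: "0 \<le> h" "h \<le> 1" and ij: "i < N" "j < N" for h i j
  proof -
    define a where "a k = ((h \<cdot>\<^sub>m G) ^\<^sub>m k) $$ (i,j) / fact k" for k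
    have hc0: "h * c \<ge> 0" using h c0 by simp
    have hG: "h \<cdot>\<^sub>m G \<in> carrier_mat N N" using G by simp
    have col: "(\<Sum>l<N. \<bar>(h \<cdot>\<^sub>m G) $$ (l,j)\<bar>) \<le> h * c" if "j < N" for j
    proof -
      have "(\<Sum>l<N. \<bar>(h \<cdot>\<^sub>m G) $$ (l,j)\<bar>) = (\<Sum>l<N. h * \<bar>G $$ (l,j)\<bar>)"
        using G h that by (intro sum.cong) (auto simp: abs_mult)
      also have "\<dots> = h * (\<Sum>l<N. \<bar>G $$ (l,j)\<bar>)" by (simp add: sum_distrib_left)
      also have "\<dots> \<le> h * c" using cj[OF that] h by (intro mult_left_mono) auto
      finally show ?thesis .
    qed
    have ak: "\<bar>a k\<bar> \<le> (h * c) ^ k / fact k" for k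
      unfolding a_def abs_divide using pow_mat_entry_bound[OF hG col hc0 ij, of k] by (simp add: divide_right_mono)
    have sm: "summable (\<lambda>k. (h * c) ^ k / fact k)" using summable_exp[of "h * c"] by (simp add: divide_inverse mult.commute)
    have sa: "summable a" by (rule summable_comparison_test'[OF sm, of 0]) (use ak in auto)
    have "mat_exp h G $$ (i,j) = suminf a" using G ij unfolding mat_exp_def a_def by simp
    also have "\<dots> = (\<Sum>k. a (k + 2)) + (\<Sum>k<2. a k)" by (rule suminf_split_initial_segment[OF sa])
    also have "(\<Sum>k<2. a k) = (if i = j then 1 else 0) + h * G $$ (i,j)"
      using G ij by (simp add: a_def numeral_2_eq_2)
    finally have "mat_exp h G $$ (i,j) - ((if i = j then 1 else 0) + h * G $$ (i,j)) = (\<Sum>k. a (k + 2))" by simp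
    also have "\<bar>\<dots>\<bar> \<le> (\<Sum>k. (h * c)\<^sup>2 * ((h * c) ^ k / fact k))"
    proof -
      have b: "\<bar>a (k + 2)\<bar> \<le> (h * c)\<^sup>2 * ((h * c) ^ k / fact k)" for k
      proof -
        have "\<bar>a (k + 2)\<bar> \<le> (h * c) ^ (k + 2) / fact (k + 2)" by (rule ak)
        also have "\<dots> \<le> (h * c) ^ (k + 2) / fact k"
          using hc0 by (intro divide_left_mono fact_mono) auto
        finally show ?thesis by (simp only: power_add mult.commute times_divide_eq_right)
      qed
      have s2: "summable (\<lambda>k. (h * c)\<^sup>2 * ((h * c) ^ k / fact k))" using sm by (rule summable_mult)
      have s3: "summable (\<lambda>k. norm (a (k + 2)))" by (rule summable_comparison_test'[OF s2, of 0]) (use b in auto)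
      have "\<bar>\<Sum>k. a (k + 2)\<bar> \<le> (\<Sum>k. \<bar>a (k + 2)\<bar>)" using summable_norm[OF s3] by simp
      also have "\<dots> \<le> (\<Sum>k. (h * c)\<^sup>2 * ((h * c) ^ k / fact k))" using s3 b s2 by (intro suminf_le) auto
      finally show ?thesis .
    qed
    also have "\<dots> = (h * c)\<^sup>2 * exp (h * c)"
      using sm by (simp add: suminf_mult exp_def divide_inverse mult.commute)
    also have "\<dots> \<le> (h * c)\<^sup>2 * exp c" using h c0 by (intro mult_left_mono) (auto simp: mult_left_le_one_le)
    finally show ?thesis by (simp add: power_mult_distrib mult_ac)
  qed
  then show ?thesis using c0 by (intro exI[of _ "c\<^sup>2 * exp c"]) auto
qed

lemma hk_integral_of_real:
  assumes "f integrable_on X"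
  shows "integral X (\<lambda>u. complex_of_real (f u)) = of_real (integral X f)"
proof -
  have "bounded_linear complex_of_real" by (rule bounded_linear_of_real)
  from integral_linear[OF assms this] show ?thesis by (simp add: o_def)
qed

locale mm_process = prob_space M for M :: "'a measure" +
  fixes N :: nat and varpi :: "nat \<Rightarrow> real" and Gen :: "real mat"
    and mu :: "nat \<Rightarrow> real measure" and psi :: "nat \<Rightarrow> real \<Rightarrow> complex"
    and nu :: "nat \<Rightarrow> nat \<Rightarrow> real measure" and phi :: "nat \<Rightarrow> real"
    and J :: "real \<Rightarrow> 'a \<Rightarrow> nat" and W V :: "real \<Rightarrow> 'a \<Rightarrow> real"
  assumes model: "mm_model M N varpi Gen mu psi nu phi J W V"
begin

lemma J_meas[measurable]: "J t \<in> measurable M (count_space UNIV)"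
  and W_meas[measurable]: "W t \<in> borel_measurable M"
  and V_meas[measurable]: "V t \<in> borel_measurable M"
  and J_cadlag: "\<omega> \<in> space M \<Longrightarrow> cadlag (\<lambda>t. J t \<omega>)"
  and J_less: "\<omega> \<in> space M \<Longrightarrow> t \<ge> 0 \<Longrightarrow> J t \<omega> < N"
  and W_cadlag: "\<omega> \<in> space M \<Longrightarrow> cadlag (\<lambda>t. W t \<omega>)"
  and V_cadlag: "\<omega> \<in> space M \<Longrightarrow> cadlag (\<lambda>t. V t \<omega>)"
  and W_0: "\<omega> \<in> space M \<Longrightarrow> W 0 \<omega> = 0"
  and V_0: "\<omega> \<in> space M \<Longrightarrow> V 0 \<omega> = 0"
  and phi_nonneg: "n < N \<Longrightarrow> phi n \<ge> 0"
  and gen: "generator N Gen"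
  and psi_0: "n < N \<Longrightarrow> psi n 0 = 0"
  and varpi_nonneg: "n < N \<Longrightarrow> varpi n \<ge> 0"
  and varpi_sum: "(\<Sum>n<N. varpi n) = 1"
  and char_mu: "n < N \<Longrightarrow> char (mu n) th = exp (psi n th)"
  using model by (auto simp: mm_model_def markov_chain_def)

lemma mu_dist: "n < N \<Longrightarrow> real_distribution (mu n)"
  and nu_dist: "n < N \<Longrightarrow> n' < N \<Longrightarrow> n \<noteq> n' \<Longrightarrow> real_distribution (nu n n')"
  using model by (auto simp: mm_model_def intro!: real_distributionI)

lemma cylinder:
  "t 0 = 0 \<Longrightarrow> (\<And>j. j < k \<Longrightarrow> t j \<le> t (Suc j)) \<Longrightarrow> (\<And>j. j \<le> k \<Longrightarrow> c j < N) \<Longrightarrow>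
    measure M {\<omega>\<in>space M. \<forall>j\<le>k. J (t j) \<omega> = c j}
          = varpi (c 0) * (\<Prod>j\<in>{1..k}. mat_exp (t j - t (j - 1)) Gen $$ (c (j - 1), c j))"
  using model unfolding mm_model_def markov_chain_def by blast

lemma N_pos: "N > 0" using varpi_sum by (cases N) auto

lemma Re_psi: "n < N \<Longrightarrow> Re (psi n th) \<le> 0"
proof -
  assume n: "n < N"
  have "cmod (exp (psi n th)) \<le> 1" using real_distribution.cmod_char_le_1[OF mu_dist[OF n], of th] char_mu[OF n] by simp
  then show ?thesis by simp
qed

definition chi :: "real \<Rightarrow> nat \<Rightarrow> nat \<Rightarrow> complex" where
  "chi th n n' = (if n = n' then 1 else char (nu n n') th)"

lemma chi_le: "n < N \<Longrightarrow> n' < N \<Longrightarrow> cmod (chi th n n') \<le> 1"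
  using real_distribution.cmod_char_le_1[OF nu_dist] by (auto simp: chi_def)

lemma chi_refl: "chi th n n = 1" by (simp add: chi_def)

lemma chi_0: "n < N \<Longrightarrow> n' < N \<Longrightarrow> chi 0 n n' = 1"
  using real_distribution.char_zero[OF nu_dist] by (auto simp: chi_def)

definition Y where "Y th s t \<omega> = path_char (\<lambda>n. psi n th) (chi th) (\<lambda>u. J u \<omega>) s t"
definition D where "D s t \<omega> = path_survival phi (\<lambda>u. J u \<omega>) s t"
definition Lam where "Lam s t \<omega> = integral {s..t} (\<lambda>u. phi (J u \<omega>))"

definition Pmax where "Pmax = (\<Sum>n<N. phi n)"
definition Qmax where "Qmax th = (\<Sum>n<N. cmod (psi n th))"

lemma Pmax: "n < N \<Longrightarrow> phi n \<le> Pmax" unfolding Pmax_def using phi_nonneg by (intro member_le_sum) auto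
lemma Qmax: "n < N \<Longrightarrow> cmod (psi n th) \<le> Qmax th" unfolding Qmax_def by (intro member_le_sum) auto

lemma Y_le:
  assumes "\<omega> \<in> space M" "0 \<le> s" "s \<le> t"
  shows "cmod (Y th s t \<omega>) \<le> 1"
  unfolding Y_def
  by (intro path_char_path_survival_bounds(1)[where N=N and Q="Qmax th" and P=Pmax and phi=phi] J_cadlag J_less Re_psi Qmax phi_nonneg Pmax chi_le chi_refl assms)

lemma D_le:
  assumes "\<omega> \<in> space M" "0 \<le> s" "s \<le> t"
  shows "D s t \<omega> \<le> 1"
  unfolding D_def
  by (intro path_char_path_survival_bounds(3)[where N=N and Q="Qmax 0" and P=Pmax and phi=phi and q="\<lambda>n. psi n 0" and a="chi 0"] J_cadlag J_less Re_psi Qmax phi_nonneg Pmax chi_le chi_refl assms)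

lemma D_pos: "D s t \<omega> > 0" by (simp add: D_def path_survival_def)

lemma Lam_nonneg: "\<omega> \<in> space M \<Longrightarrow> 0 \<le> s \<Longrightarrow> s \<le> t \<Longrightarrow> Lam s t \<omega> \<ge> 0"
  using D_le[of \<omega> s t] by (simp add: D_def path_survival_def Lam_def)

lemma D_Lam: "D s t \<omega> = exp (- Lam s t \<omega>)" by (simp add: D_def path_survival_def Lam_def)

lemma Y_meas[measurable]:
  assumes "0 \<le> s" "s \<le> t"
  shows "Y th s t \<in> borel_measurable M"
proof (cases "s = t")
  case True then show ?thesis by (simp add: Y_def[abs_def] path_char_path_survival_refl)
next
  case False
  define L where "L = t - s"
  have L: "L > 0" "t = s + L" using False assms by (auto simp: L_def)
  show ?thesis
  proof (rule borel_measurable_LIMSEQ_metric)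
    fix m
    show "(\<lambda>\<omega>. \<Prod>i<m. exp (of_real (L / real m) * psi (J (s + real i * (L / real m)) \<omega>) th)
                * chi th (J (s + real i * (L / real m)) \<omega>) (J (s + real i * (L / real m) + L / real m) \<omega>)) \<in> borel_measurable M"
      by measurable
    fix \<omega> assume "\<omega> \<in> space M"
    then show "(\<lambda>m. \<Prod>i<m. exp (of_real (L / real m) * psi (J (s + real i * (L / real m)) \<omega>) th)
                * chi th (J (s + real i * (L / real m)) \<omega>) (J (s + real i * (L / real m) + L / real m) \<omega>)) \<longlonglongrightarrow> Y th s t \<omega>"
      unfolding Y_def L(2)
      by (intro discretised_limit(2)[where j="\<lambda>u. J u \<omega>" and N=N and Q="Qmax th" and P=Pmax and phi=phi and q="\<lambda>n. psi n th" and a="chi th"] J_cadlag J_less Re_psi Qmax phi_nonneg Pmax chi_le chi_refl L assms)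
  qed
qed

lemma D_meas[measurable]:
  assumes "0 \<le> s" "s \<le> t"
  shows "D s t \<in> borel_measurable M"
proof (cases "s = t")
  case True then show ?thesis by (simp add: D_def[abs_def] path_char_path_survival_refl)
next
  case False
  define L where "L = t - s"
  have L: "L > 0" "t = s + L" using False assms by (auto simp: L_def)
  have "(\<lambda>\<omega>. complex_of_real (D s t \<omega>)) \<in> borel_measurable M"
  proof (rule borel_measurable_LIMSEQ_metric)
    fix m
    show "(\<lambda>\<omega>. \<Prod>i<m. exp (of_real (L / real m) * (- complex_of_real (phi (J (s + real i * (L / real m)) \<omega>)))) * 1) \<in> borel_measurable M"
      by measurable
    fix \<omega> assume w: "\<omega> \<in> space M"
    have "complex_of_real (D s t \<omega>) = path_char (\<lambda>n. - complex_of_real (phi n)) (\<lambda>_ _. 1) (\<lambda>u. J u \<omega>) s t"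
    proof -
      have "integral {s..t} (\<lambda>u. - complex_of_real (phi (J u \<omega>))) = - of_real (integral {s..t} (\<lambda>u. phi (J u \<omega>)))"
        using hk_integral_of_real[OF cadlag_nat_integrable[OF J_cadlag[OF w] assms, of phi]] by simp
      then show ?thesis by (simp add: D_def path_survival_def path_char_def exp_minus flip: exp_of_real)
    qed
    moreover have "(\<lambda>m. \<Prod>i<m. exp (of_real (L / real m) * (- complex_of_real (phi (J (s + real i * (L / real m)) \<omega>)))) * 1) \<longlonglongrightarrow> path_char (\<lambda>n. - complex_of_real (phi n)) (\<lambda>_ _. 1) (\<lambda>u. J u \<omega>) s t"
      unfolding L(2)
      by (intro discretised_limit(2)[where j="\<lambda>u. J u \<omega>" and N=N and Q="Pmax" and P=Pmax and phi=phi and q="\<lambda>n. - complex_of_real (phi n)" and a="\<lambda>_ _. 1"] J_cadlag J_less phi_nonneg Pmax L assms w)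
        (use phi_nonneg Pmax in auto)
    ultimately show "(\<lambda>m. \<Prod>i<m. exp (of_real (L / real m) * (- complex_of_real (phi (J (s + real i * (L / real m)) \<omega>)))) * 1) \<longlonglongrightarrow> complex_of_real (D s t \<omega>)" by simp
  qed
  then have "(\<lambda>\<omega>. Re (complex_of_real (D s t \<omega>))) \<in> borel_measurable M" by measurable
  then show ?thesis by simp
qed

lemma Lam_meas[measurable]: "0 \<le> s \<Longrightarrow> s \<le> t \<Longrightarrow> Lam s t \<in> borel_measurable M"
proof -
  assume "0 \<le> s" "s \<le> t"
  then have [measurable]: "D s t \<in> borel_measurable M" by (rule D_meas)
  have "Lam s t = (\<lambda>\<omega>. - ln (D s t \<omega>))" by (simp add: D_Lam)
  then show ?thesis by simp
qed

lemma cond_formula: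
  fixes r :: "nat \<Rightarrow> real" and c :: "nat \<Rightarrow> nat"
  assumes st: "0 \<le> s" "s \<le> t" and r: "\<And>l. l < m \<Longrightarrow> r l \<ge> 0"
  defines "B \<equiv> {\<omega>\<in>space M. \<forall>l<m. J (r l) \<omega> = c l}"
  shows "(\<integral>\<omega>. indicator B \<omega> * iexp (th1 * W s \<omega> + et1 * V s \<omega> + th2 * (W t \<omega> - W s \<omega>) + et2 * (V t \<omega> - V s \<omega>)) \<partial>M)
    = (\<integral>\<omega>. indicator B \<omega> * (Y th1 0 s \<omega> * exp (of_real (Lam 0 s \<omega>) * (iexp et1 - 1)) * (Y th2 s t \<omega> * exp (of_real (Lam s t \<omega>) * (iexp et2 - 1)))) \<partial>M)"
proof -
  define sv where "sv = (\<lambda>i::nat. if i = 0 then 0 else if i = 1 then s else t)"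
  define tv where "tv = (\<lambda>i::nat. if i = 1 then th1 else th2)"
  define ev where "ev = (\<lambda>i::nat. if i = 1 then et1 else et2)"
  have i12: "{1..2::nat} = {1,2}" by auto
  have step: "exp (integral {a..b} (\<lambda>u. psi (J u \<omega>) th + complex_of_real (phi (J u \<omega>)) * (exp (\<i> * complex_of_real et) - 1)))
       * (\<Prod>tau\<in>trans_times (\<lambda>u. J u \<omega>) a b. char (nu (left_lim (\<lambda>u. J u \<omega>) tau) (J tau \<omega>)) th)
     = Y th a b \<omega> * exp (of_real (Lam a b \<omega>) * (iexp et - 1))"
    if w: "\<omega> \<in> space M" and ab: "0 \<le> a" "a \<le> b" for \<omega> a b th et
  proof -
    have c: "cadlag (\<lambda>u. J u \<omega>)" using w by (rule J_cadlag)
    have i1: "(\<lambda>u. psi (J u \<omega>) th) integrable_on {a..b}"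
      using cadlag_nat_integrable[OF c ab, of "\<lambda>n. psi n th"] by simp
    have i2: "(\<lambda>u. complex_of_real (phi (J u \<omega>))) integrable_on {a..b}"
      using cadlag_nat_integrable[OF c ab, of "\<lambda>n. complex_of_real (phi n)"] by simp
    have i3: "integral {a..b} (\<lambda>u. complex_of_real (phi (J u \<omega>))) = of_real (Lam a b \<omega>)"
      using hk_integral_of_real[OF cadlag_nat_integrable[OF c ab, of phi]] by (simp add: Lam_def)
    have "integral {a..b} (\<lambda>u. psi (J u \<omega>) th + complex_of_real (phi (J u \<omega>)) * (exp (\<i> * complex_of_real et) - 1))
      = integral {a..b} (\<lambda>u. psi (J u \<omega>) th) + of_real (Lam a b \<omega>) * (iexp et - 1)"
      using i1 i2 by (subst Henstock_Kurzweil_Integration.integral_add) (auto simp: i3 intro: integrable_on_mult_left)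
    moreover have "(\<Prod>tau\<in>trans_times (\<lambda>u. J u \<omega>) a b. char (nu (left_lim (\<lambda>u. J u \<omega>) tau) (J tau \<omega>)) th)
      = (\<Prod>tau\<in>trans_times (\<lambda>u. J u \<omega>) a b. chi th (left_lim (\<lambda>u. J u \<omega>) tau) (J tau \<omega>))"
      by (rule prod.cong) (auto simp: chi_def trans_times_def)
    ultimately show ?thesis by (simp add: Y_def path_char_def exp_add)
  qed
  have "mm_levy_cond M J W V psi nu phi" using model by (simp add: mm_model_def)
  note H = this[unfolded mm_levy_cond_def]
  have P: "sv 0 = 0 \<and> (\<forall>j<2. sv j \<le> sv (Suc j)) \<and> (\<forall>l<m. r l \<ge> 0)"
    using st r by (auto simp: sv_def less_2_cases_iff)
  have "(\<integral>\<omega>. indicator B \<omega> * exp (\<i> * complex_of_real (\<Sum>j\<in>{1..2}.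
                tv j * (W (sv j) \<omega> - W (sv (j - 1)) \<omega>) + ev j * (V (sv j) \<omega> - V (sv (j - 1)) \<omega>))) \<partial>M)
         = (\<integral>\<omega>. indicator B \<omega> *
             (\<Prod>j\<in>{1..2}.
                exp (integral {sv (j - 1)..sv j}
                   (\<lambda>u. psi (J u \<omega>) (tv j) + complex_of_real (phi (J u \<omega>)) * (exp (\<i> * complex_of_real (ev j)) - 1)))
                * (\<Prod>tau\<in>trans_times (\<lambda>u. J u \<omega>) (sv (j - 1)) (sv j).
                     char (nu (left_lim (\<lambda>u. J u \<omega>) tau) (J tau \<omega>)) (tv j))) \<partial>M)" (is "?l = ?r")
    unfolding B_def
    by (rule H[THEN spec[of _ 2], THEN spec[of _ sv], THEN spec[of _ tv], THEN spec[of _ ev], THEN spec[of _ m],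
          THEN spec[of _ r], THEN spec[of _ c], THEN mp, OF P, unfolded Let_def])
  moreover have "?l = (\<integral>\<omega>. indicator B \<omega> * iexp (th1 * W s \<omega> + et1 * V s \<omega> + th2 * (W t \<omega> - W s \<omega>) + et2 * (V t \<omega> - V s \<omega>)) \<partial>M)"
    by (intro Bochner_Integration.integral_cong refl arg_cong2[where f="(*)"])
      (unfold i12, simp add: sv_def tv_def ev_def W_0 V_0 algebra_simps)
  moreover have "?r = (\<integral>\<omega>. indicator B \<omega> * (Y th1 0 s \<omega> * exp (of_real (Lam 0 s \<omega>) * (iexp et1 - 1)) * (Y th2 s t \<omega> * exp (of_real (Lam s t \<omega>) * (iexp et2 - 1)))) \<partial>M)"
  proof (intro Bochner_Integration.integral_cong refl arg_cong2[where f="(*)"])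
    fix \<omega> assume w: "\<omega> \<in> space M"
    show "(\<Prod>j\<in>{1..2}.
                exp (integral {sv (j - 1)..sv j}
                   (\<lambda>u. psi (J u \<omega>) (tv j) + complex_of_real (phi (J u \<omega>)) * (exp (\<i> * complex_of_real (ev j)) - 1)))
                * (\<Prod>tau\<in>trans_times (\<lambda>u. J u \<omega>) (sv (j - 1)) (sv j).
                     char (nu (left_lim (\<lambda>u. J u \<omega>) tau) (J tau \<omega>)) (tv j))) =
       Y th1 0 s \<omega> * exp (of_real (Lam 0 s \<omega>) * (iexp et1 - 1)) * (Y th2 s t \<omega> * exp (of_real (Lam s t \<omega>) * (iexp et2 - 1)))"
      unfolding i12 using step[OF w order_refl st(1), of th1 et1] step[OF w st, of th2 et2]
      by (simp add: sv_def tv_def ev_def)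
  qed
  ultimately show ?thesis by simp
qed

end

definition root_avg :: "nat \<Rightarrow> real \<Rightarrow> complex" where
  "root_avg p v = (\<Sum>l<p. iexp (2 * pi * real l / real p * v)) / of_nat p"

lemma root_avg_le: "cmod (root_avg p v) \<le> 1"
proof (cases "p = 0")
  case False
  have "cmod (\<Sum>l<p. iexp (2 * pi * real l / real p * v)) \<le> (\<Sum>l<p. 1)"
    by (rule order_trans[OF norm_sum]) (intro sum_mono, simp)
  then show ?thesis using False by (simp add: root_avg_def norm_divide divide_le_eq)
qed (simp add: root_avg_def)

lemma root_avg_int:
  assumes "v \<noteq> 0" "\<bar>v\<bar> < int p"
  shows "root_avg p (of_int v) = 0"
proof -
  have p: "p > 0" using assms by (cases p) auto
  define w where "w = iexp (2 * pi * of_int v / real p)"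
  have wl: "iexp (2 * pi * real l / real p * of_int v) = w ^ l" for l
  proof -
    have "\<i> * complex_of_real (2 * pi * real l / real p * of_int v) = of_nat l * (\<i> * complex_of_real (2 * pi * of_int v / real p))"
      by simp
    then show ?thesis unfolding w_def by (metis exp_of_nat_mult)
  qed
  have "w \<noteq> 1"
  proof
    assume "w = 1"
    then have "cos (2 * pi * of_int v / real p) = 1" unfolding w_def
      by (simp add: cis_conv_exp[symmetric] complex_eq_iff flip: of_real_mult of_real_divide)
    then obtain n :: int where "2 * pi * of_int v / real p = of_int n * 2 * pi" using cos_one_2pi_int by auto
    then have "real_of_int v = of_int n * real p" using p by (simp add: field_simps)
    then have vn: "v = n * int p" by (metis of_int_eq_iff of_int_mult of_int_of_nat_eq)
    then have "n \<noteq> 0" using assms by auto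
    then have "1 * int p \<le> \<bar>n\<bar> * int p" by (intro mult_right_mono) auto
    then show False using assms vn by (simp add: abs_mult)
  qed
  moreover have "w ^ p = 1"
  proof -
    have "w ^ p = exp (of_nat p * (\<i> * complex_of_real (2 * pi * of_int v / real p)))" unfolding w_def by (simp only: exp_of_nat_mult)
    also have "of_nat p * (\<i> * complex_of_real (2 * pi * of_int v / real p)) = 2 * of_int v * of_real pi * \<i>" using p by simp
    also have "exp \<dots> = 1" using exp_integer_2pi[of "of_int v"] by simp
    finally show ?thesis .
  qed
  ultimately have "(\<Sum>l<p. w ^ l) = 0" by (simp add: sum_gp_strict)
  then show ?thesis unfolding root_avg_def wl by simp
qed

lemma root_avg_limit:
  assumes "v \<in> \<int>"
  shows "(\<lambda>p. root_avg p v) \<longlonglongrightarrow> (if v = 0 then 1 else 0)"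
proof -
  obtain k :: int where v: "v = of_int k" using assms by (auto elim: Ints_cases)
  have "\<forall>\<^sub>F p in sequentially. root_avg p v = (if v = 0 then 1 else 0)"
    using eventually_gt_at_top[of "nat \<bar>k\<bar>"]
  proof eventually_elim
    case (elim p)
    then show ?case using root_avg_int[of k p] v by (auto simp: root_avg_def)
  qed
  then show ?thesis by (rule tendsto_eventually)
qed

lemma root_avg_poisson_limit:
  fixes L :: real
  shows "(\<lambda>p. (\<Sum>l<p. iexp (2 * pi * real l / real p * real k) * exp (of_real L * (iexp (2 * pi * real l / real p) - 1))) / of_nat p)
     \<longlonglongrightarrow> (if k = 0 then exp (- of_real L) else 0)"
proof -
  have eq: "(\<Sum>l<p. iexp (2 * pi * real l / real p * real k) * exp (of_real L * (iexp (2 * pi * real l / real p) - 1))) / of_nat p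
    = exp (- of_real L) * (\<Sum>i. (of_real L ^ i / fact i) * root_avg p (real (k + i)))" for p
  proof -
    define e where "e l = iexp (2 * pi * real l / real p)" for l
    have ev: "iexp (2 * pi * real l / real p * real n) = e l ^ n" for l n
    proof -
      have "\<i> * complex_of_real (2 * pi * real l / real p * real n) = of_nat n * (\<i> * complex_of_real (2 * pi * real l / real p))" by simp
      then show ?thesis unfolding e_def by (metis exp_of_nat_mult)
    qed
    have s: "(\<lambda>i. (of_real L * e l) ^ i / fact i) sums exp (of_real L * e l)" for l
      using exp_converges[of "of_real L * e l"] by (simp add: scaleR_conv_of_real divide_inverse mult.commute)
    have "(\<lambda>i. \<Sum>l<p. e l ^ k * ((of_real L * e l) ^ i / fact i)) sums (\<Sum>l<p. e l ^ k * exp (of_real L * e l))"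
      by (intro sums_sum sums_mult s)
    then have "(\<lambda>i. (\<Sum>l<p. e l ^ k * ((of_real L * e l) ^ i / fact i)) / of_nat p) sums ((\<Sum>l<p. e l ^ k * exp (of_real L * e l)) / of_nat p)"
      by (rule sums_divide)
    moreover have "(\<Sum>l<p. e l ^ k * ((of_real L * e l) ^ i / fact i)) / of_nat p = (of_real L ^ i / fact i) * root_avg p (real (k + i))" for i
      unfolding root_avg_def ev by (simp add: sum_distrib_left sum_divide_distrib power_mult_distrib power_add mult_ac)
    ultimately have "(\<Sum>i. (of_real L ^ i / fact i) * root_avg p (real (k + i))) = (\<Sum>l<p. e l ^ k * exp (of_real L * e l)) / of_nat p"
      by (simp add: sums_iff)
    moreover have "exp (of_real L * (e l - 1)) = exp (- of_real L) * exp (of_real L * e l)" for l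
      by (simp add: algebra_simps flip: exp_add)
    ultimately show ?thesis unfolding ev e_def[symmetric] by (simp add: sum_distrib_left mult_ac)
  qed
  have "(\<lambda>p. \<Sum>i. (of_real L ^ i / fact i) * root_avg p (real (k + i))) \<longlonglongrightarrow> (\<Sum>i. (of_real L ^ i / fact i) * (if real (k + i) = 0 then 1 else 0))"
  proof (rule tannerys_theorem[THEN conjunct2, THEN conjunct2])
    show "((\<lambda>p. (of_real L ^ i / fact i) * root_avg p (real (k + i))) \<longlongrightarrow> (of_real L ^ i / fact i) * (if real (k + i) = 0 then 1 else 0)) sequentially" for i
      by (intro tendsto_mult tendsto_const root_avg_limit) simp
    show "\<forall>\<^sub>F (i, p) in at_top \<times>\<^sub>F sequentially. cmod ((of_real L ^ i / fact i) * root_avg p (real (k + i))) \<le> \<bar>L\<bar> ^ i / fact i"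
    proof (intro always_eventually allI, clarify)
      fix i p
      have "cmod (complex_of_real L ^ i / fact i) * cmod (root_avg p (real (k + i))) \<le> cmod (complex_of_real L ^ i / fact i) * 1"
        by (intro mult_left_mono root_avg_le norm_ge_zero)
      then show "cmod ((of_real L ^ i / fact i) * root_avg p (real (k + i))) \<le> \<bar>L\<bar> ^ i / fact i"
        by (simp add: norm_mult norm_divide norm_power)
    qed
    show "summable (\<lambda>i. \<bar>L\<bar> ^ i / fact i)" using summable_exp[of "\<bar>L\<bar>"] by (simp add: divide_inverse mult.commute)
  qed auto
  moreover have "(\<Sum>i. (complex_of_real L ^ i / fact i) * (if real (k + i) = 0 then 1 else 0)) = (if k = 0 then 1 else 0)"
  proof -
    have "(\<Sum>i. (complex_of_real L ^ i / fact i) * (if real (k + i) = 0 then 1 else 0)) = (\<Sum>i\<in>{0}. (complex_of_real L ^ i / fact i) * (if real (k + i) = 0 then 1 else 0))"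
      by (rule suminf_finite) auto
    then show ?thesis by simp
  qed
  ultimately show ?thesis unfolding eq using tendsto_mult_left[of _ _ sequentially "exp (- complex_of_real L)"]
    by (fastforce split: if_splits)
qed

lemma (in prob_space) extract_integer_atom:
  fixes X L :: "'a \<Rightarrow> real" and U Z :: "'a \<Rightarrow> complex"
  assumes [measurable]: "X \<in> borel_measurable M" "L \<in> borel_measurable M" "U \<in> borel_measurable M" "Z \<in> borel_measurable M"
    and int: "AE \<omega> in M. X \<omega> \<in> \<int>" and U: "\<And>\<omega>. \<omega> \<in> space M \<Longrightarrow> cmod (U \<omega>) \<le> 1" and Z: "\<And>\<omega>. \<omega> \<in> space M \<Longrightarrow> cmod (Z \<omega>) \<le> 1"
    and L: "\<And>\<omega>. \<omega> \<in> space M \<Longrightarrow> L \<omega> \<ge> 0"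
    and eq: "\<And>et. (\<integral>\<omega>. U \<omega> * iexp (et * X \<omega>) \<partial>M) = (\<integral>\<omega>. Z \<omega> * exp (of_real (L \<omega>) * (iexp et - 1)) \<partial>M)"
  shows "(\<integral>\<omega>. U \<omega> * (if X \<omega> = - real k then 1 else 0) \<partial>M) = (\<integral>\<omega>. Z \<omega> * (if k = 0 then exp (- of_real (L \<omega>)) else 0) \<partial>M)"
proof -
  define G where "G p \<omega> = (\<Sum>l<p. iexp (2 * pi * real l / real p * real k) * exp (of_real (L \<omega>) * (iexp (2 * pi * real l / real p) - 1))) / of_nat p" for p \<omega>
  have eL: "cmod (exp (of_real (L \<omega>) * (iexp et - 1))) \<le> 1" if "\<omega> \<in> space M" for \<omega> et
  proof -
    have "Re (of_real (L \<omega>) * (iexp et - 1)) = L \<omega> * (cos et - 1)"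
      by (simp add: cis_conv_exp[symmetric])
    also have "\<dots> \<le> 0" using L[OF that] by (intro mult_nonneg_nonpos) auto
    finally show ?thesis by simp
  qed
  have Gle: "cmod (G p \<omega>) \<le> 1" if w: "\<omega> \<in> space M" for p \<omega>
  proof (cases "p = 0")
    case False
    have "cmod (\<Sum>l<p. iexp (2 * pi * real l / real p * real k) * exp (of_real (L \<omega>) * (iexp (2 * pi * real l / real p) - 1))) \<le> (\<Sum>l<p. 1)"
      by (rule order_trans[OF norm_sum], intro sum_mono) (use eL[OF w] in \<open>simp only: norm_mult norm_exp_i_times mult_1\<close>)
    then show ?thesis using False by (simp add: G_def norm_divide divide_le_eq)
  qed (simp add: G_def)
  have avg: "(\<integral>\<omega>. U \<omega> * root_avg p (X \<omega> + real k) \<partial>M) = (\<integral>\<omega>. Z \<omega> * G p \<omega> \<partial>M)" for p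
  proof -
    define e where "e l = 2 * pi * real l / real p" for l
    have iU: "integrable M (\<lambda>\<omega>. U \<omega> * iexp (e l * X \<omega>))" for l
      by (rule integrable_const_bound[where B=1]) (use U in \<open>auto simp: norm_mult\<close>)
    have iZ: "integrable M (\<lambda>\<omega>. Z \<omega> * exp (of_real (L \<omega>) * (iexp (e l) - 1)))" for l
    proof (rule integrable_const_bound[where B=1])
      show "AE \<omega> in M. cmod (Z \<omega> * exp (of_real (L \<omega>) * (iexp (e l) - 1))) \<le> 1"
        unfolding norm_mult by (intro AE_I2 mult_le_one Z eL norm_ge_zero)
    qed measurable
    have "(\<integral>\<omega>. U \<omega> * root_avg p (X \<omega> + real k) \<partial>M) = (\<integral>\<omega>. (\<Sum>l<p. iexp (e l * real k) * (U \<omega> * iexp (e l * X \<omega>))) / of_nat p \<partial>M)"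
    proof (intro Bochner_Integration.integral_cong refl)
      fix \<omega>
      have ex: "iexp (a * (X \<omega> + real k)) = iexp (a * real k) * iexp (a * X \<omega>)" for a
        by (simp add: algebra_simps flip: exp_add)
      show "U \<omega> * root_avg p (X \<omega> + real k) = (\<Sum>l<p. iexp (e l * real k) * (U \<omega> * iexp (e l * X \<omega>))) / of_nat p"
        unfolding root_avg_def e_def[symmetric] ex times_divide_eq_right sum_distrib_left by (simp only: mult_ac)
    qed
    also have "\<dots> = (\<Sum>l<p. iexp (e l * real k) * (\<integral>\<omega>. U \<omega> * iexp (e l * X \<omega>) \<partial>M)) / of_nat p"
      using iU by (simp del: of_real_mult)
    also have "\<dots> = (\<Sum>l<p. iexp (e l * real k) * (\<integral>\<omega>. Z \<omega> * exp (of_real (L \<omega>) * (iexp (e l) - 1)) \<partial>M)) / of_nat p"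
      unfolding eq ..
    also have "\<dots> = (\<integral>\<omega>. (\<Sum>l<p. iexp (e l * real k) * (Z \<omega> * exp (of_real (L \<omega>) * (iexp (e l) - 1)))) / of_nat p \<partial>M)"
      using iZ by (simp del: of_real_mult)
    also have "\<dots> = (\<integral>\<omega>. Z \<omega> * G p \<omega> \<partial>M)"
      by (intro Bochner_Integration.integral_cong refl) (unfold G_def e_def[symmetric] times_divide_eq_right sum_distrib_left, simp only: mult_ac)
    finally show ?thesis .
  qed
  have [measurable]: "(\<lambda>\<omega>. root_avg p (X \<omega> + real k)) \<in> borel_measurable M" "G p \<in> borel_measurable M" for p
    unfolding root_avg_def G_def by measurable
  have l1: "(\<lambda>p. \<integral>\<omega>. U \<omega> * root_avg p (X \<omega> + real k) \<partial>M) \<longlonglongrightarrow> (\<integral>\<omega>. U \<omega> * (if X \<omega> = - real k then 1 else 0) \<partial>M)"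
  proof (rule integral_dominated_convergence[where w="\<lambda>_. 1"])
    show "AE \<omega> in M. (\<lambda>p. U \<omega> * root_avg p (X \<omega> + real k)) \<longlonglongrightarrow> U \<omega> * (if X \<omega> = - real k then 1 else 0)"
      using int
    proof eventually_elim
      case (elim \<omega>)
      have "(\<lambda>p. root_avg p (X \<omega> + real k)) \<longlonglongrightarrow> (if X \<omega> + real k = 0 then 1 else 0)"
        using elim by (intro root_avg_limit) auto
      then show ?case by (intro tendsto_mult tendsto_const) (simp add: add_eq_0_iff2)
    qed
    show "AE \<omega> in M. cmod (U \<omega> * root_avg p (X \<omega> + real k)) \<le> 1" for p
      unfolding norm_mult by (intro AE_I2 mult_le_one U root_avg_le norm_ge_zero)
  qed simp_all
  have l2: "(\<lambda>p. \<integral>\<omega>. Z \<omega> * G p \<omega> \<partial>M) \<longlonglongrightarrow> (\<integral>\<omega>. Z \<omega> * (if k = 0 then exp (- of_real (L \<omega>)) else 0) \<partial>M)"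
  proof (rule integral_dominated_convergence[where w="\<lambda>_. 1"])
    show "AE \<omega> in M. (\<lambda>p. Z \<omega> * G p \<omega>) \<longlonglongrightarrow> Z \<omega> * (if k = 0 then exp (- of_real (L \<omega>)) else 0)"
      unfolding G_def by (intro AE_I2 tendsto_mult tendsto_const root_avg_poisson_limit)
    show "AE \<omega> in M. cmod (Z \<omega> * G p \<omega>) \<le> 1" for p
      unfolding norm_mult by (intro AE_I2 mult_le_one Z Gle norm_ge_zero)
  qed simp_all
  show ?thesis using LIMSEQ_unique l1 l2 unfolding avg by blast
qed

context mm_process
begin

lemma Y_zero: "\<omega> \<in> space M \<Longrightarrow> 0 \<le> s \<Longrightarrow> s \<le> t \<Longrightarrow> Y 0 s t \<omega> = 1"
proof -
  assume w: "\<omega> \<in> space M" and st: "0 \<le> s" "s \<le> t"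
  have "integral {s..t} (\<lambda>u. psi (J u \<omega>) 0) = integral {s..t} (\<lambda>u. 0)"
    using st by (intro integral_cong psi_0 J_less w) auto
  moreover have "(\<Prod>tau\<in>trans_times (\<lambda>u. J u \<omega>) s t. chi 0 (left_lim (\<lambda>u. J u \<omega>) tau) (J tau \<omega>)) = 1"
  proof (rule prod.neutral, rule ballI)
    fix tau assume "tau \<in> trans_times (\<lambda>u. J u \<omega>) s t"
    then have "tau > 0" using trans_timesD st by fastforce
    then show "chi 0 (left_lim (\<lambda>u. J u \<omega>) tau) (J tau \<omega>) = 1"
      by (intro chi_0 left_lim_less[where j="\<lambda>u. J u \<omega>" and q="\<lambda>n. psi n 0" and Q="Qmax 0" and phi=phi and P=Pmax and a="chi 0"]
          J_cadlag J_less Re_psi Qmax phi_nonneg Pmax chi_le chi_refl w) simp_all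
  qed
  ultimately show ?thesis by (simp add: Y_def path_char_def)
qed

lemma cond_formula_all:
  assumes st: "0 \<le> s" "s \<le> t"
  shows "(\<integral>\<omega>. iexp (th1 * W s \<omega> + et1 * V s \<omega> + th2 * (W t \<omega> - W s \<omega>) + et2 * (V t \<omega> - V s \<omega>)) \<partial>M)
    = (\<integral>\<omega>. Y th1 0 s \<omega> * exp (of_real (Lam 0 s \<omega>) * (iexp et1 - 1)) * (Y th2 s t \<omega> * exp (of_real (Lam s t \<omega>) * (iexp et2 - 1))) \<partial>M)"
proof -
  have i: "indicator {\<omega>\<in>space M. \<forall>l<0::nat. J ((\<lambda>_. 0) l) \<omega> = (\<lambda>_. 0) l} \<omega> = (1 :: complex)" if "\<omega> \<in> space M" for \<omega>
    using that by simp
  have "(\<integral>\<omega>. iexp (th1 * W s \<omega> + et1 * V s \<omega> + th2 * (W t \<omega> - W s \<omega>) + et2 * (V t \<omega> - V s \<omega>)) \<partial>M)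
    = (\<integral>\<omega>. indicator {\<omega>\<in>space M. \<forall>l<0::nat. J ((\<lambda>_. 0) l) \<omega> = (\<lambda>_. 0) l} \<omega> * iexp (th1 * W s \<omega> + et1 * V s \<omega> + th2 * (W t \<omega> - W s \<omega>) + et2 * (V t \<omega> - V s \<omega>)) \<partial>M)"
    by (intro Bochner_Integration.integral_cong refl) (simp only: i mult_1)
  also have "\<dots> = (\<integral>\<omega>. indicator {\<omega>\<in>space M. \<forall>l<0::nat. J ((\<lambda>_. 0) l) \<omega> = (\<lambda>_. 0) l} \<omega> * (Y th1 0 s \<omega> * exp (of_real (Lam 0 s \<omega>) * (iexp et1 - 1)) * (Y th2 s t \<omega> * exp (of_real (Lam s t \<omega>) * (iexp et2 - 1)))) \<partial>M)"
    by (rule cond_formula[OF st]) simp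
  also have "\<dots> = (\<integral>\<omega>. Y th1 0 s \<omega> * exp (of_real (Lam 0 s \<omega>) * (iexp et1 - 1)) * (Y th2 s t \<omega> * exp (of_real (Lam s t \<omega>) * (iexp et2 - 1))) \<partial>M)"
    by (intro Bochner_Integration.integral_cong refl) (simp only: i mult_1)
  finally show ?thesis .
qed

lemma V_increment_char:
  assumes st: "0 \<le> s" "s \<le> t"
  shows "(\<integral>\<omega>. 1 * iexp (et * (V t \<omega> - V s \<omega>)) \<partial>M) = (\<integral>\<omega>. 1 * exp (of_real (Lam s t \<omega>) * (iexp et - 1)) \<partial>M)"
proof -
  have "(\<integral>\<omega>. 1 * iexp (et * (V t \<omega> - V s \<omega>)) \<partial>M) = (\<integral>\<omega>. iexp (0 * W s \<omega> + 0 * V s \<omega> + 0 * (W t \<omega> - W s \<omega>) + et * (V t \<omega> - V s \<omega>)) \<partial>M)"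
    by (intro Bochner_Integration.integral_cong refl) simp
  also have "\<dots> = (\<integral>\<omega>. (Y 0 0 s \<omega> * exp (of_real (Lam 0 s \<omega>) * (iexp 0 - 1)) * (Y 0 s t \<omega> * exp (of_real (Lam s t \<omega>) * (iexp et - 1)))) \<partial>M)"
    by (rule cond_formula_all[OF st])
  also have "\<dots> = (\<integral>\<omega>. 1 * exp (of_real (Lam s t \<omega>) * (iexp et - 1)) \<partial>M)"
    using st by (intro Bochner_Integration.integral_cong refl) (simp add: Y_zero)
  finally show ?thesis .
qed

lemma V_increment_int:
  assumes st: "0 \<le> s" "s \<le> t"
  shows "AE \<omega> in M. V t \<omega> - V s \<omega> \<in> \<int>"
proof -
  define X where "X \<omega> = V t \<omega> - V s \<omega>" for \<omega>
  have [measurable]: "X \<in> borel_measurable M" unfolding X_def by measurable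
  have e1: "iexp (2 * pi) = 1" using exp_integer_2pi[of 1] by (simp add: mult_ac)
  have "(\<integral>\<omega>. iexp (2 * pi * X \<omega>) \<partial>M) = 1"
    using V_increment_char[OF st, of "2 * pi"] unfolding e1 X_def using prob_space by simp
  moreover have i: "integrable M (\<lambda>\<omega>. iexp (2 * pi * X \<omega>))" by (rule integrable_const_bound[where B=1]) auto
  ultimately have "(\<integral>\<omega>. Re (iexp (2 * pi * X \<omega>)) \<partial>M) = 1" by simp
  moreover have Re: "Re (iexp x) = cos x" for x by (simp add: cis_conv_exp[symmetric])
  ultimately have c: "(\<integral>\<omega>. cos (2 * pi * X \<omega>) \<partial>M) = 1" by (simp only: Re)
  have ic: "integrable M (\<lambda>\<omega>. cos (2 * pi * X \<omega>))" by (rule integrable_const_bound[where B=1]) auto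
  have "(\<integral>\<omega>. 1 - cos (2 * pi * X \<omega>) \<partial>M) = 0" using c ic prob_space by simp
  then have "AE \<omega> in M. 1 - cos (2 * pi * X \<omega>) = 0"
    using ic by (subst (asm) integral_nonneg_eq_0_iff_AE) auto
  then show ?thesis
  proof eventually_elim
    case (elim \<omega>)
    then obtain n :: int where "2 * pi * X \<omega> = of_int n * 2 * pi" using cos_one_2pi_int[of "2 * pi * X \<omega>"] by auto
    then have "X \<omega> = of_int n" by simp
    then show ?case unfolding X_def[symmetric] by simp
  qed
qed

lemma V_increment_nonneg:
  assumes st: "0 \<le> s" "s \<le> t"
  shows "AE \<omega> in M. V t \<omega> - V s \<omega> \<ge> 0"
proof -
  define X where "X \<omega> = V t \<omega> - V s \<omega>" for \<omega>
  have [measurable]: "X \<in> borel_measurable M" unfolding X_def by measurable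
  have Lm: "Lam s t \<in> borel_measurable M" using st by (rule Lam_meas)
  have "AE \<omega> in M. X \<omega> \<noteq> - real (Suc k)" for k
  proof -
    have "(\<integral>\<omega>. 1 * (if X \<omega> = - real (Suc k) then 1 else 0) \<partial>M) = (\<integral>\<omega>. 1 * (if Suc k = 0 then exp (- complex_of_real (Lam s t \<omega>)) else 0) \<partial>M)"
      using V_increment_int[OF st] V_increment_char[OF st] Lam_nonneg[OF _ st] Lm
      by (intro extract_integer_atom[where L="Lam s t"]) (auto simp: X_def)
    then have "(\<integral>\<omega>. (if X \<omega> = - real (Suc k) then 1 else 0 :: complex) \<partial>M) = 0" by simp
    moreover have "(\<lambda>\<omega>. if X \<omega> = - real (Suc k) then 1 else 0 :: complex) = (\<lambda>\<omega>. of_real (if X \<omega> = - real (Suc k) then 1 else 0))" by auto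
    ultimately have z: "(\<integral>\<omega>. (if X \<omega> = - real (Suc k) then 1 else 0 :: real) \<partial>M) = 0" by (simp only: integral_complex_of_real of_real_eq_0_iff)
    have "integrable M (\<lambda>\<omega>. if X \<omega> = - real (Suc k) then 1 else 0 :: real)" by (rule integrable_const_bound[where B=1]) auto
    then have "AE \<omega> in M. (if X \<omega> = - real (Suc k) then 1 else 0 :: real) = 0"
      using z by (subst (asm) integral_nonneg_eq_0_iff_AE) auto
    then show ?thesis by eventually_elim (auto split: if_splits)
  qed
  then have "AE \<omega> in M. \<forall>k. X \<omega> \<noteq> - real (Suc k)" by (simp add: AE_all_countable)
  then show ?thesis using V_increment_int[OF st]
  proof eventually_elim
    case (elim \<omega>)
    then obtain n :: int where n: "X \<omega> = of_int n" by (auto simp: X_def elim: Ints_cases)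
    have "n \<ge> 0"
    proof (rule ccontr)
      assume "\<not> n \<ge> 0"
      then have "X \<omega> = - real (Suc (nat (- n) - 1))" using n by simp
      then show False using elim(1) by blast
    qed
    then show ?case using n by (simp add: X_def)
  qed
qed

lemma survival_char:
  assumes st: "0 \<le> s" "s \<le> t"
  shows "(\<integral>\<omega>. iexp (th * W t \<omega>) * (if V s \<omega> = 0 then 1 else 0) \<partial>M) = (\<integral>\<omega>. Y th 0 t \<omega> * of_real (D 0 s \<omega>) \<partial>M)"
proof -
  have t0: "0 \<le> t" using st by simp
  have [measurable]: "Y th 0 t \<in> borel_measurable M" using t0 by (intro Y_meas) auto
  have [measurable]: "Lam 0 s \<in> borel_measurable M" using st by (intro Lam_meas) auto
  have eq: "(\<integral>\<omega>. iexp (th * W t \<omega>) * iexp (et * V s \<omega>) \<partial>M) = (\<integral>\<omega>. Y th 0 t \<omega> * exp (of_real (Lam 0 s \<omega>) * (iexp et - 1)) \<partial>M)" for et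
  proof -
    have "(\<integral>\<omega>. iexp (th * W t \<omega>) * iexp (et * V s \<omega>) \<partial>M) = (\<integral>\<omega>. iexp (th * W s \<omega> + et * V s \<omega> + th * (W t \<omega> - W s \<omega>) + 0 * (V t \<omega> - V s \<omega>)) \<partial>M)"
      by (intro Bochner_Integration.integral_cong refl) (simp add: algebra_simps flip: exp_add)
    also have "\<dots> = (\<integral>\<omega>. (Y th 0 s \<omega> * exp (of_real (Lam 0 s \<omega>) * (iexp et - 1)) * (Y th s t \<omega> * exp (of_real (Lam s t \<omega>) * (iexp 0 - 1)))) \<partial>M)"
      by (rule cond_formula_all[OF st])
    also have "\<dots> = (\<integral>\<omega>. Y th 0 t \<omega> * exp (of_real (Lam 0 s \<omega>) * (iexp et - 1)) \<partial>M)"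
      using st path_char_split[OF J_cadlag _ st] by (intro Bochner_Integration.integral_cong refl) (simp add: Y_def mult_ac)
    finally show ?thesis .
  qed
  have "AE \<omega> in M. V s \<omega> \<in> \<int>" using V_increment_int[OF order_refl st(1)] AE_space by eventually_elim (simp add: V_0)
  from extract_integer_atom[where k=0 and L="Lam 0 s" and X="V s" and U="\<lambda>\<omega>. iexp (th * W t \<omega>)" and Z="Y th 0 t", OF _ _ _ _ this _ _ _ eq]
  have "(\<integral>\<omega>. iexp (th * W t \<omega>) * (if V s \<omega> = - real 0 then 1 else 0) \<partial>M) = (\<integral>\<omega>. Y th 0 t \<omega> * (if (0::nat) = 0 then exp (- of_real (Lam 0 s \<omega>)) else 0) \<partial>M)"
    using Y_le[OF _ order_refl t0] Lam_nonneg[OF _ order_refl st(1)] by simp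
  then show ?thesis by (simp add: D_Lam exp_of_real[symmetric] del: exp_of_real)
qed

end

primrec conv_pow :: "real measure \<Rightarrow> nat \<Rightarrow> real measure" where
  "conv_pow R 0 = return borel 0"
| "conv_pow R (Suc k) = (R \<star> conv_pow R k)"

lemma conv_pow_props:
  assumes R: "real_distribution R"
  shows "real_distribution (conv_pow R k)" "char (conv_pow R k) t = char R t ^ k"
    "(\<integral>\<^sup>+x. ennreal (exp (s * x)) \<partial>conv_pow R k) = (\<integral>\<^sup>+x. ennreal (exp (s * x)) \<partial>R) ^ k"
proof -
  interpret R: real_distribution R by fact
  show d: "real_distribution (conv_pow R k)" for k
    by (induction k) (auto intro!: real_distributionI[OF prob_space_return] real_distribution_convolution R)
  show "char (conv_pow R k) t = char R t ^ k"
    by (induction k) (auto simp: char_def[of "return borel 0"] integral_return char_convolution[OF R d])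
  show "(\<integral>\<^sup>+x. ennreal (exp (s * x)) \<partial>conv_pow R k) = (\<integral>\<^sup>+x. ennreal (exp (s * x)) \<partial>R) ^ k"
  proof (induction k)
    case 0 show ?case by (simp add: nn_integral_return)
  next
    case (Suc k)
    interpret C: real_distribution "conv_pow R k" by (rule d)
    have "(\<integral>\<^sup>+x. ennreal (exp (s * x)) \<partial>conv_pow R (Suc k)) = (\<integral>\<^sup>+x. \<integral>\<^sup>+y. ennreal (exp (s * (x + y))) \<partial>conv_pow R k \<partial>R)"
      unfolding conv_pow.simps by (rule nn_integral_convolution) (auto simp: R.finite_measure_axioms C.finite_measure_axioms)
    also have "\<dots> = (\<integral>\<^sup>+x. ennreal (exp (s * x)) * (\<integral>\<^sup>+y. ennreal (exp (s * y)) \<partial>conv_pow R k) \<partial>R)"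
      by (intro nn_integral_cong) (simp add: distrib_left exp_add ennreal_mult nn_integral_cmult)
    also have "\<dots> = (\<integral>\<^sup>+x. ennreal (exp (s * x)) \<partial>R) * (\<integral>\<^sup>+y. ennreal (exp (s * y)) \<partial>conv_pow R k)"
      by (rule nn_integral_multc) simp
    finally show ?case using Suc by simp
  qed
qed

lemma root_mgf:
  assumes R: "real_distribution R" and Q: "real_distribution Q" and m: "m > 0"
    and ch: "\<And>t. char R t ^ m = char Q t" and int: "integrable Q (\<lambda>x. exp (s * x))"
  shows "integrable R (\<lambda>x. exp (s * x))" "mgf R s = exp (1 / real m * ln (mgf Q s))"
proof -
  interpret R: real_distribution R by fact
  have "conv_pow R m = Q"
    by (rule Levy_uniqueness[OF conv_pow_props(1)[OF R] Q]) (auto simp: conv_pow_props(2)[OF R] ch)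
  then have "(\<integral>\<^sup>+x. ennreal (exp (s * x)) \<partial>R) ^ m = (\<integral>\<^sup>+x. ennreal (exp (s * x)) \<partial>Q)"
    using conv_pow_props(3)[OF R, where s=s and k=m] by simp
  also have "\<dots> = ennreal (mgf Q s)" unfolding mgf_def by (rule nn_integral_eq_integral[OF int]) simp
  finally have eq: "(\<integral>\<^sup>+x. ennreal (exp (s * x)) \<partial>R) ^ m = ennreal (mgf Q s)" .
  have "(\<integral>\<^sup>+x. ennreal (exp (s * x)) \<partial>R) ^ m \<noteq> \<top>" unfolding eq by simp
  then have "(\<integral>\<^sup>+x. ennreal (exp (s * x)) \<partial>R) \<noteq> \<top>" using m power_eq_top_ennreal by fastforce
  then have "(\<integral>\<^sup>+x. ennreal (exp (s * x)) \<partial>R) < \<infinity>" by (simp add: top.not_eq_extremum)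
  then show i: "integrable R (\<lambda>x. exp (s * x))" by (intro integrableI_bounded) auto
  have "(\<integral>\<^sup>+x. ennreal (exp (s * x)) \<partial>R) = ennreal (mgf R s)" unfolding mgf_def by (rule nn_integral_eq_integral[OF i]) simp
  then have "ennreal (mgf R s ^ m) = ennreal (mgf Q s)" using eq R.mgf_pos[OF i] by (simp add: ennreal_power)
  then have "mgf R s ^ m = mgf Q s" using R.mgf_pos[OF i] real_distribution.mgf_pos[OF Q int]
    by (subst (asm) ennreal_inj) auto
  then have "ln (mgf Q s) = real m * ln (mgf R s)" using R.mgf_pos[OF i] ln_realpow by metis
  then show "mgf R s = exp (1 / real m * ln (mgf Q s))" using R.mgf_pos[OF i] m by simp
qed

context mm_process
begin

definition cyl :: "real \<Rightarrow> nat \<Rightarrow> (nat \<Rightarrow> nat) \<Rightarrow> 'a set" where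
  "cyl h i c = {\<omega>\<in>space M. \<forall>l\<le>i. J (real l * h) \<omega> = c l}"

lemma J_eq_sets: "{\<omega>\<in>space M. J t \<omega> = n} \<in> sets M"
proof -
  have "J t -` {n} \<inter> space M \<in> sets M" by (rule measurable_sets[OF J_meas]) simp
  also have "J t -` {n} \<inter> space M = {\<omega>\<in>space M. J t \<omega> = n}" by auto
  finally show ?thesis .
qed

lemma J_path_sets: "{\<omega>\<in>space M. \<forall>l\<le>(i::nat). J (t l) \<omega> = c l} \<in> sets M"
proof -
  have "{\<omega>\<in>space M. \<forall>l\<in>{..i}. J (t l) \<omega> = c l} \<in> sets M"
    by (intro sets.sets_Collect_finite_All J_eq_sets) auto
  then show ?thesis by simp
qed

lemma cyl_sets[measurable]: "cyl h i c \<in> sets M"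
  unfolding cyl_def by (rule J_path_sets)

lemma cyl_mono: "cyl h (Suc i) (c(Suc i := n)) \<subseteq> cyl h i c"
proof
  fix \<omega> assume a: "\<omega> \<in> cyl h (Suc i) (c(Suc i := n))"
  have "J (real l * h) \<omega> = c l" if "l \<le> i" for l
  proof -
    have "J (real l * h) \<omega> = (c(Suc i := n)) l" using a le_SucI[OF that] unfolding cyl_def by blast
    then show ?thesis using that by simp
  qed
  then show "\<omega> \<in> cyl h i c" using a unfolding cyl_def by blast
qed

lemma cyl_measure:
  assumes "h \<ge> 0" "\<And>l. l \<le> i \<Longrightarrow> c l < N"
  shows "measure M (cyl h i c) = varpi (c 0) * (\<Prod>j\<in>{1..i}. mat_exp h Gen $$ (c (j - 1), c j))"
proof -
  have "measure M (cyl h i c) = varpi (c 0) * (\<Prod>j\<in>{1..i}. mat_exp (real j * h - real (j - 1) * h) Gen $$ (c (j - 1), c j))"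
    unfolding cyl_def using assms by (intro cylinder[where t="\<lambda>l. real l * h"]) (auto simp: mult_right_mono)
  also have "(\<Prod>j\<in>{1..i}. mat_exp (real j * h - real (j - 1) * h) Gen $$ (c (j - 1), c j)) = (\<Prod>j\<in>{1..i}. mat_exp h Gen $$ (c (j - 1), c j))"
  proof (rule prod.cong[OF refl])
    fix j assume "j \<in> {1..i}"
    then have "real j * h - real (j - 1) * h = h" by (simp add: of_nat_diff algebra_simps)
    then show "mat_exp (real j * h - real (j - 1) * h) Gen $$ (c (j - 1), c j) = mat_exp h Gen $$ (c (j - 1), c j)" by simp
  qed
  finally show ?thesis .
qed

lemma cyl_measure_Suc:
  assumes "h \<ge> 0" "\<And>l. l \<le> i \<Longrightarrow> c l < N" "n < N"
  shows "measure M (cyl h (Suc i) (c(Suc i := n))) = measure M (cyl h i c) * mat_exp h Gen $$ (c i, n)"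
proof -
  have "measure M (cyl h (Suc i) (c(Suc i := n))) = varpi (c 0) * (\<Prod>j\<in>{1..Suc i}. mat_exp h Gen $$ ((c(Suc i := n)) (j - 1), (c(Suc i := n)) j))"
    using assms by (subst cyl_measure) auto
  also have "(\<Prod>j\<in>{1..Suc i}. mat_exp h Gen $$ ((c(Suc i := n)) (j - 1), (c(Suc i := n)) j)) =
     (\<Prod>j\<in>{1..i}. mat_exp h Gen $$ ((c(Suc i := n)) (j - 1), (c(Suc i := n)) j)) * mat_exp h Gen $$ (c i, n)" by simp
  also have "(\<Prod>j\<in>{1..i}. mat_exp h Gen $$ ((c(Suc i := n)) (j - 1), (c(Suc i := n)) j)) = (\<Prod>j\<in>{1..i}. mat_exp h Gen $$ (c (j - 1), c j))"
    by (rule prod.cong) auto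
  finally have e: "measure M (cyl h (Suc i) (c(Suc i := n))) = varpi (c 0) * ((\<Prod>j\<in>{1..i}. mat_exp h Gen $$ (c (j - 1), c j)) * mat_exp h Gen $$ (c i, n))" .
  have m: "measure M (cyl h i c) = varpi (c 0) * (\<Prod>j\<in>{1..i}. mat_exp h Gen $$ (c (j - 1), c j))"
    by (rule cyl_measure) (use assms in auto)
  show ?thesis unfolding e m mult.assoc ..
qed

primrec euler_expect :: "real \<Rightarrow> (nat \<Rightarrow> nat \<Rightarrow> complex) \<Rightarrow> (nat \<Rightarrow> real) \<Rightarrow> nat \<Rightarrow> nat \<Rightarrow> complex" where
  "euler_expect h F p 0 = (\<lambda>n. 1)"
| "euler_expect h F p (Suc k) = (\<lambda>n. of_real (p n) + (\<Sum>n'<N. of_real (mat_exp h Gen $$ (n,n')) * F n n' * euler_expect h F p k n'))"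

lemma markov_grid_euler:
  fixes F :: "nat \<Rightarrow> nat \<Rightarrow> complex" and p :: "nat \<Rightarrow> real"
  assumes h: "h \<ge> 0" and F: "\<And>n n'. n < N \<Longrightarrow> n' < N \<Longrightarrow> cmod (F n n') \<le> 1"
    and c: "\<And>l. l \<le> i \<Longrightarrow> c l < N"
  shows "(\<integral>\<omega>. indicator (cyl h i c) \<omega> * grid_euler (\<lambda>l. F (J (real l * h) \<omega>) (J (real l * h + h) \<omega>)) (\<lambda>l. p (J (real l * h) \<omega>)) i k \<partial>M)
    = of_real (measure M (cyl h i c)) * euler_expect h F p k (c i)"
proof -
  define E where "E i k \<omega> = grid_euler (\<lambda>l. F (J (real l * h) \<omega>) (J (real l * h + h) \<omega>)) (\<lambda>l. p (J (real l * h) \<omega>)) i k" for i k \<omega>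
  have E_meas[measurable]: "E i k \<in> borel_measurable M" for i k
    unfolding E_def
  proof (induction k arbitrary: i)
    case (Suc k)
    note [measurable] = Suc
    show ?case unfolding grid_euler.simps by measurable
  qed simp
  define P where "P = (\<Sum>n<N. \<bar>p n\<bar>)"
  have P: "\<bar>p n\<bar> \<le> P" if "n < N" for n unfolding P_def using that by (intro member_le_sum) auto
  have E_bound: "cmod (E i k \<omega>) \<le> 1 + real k * P" if w: "\<omega> \<in> space M" for i k \<omega>
    unfolding E_def
  proof (induction k arbitrary: i)
    case (Suc k)
    have "cmod (F (J (real i * h) \<omega>) (J (real i * h + h) \<omega>)) \<le> 1" using h w by (intro F J_less) auto
    then have "cmod (F (J (real i * h) \<omega>) (J (real i * h + h) \<omega>) * grid_euler (\<lambda>l. F (J (real l * h) \<omega>) (J (real l * h + h) \<omega>)) (\<lambda>l. p (J (real l * h) \<omega>)) (Suc i) k) \<le> 1 * (1 + real k * P)"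
      unfolding norm_mult using Suc[of "Suc i"] by (intro mult_mono) auto
    moreover have "\<bar>p (J (real i * h) \<omega>)\<bar> \<le> P" using h w by (intro P J_less) auto
    ultimately have "cmod (grid_euler (\<lambda>l. F (J (real l * h) \<omega>) (J (real l * h + h) \<omega>)) (\<lambda>l. p (J (real l * h) \<omega>)) i (Suc k)) \<le> P + (1 + real k * P)"
      unfolding grid_euler.simps by (intro order_trans[OF norm_triangle_ineq] add_mono) auto
    then show ?case by (simp add: algebra_simps)
  qed simp
  have intE: "integrable M (\<lambda>\<omega>. indicator (cyl h i' c') \<omega> * E i k \<omega>)" for i' c' i k
  proof (rule integrable_const_bound[where B="1 + real k * P"])
    have "P \<ge> 0" unfolding P_def by (intro sum_nonneg) auto
    then show "AE \<omega> in M. cmod (indicator (cyl h i' c') \<omega> * E i k \<omega>) \<le> 1 + real k * P"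
      using E_bound by (intro AE_I2) (auto simp: indicator_def)
  qed measurable
  have intI: "integrable M (indicator (cyl h i' c') :: _ \<Rightarrow> complex)" for i' c'
    by (rule integrable_const_bound[where B=1]) (auto split: split_indicator)
  have "(\<integral>\<omega>. indicator (cyl h i c) \<omega> * E i k \<omega> \<partial>M) = of_real (measure M (cyl h i c)) * euler_expect h F p k (c i)"
    using c
  proof (induction k arbitrary: i c)
    case 0
    have "(\<integral>\<omega>. indicator (cyl h i c) \<omega> * E i 0 \<omega> \<partial>M) = (\<integral>\<omega>. indicator (cyl h i c) \<omega> *\<^sub>R 1 \<partial>M)"
      by (intro Bochner_Integration.integral_cong refl) (simp add: E_def indicator_def)
    also have "\<dots> = of_real (measure M (cyl h i c))" by (simp add: scaleR_conv_of_real sets.Int_space_eq2[OF cyl_sets])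
    finally show ?case by simp
  next
    case (Suc k)
    have split: "indicator (cyl h i c) \<omega> * E i (Suc k) \<omega> = of_real (p (c i)) * indicator (cyl h i c) \<omega>
        + (\<Sum>n<N. F (c i) n * (indicator (cyl h (Suc i) (c(Suc i := n))) \<omega> * E (Suc i) k \<omega>))" if w: "\<omega> \<in> space M" for \<omega>
    proof (cases "\<omega> \<in> cyl h i c")
      case True
      then have Ji: "J (real i * h) \<omega> = c i" by (auto simp: cyl_def)
      have t: "real (Suc i) * h = real i * h + h" by (simp add: algebra_simps)
      have ind: "indicator (cyl h (Suc i) (c(Suc i := n))) \<omega> = (if n = J (real i * h + h) \<omega> then 1 else 0 :: complex)" for n
        using True w t by (auto simp: cyl_def indicator_def le_Suc_eq)
      have "(\<Sum>n<N. F (c i) n * (indicator (cyl h (Suc i) (c(Suc i := n))) \<omega> * E (Suc i) k \<omega>))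
        = (\<Sum>n<N. if n = J (real i * h + h) \<omega> then F (c i) (J (real i * h + h) \<omega>) * E (Suc i) k \<omega> else 0)"
        unfolding ind by (intro sum.cong) auto
      also have "\<dots> = F (c i) (J (real i * h + h) \<omega>) * E (Suc i) k \<omega>"
        using J_less[OF w, of "real i * h + h"] h by (simp add: sum.delta)
      finally show ?thesis using True by (simp add: E_def Ji)
    next
      case False
      then have "\<omega> \<notin> cyl h (Suc i) (c(Suc i := n))" for n using cyl_mono by blast
      then show ?thesis using False by simp
    qed
    have "(\<integral>\<omega>. indicator (cyl h i c) \<omega> * E i (Suc k) \<omega> \<partial>M) = (\<integral>\<omega>. of_real (p (c i)) * indicator (cyl h i c) \<omega>
        + (\<Sum>n<N. F (c i) n * (indicator (cyl h (Suc i) (c(Suc i := n))) \<omega> * E (Suc i) k \<omega>)) \<partial>M)"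
      by (intro Bochner_Integration.integral_cong refl split)
    also have "\<dots> = of_real (p (c i)) * (\<integral>\<omega>. indicator (cyl h i c) \<omega> \<partial>M)
        + (\<Sum>n<N. F (c i) n * (\<integral>\<omega>. indicator (cyl h (Suc i) (c(Suc i := n))) \<omega> * E (Suc i) k \<omega> \<partial>M))"
      using intE intI by (subst Bochner_Integration.integral_add) auto
    also have "(\<integral>\<omega>. indicator (cyl h i c) \<omega> \<partial>M) = complex_of_real (measure M (cyl h i c))"
    proof -
      have "(\<integral>\<omega>. indicator (cyl h i c) \<omega> \<partial>M) = (\<integral>\<omega>. indicator (cyl h i c) \<omega> *\<^sub>R (1::complex) \<partial>M)"
        by (intro Bochner_Integration.integral_cong refl) (simp add: indicator_def)
      then show ?thesis by (simp add: scaleR_conv_of_real sets.Int_space_eq2[OF cyl_sets])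
    qed
    also have "(\<Sum>n<N. F (c i) n * (\<integral>\<omega>. indicator (cyl h (Suc i) (c(Suc i := n))) \<omega> * E (Suc i) k \<omega> \<partial>M))
      = (\<Sum>n<N. F (c i) n * (of_real (measure M (cyl h i c) * mat_exp h Gen $$ (c i, n)) * euler_expect h F p k n))"
    proof (rule sum.cong[OF refl])
      fix n assume "n \<in> {..<N}"
      then have n: "n < N" by simp
      have "(\<integral>\<omega>. indicator (cyl h (Suc i) (c(Suc i := n))) \<omega> * E (Suc i) k \<omega> \<partial>M) = of_real (measure M (cyl h (Suc i) (c(Suc i := n)))) * euler_expect h F p k ((c(Suc i := n)) (Suc i))"
        using Suc.prems n by (intro Suc.IH) (auto simp: le_Suc_eq)
      also have "measure M (cyl h (Suc i) (c(Suc i := n))) = measure M (cyl h i c) * mat_exp h Gen $$ (c i, n)"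
        using h Suc.prems n by (intro cyl_measure_Suc) auto
      finally have q: "(\<integral>\<omega>. indicator (cyl h (Suc i) (c(Suc i := n))) \<omega> * E (Suc i) k \<omega> \<partial>M) = of_real (measure M (cyl h i c) * mat_exp h Gen $$ (c i, n)) * euler_expect h F p k ((c(Suc i := n)) (Suc i))" .
      show "F (c i) n * (\<integral>\<omega>. indicator (cyl h (Suc i) (c(Suc i := n))) \<omega> * E (Suc i) k \<omega> \<partial>M) = F (c i) n * (of_real (measure M (cyl h i c) * mat_exp h Gen $$ (c i, n)) * euler_expect h F p k n)"
        unfolding q fun_upd_same ..
    qed
    finally show ?case by (simp add: distrib_left sum_distrib_left mult_ac)
  qed
  then show ?thesis unfolding E_def .
qed

lemma expectation_grid_euler:
  fixes F :: "nat \<Rightarrow> nat \<Rightarrow> complex" and p :: "nat \<Rightarrow> real" and k :: nat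
  assumes h: "h \<ge> 0" and F: "\<And>n n'. n < N \<Longrightarrow> n' < N \<Longrightarrow> cmod (F n n') \<le> 1"
  defines "E \<equiv> \<lambda>\<omega>. grid_euler (\<lambda>l. F (J (real l * h) \<omega>) (J (real l * h + h) \<omega>)) (\<lambda>l. p (J (real l * h) \<omega>)) 0 k"
  assumes int: "integrable M E"
  shows "(\<integral>\<omega>. E \<omega> \<partial>M) = (\<Sum>n<N. of_real (varpi n) * euler_expect h F p k n)"
proof -
  have "(\<integral>\<omega>. E \<omega> \<partial>M) = (\<integral>\<omega>. (\<Sum>n<N. indicator (cyl h 0 (\<lambda>_. n)) \<omega> * E \<omega>) \<partial>M)"
  proof (intro Bochner_Integration.integral_cong refl)
    fix \<omega> assume w: "\<omega> \<in> space M"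
    have "(\<Sum>n<N. indicator (cyl h 0 (\<lambda>_. n)) \<omega> * E \<omega>) = (\<Sum>n<N. if n = J 0 \<omega> then E \<omega> else 0)"
      by (rule sum.cong) (auto simp: cyl_def indicator_def w)
    then show "E \<omega> = (\<Sum>n<N. indicator (cyl h 0 (\<lambda>_. n)) \<omega> * E \<omega>)" using J_less[OF w, of 0] by (simp add: sum.delta)
  qed
  also have "\<dots> = (\<Sum>n<N. (\<integral>\<omega>. indicator (cyl h 0 (\<lambda>_. n)) \<omega> * E \<omega> \<partial>M))"
  proof (rule Bochner_Integration.integral_sum)
    fix n
    have "integrable M (\<lambda>\<omega>. indicator (cyl h 0 (\<lambda>_. n)) \<omega> *\<^sub>R E \<omega>)" using int by (intro integrable_mult_indicator) auto
    then show "integrable M (\<lambda>\<omega>. indicator (cyl h 0 (\<lambda>_. n)) \<omega> * E \<omega>)" by (simp add: scaleR_conv_of_real of_real_indicator)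
  qed
  also have "\<dots> = (\<Sum>n<N. of_real (varpi n) * euler_expect h F p k n)"
  proof (rule sum.cong[OF refl])
    fix n assume "n \<in> {..<N}"
    then have n: "n < N" by simp
    show "(\<integral>\<omega>. indicator (cyl h 0 (\<lambda>_. n)) \<omega> * E \<omega> \<partial>M) = of_real (varpi n) * euler_expect h F p k n"
      unfolding E_def using n by (subst markov_grid_euler[OF h F]) (auto simp: cyl_measure[OF h])
  qed
  finally show ?thesis .
qed

end

section \<open>Roots of the Levy laws\<close>

context mm_process
begin

lemma Gen_nonneg: "n < N \<Longrightarrow> n' < N \<Longrightarrow> n \<noteq> n' \<Longrightarrow> Gen $$ (n,n') \<ge> 0"
  and Gen_carrier: "Gen \<in> carrier_mat N N"
  using gen by (auto simp: generator_def)

lemma reachable: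
  assumes irr: "irreducible_mat N Gen" and n: "n < N"
  shows "\<exists>e i c. e > 0 \<and> c i = n \<and> (\<forall>l\<le>i. c l < N) \<and> measure M (cyl e i c) > 0"
proof -
  obtain K where K: "K \<ge> 0" "\<And>h i j. 0 \<le> h \<Longrightarrow> h \<le> 1 \<Longrightarrow> i < N \<Longrightarrow> j < N \<Longrightarrow>
    \<bar>mat_exp h Gen $$ (i,j) - ((if i = j then 1 else 0) + h * Gen $$ (i,j))\<bar> \<le> K * h\<^sup>2"
    using mat_exp_expansion[OF Gen_carrier] by blast
  define g where "g = Min (insert 1 ((\<lambda>(a,b). Gen $$ (a,b)) ` {(a,b) \<in> {..<N} \<times> {..<N}. a \<noteq> b \<and> Gen $$ (a,b) \<noteq> 0}))"
  have fin: "finite {(a,b) \<in> {..<N} \<times> {..<N}. a \<noteq> b \<and> Gen $$ (a,b) \<noteq> 0}"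
    by (rule finite_subset[of _ "{..<N} \<times> {..<N}"]) auto
  have g0: "g > 0" unfolding g_def using fin Gen_nonneg by (subst Min_gr_iff) (auto simp: order.strict_iff_order)
  have g: "g \<le> Gen $$ (a,b)" if "a < N" "b < N" "a \<noteq> b" "Gen $$ (a,b) \<noteq> 0" for a b
    unfolding g_def using fin that by (intro Min_le) auto
  define e where "e = min 1 (g / (2 * (K + 1)))"
  have e: "e > 0" "e \<le> 1" using g0 K by (auto simp: e_def)
  have "K * e \<le> K * (g / (2 * (K + 1)))" using K by (intro mult_left_mono) (auto simp: e_def)
  also have "\<dots> \<le> g / 2" using K g0 by (simp add: field_simps)
  finally have Ke: "K * e \<le> g / 2" .
  have pos: "mat_exp e Gen $$ (a,b) > 0" if "a < N" "b < N" "a \<noteq> b" "Gen $$ (a,b) \<noteq> 0" for a b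
  proof -
    have "e * Gen $$ (a,b) - K * e\<^sup>2 \<le> mat_exp e Gen $$ (a,b)" using K(2)[of e a b] e that by auto
    moreover have "e * Gen $$ (a,b) - K * e\<^sup>2 = e * (Gen $$ (a,b) - K * e)" by (simp add: algebra_simps power2_eq_square)
    moreover have "Gen $$ (a,b) - K * e > 0" using g[OF that] Ke g0 by linarith
    ultimately show ?thesis using mult_pos_pos[OF e(1), of "Gen $$ (a,b) - K * e"] by linarith
  qed
  define X where "X = {n. n < N \<and> (\<exists>i c. c i = n \<and> (\<forall>l\<le>i. c l < N) \<and> measure M (cyl e i c) > 0)}"
  have "X \<noteq> {}"
  proof -
    have "\<exists>n<N. varpi n > 0"
    proof (rule ccontr)
      assume "\<not> (\<exists>n<N. varpi n > 0)"
      then have "\<forall>n\<in>{..<N}. varpi n = 0" using varpi_nonneg by (metis antisym_conv1 lessThan_iff)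
      then show False using varpi_sum by simp
    qed
    then obtain n where n: "n < N" "varpi n > 0" by blast
    have "measure M (cyl e 0 (\<lambda>_. n)) = varpi n" using e n by (subst cyl_measure) auto
    then have "n \<in> X" using n unfolding X_def by (intro CollectI conjI exI[of _ 0] exI[of _ "\<lambda>_. n"]) auto
    then show ?thesis by auto
  qed
  moreover have "\<not> X \<subset> {0..<N}"
  proof
    assume "X \<subset> {0..<N}"
    with \<open>X \<noteq> {}\<close> obtain a b where ab: "a \<in> X" "b \<in> {0..<N} - X" "Gen $$ (a,b) \<noteq> 0"
      using irr unfolding irreducible_mat_def by blast
    then obtain i c where c: "c i = a" "\<forall>l\<le>i. c l < N" "measure M (cyl e i c) > 0" "a < N" by (auto simp: X_def)
    have "a \<noteq> b" "b < N" using ab by auto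
    then have "measure M (cyl e (Suc i) (c(Suc i := b))) = measure M (cyl e i c) * mat_exp e Gen $$ (c i, b)"
      using c e by (intro cyl_measure_Suc) auto
    then have "measure M (cyl e (Suc i) (c(Suc i := b))) > 0" using c pos[of a b] \<open>a \<noteq> b\<close> \<open>b < N\<close> ab by simp
    moreover have "\<forall>l\<le>Suc i. (c(Suc i := b)) l < N" using c \<open>b < N\<close> by (simp add: le_Suc_eq)
    ultimately have "b \<in> X" using \<open>b < N\<close> unfolding X_def by (intro CollectI conjI exI[of _ "Suc i"] exI[of _ "c(Suc i := b)"]) auto
    then show False using ab by simp
  qed
  moreover have "X \<subseteq> {0..<N}" by (auto simp: X_def)
  ultimately have "X = {0..<N}" by blast
  then have "n \<in> X" using n by simp
  then show ?thesis using e unfolding X_def by blast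
qed

lemma one_minus_ge_exp: "0 \<le> x \<Longrightarrow> x \<le> 1/2 \<Longrightarrow> exp (- 2 * x) \<le> 1 - (x::real)"
proof -
  assume x: "0 \<le> x" "x \<le> 1/2"
  have "1 + 2 * x \<le> exp (2 * x)" by (rule exp_ge_add_one_self)
  then have "(1 - x) * exp (2 * x) \<ge> (1 - x) * (1 + 2 * x)" using x by (intro mult_left_mono) auto
  also have "(1 - x) * (1 + 2 * x) = 1 + x * (1 - 2 * x)" by (simp add: algebra_simps)
  finally have "(1 - x) * exp (2 * x) \<ge> 1 + x * (1 - 2 * x)" .
  moreover have "x * (1 - 2 * x) \<ge> 0" using x by (intro mult_nonneg_nonneg) auto
  ultimately have "(1 - x) * exp (2 * x) \<ge> 1" by linarith
  then show ?thesis by (simp add: exp_minus field_simps)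
qed

text \<open>Since the conditional law is only tested on cylinder events, the event of staying in state
  \<open>n\<close> on a whole interval is approximated along dyadic grids.\<close>
lemma root_exists:
  assumes irr: "irreducible_mat N Gen" and n: "n < N" and h: "h > 0" "h \<le> 1"
  shows "\<exists>R. real_distribution R \<and> (\<forall>th. char R th = exp (of_real h * psi n th))"
proof -
  obtain e i c where c: "e > 0" "c i = n" "\<And>l. l \<le> i \<Longrightarrow> c l < N" "measure M (cyl e i c) > 0"
    using reachable[OF irr n] by blast
  define r where "r = real i * e"
  have r0: "r \<ge> 0" using c by (simp add: r_def)
  define t where "t l j = (if j \<le> i then real j * e else r + real (j - i) * (h / 2 ^ l))" for l j :: nat
  define cc where "cc j = (if j \<le> i then c j else n)" for j
  define B where "B l = {\<omega>\<in>space M. \<forall>j\<le>i + 2 ^ l. J (t l j) \<omega> = cc j}" for l :: nat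
  have B_sets[measurable]: "B l \<in> sets M" for l unfolding B_def by (rule J_path_sets)
  have t_nonneg: "t l j \<ge> 0" for l j using c r0 h by (simp add: t_def)
  have t_at: "t l (i + a) = r + real a * (h / 2 ^ l)" for l a by (simp add: t_def r_def)
  have t_mono: "t l j \<le> t l (Suc j)" for l j
  proof (cases "j < i")
    case True then show ?thesis using c by (simp add: t_def)
  next
    case False
    then obtain a where a: "j = i + a" by (metis le_add_diff_inverse not_less)
    show ?thesis unfolding a add_Suc_right[symmetric] t_at using h by (simp add: divide_right_mono)
  qed
  have cc_at: "cc (i + a) = n" for a using c by (simp add: cc_def)
  have cc_less: "cc j < N" for j using c n by (simp add: cc_def)
  obtain K where K: "K \<ge> 0" "\<And>h i j. 0 \<le> h \<Longrightarrow> h \<le> 1 \<Longrightarrow> i < N \<Longrightarrow> j < N \<Longrightarrow>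
    \<bar>mat_exp h Gen $$ (i,j) - ((if i = j then 1 else 0) + h * Gen $$ (i,j))\<bar> \<le> K * h\<^sup>2"
    using mat_exp_expansion[OF Gen_carrier] by blast
  define \<kappa> where "\<kappa> = K + \<bar>Gen $$ (n,n)\<bar>"
  have \<kappa>: "\<kappa> \<ge> 0" using K by (simp add: \<kappa>_def)
  have stay: "1 - \<kappa> * d \<le> mat_exp d Gen $$ (n,n)" if "0 \<le> d" "d \<le> 1" for d
  proof -
    have "1 + d * Gen $$ (n,n) - K * d\<^sup>2 \<le> mat_exp d Gen $$ (n,n)" using K(2)[of d n n] that n by auto
    moreover have "K * d\<^sup>2 \<le> K * d" using that K by (intro mult_left_mono) (auto simp: power2_eq_square mult_left_le_one_le)
    moreover have "d * Gen $$ (n,n) \<ge> d * (- \<bar>Gen $$ (n,n)\<bar>)" using that by (intro mult_left_mono) auto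
    ultimately show ?thesis by (simp add: \<kappa>_def algebra_simps)
  qed
  have B_measure: "measure M (B l) = measure M (cyl e i c) * mat_exp (h / 2 ^ l) Gen $$ (n,n) ^ (2 ^ l)" for l
  proof -
    have "measure M (B l) = varpi (cc 0) * (\<Prod>j\<in>{1..i + 2 ^ l}. mat_exp (t l j - t l (j - 1)) Gen $$ (cc (j - 1), cc j))"
      unfolding B_def by (rule cylinder) (use t_mono cc_less in \<open>auto simp: t_def\<close>)
    also have "{1..i + 2 ^ l} = {1..i} \<union> {i+1..i + 2 ^ l}" by auto
    also have "(\<Prod>j\<in>{1..i} \<union> {i+1..i + 2 ^ l}. mat_exp (t l j - t l (j - 1)) Gen $$ (cc (j - 1), cc j)) =
      (\<Prod>j\<in>{1..i}. mat_exp (t l j - t l (j - 1)) Gen $$ (cc (j - 1), cc j)) * (\<Prod>j\<in>{i+1..i + 2 ^ l}. mat_exp (t l j - t l (j - 1)) Gen $$ (cc (j - 1), cc j))"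
      by (rule prod.union_disjoint) auto
    also have "(\<Prod>j\<in>{1..i}. mat_exp (t l j - t l (j - 1)) Gen $$ (cc (j - 1), cc j)) = (\<Prod>j\<in>{1..i}. mat_exp e Gen $$ (c (j - 1), c j))"
    proof (rule prod.cong[OF refl])
      fix j assume j: "j \<in> {1..i}"
      then have ji: "j - 1 \<le> i" "j \<le> i" "1 \<le> j" by auto
      have "t l j - t l (j - 1) = real j * e - real (j - 1) * e" unfolding t_def if_P[OF ji(1)] if_P[OF ji(2)] ..
      also have "\<dots> = e" using ji(3) by (simp add: of_nat_diff algebra_simps)
      finally have "t l j - t l (j - 1) = e" .
      then show "mat_exp (t l j - t l (j - 1)) Gen $$ (cc (j - 1), cc j) = mat_exp e Gen $$ (c (j - 1), c j)"
        unfolding cc_def if_P[OF ji(1)] if_P[OF ji(2)] by simp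
    qed
    also have "(\<Prod>j\<in>{i+1..i + 2 ^ l}. mat_exp (t l j - t l (j - 1)) Gen $$ (cc (j - 1), cc j)) = (\<Prod>j\<in>{i+1..i + 2 ^ l}. mat_exp (h / 2 ^ l) Gen $$ (n,n))"
    proof (rule prod.cong[OF refl])
      fix j assume "j \<in> {i+1..i + 2 ^ l}"
      then have a: "j = i + Suc (j - Suc i)" by auto
      define a where "a = j - Suc i"
      have ja: "j = i + Suc a" "j - 1 = i + a" using a by (auto simp: a_def)
      have "t l j = r + real (Suc a) * (h / 2 ^ l)" "t l (j - 1) = r + real a * (h / 2 ^ l)" "cc j = n" "cc (j - 1) = n"
        using t_at[of l "Suc a"] t_at[of l a] cc_at[of "Suc a"] cc_at[of a] unfolding ja(1)[symmetric] ja(2)[symmetric] by auto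
      then show "mat_exp (t l j - t l (j - 1)) Gen $$ (cc (j - 1), cc j) = mat_exp (h / 2 ^ l) Gen $$ (n,n)"
        by (simp add: algebra_simps add_divide_distrib)
    qed
    also have "\<dots> = mat_exp (h / 2 ^ l) Gen $$ (n,n) ^ (2 ^ l)" by simp
    also have "varpi (cc 0) = varpi (c 0)" by (simp add: cc_def)
    finally have eq: "measure M (B l) = varpi (c 0) * ((\<Prod>j\<in>{1..i}. mat_exp e Gen $$ (c (j - 1), c j)) * mat_exp (h / 2 ^ l) Gen $$ (n,n) ^ (2 ^ l))" .
    have m: "measure M (cyl e i c) = varpi (c 0) * (\<Prod>j\<in>{1..i}. mat_exp e Gen $$ (c (j - 1), c j))"
      by (rule cyl_measure) (use c in auto)
    show ?thesis unfolding eq m mult.assoc ..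
  qed
  define b where "b = measure M (cyl e i c) * exp (- 2 * \<kappa> * h)"
  have b0: "b > 0" using c by (simp add: b_def)
  have ev: "\<forall>\<^sub>F l in sequentially. b \<le> measure M (B l)"
  proof -
    have "(\<lambda>l. \<kappa> * h * (1/2) ^ l) \<longlonglongrightarrow> \<kappa> * h * 0" by (intro tendsto_intros LIMSEQ_power_zero) auto
    then have "\<forall>\<^sub>F l in sequentially. \<kappa> * h * (1/2) ^ l < 1/2" by (intro order_tendstoD(2)) auto
    then show ?thesis
    proof eventually_elim
      case (elim l)
      let ?d = "h / 2 ^ l"
      have d: "0 \<le> ?d" "?d \<le> 1"
      proof -
        have "h \<le> 2 ^ l" using h(2) one_le_power[of "2::real" l] by linarith
        then show "?d \<le> 1" by simp
      qed (use h in simp)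
      have kd: "\<kappa> * ?d \<le> 1/2" "0 \<le> \<kappa> * ?d" 
        using elim mult_nonneg_nonneg[OF \<kappa> d(1)] by (simp_all add: power_one_over)
      have "exp (- 2 * \<kappa> * h) = exp (- 2 * (\<kappa> * ?d)) ^ (2 ^ l)" by (simp flip: exp_of_nat_mult)
      also have "\<dots> \<le> (1 - \<kappa> * ?d) ^ (2 ^ l)" using one_minus_ge_exp[OF kd(2,1)] by (intro power_mono) auto
      also have "\<dots> \<le> mat_exp ?d Gen $$ (n,n) ^ (2 ^ l)"
      proof (rule power_mono[OF stay[OF d]])
        show "0 \<le> 1 - \<kappa> * ?d" using kd(1) by linarith
      qed
      finally show ?case unfolding B_measure b_def using c by (intro mult_left_mono) auto
    qed
  qed
  have decr: "B (Suc l) \<subseteq> B l" for l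
  proof
    fix \<omega> assume w: "\<omega> \<in> B (Suc l)"
    have wj: "\<And>j. j \<le> i + 2 ^ Suc l \<Longrightarrow> J (t (Suc l) j) \<omega> = cc j" using w unfolding B_def by blast
    have "J (t l j) \<omega> = cc j" if "j \<le> i + 2 ^ l" for j
    proof (cases "j \<le> i")
      case True
      then have "t l j = t (Suc l) j" "j \<le> i + 2 ^ Suc l" by (auto simp: t_def)
      then show ?thesis using wj[of j] by simp
    next
      case False
      then obtain a where a: "j = i + a" by (metis le_add_diff_inverse nat_le_linear)
      have "t l j = t (Suc l) (i + 2 * a)" unfolding a t_at by simp
      moreover have "i + 2 * a \<le> i + 2 ^ Suc l" using that a by simp
      ultimately have "J (t l j) \<omega> = cc (i + 2 * a)" using wj[of "i + 2 * a"] by presburger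
      then show ?thesis unfolding a cc_at .
    qed
    then show "\<omega> \<in> B l" using w unfolding B_def by blast
  qed
  define Bi where "Bi = (\<Inter>l. B l)"
  have Bi_sets[measurable]: "Bi \<in> sets M" unfolding Bi_def by measurable
  have dec: "decseq B" by (rule decseq_SucI) (rule decr)
  have "(\<lambda>l. measure M (B l)) \<longlonglongrightarrow> measure M Bi" unfolding Bi_def
    by (rule finite_Lim_measure_decseq) (use dec in auto)
  then have Bi_pos: "measure M Bi > 0" using tendsto_lowerbound[OF _ ev, of "measure M Bi"] b0 by simp
  have Bi_space: "Bi \<subseteq> space M" using sets.sets_into_space[OF Bi_sets] .
  have on_Bi: "J u \<omega> = n" if w: "\<omega> \<in> Bi" and u: "r \<le> u" "u \<le> r + h" for \<omega> u
  proof -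
    have ws: "\<omega> \<in> space M" using w Bi_space by auto
    have dy: "J (r + real a * (h / 2 ^ l)) \<omega> = n" if "a \<le> 2 ^ l" for a l
    proof -
      have "\<omega> \<in> B l" using w by (auto simp: Bi_def)
      moreover have "i + a \<le> i + 2 ^ l" using that by simp
      ultimately have "J (t l (i + a)) \<omega> = cc (i + a)" unfolding B_def by blast
      then show ?thesis unfolding t_at cc_at .
    qed
    show ?thesis
    proof (cases "u = r + h")
      case True then show ?thesis using dy[of 1 0] by simp
    next
      case False
      then have ul: "u < r + h" using u by simp
      obtain d where d: "d > 0" "\<And>v. u \<le> v \<Longrightarrow> v < u + d \<Longrightarrow> J v \<omega> = J u \<omega>"
        using cadlag_nat_right[OF J_cadlag[OF ws], of u] r0 u by auto
      have "(\<lambda>l. h * (1/2) ^ l) \<longlonglongrightarrow> h * 0" by (intro tendsto_intros LIMSEQ_power_zero) auto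
      then have "\<forall>\<^sub>F l in sequentially. h * (1/2) ^ l < d" using d by (intro order_tendstoD(2)) auto
      then obtain l where l: "h / 2 ^ l < d" by (auto simp: eventually_sequentially power_one_over)
      define z where "z = (u - r) * 2 ^ l / h"
      define a where "a = nat \<lceil>z\<rceil>"
      have "(u - r) * 2 ^ l \<le> h * 2 ^ l" using ul by (intro mult_right_mono) auto
      then have z: "0 \<le> z" "z \<le> 2 ^ l" using u h by (simp_all add: z_def divide_le_eq mult.commute)
      have az: "z \<le> real a" "real a < z + 1" using z unfolding a_def by linarith+
      have "a \<le> 2 ^ l"
      proof -
        have "\<lceil>z\<rceil> \<le> 2 ^ l" using z(2) by (simp add: ceiling_le_iff)
        then show ?thesis unfolding a_def by (simp add: nat_le_iff)
      qed
      have zu: "z * (h / 2 ^ l) = u - r" using h by (simp add: z_def)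
      have hl: "h / 2 ^ l > 0" using h by simp
      have "z * (h / 2 ^ l) \<le> real a * (h / 2 ^ l)" using az hl by (intro mult_right_mono) auto
      moreover have "real a * (h / 2 ^ l) < (z + 1) * (h / 2 ^ l)" using az hl by (intro mult_strict_right_mono) auto
      moreover have "(z + 1) * (h / 2 ^ l) = u - r + h / 2 ^ l" unfolding distrib_right zu by simp
      ultimately obtain q e' where q: "q = real a * (h / 2 ^ l)" "e' = h / 2 ^ l" "u - r \<le> q" "q < u - r + e'" "e' < d"
        using l zu by metis
      have "J (r + q) \<omega> = J u \<omega>" using q(3-5) by (intro d(2)) linarith+
      then have "J (r + real a * (h / 2 ^ l)) \<omega> = J u \<omega>" unfolding q(1) .
      then show ?thesis using dy[OF \<open>a \<le> 2 ^ l\<close>] by simp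
    qed
  qed
  have rh: "r \<le> r + h" using h by simp
  have Y_Bi: "Y th r (r + h) \<omega> = exp (of_real h * psi n th)" if w: "\<omega> \<in> Bi" for th \<omega>
  proof -
    have "trans_times (\<lambda>u. J u \<omega>) r (r + h) = {}"
    proof -
      have "left_lim (\<lambda>u. J u \<omega>) tau = J tau \<omega>" if "tau \<in> {r<..r+h}" for tau
      proof -
        have "left_lim (\<lambda>u. J u \<omega>) tau = n"
          by (rule left_limI[of "tau - r"]) (use that in \<open>auto intro!: on_Bi[OF w]\<close>)
        then show ?thesis using on_Bi[OF w, of tau] that by simp
      qed
      then show ?thesis unfolding trans_times_def by blast
    qed
    moreover have "integral {r..r+h} (\<lambda>u. psi (J u \<omega>) th) = integral {r..r+h} (\<lambda>u. psi n th)"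
      by (intro integral_cong) (simp add: on_Bi[OF w])
    ultimately show ?thesis using h by (simp add: Y_def path_char_def scaleR_conv_of_real)
  qed
  have ind_lim: "(\<lambda>l. indicator (B l) \<omega> :: complex) \<longlonglongrightarrow> indicator Bi \<omega>" for \<omega>
    unfolding Bi_def by (rule LIMSEQ_indicator_decseq[OF dec])
  have lim: "(\<lambda>l. \<integral>\<omega>. indicator (B l) \<omega> * f \<omega> \<partial>M) \<longlonglongrightarrow> (\<integral>\<omega>. indicator Bi \<omega> * f \<omega> \<partial>M)"
    if [measurable]: "f \<in> borel_measurable M" and f: "\<And>\<omega>. \<omega> \<in> space M \<Longrightarrow> cmod (f \<omega>) \<le> 1" for f :: "'a \<Rightarrow> complex"
  proof (rule integral_dominated_convergence[where w="\<lambda>_. 1"])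
    show "AE \<omega> in M. (\<lambda>l. indicator (B l) \<omega> * f \<omega>) \<longlonglongrightarrow> indicator Bi \<omega> * f \<omega>"
      by (intro AE_I2 tendsto_mult ind_lim tendsto_const)
    show "AE \<omega> in M. cmod (indicator (B l) \<omega> * f \<omega>) \<le> 1" for l
      using f by (intro AE_I2) (auto simp: norm_mult split: split_indicator)
  qed auto
  have Ym: "Y th r (r + h) \<in> borel_measurable M" for th by (rule Y_meas[OF r0 rh])
  have key: "(\<integral>\<omega>. indicator Bi \<omega> * iexp (th * (W (r + h) \<omega> - W r \<omega>)) \<partial>M) = of_real (measure M Bi) * exp (of_real h * psi n th)" for th
  proof -
    have "(\<integral>\<omega>. indicator (B l) \<omega> * iexp (th * (W (r + h) \<omega> - W r \<omega>)) \<partial>M) = (\<integral>\<omega>. indicator (B l) \<omega> * Y th r (r + h) \<omega> \<partial>M)" for l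
    proof -
      have Bl: "B l = {\<omega>\<in>space M. \<forall>j<Suc (i + 2 ^ l). J (t l j) \<omega> = cc j}" unfolding B_def by (simp add: less_Suc_eq_le)
      have "(\<integral>\<omega>. indicator (B l) \<omega> * iexp (th * (W (r + h) \<omega> - W r \<omega>)) \<partial>M) =
        (\<integral>\<omega>. indicator (B l) \<omega> * iexp (0 * W r \<omega> + 0 * V r \<omega> + th * (W (r + h) \<omega> - W r \<omega>) + 0 * (V (r + h) \<omega> - V r \<omega>)) \<partial>M)"
        by simp
      also have "\<dots> = (\<integral>\<omega>. indicator (B l) \<omega> * (Y 0 0 r \<omega> * exp (of_real (Lam 0 r \<omega>) * (iexp 0 - 1)) * (Y th r (r + h) \<omega> * exp (of_real (Lam r (r + h) \<omega>) * (iexp 0 - 1)))) \<partial>M)"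
        unfolding Bl by (rule cond_formula[OF r0 rh]) (rule t_nonneg)
      also have "\<dots> = (\<integral>\<omega>. indicator (B l) \<omega> * Y th r (r + h) \<omega> \<partial>M)"
        by (intro Bochner_Integration.integral_cong refl) (simp add: Y_zero[OF _ order_refl r0])
      finally show ?thesis .
    qed
    then have "(\<integral>\<omega>. indicator Bi \<omega> * iexp (th * (W (r + h) \<omega> - W r \<omega>)) \<partial>M) = (\<integral>\<omega>. indicator Bi \<omega> * Y th r (r + h) \<omega> \<partial>M)"
      using lim[of "\<lambda>\<omega>. iexp (th * (W (r + h) \<omega> - W r \<omega>))"] lim[OF Ym Y_le[OF _ r0 rh], of th] LIMSEQ_unique
      by (simp add: LIMSEQ_unique)
    also have "\<dots> = (\<integral>\<omega>. indicator Bi \<omega> *\<^sub>R exp (of_real h * psi n th) \<partial>M)"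
      by (intro Bochner_Integration.integral_cong refl) (auto simp: Y_Bi split: split_indicator)
    also have "\<dots> = of_real (measure M Bi) * exp (of_real h * psi n th)"
      by (simp add: scaleR_conv_of_real sets.Int_space_eq2[OF Bi_sets])
    finally show ?thesis .
  qed
  define g where "g \<omega> = indicator Bi \<omega> / measure M Bi" for \<omega>
  define MB where "MB = density M (\<lambda>\<omega>. ennreal (g \<omega>))"
  have g_meas[measurable]: "g \<in> borel_measurable M" unfolding g_def by measurable
  have g0: "g \<omega> \<ge> 0" for \<omega> by (simp add: g_def)
  have MB: "prob_space MB"
  proof
    have "emeasure MB (space MB) = (\<integral>\<^sup>+\<omega>. ennreal (g \<omega>) \<partial>M)" unfolding MB_def
      by (simp add: emeasure_density cong: nn_integral_cong)
    also have "\<dots> = ennreal (\<integral>\<omega>. g \<omega> \<partial>M)"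
      by (rule nn_integral_eq_integral) (auto simp: g_def intro!: integrable_const_bound[where B="1 / measure M Bi"] split: split_indicator)
    also have "(\<integral>\<omega>. g \<omega> \<partial>M) = 1" unfolding g_def using Bi_pos by (simp add: sets.Int_space_eq2[OF Bi_sets])
    finally show "emeasure MB (space MB) = 1" by simp
  qed
  define R where "R = distr MB borel (\<lambda>\<omega>. W (r + h) \<omega> - W r \<omega>)"
  have [measurable]: "(\<lambda>\<omega>. W (r + h) \<omega> - W r \<omega>) \<in> borel_measurable MB" unfolding MB_def by simp
  have "real_distribution R" unfolding R_def
    by (intro real_distributionI prob_space.prob_space_distr[OF MB]) auto
  moreover have "char R th = exp (of_real h * psi n th)" for th
  proof -
    have "char R th = (\<integral>\<omega>. iexp (th * (W (r + h) \<omega> - W r \<omega>)) \<partial>MB)"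
      unfolding char_def R_def by (subst integral_distr) auto
    also have "\<dots> = (\<integral>\<omega>. g \<omega> *\<^sub>R iexp (th * (W (r + h) \<omega> - W r \<omega>)) \<partial>M)"
      unfolding MB_def by (rule integral_density) (use g0 in auto)
    also have "\<dots> = (\<integral>\<omega>. (indicator Bi \<omega> * iexp (th * (W (r + h) \<omega> - W r \<omega>))) / of_real (measure M Bi) \<partial>M)"
      by (intro Bochner_Integration.integral_cong refl) (simp add: g_def scaleR_conv_of_real of_real_indicator)
    also have "\<dots> = (\<integral>\<omega>. indicator Bi \<omega> * iexp (th * (W (r + h) \<omega> - W r \<omega>)) \<partial>M) / of_real (measure M Bi)"
      by simp
    also have "\<dots> = exp (of_real h * psi n th)" unfolding key using Bi_pos by simp
    finally show ?thesis .
  qed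
  ultimately show ?thesis by blast
qed

end

section \<open>The killing time\<close>

context mm_process
begin

definition tau where "tau \<omega> = real_of_ereal (first_pos V \<omega>)"

definition regular where
  "regular \<omega> \<longleftrightarrow> (\<forall>s t. 0 \<le> s \<and> s \<le> t \<longrightarrow> V t \<omega> - V s \<omega> \<in> {x. x \<in> \<int> \<and> 0 \<le> x})"

lemma V_right: "\<omega> \<in> space M \<Longrightarrow> t \<ge> 0 \<Longrightarrow> ((\<lambda>u. V u \<omega>) \<longlongrightarrow> V t \<omega>) (at_right t)"
  and W_right: "\<omega> \<in> space M \<Longrightarrow> t \<ge> 0 \<Longrightarrow> ((\<lambda>u. W u \<omega>) \<longlongrightarrow> W t \<omega>) (at_right t)"
  using V_cadlag W_cadlag by (auto simp: cadlag_def continuous_within)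

lemma right_rational_seq:
  fixes t :: real
  assumes "t \<ge> 0"
  shows "\<exists>q :: nat \<Rightarrow> rat. (\<forall>k. t < of_rat (q k)) \<and> filterlim (\<lambda>k. of_rat (q k) :: real) (at_right t) sequentially"
proof -
  have "\<exists>q :: rat. t < of_rat q \<and> of_rat q < t + 1 / real (Suc k)" for k
    using of_rat_dense[of t "t + 1 / real (Suc k)"] by auto
  then obtain q :: "nat \<Rightarrow> rat" where q: "\<And>k. t < of_rat (q k)" "\<And>k. of_rat (q k) < t + 1 / real (Suc k)" by metis
  have "(\<lambda>k. of_rat (q k)) \<longlonglongrightarrow> t"
  proof (rule tendsto_sandwich[of "\<lambda>_. t" _ _ "\<lambda>k. t + 1 / real (Suc k)"])
    show "(\<lambda>k. t + 1 / real (Suc k)) \<longlonglongrightarrow> t" using LIMSEQ_inverse_real_of_nat_add[of t] by (simp add: inverse_eq_divide)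
  qed (use q in \<open>auto intro!: always_eventually less_imp_le\<close>)
  then have "filterlim (\<lambda>k. of_rat (q k) :: real) (at_right t) sequentially"
    using q(1) by (auto simp: filterlim_at intro!: always_eventually)
  then show ?thesis using q(1) by blast
qed

lemma regular_AE: "AE \<omega> in M. regular \<omega>"
proof -
  have "AE \<omega> in M. 0 \<le> p \<and> p \<le> q \<longrightarrow> V (of_rat q) \<omega> - V (of_rat p) \<omega> \<in> {x. x \<in> \<int> \<and> 0 \<le> x}" for p q :: rat
  proof (cases "0 \<le> p \<and> p \<le> q")
    case True
    then have "0 \<le> real_of_rat p" "real_of_rat p \<le> real_of_rat q" by (auto simp: of_rat_less_eq)
    from V_increment_int[OF this] V_increment_nonneg[OF this] show ?thesis by eventually_elim auto
  qed auto
  then have "AE \<omega> in M. \<forall>p q :: rat. 0 \<le> p \<and> p \<le> q \<longrightarrow> V (of_rat q) \<omega> - V (of_rat p) \<omega> \<in> {x. x \<in> \<int> \<and> 0 \<le> x}"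
    by (simp add: AE_all_countable)
  then show ?thesis using AE_space
  proof eventually_elim
    case (elim \<omega>)
    note rat = elim(1)[rule_format] and w = elim(2)
    have cl: "closed {x::real. x \<in> \<int> \<and> 0 \<le> x}"
    proof -
      have "{x::real. x \<in> \<int> \<and> 0 \<le> x} = \<int> \<inter> {0..}" by auto
      then show ?thesis by (simp add: closed_Ints closed_Int)
    qed
    show ?case unfolding regular_def
    proof (intro allI impI)
      fix s t :: real assume st: "0 \<le> s \<and> s \<le> t"
      show "V t \<omega> - V s \<omega> \<in> {x. x \<in> \<int> \<and> 0 \<le> x}"
      proof (cases "s = t")
        case False
        then have lt: "s < t" using st by simp
        obtain p where p: "\<forall>k. s < of_rat (p k)" "filterlim (\<lambda>k. of_rat (p k) :: real) (at_right s) sequentially"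
          using right_rational_seq[of s] st by blast
        obtain q where q: "\<forall>k. t < of_rat (q k)" "filterlim (\<lambda>k. of_rat (q k) :: real) (at_right t) sequentially"
          using right_rational_seq[of t] st by auto
        have lim: "(\<lambda>k. V (of_rat (q k)) \<omega> - V (of_rat (p k)) \<omega>) \<longlonglongrightarrow> V t \<omega> - V s \<omega>"
          using st by (intro tendsto_diff filterlim_compose[OF V_right q(2)] filterlim_compose[OF V_right p(2)] w) auto
        have "(\<lambda>k. of_rat (p k) :: real) \<longlonglongrightarrow> s" using p(2) by (simp add: filterlim_at)
        then have ev: "\<forall>\<^sub>F k in sequentially. real_of_rat (p k) < t" using lt by (rule order_tendstoD)
        have "\<forall>\<^sub>F k in sequentially. V (of_rat (q k)) \<omega> - V (of_rat (p k)) \<omega> \<in> {x. x \<in> \<int> \<and> 0 \<le> x}"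
          using ev
        proof eventually_elim
          case (elim k)
          have "real_of_rat (p k) \<le> real_of_rat (q k)" using elim q(1)[rule_format, of k] by linarith
          moreover have "0 \<le> real_of_rat (p k)" using p(1)[rule_format, of k] st by linarith
          ultimately show ?case by (intro rat) (simp add: of_rat_less_eq)
        qed
        then show ?thesis using Lim_in_closed_set[OF cl _ _ lim] by simp
      qed simp
    qed
  qed
qed

lemma tau_char:
  assumes w: "\<omega> \<in> space M" and r: "regular \<omega>" and f: "first_pos V \<omega> < \<infinity>"
  shows "tau \<omega> > 0" "\<And>t. t \<ge> 0 \<Longrightarrow> V t \<omega> = 0 \<longleftrightarrow> t < tau \<omega>"
proof -
  define A where "A = {t. t \<ge> 0 \<and> V t \<omega> > 0}"
  have mono: "V s \<omega> \<le> V t \<omega>" if "0 \<le> s" "s \<le> t" for s t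
    using r that unfolding regular_def by fastforce
  have V0: "V t \<omega> \<in> \<int>" "V t \<omega> \<ge> 0" if "t \<ge> 0" for t
    using r that V_0[OF w] unfolding regular_def by fastforce+
  have "A \<noteq> {}"
  proof
    assume "A = {}"
    then have e: "{ereal t | t. t \<ge> 0 \<and> V t \<omega> > 0} = {}" by (auto simp: A_def)
    have "first_pos V \<omega> = \<infinity>" unfolding first_pos_def e by (simp add: top_ereal_def)
    then show False using f by simp
  qed
  have bdd: "bdd_below A" by (rule bdd_belowI[of _ 0]) (auto simp: A_def)
  have img: "{ereal t | t. t \<ge> 0 \<and> V t \<omega> > 0} = ereal ` A" by (auto simp: A_def)
  have fp: "first_pos V \<omega> = ereal (Inf A)"
  proof -
    have "Inf (ereal ` A) = ereal (Inf A)" using ereal_Inf'[OF bdd \<open>A \<noteq> {}\<close>] by simp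
    then show ?thesis unfolding first_pos_def img .
  qed
  have tau: "tau \<omega> = Inf A" unfolding tau_def fp by simp
  have t0: "Inf A \<ge> 0" using \<open>A \<noteq> {}\<close> by (intro cInf_greatest) (auto simp: A_def)
  have Vpos: "V (Inf A) \<omega> > 0"
  proof -
    have "\<forall>\<^sub>F u in at_right (Inf A). dist (V u \<omega>) (V (Inf A) \<omega>) < 1/2"
      using V_right[OF w t0] by (intro tendstoD) auto
    then obtain b where b: "b > Inf A" "\<And>u. Inf A < u \<Longrightarrow> u < b \<Longrightarrow> dist (V u \<omega>) (V (Inf A) \<omega>) < 1/2"
      by (auto simp: eventually_at_right_field)
    obtain a where a: "a \<in> A" "a < b" using cInf_less_iff[OF \<open>A \<noteq> {}\<close> bdd] b(1) by auto
    have la: "Inf A \<le> a" using a bdd by (intro cInf_lower) auto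
    have "V a \<omega> > 0" "a \<ge> 0" using a by (auto simp: A_def)
    then have "V a \<omega> \<ge> 1" using V0[of a] by (auto elim!: Ints_cases)
    show ?thesis
    proof (cases "a = Inf A")
      case True then show ?thesis using \<open>V a \<omega> > 0\<close> by simp
    next
      case False
      then have "dist (V a \<omega>) (V (Inf A) \<omega>) < 1/2" using b(2)[of a] la a by simp
      then show ?thesis using \<open>V a \<omega> \<ge> 1\<close> by (auto simp: dist_real_def abs_if split: if_splits)
    qed
  qed
  show tp: "tau \<omega> > 0"
  proof (rule ccontr)
    assume "\<not> tau \<omega> > 0"
    then have "Inf A = 0" using t0 tau by simp
    then show False using Vpos V_0[OF w] by simp
  qed
  show "V t \<omega> = 0 \<longleftrightarrow> t < tau \<omega>" if t: "t \<ge> 0" for t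
  proof
    assume "V t \<omega> = 0"
    show "t < tau \<omega>"
    proof (rule ccontr)
      assume "\<not> t < tau \<omega>"
      then have "V (Inf A) \<omega> \<le> V t \<omega>" using t0 tau by (intro mono) auto
      then show False using Vpos \<open>V t \<omega> = 0\<close> by simp
    qed
  next
    assume "t < tau \<omega>"
    then have "t \<notin> A" using cInf_lower[OF _ bdd, of t] tau by auto
    then show "V t \<omega> = 0" using V0(2)[OF t] t by (auto simp: A_def)
  qed
qed

lemma first_pos_meas[measurable]: "first_pos V \<in> borel_measurable M"
proof -
  have "first_pos V \<omega> = (INF q::rat. if 0 \<le> q \<and> V (of_rat q) \<omega> > 0 then ereal (of_rat q) else \<infinity>)" if w: "\<omega> \<in> space M" for \<omega>
  proof (rule antisym)
    show "first_pos V \<omega> \<le> (INF q::rat. if 0 \<le> q \<and> V (of_rat q) \<omega> > 0 then ereal (of_rat q) else \<infinity>)"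
      unfolding first_pos_def by (intro INF_greatest) (auto intro!: Inf_lower)
    show "(INF q::rat. if 0 \<le> q \<and> V (of_rat q) \<omega> > 0 then ereal (of_rat q) else \<infinity>) \<le> first_pos V \<omega>" (is "?I \<le> _")
      unfolding first_pos_def
    proof (rule Inf_greatest, clarify)
      fix t :: real assume t: "0 \<le> t" "0 < V t \<omega>"
      obtain q where q: "\<forall>k. t < of_rat (q k)" "filterlim (\<lambda>k. of_rat (q k) :: real) (at_right t) sequentially"
        using right_rational_seq[OF t(1)] by blast
      have "(\<lambda>k. V (of_rat (q k)) \<omega>) \<longlonglongrightarrow> V t \<omega>" by (rule filterlim_compose[OF V_right[OF w t(1)] q(2)])
      then have ev: "\<forall>\<^sub>F k in sequentially. V (of_rat (q k)) \<omega> > 0" using t(2) by (rule order_tendstoD)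
      have "(\<lambda>k. of_rat (q k) :: real) \<longlonglongrightarrow> t" using q(2) by (simp add: filterlim_at)
      then have lim: "(\<lambda>k. ereal (of_rat (q k))) \<longlonglongrightarrow> ereal t" by (simp)
      show "?I \<le> ereal t"
      proof (rule tendsto_lowerbound[OF lim])
        show "\<forall>\<^sub>F k in sequentially. ?I \<le> ereal (of_rat (q k))"
          using ev
        proof eventually_elim
          case (elim k)
          have "0 \<le> real_of_rat (q k)" using q(1)[rule_format, of k] t by linarith
          then have "0 \<le> q k" by simp
          then show ?case using elim by (intro INF_lower2[of "q k"]) auto
        qed
      qed simp
    qed
  qed
  moreover have "(\<lambda>\<omega>. INF q::rat. if 0 \<le> q \<and> V (of_rat q) \<omega> > 0 then ereal (of_rat q) else \<infinity>) \<in> borel_measurable M"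
    by (intro borel_measurable_INF) auto
  ultimately show ?thesis by (subst measurable_cong) auto
qed

lemma tau_meas[measurable]: "tau \<in> borel_measurable M"
  unfolding tau_def by measurable

lemma tau_nonneg: "tau \<omega> \<ge> 0"
proof -
  have "first_pos V \<omega> \<ge> 0" unfolding first_pos_def by (intro Inf_greatest) auto
  then show ?thesis unfolding tau_def by (simp add: real_of_ereal_pos)
qed

lemma W_at_meas:
  assumes [measurable]: "\<sigma> \<in> borel_measurable M" and pos: "\<And>\<omega>. \<omega> \<in> space M \<Longrightarrow> \<sigma> \<omega> \<ge> 0"
  shows "(\<lambda>\<omega>. W (\<sigma> \<omega>) \<omega>) \<in> borel_measurable M"
proof (rule borel_measurable_LIMSEQ_metric)
  fix m :: nat
  show "(\<lambda>\<omega>. W ((of_int \<lfloor>\<sigma> \<omega> * real (Suc m)\<rfloor> + 1) / real (Suc m)) \<omega>) \<in> borel_measurable M"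
  proof (rule measurable_compose_countable[where f="\<lambda>i \<omega>. W ((of_int i + 1) / real (Suc m)) \<omega>" and g="\<lambda>\<omega>. \<lfloor>\<sigma> \<omega> * real (Suc m)\<rfloor>"])
    show "(\<lambda>\<omega>. \<lfloor>\<sigma> \<omega> * real (Suc m)\<rfloor>) \<in> measurable M (count_space UNIV)" by measurable
  qed measurable
next
  fix \<omega> assume w: "\<omega> \<in> space M"
  define a where "a m = (of_int \<lfloor>\<sigma> \<omega> * real (Suc m)\<rfloor> + 1) / real (Suc m)" for m
  have a: "\<sigma> \<omega> < a m" "a m \<le> \<sigma> \<omega> + 1 / real (Suc m)" for m
  proof -
    have "\<sigma> \<omega> * real (Suc m) < of_int \<lfloor>\<sigma> \<omega> * real (Suc m)\<rfloor> + 1" "of_int \<lfloor>\<sigma> \<omega> * real (Suc m)\<rfloor> + 1 \<le> \<sigma> \<omega> * real (Suc m) + 1"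
      by linarith+
    then show "\<sigma> \<omega> < a m" "a m \<le> \<sigma> \<omega> + 1 / real (Suc m)"
      unfolding a_def by (simp_all add: less_divide_eq divide_le_eq distrib_right del: of_nat_Suc)
  qed
  have "a \<longlonglongrightarrow> \<sigma> \<omega>"
  proof (rule tendsto_sandwich[of "\<lambda>_. \<sigma> \<omega>" _ _ "\<lambda>k. \<sigma> \<omega> + 1 / real (Suc k)"])
    show "(\<lambda>k. \<sigma> \<omega> + 1 / real (Suc k)) \<longlonglongrightarrow> \<sigma> \<omega>" using LIMSEQ_inverse_real_of_nat_add[of "\<sigma> \<omega>"] by (simp add: inverse_eq_divide)
  qed (use a in \<open>auto intro!: always_eventually less_imp_le\<close>)
  moreover have "a m \<noteq> \<sigma> \<omega>" "a m \<in> {\<sigma> \<omega><..}" for m using a(1)[of m] by auto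
  ultimately have "filterlim a (at_right (\<sigma> \<omega>)) sequentially" by (simp add: filterlim_at)
  from filterlim_compose[OF W_right[OF w pos[OF w]] this]
  show "(\<lambda>m. W ((of_int \<lfloor>\<sigma> \<omega> * real (Suc m)\<rfloor> + 1) / real (Suc m)) \<omega>) \<longlonglongrightarrow> W (\<sigma> \<omega>) \<omega>" by (simp add: a_def)
qed

lemma phi_not_zero:
  assumes fin: "AE \<omega> in M. first_pos V \<omega> < \<infinity>"
  shows "\<exists>n<N. phi n > 0"
proof (rule ccontr)
  assume "\<not> (\<exists>n<N. phi n > 0)"
  then have z: "phi n = 0" if "n < N" for n using phi_nonneg[OF that] that by force
  have D1: "D 0 s \<omega> = 1" if "\<omega> \<in> space M" "s \<ge> 0" for s \<omega>
  proof -
    have "integral {0..s} (\<lambda>u. phi (J u \<omega>)) = integral {0..s} (\<lambda>u. 0)" using that by (intro integral_cong z J_less) auto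
    then show ?thesis by (simp add: D_def path_survival_def)
  qed
  have "AE \<omega> in M. V (real k) \<omega> = 0" for k :: nat
  proof -
    have "(\<integral>\<omega>. iexp (0 * W (real k) \<omega>) * (if V (real k) \<omega> = 0 then 1 else 0) \<partial>M) = (\<integral>\<omega>. Y 0 0 (real k) \<omega> * of_real (D 0 (real k) \<omega>) \<partial>M)"
      by (rule survival_char) auto
    also have "\<dots> = (\<integral>\<omega>. 1 \<partial>M)" by (intro Bochner_Integration.integral_cong refl) (simp add: Y_zero D1)
    finally have "(\<integral>\<omega>. complex_of_real (if V (real k) \<omega> = 0 then 1 else 0) \<partial>M) = 1"
      using prob_space by (simp add: if_distrib cong: if_cong)
    then have e: "(\<integral>\<omega>. (if V (real k) \<omega> = 0 then 1 else 0) \<partial>M) = (1::real)"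
      unfolding integral_complex_of_real by (metis of_real_eq_1_iff)
    have i: "integrable M (\<lambda>\<omega>. if V (real k) \<omega> = 0 then 1 else 0 :: real)" by (rule integrable_const_bound[where B=1]) auto
    have "(\<integral>\<omega>. 1 - (if V (real k) \<omega> = 0 then 1 else 0) \<partial>M) = (0::real)" using e i prob_space by simp
    then have "AE \<omega> in M. 1 - (if V (real k) \<omega> = 0 then 1 else 0) = (0::real)"
      using i by (subst (asm) integral_nonneg_eq_0_iff_AE) auto
    then show ?thesis by eventually_elim (auto split: if_splits)
  qed
  then have "AE \<omega> in M. \<forall>k::nat. V (real k) \<omega> = 0" by (simp add: AE_all_countable)
  then have "AE \<omega> in M. False" using regular_AE fin AE_space
  proof eventually_elim
    case (elim \<omega>)
    obtain k :: nat where "tau \<omega> < real k" using reals_Archimedean2 by blast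
    then show ?case using tau_char(2)[OF elim(4,2,3), of "real k"] elim(1) by auto
  qed
  then show False by simp
qed

lemma survival_prob_limit:
  assumes fin: "AE \<omega> in M. first_pos V \<omega> < \<infinity>"
  shows "(\<lambda>R. measure M {\<omega>\<in>space M. real R < tau \<omega>}) \<longlonglongrightarrow> 0"
proof -
  have "(\<lambda>R. measure M {\<omega>\<in>space M. real R < tau \<omega>}) \<longlonglongrightarrow> measure M (\<Inter>R. {\<omega>\<in>space M. real R < tau \<omega>})"
    by (rule finite_Lim_measure_decseq) (auto simp: decseq_def)
  moreover have "(\<Inter>R::nat. {\<omega>\<in>space M. real R < tau \<omega>}) = {}"
  proof -
    have "\<exists>R::nat. \<not> real R < tau \<omega>" for \<omega> using reals_Archimedean2[of "tau \<omega>"] by (auto intro: less_imp_le simp: not_less)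
    then show ?thesis by auto
  qed
  ultimately show ?thesis by simp
qed

end

section \<open>Convergence of the discretised stopped laws\<close>

lemma telescope_first:
  fixes f :: "nat \<Rightarrow> 'b::comm_ring_1"
  shows "(\<Sum>k<n. f (Suc k) * ((if k < a then 1 else 0) - (if Suc k < a then 1 else 0))) + f n * (if n < a then 1 else 0)
    = (if 0 < a then f (min a n) else 0)"
proof (induction n)
  case 0 show ?case by simp
next
  case (Suc n)
  have "(\<Sum>k<Suc n. f (Suc k) * ((if k < a then 1 else 0) - (if Suc k < a then 1 else 0))) + f (Suc n) * (if Suc n < a then 1 else 0)
    = (\<Sum>k<n. f (Suc k) * ((if k < a then 1 else 0) - (if Suc k < a then 1 else 0))) + f n * (if n < a then 1 else 0)
      + (f (Suc n) - f n) * (if n < a then 1 else 0)"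
    by (simp add: algebra_simps)
  also have "\<dots> = (if 0 < a then f (min a n) else 0) + (f (Suc n) - f n) * (if n < a then 1 else 0)" unfolding Suc ..
  also have "\<dots> = (if 0 < a then f (min a (Suc n)) else 0)"
    by (cases "n < a") (auto simp: min_def dest: le_antisym[OF Suc_leI])
  finally show ?case .
qed

lemma grid_euler_bound:
  assumes "\<And>i. cmod (F i) \<le> 1" "\<And>i. \<bar>p i\<bar> \<le> P"
  shows "cmod (grid_euler F p i k) \<le> 1 + real k * P"
proof (induction k arbitrary: i)
  case (Suc k)
  have "cmod (F i * grid_euler F p (Suc i) k) \<le> 1 * (1 + real k * P)"
    unfolding norm_mult using Suc[of "Suc i"] assms(1)[of i] by (intro mult_mono) auto
  then have "cmod (grid_euler F p i (Suc k)) \<le> P + (1 + real k * P)"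
    unfolding grid_euler.simps using assms(2)[of i] by (intro order_trans[OF norm_triangle_ineq] add_mono) auto
  then show ?case by (simp add: algebra_simps)
qed simp

context mm_process
begin

definition euler_weight where "euler_weight th h n n' = exp (of_real h * (psi n th - of_real (phi n))) * chi th n n'"

lemma euler_weight_le: "0 \<le> h \<Longrightarrow> n < N \<Longrightarrow> n' < N \<Longrightarrow> cmod (euler_weight th h n n') \<le> 1"
proof -
  assume a: "0 \<le> h" "n < N" "n' < N"
  have "Re (of_real h * (psi n th - of_real (phi n))) = h * (Re (psi n th) - phi n)" by simp
  also have "\<dots> \<le> 0" using a Re_psi[of n th] phi_nonneg[of n] by (intro mult_nonneg_nonpos) auto
  finally have "cmod (exp (of_real h * (psi n th - of_real (phi n)))) \<le> 1" by simp
  then show ?thesis unfolding euler_weight_def norm_mult using chi_le[OF a(2,3), of th] by (intro mult_le_one) auto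
qed

lemma stopped_char_limit:
  assumes fin: "AE \<omega> in M. first_pos V \<omega> < \<infinity>" and R: "R > 0"
  shows "(\<lambda>m. \<Sum>n<N. of_real (varpi n) * euler_expect (1 / real (Suc m)) (euler_weight th (1 / real (Suc m))) (\<lambda>n. 1 / real (Suc m) * phi n) (R * Suc m) n)
     \<longlonglongrightarrow> (\<integral>\<omega>. iexp (th * W (min (tau \<omega>) (real R)) \<omega>) \<partial>M)"
proof -
  define h where "h m = 1 / real (Suc m)" for m
  define Js where "Js m = R * Suc m" for m
  have h0: "h m > 0" for m by (simp add: h_def)
  have Jh: "real (Js m) * h m = real R" for m unfolding Js_def h_def of_nat_mult by (simp del: of_nat_Suc mult_Suc_right)
  have hR: "real R / real (Js m) = h m" for m using R unfolding Js_def h_def of_nat_mult by (simp del: of_nat_Suc mult_Suc_right)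
  define I where "I m k \<omega> = (if V (real k * h m) \<omega> = 0 then 1 else 0 :: complex)" for m k \<omega>
  define f where "f m k \<omega> = iexp (th * W (real k * h m) \<omega>)" for m k \<omega>
  define X where "X m \<omega> = (\<Sum>k<Js m. f m (Suc k) \<omega> * (I m k \<omega> - I m (Suc k) \<omega>)) + f m (Js m) \<omega> * I m (Js m) \<omega>" for m \<omega>
  have [measurable]: "I m k \<in> borel_measurable M" "f m k \<in> borel_measurable M" for m k unfolding I_def f_def by measurable
  have [measurable]: "X m \<in> borel_measurable M" for m unfolding X_def by measurable
  define E where "E \<omega> = iexp (th * W (min (tau \<omega>) (real R)) \<omega>)" for \<omega>
  have WR[measurable]: "(\<lambda>\<omega>. W (min (tau \<omega>) (real R)) \<omega>) \<in> borel_measurable M"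
    by (rule W_at_meas) (auto simp: tau_nonneg)
  have E_meas: "E \<in> borel_measurable M" unfolding E_def by measurable
  have Xform: "X m \<omega> = iexp (th * W (min (real (nat \<lceil>tau \<omega> * real (Suc m)\<rceil>) * h m) (real R)) \<omega>)"
    if w: "\<omega> \<in> space M" "regular \<omega>" "first_pos V \<omega> < \<infinity>" for \<omega> m
  proof -
    define a where "a = nat \<lceil>tau \<omega> * real (Suc m)\<rceil>"
    have tp: "tau \<omega> > 0" using tau_char(1)[OF w] .
    have a0: "a > 0" using tp by (simp add: a_def)
    have Ik: "I m k \<omega> = (if k < a then 1 else 0)" for k
    proof -
      have "V (real k * h m) \<omega> = 0 \<longleftrightarrow> real k * h m < tau \<omega>" using h0[of m] by (intro tau_char(2)[OF w]) auto
      also have "\<dots> \<longleftrightarrow> real k < tau \<omega> * real (Suc m)" by (simp add: h_def divide_less_eq)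
      also have "\<dots> \<longleftrightarrow> k < a"
      proof -
        have "real k < tau \<omega> * real (Suc m) \<longleftrightarrow> int k < \<lceil>tau \<omega> * real (Suc m)\<rceil>" by (simp add: less_ceiling_iff)
        also have "\<dots> \<longleftrightarrow> k < a" unfolding a_def by (simp add: zless_nat_eq_int_zless)
        finally show ?thesis .
      qed
      finally show ?thesis by (simp add: I_def)
    qed
    have "X m \<omega> = f m (min a (Js m)) \<omega>" unfolding X_def Ik using telescope_first[of "\<lambda>k. f m k \<omega>" a "Js m"] a0 by simp
    also have "real (min a (Js m)) * h m = min (real a * h m) (real R)"
      using h0[of m] Jh[of m] by (simp add: of_nat_min min_mult_distrib_right less_imp_le)
    then have "f m (min a (Js m)) \<omega> = iexp (th * W (min (real a * h m) (real R)) \<omega>)" unfolding f_def by simp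
    finally show ?thesis unfolding a_def .
  qed
  have Xlim: "AE \<omega> in M. (\<lambda>m. X m \<omega>) \<longlonglongrightarrow> E \<omega>"
    using regular_AE fin AE_space
  proof eventually_elim
    case (elim \<omega>)
    define t where "t = tau \<omega>"
    have tp: "t > 0" using tau_char(1)[OF elim(3,1,2)] by (simp add: t_def)
    define b where "b m = real (nat \<lceil>t * real (Suc m)\<rceil>) * h m" for m
    have b: "t \<le> b m" "b m \<le> t + h m" for m
    proof -
      have e: "real (nat \<lceil>t * real (Suc m)\<rceil>) = of_int \<lceil>t * real (Suc m)\<rceil>" using tp by simp
      have "t * real (Suc m) \<le> of_int \<lceil>t * real (Suc m)\<rceil>" "of_int \<lceil>t * real (Suc m)\<rceil> \<le> t * real (Suc m) + 1" by linarith+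
      then show "t \<le> b m" "b m \<le> t + h m" unfolding b_def e h_def
        by (simp_all add: le_divide_eq divide_le_eq distrib_right del: of_nat_Suc)
    qed
    have hl: "h \<longlonglongrightarrow> 0" unfolding h_def using LIMSEQ_inverse_real_of_nat by (simp add: inverse_eq_divide)
    have blim: "b \<longlonglongrightarrow> t"
    proof (rule tendsto_sandwich[of "\<lambda>_. t" _ _ "\<lambda>m. t + h m"])
      show "(\<lambda>m. t + h m) \<longlonglongrightarrow> t" using tendsto_add[OF tendsto_const hl, of t] by simp
    qed (use b in auto)
    have "(\<lambda>m. W (min (b m) (real R)) \<omega>) \<longlonglongrightarrow> W (min t (real R)) \<omega>"
    proof (cases "t < real R")
      case False
      then have "min (b m) (real R) = real R" for m using b(1)[of m] by simp
      then show ?thesis using False by simp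
    next
      case True
      have mt: "min t (real R) = t" using True by simp
      have ge: "t \<le> min (b m) (real R)" for m using b(1)[of m] True by simp
      have mlim: "(\<lambda>m. min (b m) (real R)) \<longlonglongrightarrow> t" using tendsto_min[OF blim tendsto_const[of "real R"]] True by simp
      have cont: "continuous (at t within {t..}) (\<lambda>u. W u \<omega>)"
        using W_right[OF elim(3), of t] tp unfolding continuous_within by (simp add: at_within_Ici_at_right)
      show ?thesis unfolding mt
        by (rule continuous_within_tendsto_compose'[OF cont _ mlim]) (use ge in auto)
    qed
    then show ?case unfolding Xform[OF elim(3,1,2)] E_def b_def t_def
      by (intro tendsto_exp tendsto_mult tendsto_const tendsto_of_real)
  qed
  have Xbound: "AE \<omega> in M. cmod (X m \<omega>) \<le> 1" for m
    using regular_AE fin AE_space by eventually_elim (simp add: Xform)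
  have l1: "(\<lambda>m. \<integral>\<omega>. X m \<omega> \<partial>M) \<longlonglongrightarrow> (\<integral>\<omega>. E \<omega> \<partial>M)"
    by (rule integral_dominated_convergence[where w="\<lambda>_. 1"]) (use Xlim Xbound E_meas in auto)
  define ty where "ty m i = real i * h m" for m i
  define AL where "AL m \<omega> = grid_killed (\<lambda>i. Y th (0 + real i * h m) (0 + real i * h m + h m) \<omega>) (\<lambda>i. D (0 + real i * h m) (0 + real i * h m + h m) \<omega>) 0 (Js m)" for m \<omega>
  define BE where "BE m \<omega> = grid_euler (\<lambda>i. euler_weight th (h m) (J (real i * h m) \<omega>) (J (real i * h m + h m) \<omega>)) (\<lambda>i. h m * phi (J (real i * h m) \<omega>)) 0 (Js m)" for m \<omega>
  have k0: "0 \<le> real k * h m" for k m using h0[of m] by simp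
  have kS: "real k * h m \<le> real (Suc k) * h m" for k m using h0[of m] by (simp add: mult_right_mono)
  have Ym[measurable]: "Y th 0 (real k * h m) \<in> borel_measurable M" for k m by (rule Y_meas[OF order_refl k0])
  have Dm[measurable]: "D 0 (real k * h m) \<in> borel_measurable M" for k m by (rule D_meas[OF order_refl k0])
  have ALform: "AL m \<omega> = (\<Sum>k<Js m. Y th 0 (real (Suc k) * h m) \<omega> * of_real (D 0 (real k * h m) \<omega> - D 0 (real (Suc k) * h m) \<omega>))
      + Y th 0 (real (Js m) * h m) \<omega> * of_real (D 0 (real (Js m) * h m) \<omega>)" if w: "\<omega> \<in> space M" for m \<omega>
  proof -
    have py: "(\<Prod>i<k. Y th (0 + real i * h m) (0 + real i * h m + h m) \<omega>) = Y th 0 (real k * h m) \<omega>" for k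
      unfolding Y_def using path_char_prod(1)[OF J_cadlag[OF w] order_refl less_imp_le[OF h0[of m]], of "\<lambda>n. psi n th" "chi th" k] by simp
    have pd: "(\<Prod>i<k. D (0 + real i * h m) (0 + real i * h m + h m) \<omega>) = D 0 (real k * h m) \<omega>" for k
      unfolding D_def using path_char_prod(2)[OF J_cadlag[OF w] order_refl less_imp_le[OF h0[of m]], of phi k] by simp
    show ?thesis unfolding AL_def grid_killed_closed_form py pd ..
  qed
  have AL_meas[measurable]: "AL m \<in> borel_measurable M" for m
  proof -
    have "(\<lambda>\<omega>. (\<Sum>k<Js m. Y th 0 (real (Suc k) * h m) \<omega> * of_real (D 0 (real k * h m) \<omega> - D 0 (real (Suc k) * h m) \<omega>))
      + Y th 0 (real (Js m) * h m) \<omega> * of_real (D 0 (real (Js m) * h m) \<omega>)) \<in> borel_measurable M" by measurable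
    then show ?thesis by (rule subst[OF measurable_cong[THEN sym], rotated]) (rule ALform)
  qed
  have AL_le: "cmod (AL m \<omega>) \<le> 1" if w: "\<omega> \<in> space M" for m \<omega>
    unfolding AL_def
  proof (rule grid_killed_le_1)
    fix i
    have "0 \<le> 0 + real i * h m" "0 + real i * h m \<le> 0 + real i * h m + h m" using k0[of i m] h0[of m] by auto
    note st = this
    show "cmod (Y th (0 + real i * h m) (0 + real i * h m + h m) \<omega>) \<le> 1" by (rule Y_le[OF w st])
    show "0 \<le> D (0 + real i * h m) (0 + real i * h m + h m) \<omega> \<and> D (0 + real i * h m) (0 + real i * h m + h m) \<omega> \<le> 1"
      using D_le[OF w st] D_pos less_imp_le by blast
  qed
  have EX: "(\<integral>\<omega>. X m \<omega> \<partial>M) = (\<integral>\<omega>. AL m \<omega> \<partial>M)" for m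
  proof -
    have if1: "integrable M (\<lambda>\<omega>. f m k \<omega> * I m l \<omega>)" for k l
      by (rule integrable_const_bound[where B=1]) (auto simp: f_def I_def norm_mult)
    have iy: "integrable M (\<lambda>\<omega>. Y th 0 (real k * h m) \<omega> * of_real (D 0 (real l * h m) \<omega>))" for k l
    proof (rule integrable_const_bound[where B=1])
      have "cmod (Y th 0 (real k * h m) \<omega> * of_real (D 0 (real l * h m) \<omega>)) \<le> 1" if w: "\<omega> \<in> space M" for \<omega>
        unfolding norm_mult using Y_le[OF w order_refl k0] D_le[OF w order_refl k0[of l m]] D_pos[of 0 "real l * h m" \<omega>]
        by (intro mult_le_one) auto
      then show "AE \<omega> in M. cmod (Y th 0 (real k * h m) \<omega> * of_real (D 0 (real l * h m) \<omega>)) \<le> 1" by simp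
    qed measurable
    have sc: "(\<integral>\<omega>. f m k \<omega> * I m l \<omega> \<partial>M) = (\<integral>\<omega>. Y th 0 (real k * h m) \<omega> * of_real (D 0 (real l * h m) \<omega>) \<partial>M)" if "l \<le> k" for k l
      unfolding f_def I_def by (rule survival_char[OF k0]) (use that h0[of m] in \<open>auto intro!: mult_right_mono\<close>)
    have "(\<integral>\<omega>. X m \<omega> \<partial>M) = (\<integral>\<omega>. (\<Sum>k<Js m. f m (Suc k) \<omega> * I m k \<omega> - f m (Suc k) \<omega> * I m (Suc k) \<omega>) + f m (Js m) \<omega> * I m (Js m) \<omega> \<partial>M)"
      unfolding X_def by (simp add: right_diff_distrib)
    also have "\<dots> = (\<Sum>k<Js m. (\<integral>\<omega>. f m (Suc k) \<omega> * I m k \<omega> \<partial>M) - (\<integral>\<omega>. f m (Suc k) \<omega> * I m (Suc k) \<omega> \<partial>M)) + (\<integral>\<omega>. f m (Js m) \<omega> * I m (Js m) \<omega> \<partial>M)"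
      using if1 by simp
    also have "\<dots> = (\<Sum>k<Js m. (\<integral>\<omega>. Y th 0 (real (Suc k) * h m) \<omega> * of_real (D 0 (real k * h m) \<omega>) \<partial>M) - (\<integral>\<omega>. Y th 0 (real (Suc k) * h m) \<omega> * of_real (D 0 (real (Suc k) * h m) \<omega>) \<partial>M))
       + (\<integral>\<omega>. Y th 0 (real (Js m) * h m) \<omega> * of_real (D 0 (real (Js m) * h m) \<omega>) \<partial>M)"
      using sc by (simp del: of_nat_Suc)
    also have "\<dots> = (\<integral>\<omega>. (\<Sum>k<Js m. Y th 0 (real (Suc k) * h m) \<omega> * of_real (D 0 (real k * h m) \<omega>) - Y th 0 (real (Suc k) * h m) \<omega> * of_real (D 0 (real (Suc k) * h m) \<omega>))
       + Y th 0 (real (Js m) * h m) \<omega> * of_real (D 0 (real (Js m) * h m) \<omega>) \<partial>M)"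
      using iy by (simp del: of_nat_Suc)
    also have "\<dots> = (\<integral>\<omega>. AL m \<omega> \<partial>M)"
      by (intro Bochner_Integration.integral_cong refl) (simp add: ALform right_diff_distrib del: of_nat_Suc)
    finally show ?thesis .
  qed
  have BE_bound: "cmod (BE m \<omega>) \<le> 1 + real R * Pmax" if w: "\<omega> \<in> space M" for m \<omega>
  proof -
    have "cmod (BE m \<omega>) \<le> 1 + real (Js m) * (h m * Pmax)" unfolding BE_def
    proof (rule grid_euler_bound)
      fix i
      have j1: "J (real i * h m) \<omega> < N" by (rule J_less[OF w k0])
      have j2: "J (real i * h m + h m) \<omega> < N" using k0[of i m] h0[of m] by (intro J_less[OF w]) auto
      show "cmod (euler_weight th (h m) (J (real i * h m) \<omega>) (J (real i * h m + h m) \<omega>)) \<le> 1"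
        using h0[of m] j1 j2 by (intro euler_weight_le) auto
      have "0 \<le> h m * phi (J (real i * h m) \<omega>)" using h0[of m] phi_nonneg[OF j1] by simp
      then have "\<bar>h m * phi (J (real i * h m) \<omega>)\<bar> = h m * phi (J (real i * h m) \<omega>)" by (rule abs_of_nonneg)
      also have "\<dots> \<le> h m * Pmax" using h0[of m] Pmax[OF j1] by (intro mult_left_mono) auto
      finally show "\<bar>h m * phi (J (real i * h m) \<omega>)\<bar> \<le> h m * Pmax" .
    qed
    then show ?thesis using Jh[of m] by (simp add: mult.assoc[symmetric])
  qed
  have BE_meas[measurable]: "BE m \<in> borel_measurable M" for m
  proof -
    have "(\<lambda>\<omega>. grid_euler (\<lambda>i. euler_weight th (h m) (J (real i * h m) \<omega>) (J (real i * h m + h m) \<omega>)) (\<lambda>i. h m * phi (J (real i * h m) \<omega>)) i k) \<in> borel_measurable M" for i k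
    proof (induction k arbitrary: i)
      case (Suc k)
      note [measurable] = Suc
      show ?case unfolding grid_euler.simps by measurable
    qed simp
    then show ?thesis unfolding BE_def .
  qed
  have BE_int: "integrable M (BE m)" for m
    by (rule integrable_const_bound[where B="1 + real R * Pmax"]) (use BE_bound in auto)
  have AL_int: "integrable M (AL m)" for m
    by (rule integrable_const_bound[where B=1]) (use AL_le in auto)
  have diff: "(\<lambda>m. AL m \<omega> - BE m \<omega>) \<longlonglongrightarrow> 0" if w: "\<omega> \<in> space M" for \<omega>
  proof -
    have R0: "real R > 0" using R by simp
    have sm: "strict_mono Js" unfolding Js_def strict_mono_def using R by simp
    have "(\<lambda>m. grid_killed (\<lambda>i. path_char (\<lambda>n. psi n th) (chi th) (\<lambda>u. J u \<omega>) (0 + real i * (real R / real m)) (0 + real i * (real R / real m) + real R / real m))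
               (\<lambda>i. path_survival phi (\<lambda>u. J u \<omega>) (0 + real i * (real R / real m)) (0 + real i * (real R / real m) + real R / real m)) 0 m
           - grid_euler (\<lambda>i. exp (of_real (real R / real m) * (psi (J (0 + real i * (real R / real m)) \<omega>) th - of_real (phi (J (0 + real i * (real R / real m)) \<omega>))))
                * chi th (J (0 + real i * (real R / real m)) \<omega>) (J (0 + real i * (real R / real m) + real R / real m) \<omega>))
               (\<lambda>i. real R / real m * phi (J (0 + real i * (real R / real m)) \<omega>)) 0 m) \<longlonglongrightarrow> 0"
      by (intro discretised_limit(1)[where j="\<lambda>u. J u \<omega>" and N=N and Q="Qmax th" and P=Pmax and phi=phi and q="\<lambda>n. psi n th" and a="chi th"]
          J_cadlag J_less Re_psi Qmax phi_nonneg Pmax chi_le chi_refl R0 order_refl w)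
    from LIMSEQ_subseq_LIMSEQ[OF this sm] show ?thesis
      unfolding o_def hR AL_def BE_def Y_def D_def euler_weight_def by simp
  qed
  have l2: "(\<lambda>m. \<integral>\<omega>. AL m \<omega> - BE m \<omega> \<partial>M) \<longlonglongrightarrow> (\<integral>\<omega>. 0 \<partial>M)"
  proof (rule integral_dominated_convergence[where w="\<lambda>_. 2 + real R * Pmax"])
    show "AE \<omega> in M. (\<lambda>m. AL m \<omega> - BE m \<omega>) \<longlonglongrightarrow> 0" using diff by simp
    have "cmod (AL m \<omega> - BE m \<omega>) \<le> 2 + real R * Pmax" if "\<omega> \<in> space M" for m \<omega>
      using norm_triangle_ineq4[of "AL m \<omega>" "BE m \<omega>"] AL_le[OF that, of m] BE_bound[OF that, of m] by linarith
    then show "AE \<omega> in M. cmod (AL m \<omega> - BE m \<omega>) \<le> 2 + real R * Pmax" for m by simp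
  qed auto
  have "(\<lambda>m. (\<integral>\<omega>. X m \<omega> \<partial>M) - (\<integral>\<omega>. AL m \<omega> - BE m \<omega> \<partial>M)) \<longlonglongrightarrow> (\<integral>\<omega>. E \<omega> \<partial>M) - (\<integral>\<omega>. 0 \<partial>M)"
    by (rule tendsto_diff[OF l1 l2])
  moreover have "(\<integral>\<omega>. X m \<omega> \<partial>M) - (\<integral>\<omega>. AL m \<omega> - BE m \<omega> \<partial>M) = (\<integral>\<omega>. BE m \<omega> \<partial>M)" for m
    unfolding EX using AL_int BE_int by simp
  moreover have "(\<integral>\<omega>. BE m \<omega> \<partial>M) = (\<Sum>n<N. of_real (varpi n) * euler_expect (h m) (euler_weight th (h m)) (\<lambda>n. h m * phi n) (Js m) n)" for m
    unfolding BE_def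
    by (rule expectation_grid_euler) (use h0[of m] euler_weight_le BE_int[of m, unfolded BE_def[abs_def]] in \<open>auto simp: less_imp_le\<close>)
  ultimately show ?thesis by (simp add: E_def h_def Js_def)
qed

end

lemma weak_conv_tail:
  assumes \<nu>: "\<And>m. real_distribution (\<nu> m)" and L: "real_distribution L" and wc: "weak_conv_m \<nu> L"
    and x: "isCont (cdf L) x"
  shows "(\<lambda>m. measure (\<nu> m) {x<..}) \<longlonglongrightarrow> measure L {x<..}"
proof -
  have t: "measure Q {x<..} = 1 - cdf Q x" if "real_distribution Q" for Q
  proof -
    interpret real_distribution Q by fact
    have "measure Q {x<..} = measure Q (space Q - {..x})" by (rule arg_cong[where f="measure Q"]) auto
    also have "\<dots> = 1 - measure Q {..x}" by (rule prob_compl) simp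
    finally show ?thesis by (simp add: cdf_def)
  qed
  have "(\<lambda>m. cdf (\<nu> m) x) \<longlonglongrightarrow> cdf L x" using wc x by (auto simp: weak_conv_m_def weak_conv_def)
  then show ?thesis unfolding t[OF \<nu>] t[OF L] by (intro tendsto_intros)
qed

lemma (in real_distribution) continuity_point_between:
  assumes "a < b"
  shows "\<exists>x. a < x \<and> x < b \<and> isCont (cdf M) x"
proof -
  have "countable {x. measure M {x} \<noteq> 0}" by (rule countable_support)
  moreover have "uncountable {a<..<b}" using assms by (simp add: uncountable_open_interval)
  ultimately have "\<not> {a<..<b} \<subseteq> {x. measure M {x} \<noteq> 0}" using countable_subset by blast
  then obtain x where "a < x" "x < b" "measure M {x} = 0" by auto
  then show ?thesis using isCont_cdf by auto
qed

context mm_process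
begin

lemma euler_expect_rho_close:
  assumes par: "mm_params N Gen mu nu phi"
  shows "\<exists>K\<ge>0. \<forall>h Mr k n. mm_params.roots N Gen mu nu phi h Mr \<longrightarrow> (\<forall>n<N. char (Mr n) th = exp (of_real h * psi n th)) \<longrightarrow> n < N \<longrightarrow>
     cmod (euler_expect h (euler_weight th h) (\<lambda>n. h * phi n) k n - char (mm_params.rho N Gen nu phi h Mr k n) th) \<le> (1 + K * h\<^sup>2) ^ k - 1"
proof -
  interpret P: mm_params N Gen mu nu phi by fact
  obtain K where K: "K \<ge> 0" "\<And>h i j. 0 \<le> h \<Longrightarrow> h \<le> 1 \<Longrightarrow> i < N \<Longrightarrow> j < N \<Longrightarrow>
    \<bar>mat_exp h Gen $$ (i,j) - ((if i = j then 1 else 0) + h * Gen $$ (i,j))\<bar> \<le> K * h\<^sup>2"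
    using mat_exp_expansion[OF Gen_carrier] by blast
  define G where "G = (\<Sum>i<N. \<Sum>j<N. \<bar>Gen $$ (i,j)\<bar>)"
  have G: "\<bar>Gen $$ (i,j)\<bar> \<le> G" if "i < N" "j < N" for i j
  proof -
    have "\<bar>Gen $$ (i,j)\<bar> \<le> (\<Sum>j<N. \<bar>Gen $$ (i,j)\<bar>)" using that by (intro member_le_sum[of j]) auto
    also have "\<dots> \<le> G" unfolding G_def using that by (intro member_le_sum[of i "{..<N}" "\<lambda>i. \<Sum>j<N. \<bar>Gen $$ (i,j)\<bar>"]) (auto intro: sum_nonneg)
    finally show ?thesis .
  qed
  have G0: "G \<ge> 0" unfolding G_def by (intro sum_nonneg) auto
  let ?Q = "Qmax th" and ?P = Pmax
  have Q0: "?Q \<ge> 0" unfolding Qmax_def by (intro sum_nonneg) auto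
  have P0: "?P \<ge> 0" unfolding Pmax_def using phi_nonneg by (intro sum_nonneg) auto
  define K0 where "K0 = K + G * (?Q + ?P) + (G * ?P + (1 + G) * (exp ?P * ?P\<^sup>2))"
  have K0: "K0 \<ge> 0" unfolding K0_def using K G0 Q0 P0 by simp
  define C where "C h n n' = of_real (mat_exp h Gen $$ (n,n')) * euler_weight th h n n'" for h n n'
  define Ch where "Ch h n n' = (if n = n' then of_real (1 - h * P.exit_rate n) * exp (of_real h * psi n th) else of_real (h * Gen $$ (n,n')) * chi th n n')" for h n n'
  have CCh: "cmod (C h n n' - Ch h n n') \<le> K0 * h\<^sup>2" if h: "0 \<le> h" "h \<le> 1" and n: "n < N" "n' < N" for h n n'
  proof -
    define g where "g = Gen $$ (n,n')"
    define \<rho> where "\<rho> = mat_exp h Gen $$ (n,n') - ((if n = n' then 1 else 0) + h * g)"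
    have \<rho>: "\<bar>\<rho>\<bar> \<le> K * h\<^sup>2" unfolding \<rho>_def g_def by (rule K(2)[OF h n])
    have g: "\<bar>g\<bar> \<le> G" unfolding g_def by (rule G[OF n])
    have me: "mat_exp h Gen $$ (n,n') = (if n = n' then 1 else 0) + h * g + \<rho>" by (simp add: \<rho>_def)
    define e where "e = exp (of_real h * (psi n th - of_real (phi n)))"
    have Re_e: "Re (of_real h * (psi n th - of_real (phi n))) \<le> 0"
      using h Re_psi[OF n(1), of th] phi_nonneg[OF n(1)] by (simp add: mult_nonneg_nonpos)
    have e1: "cmod e \<le> 1" using Re_e by (simp add: e_def)
    have nz: "cmod (psi n th - of_real (phi n)) \<le> ?Q + ?P"
      using norm_triangle_ineq4[of "psi n th" "of_real (phi n)"] Qmax[OF n(1), of th] Pmax[OF n(1)] phi_nonneg[OF n(1)] by simp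
    show ?thesis
    proof (cases "n = n'")
      case False
      have "cmod (e - 1) \<le> cmod (of_real h * (psi n th - of_real (phi n)) - 0)"
        using cmod_exp_diff_le[OF Re_e, of 0] by (simp add: e_def)
      also have "\<dots> \<le> h * (?Q + ?P)" using h nz by (simp add: norm_mult mult_left_mono)
      finally have em: "cmod (e - 1) \<le> h * (?Q + ?P)" .
      have "C h n n' - Ch h n n' = chi th n n' * (of_real (h * g) * (e - 1) + of_real \<rho> * e)"
        using False by (simp add: C_def Ch_def euler_weight_def me e_def g_def algebra_simps)
      also have "cmod \<dots> \<le> 1 * (cmod (of_real (h * g) * (e - 1)) + cmod (of_real \<rho> * e))"
        unfolding norm_mult[of "chi th n n'"] using chi_le[OF n, of th] by (intro mult_mono norm_triangle_ineq) auto
      also have "\<dots> \<le> (h * G) * (h * (?Q + ?P)) + (K * h\<^sup>2) * 1"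
        unfolding norm_mult norm_of_real mult_1
        using em \<rho> e1 h g K(1) G0 Q0 P0 by (intro add_mono mult_mono) (auto simp: abs_mult mult_left_mono)
      also have "\<dots> = (K + G * (?Q + ?P)) * h\<^sup>2" by (simp add: power2_eq_square algebra_simps)
      also have "\<dots> \<le> K0 * h\<^sup>2" unfolding K0_def using G0 P0 by (intro mult_right_mono) auto
      finally show ?thesis .
    next
      case True
      define r2 where "r2 = exp (- (h * phi n)) - 1 - (- (h * phi n))"
      have r2: "\<bar>r2\<bar> \<le> exp ?P * ?P\<^sup>2 * h\<^sup>2"
      proof -
        have hp: "0 \<le> h * phi n" "h * phi n \<le> h * ?P" using h phi_nonneg[OF n(1)] Pmax[OF n(1)] by (auto intro: mult_left_mono)
        have "h * ?P \<le> 1 * ?P" using h P0 by (intro mult_right_mono) auto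
        then have hp1: "h * phi n \<le> ?P" using hp by linarith
        have "complex_of_real r2 = exp (- of_real (h * phi n)) - 1 - (- of_real (h * phi n))" unfolding r2_def by (simp flip: exp_of_real)
        then have "\<bar>r2\<bar> = cmod (exp (- complex_of_real (h * phi n)) - 1 - (- of_real (h * phi n)))" by (metis norm_of_real)
        also have "\<dots> \<le> exp (cmod (- complex_of_real (h * phi n))) * (cmod (- complex_of_real (h * phi n)))\<^sup>2" by (rule cmod_exp_minus_1_minus_le)
        also have "cmod (- complex_of_real (h * phi n)) = h * phi n" unfolding norm_minus_cancel norm_of_real using hp(1) by (rule abs_of_nonneg)
        also have "exp (h * phi n) * (h * phi n)\<^sup>2 \<le> exp ?P * (h * ?P)\<^sup>2" by (intro mult_mono power_mono[OF hp(2) hp(1)]) (use hp1 in auto)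
        finally show ?thesis by (simp add: power_mult_distrib mult_ac)
      qed
      have er: "exp (- (h * phi n)) = 1 - h * phi n + r2" by (simp add: r2_def)
      have ee: "e = exp (of_real h * psi n th) * of_real (exp (- (h * phi n)))"
        unfolding e_def by (simp add: right_diff_distrib exp_diff exp_minus divide_inverse flip: exp_of_real)
      have ep: "cmod (exp (of_real h * psi n th)) \<le> 1" using h Re_psi[OF n(1), of th] by (simp add: mult_nonneg_nonpos)
      have chin: "chi th n n = 1" by (rule chi_refl)
      have "C h n n' = exp (of_real h * psi n th) * of_real (exp (- (h * phi n)) * (1 + h * g + \<rho>))"
        unfolding C_def euler_weight_def e_def[symmetric] me ee using True chin by simp
      moreover have "Ch h n n' = exp (of_real h * psi n th) * of_real (1 - h * phi n + h * g)"
        using True by (simp add: Ch_def P.exit_rate_def g_def algebra_simps)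
      ultimately have "C h n n' - Ch h n n' = exp (of_real h * psi n th) * of_real (exp (- (h * phi n)) * (1 + h * g + \<rho>) - (1 - h * phi n + h * g))"
        by (simp only: right_diff_distrib of_real_diff)
      then have "cmod (C h n n' - Ch h n n') \<le> 1 * \<bar>exp (- (h * phi n)) * (1 + h * g + \<rho>) - (1 - h * phi n + h * g)\<bar>"
        unfolding norm_mult norm_of_real using ep by (simp add: norm_mult mult_right_mono mult_left_le_one_le del: of_real_diff of_real_mult)
      also have "exp (- (h * phi n)) * (1 + h * g + \<rho>) - (1 - h * phi n + h * g) = exp (- (h * phi n)) * \<rho> + ((1 + h * g) * r2 - h * h * (g * phi n))"
        unfolding er by (simp add: algebra_simps)
      also have "1 * \<bar>\<dots>\<bar> \<le> K * h\<^sup>2 + ((1 + G) * (exp ?P * ?P\<^sup>2 * h\<^sup>2) + h * h * (G * ?P))"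
      proof -
        have tri: "1 * \<bar>a + (b - c)\<bar> \<le> a1 + (b1 + c1)" if "\<bar>a\<bar> \<le> 1 * a1" "\<bar>b\<bar> \<le> b1" "\<bar>c\<bar> \<le> c1" for a b c a1 b1 c1 :: real
          using that unfolding mult_1 by linarith
        have "\<bar>exp (- (h * phi n)) * \<rho>\<bar> \<le> 1 * (K * h\<^sup>2)"
          unfolding abs_mult using \<rho> h phi_nonneg[OF n(1)] by (intro mult_mono) auto
        moreover have "\<bar>(1 + h * g) * r2\<bar> \<le> (1 + G) * (exp ?P * ?P\<^sup>2 * h\<^sup>2)"
        proof -
          have "\<bar>h * g\<bar> \<le> 1 * G" unfolding abs_mult using h g by (intro mult_mono) auto
          then have "\<bar>1 + h * g\<bar> \<le> 1 + G" by linarith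
          then show ?thesis unfolding abs_mult using r2 G0 by (intro mult_mono) auto
        qed
        moreover have "\<bar>h * h * (g * phi n)\<bar> \<le> h * h * (G * ?P)"
        proof -
          have "\<bar>g * phi n\<bar> \<le> G * ?P" unfolding abs_mult using g Pmax[OF n(1)] phi_nonneg[OF n(1)] G0 by (intro mult_mono) auto
          then show ?thesis unfolding abs_mult[of "h * h"] using h by (intro mult_mono) auto
        qed
        ultimately show ?thesis by (rule tri)
      qed
      also have "\<dots> = (K + (G * ?P + (1 + G) * (exp ?P * ?P\<^sup>2))) * h\<^sup>2" by (simp add: power2_eq_square algebra_simps)
      also have "\<dots> \<le> K0 * h\<^sup>2" unfolding K0_def using G0 P0 Q0 by (intro mult_right_mono) auto
      finally show ?thesis .
    qed
  qed
  define K1 where "K1 = real N * K0"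
  have K1: "K1 \<ge> 0" using K0 by (simp add: K1_def)
  have main: "cmod (euler_expect h (euler_weight th h) (\<lambda>n. h * phi n) k n - char (P.rho h Mr k n) th) \<le> (1 + K1 * h\<^sup>2) ^ k - 1"
    if r: "P.roots h Mr" and ch: "\<And>n. n < N \<Longrightarrow> char (Mr n) th = exp (of_real h * psi n th)" and n: "n < N" for h Mr k n
    using n
  proof (induction k arbitrary: n)
    case 0 then show ?case using P.rho_char(1)[OF r 0] by simp
  next
    case (Suc k)
    have h: "0 \<le> h" "h \<le> 1" "0 < h" using r by (auto simp: P.roots_def)
    let ?b = "euler_expect h (euler_weight th h) (\<lambda>n. h * phi n) k" and ?c = "\<lambda>n. char (P.rho h Mr k n) th"
    have c1: "cmod (?c i) \<le> 1" if "i < N" for i using real_distribution.cmod_char_le_1[OF P.rho_dist[OF r that]] .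
    have rc: "char (P.rho h Mr (Suc k) n) th = of_real (h * phi n) + (\<Sum>i<N. Ch h n i * ?c i)"
    proof -
      have "(\<Sum>i<N. Ch h n i * ?c i) = Ch h n n * ?c n + (\<Sum>i\<in>{..<N}-{n}. Ch h n i * ?c i)"
        using Suc.prems by (simp add: sum.remove)
      also have "(\<Sum>i\<in>{..<N}-{n}. Ch h n i * ?c i) = (\<Sum>i\<in>{..<N}-{n}. of_real (h * Gen $$ (n,i)) * (char (nu n i) th * ?c i))"
        by (rule sum.cong) (auto simp: Ch_def chi_def)
      finally show ?thesis unfolding P.rho_char(2)[OF r Suc.prems] using ch[OF Suc.prems] by (simp add: Ch_def)
    qed
    have row: "(\<Sum>i<N. cmod (Ch h n i)) \<le> 1"
    proof -
      have "(\<Sum>i<N. cmod (Ch h n i)) = cmod (Ch h n n) + (\<Sum>i\<in>{..<N}-{n}. cmod (Ch h n i))" using Suc.prems by (simp add: sum.remove)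
      also have "\<dots> \<le> (1 - h * P.exit_rate n) + (\<Sum>i\<in>{..<N}-{n}. h * Gen $$ (n,i))"
      proof (intro add_mono sum_mono)
        have l0: "0 \<le> 1 - h * P.exit_rate n" by (rule P.step_op_weights(1)[OF r Suc.prems])
        have "cmod (exp (of_real h * psi n th)) \<le> 1" using h Re_psi[OF Suc.prems, of th] by (simp add: mult_nonneg_nonpos)
        then show "cmod (Ch h n n) \<le> 1 - h * P.exit_rate n"
          unfolding Ch_def norm_mult norm_of_real if_P[OF refl] abs_of_nonneg[OF l0] using l0 by (intro mult_left_le) auto
        fix i assume i: "i \<in> {..<N}-{n}"
        have g0: "0 \<le> h * Gen $$ (n,i)" by (rule P.step_op_weights(2)[OF r Suc.prems i])
        have ni: "n \<noteq> i" "i < N" using i by auto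
        show "cmod (Ch h n i) \<le> h * Gen $$ (n,i)"
          unfolding Ch_def norm_mult if_not_P[OF ni(1)] norm_of_real abs_of_nonneg[OF g0] using g0 chi_le[OF Suc.prems ni(2), of th]
          by (intro mult_left_le) auto
      qed
      also have "\<dots> = 1 - h * phi n"
      proof -
        have "(\<Sum>i<N. Gen $$ (n,i)) = Gen $$ (n,n) + (\<Sum>i\<in>{..<N}-{n}. Gen $$ (n,i))" using Suc.prems by (simp add: sum.remove)
        then have "(\<Sum>i\<in>{..<N}-{n}. Gen $$ (n,i)) = - Gen $$ (n,n)" using P.Gen_rowsum[OF Suc.prems] by simp
        then show ?thesis by (simp add: sum_distrib_left[symmetric] P.exit_rate_def algebra_simps)
      qed
      also have "\<dots> \<le> 1" using h phi_nonneg[OF Suc.prems] by simp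
      finally show ?thesis .
    qed
    have CCs: "(\<Sum>i<N. cmod (C h n i - Ch h n i)) \<le> K1 * h\<^sup>2"
    proof -
      have "(\<Sum>i<N. cmod (C h n i - Ch h n i)) \<le> (\<Sum>i<N. K0 * h\<^sup>2)" using CCh[OF h(1,2) Suc.prems] by (intro sum_mono) auto
      then show ?thesis by (simp add: K1_def)
    qed
    have Cs: "(\<Sum>i<N. cmod (C h n i)) \<le> 1 + K1 * h\<^sup>2"
    proof -
      have "(\<Sum>i<N. cmod (C h n i)) \<le> (\<Sum>i<N. cmod (Ch h n i) + cmod (C h n i - Ch h n i))"
        by (intro sum_mono) (metis add.commute diff_add_cancel norm_triangle_ineq)
      then show ?thesis using row CCs by (simp add: sum.distrib)
    qed
    let ?e = "(1 + K1 * h\<^sup>2) ^ k - 1"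
    have e0: "?e \<ge> 0" using K1 one_le_power[of "1 + K1 * h\<^sup>2" k] by simp
    have dec: "euler_expect h (euler_weight th h) (\<lambda>n. h * phi n) (Suc k) n - char (P.rho h Mr (Suc k) n) th = (\<Sum>i<N. C h n i * (?b i - ?c i)) + (\<Sum>i<N. (C h n i - Ch h n i) * ?c i)"
    proof -
      have bS: "euler_expect h (euler_weight th h) (\<lambda>n. h * phi n) (Suc k) n = of_real (h * phi n) + (\<Sum>i<N. C h n i * ?b i)"
        unfolding euler_expect.simps C_def ..
      have "(\<Sum>i<N. C h n i * (?b i - ?c i)) + (\<Sum>i<N. (C h n i - Ch h n i) * ?c i) = (\<Sum>i<N. C h n i * ?b i) - (\<Sum>i<N. Ch h n i * ?c i)"
        unfolding right_diff_distrib left_diff_distrib sum_subtractf by (simp only: diff_add_cancel add_diff_eq)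
      then show ?thesis unfolding rc bS by (simp only: add_diff_cancel_left)
    qed
    have "cmod (euler_expect h (euler_weight th h) (\<lambda>n. h * phi n) (Suc k) n - char (P.rho h Mr (Suc k) n) th) \<le> (\<Sum>i<N. cmod (C h n i) * cmod (?b i - ?c i)) + (\<Sum>i<N. cmod (C h n i - Ch h n i) * cmod (?c i))"
      unfolding dec norm_mult[symmetric] by (rule order_trans[OF norm_triangle_ineq add_mono[OF norm_sum norm_sum]])
    also have "\<dots> \<le> (\<Sum>i<N. cmod (C h n i) * ?e) + (\<Sum>i<N. cmod (C h n i - Ch h n i) * 1)"
    proof (rule add_mono; rule sum_mono; rule mult_left_mono[OF _ norm_ge_zero])
      fix i assume "i \<in> {..<N}"
      then have i: "i < N" by (rule lessThan_iff[THEN iffD1])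
      show "cmod (?b i - ?c i) \<le> ?e" by (rule Suc.IH[OF i])
      show "cmod (?c i) \<le> 1" by (rule c1[OF i])
    qed
    also have "\<dots> = (\<Sum>i<N. cmod (C h n i)) * ?e + (\<Sum>i<N. cmod (C h n i - Ch h n i))" by (simp add: sum_distrib_right)
    also have "\<dots> \<le> (1 + K1 * h\<^sup>2) * ?e + K1 * h\<^sup>2" by (intro add_mono mult_right_mono Cs CCs e0)
    also have "\<dots> = (1 + K1 * h\<^sup>2) ^ Suc k - 1" by (simp add: algebra_simps)
    finally show ?case .
  qed
  show ?thesis using main K1 by blast
qed

end

lemma steps_times_square:
  fixes x K r :: real assumes "x \<noteq> 0"
  shows "(r * x) * (K * (1 / x)\<^sup>2) = K * r / x"
  using assms by (simp add: power2_eq_square)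

lemma small_step_power_upper:
  fixes K :: real assumes K: "K \<ge> 0"
  shows "(\<lambda>m. (1 + K * (1 / real (Suc m))\<^sup>2) ^ (R * Suc m)) \<longlonglongrightarrow> 1"
proof (rule tendsto_sandwich[where f="\<lambda>_. 1" and h="\<lambda>m. exp (K * real R / real (Suc m))"])
  show "\<forall>\<^sub>F m in sequentially. 1 \<le> (1 + K * (1 / real (Suc m))\<^sup>2) ^ (R * Suc m)"
    using K by (intro always_eventually allI one_le_power) simp
  have "(1 + K * (1 / real (Suc m))\<^sup>2) ^ (R * Suc m) \<le> exp (K * real R / real (Suc m))" for m
  proof -
    have "(1 + K * (1 / real (Suc m))\<^sup>2) ^ (R * Suc m) \<le> exp (K * (1 / real (Suc m))\<^sup>2) ^ (R * Suc m)"
      using K by (intro power_mono) auto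
    also have "\<dots> = exp (real (R * Suc m) * (K * (1 / real (Suc m))\<^sup>2))" by (simp only: exp_of_nat_mult)
    also have "real (R * Suc m) * (K * (1 / real (Suc m))\<^sup>2) = K * real R / real (Suc m)"
      unfolding of_nat_mult by (rule steps_times_square) simp
    finally show ?thesis .
  qed
  then show "\<forall>\<^sub>F m in sequentially. (1 + K * (1 / real (Suc m))\<^sup>2) ^ (R * Suc m) \<le> exp (K * real R / real (Suc m))" by simp
  have "(\<lambda>m. K * real R / real (Suc m)) \<longlonglongrightarrow> 0" by (rule LIMSEQ_Suc[OF lim_const_over_n])
  from tendsto_exp[OF this] show "(\<lambda>m. exp (K * real R / real (Suc m))) \<longlonglongrightarrow> 1" by simp
qed simp

lemma small_step_power_lower:
  fixes K :: real assumes K: "K \<ge> 0"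
  shows "\<forall>\<^sub>F m in sequentially. 1 - K * real R / real (Suc m) \<le> (1 - K * (1 / real (Suc m))\<^sup>2) ^ (R * Suc m)"
proof -
  have "\<forall>\<^sub>F m in sequentially. K / real (Suc m) < 1"
    using order_tendstoD(2)[OF LIMSEQ_Suc[OF lim_const_over_n[of K]], of 1] by simp
  then show ?thesis
  proof eventually_elim
    case (elim m)
    have "K / real (Suc m) * (1 / real (Suc m)) \<le> 1 * 1" using elim K by (intro mult_mono) auto
    then have k: "- 1 \<le> - (K * (1 / real (Suc m))\<^sup>2)" by (simp add: power2_eq_square del: of_nat_Suc)
    have "1 - K * real R / real (Suc m) = 1 + real (R * Suc m) * (- (K * (1 / real (Suc m))\<^sup>2))"
      using steps_times_square[of "real (Suc m)" "real R" K] by (simp only: of_nat_mult mult_minus_right)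
    also have "\<dots> \<le> (1 + (- (K * (1 / real (Suc m))\<^sup>2))) ^ (R * Suc m)" by (rule Bernoulli_inequality[OF k])
    finally show ?case by simp
  qed
qed

context mm_process
begin

lemma W_tau_meas[measurable]: "(\<lambda>\<omega>. W (tau \<omega>) \<omega>) \<in> borel_measurable M"
  by (rule W_at_meas) (auto simp: tau_nonneg)

lemma W_stopped_meas[measurable]: "(\<lambda>\<omega>. W (min (tau \<omega>) (real R)) \<omega>) \<in> borel_measurable M"
  by (rule W_at_meas) (auto simp: tau_nonneg)

lemma params_of_model:
  assumes irr: "irreducible_mat N Gen" and fin: "AE \<omega> in M. first_pos V \<omega> < \<infinity>"
  shows "mm_params N Gen mu nu phi"
  by (rule mm_params.intro) (fact N_pos gen irr phi_nonneg mu_dist nu_dist phi_not_zero[OF fin])+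

lemma stopped_approximation:
  assumes irr: "irreducible_mat N Gen" and fin: "AE \<omega> in M. first_pos V \<omega> < \<infinity>" and R: "R > 0" and h0: "h0 > 0"
  shows "\<exists>m0 Mr. (\<forall>m\<ge>m0. mm_params.roots N Gen mu nu phi (1 / real (Suc m)) (Mr m) \<and> 1 / real (Suc m) \<le> h0) \<and>
    (\<forall>x. isCont (cdf (distr M borel (\<lambda>\<omega>. W (min (tau \<omega>) (real R)) \<omega>))) x \<longrightarrow>
      (\<lambda>m. \<Sum>n<N. varpi n * measure (mm_params.rho N Gen nu phi (1 / real (Suc m)) (Mr m) (R * Suc m) n) {x<..})
        \<longlonglongrightarrow> measure (distr M borel (\<lambda>\<omega>. W (min (tau \<omega>) (real R)) \<omega>)) {x<..})"
proof -
  note par = params_of_model[OF irr fin]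
  interpret P: mm_params N Gen mu nu phi by (rule par)
  define h where "h m = 1 / real (Suc m)" for m
  have h: "0 < h m" "h m \<le> 1" for m by (simp_all add: h_def)
  have "\<forall>m n. \<exists>Q. n < N \<longrightarrow> real_distribution Q \<and> (\<forall>th. char Q th = exp (of_real (h m) * psi n th))"
    using root_exists[OF irr _ h] by blast
  then obtain Mr where Mr: "\<And>m n. n < N \<Longrightarrow> real_distribution (Mr m n)" "\<And>m n th. n < N \<Longrightarrow> char (Mr m n) th = exp (of_real (h m) * psi n th)"
    unfolding choice_iff by blast
  have h_lim: "(\<lambda>m. h m * c) \<longlonglongrightarrow> 0" for c :: real
    using LIMSEQ_Suc[OF lim_const_over_n[of c]] by (simp add: h_def)
  have ev_le: "\<forall>\<^sub>F m in sequentially. h m * c < 1" for c :: real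
    using order_tendstoD(2)[OF h_lim, of 1 c] by simp
  have "\<forall>\<^sub>F m in sequentially. (\<forall>n\<in>{..<N}. h m * P.exit_rate n < 1) \<and> h m * (1 / h0) < 1"
    by (intro eventually_conj eventually_ball_finite ballI ev_le) auto
  then obtain m0 where m00: "\<forall>m\<ge>m0. (\<forall>n\<in>{..<N}. h m * P.exit_rate n < 1) \<and> h m * (1 / h0) < 1"
    unfolding eventually_sequentially ..
  have m0: "\<And>m n. m \<ge> m0 \<Longrightarrow> n < N \<Longrightarrow> h m * P.exit_rate n < 1" "\<And>m. m \<ge> m0 \<Longrightarrow> h m * (1 / h0) < 1"
    using m00 by blast+
  have m0': "h m \<le> h0" if "m \<ge> m0" for m using m0(2)[OF that] h0 by (simp add: field_simps)
  have rt: "P.roots (h m) (Mr m)" if m: "m \<ge> m0" for m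
    unfolding P.roots_def
  proof (intro conjI allI impI ballI)
    show "0 < h m" "h m \<le> 1" by (rule h)+
    fix n assume n: "n < N"
    show "h m * P.exit_rate n \<le> 1" using m0(1)[OF m n] by simp
    show "real_distribution (Mr m n)" by (rule Mr(1)[OF n])
    fix s assume s: "s \<in> P.S"
    have c: "char (Mr m n) t ^ Suc m = char (mu n) t" for t
      unfolding Mr(2)[OF n] char_mu[OF n] exp_of_nat_mult[symmetric] by (simp add: h_def del: of_nat_Suc)
    have i: "integrable (mu n) (\<lambda>x. exp (s * x))" using s n by (simp add: strip_I_def)
    note rm = root_mgf[OF Mr(1)[OF n] mu_dist[OF n] zero_less_Suc c i]
    show "integrable (Mr m n) (\<lambda>x. exp (s * x))" by (rule rm(1))
    show "mgf (Mr m n) s = exp (h m * ln (mgf (mu n) s))" unfolding h_def by (rule rm(2))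
  qed
  define L where "L = distr M borel (\<lambda>\<omega>. W (min (tau \<omega>) (real R)) \<omega>)"
  interpret L: real_distribution L unfolding L_def by (intro real_distribution_distr) simp
  define w where "w i = (if i < N then varpi i else 0)" for i
  have sw: "(\<Sum>i\<le>N. f i (w i)) = (\<Sum>i<N. f i (varpi i)) + f N 0" for f :: "nat \<Rightarrow> real \<Rightarrow> 'b::comm_monoid_add"
    by (simp add: lessThan_Suc_atMost[symmetric] w_def)
  have w: "\<And>i. i \<le> N \<Longrightarrow> w i \<ge> 0" "(\<Sum>i\<le>N. w i) = 1"
    using varpi_nonneg varpi_sum sw[of "\<lambda>i x. x"] by (auto simp: w_def)
  define Rm where "Rm m i = (if i < N then P.rho (h m) (Mr m) (R * Suc m) i else return borel 0)" for m i
  have Rm: "real_distribution (Rm m i)" if "m \<ge> m0" for m i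
    unfolding Rm_def using P.rho_dist[OF rt[OF that]] P.real_distribution_return by (cases "i < N") (simp_all del: mult_Suc_right)
  define \<nu> where "\<nu> m = mixture N w (Rm (m + m0))" for m
  note mp = mixture_props[OF w Rm]
  have \<nu>: "real_distribution (\<nu> m)" for m unfolding \<nu>_def by (rule mp(1)) auto
  have \<nu>_meas: "measure (\<nu> m) {x<..} = (\<Sum>n<N. varpi n * measure (P.rho (h (m + m0)) (Mr (m + m0)) (R * Suc (m + m0)) n) {x<..})" for m x
  proof -
    have "measure (\<nu> m) {x<..} = (\<Sum>i\<le>N. w i * measure (Rm (m + m0) i) {x<..})" unfolding \<nu>_def by (rule mp(2)) auto
    also have "\<dots> = (\<Sum>i<N. varpi i * measure (Rm (m + m0) i) {x<..})" using sw[of "\<lambda>i y. y * measure (Rm (m + m0) i) {x<..}"] by simp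
    finally show ?thesis unfolding Rm_def by (rule trans) (rule sum.cong, simp_all del: mult_Suc_right)
  qed
  have \<nu>_char: "char (\<nu> m) th = (\<Sum>n<N. of_real (varpi n) * char (P.rho (h (m + m0)) (Mr (m + m0)) (R * Suc (m + m0)) n) th)" for m th
  proof -
    have "char (\<nu> m) th = (\<Sum>i\<le>N. of_real (w i) * char (Rm (m + m0) i) th)" unfolding \<nu>_def by (rule mp(3)) auto
    also have "\<dots> = (\<Sum>i<N. of_real (varpi i) * char (Rm (m + m0) i) th)" using sw[of "\<lambda>i y. of_real y * char (Rm (m + m0) i) th"] by simp
    finally show ?thesis unfolding Rm_def by (rule trans) (rule sum.cong, simp_all del: mult_Suc_right)
  qed
  have clim: "(\<lambda>m. char (\<nu> m) th) \<longlonglongrightarrow> char L th" for th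
  proof -
    obtain K where K: "K \<ge> 0" "\<And>h Mr k n. P.roots h Mr \<Longrightarrow> (\<forall>n<N. char (Mr n) th = exp (of_real h * psi n th)) \<Longrightarrow> n < N \<Longrightarrow>
       cmod (euler_expect h (euler_weight th h) (\<lambda>n. h * phi n) k n - char (P.rho h Mr k n) th) \<le> (1 + K * h\<^sup>2) ^ k - 1"
      using euler_expect_rho_close[OF par, of th] by blast
    define b where "b m = (\<Sum>n<N. of_real (varpi n) * euler_expect (h m) (euler_weight th (h m)) (\<lambda>n. h m * phi n) (R * Suc m) n)" for m
    have "b \<longlonglongrightarrow> (\<integral>\<omega>. iexp (th * W (min (tau \<omega>) (real R)) \<omega>) \<partial>M)"
      unfolding b_def[abs_def] h_def by (rule stopped_char_limit[OF fin R])
    also have "(\<integral>\<omega>. iexp (th * W (min (tau \<omega>) (real R)) \<omega>) \<partial>M) = char L th"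
      unfolding L_def char_def by (subst integral_distr) auto
    finally have b: "(\<lambda>m. b (m + m0)) \<longlonglongrightarrow> char L th" by (rule LIMSEQ_ignore_initial_segment)
    have "(\<lambda>m. char (\<nu> m) th - b (m + m0)) \<longlonglongrightarrow> 0"
    proof (rule Lim_null_comparison)
      let ?e = "\<lambda>m. (1 + K * (1 / real (Suc m))\<^sup>2) ^ (R * Suc m) - 1"
      have "cmod (char (\<nu> m) th - b (m + m0)) \<le> ?e (m + m0)" for m
      proof -
        let ?m = "m + m0"
        have "cmod (char (\<nu> m) th - b ?m) = cmod (\<Sum>n<N. of_real (varpi n) * (char (P.rho (h ?m) (Mr ?m) (R * Suc ?m) n) th - euler_expect (h ?m) (euler_weight th (h ?m)) (\<lambda>n. h ?m * phi n) (R * Suc ?m) n))"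
          unfolding \<nu>_char b_def by (simp only: sum_subtractf right_diff_distrib)
        also have "\<dots> \<le> (\<Sum>n<N. cmod (of_real (varpi n) * (char (P.rho (h ?m) (Mr ?m) (R * Suc ?m) n) th - euler_expect (h ?m) (euler_weight th (h ?m)) (\<lambda>n. h ?m * phi n) (R * Suc ?m) n)))"
          by (rule norm_sum)
        also have "\<dots> \<le> (\<Sum>n<N. varpi n * ?e ?m)"
        proof (rule sum_mono)
          fix n assume "n \<in> {..<N}" then have n: "n < N" by simp
          have "cmod (char (P.rho (h ?m) (Mr ?m) (R * Suc ?m) n) th - euler_expect (h ?m) (euler_weight th (h ?m)) (\<lambda>n. h ?m * phi n) (R * Suc ?m) n) \<le> ?e ?m"
          proof -
            have "cmod (euler_expect (h ?m) (euler_weight th (h ?m)) (\<lambda>n. h ?m * phi n) (R * Suc ?m) n - char (P.rho (h ?m) (Mr ?m) (R * Suc ?m) n) th) \<le> (1 + K * (h ?m)\<^sup>2) ^ (R * Suc ?m) - 1"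
              by (rule K(2)[OF rt[OF le_add2] _ n]) (use Mr(2) in blast)
            then show ?thesis unfolding norm_minus_commute[of "char _ _"] h_def .
          qed
          then show "cmod (of_real (varpi n) * (char (P.rho (h ?m) (Mr ?m) (R * Suc ?m) n) th - euler_expect (h ?m) (euler_weight th (h ?m)) (\<lambda>n. h ?m * phi n) (R * Suc ?m) n)) \<le> varpi n * ?e ?m"
            unfolding norm_mult norm_of_real abs_of_nonneg[OF varpi_nonneg[OF n]] by (rule mult_left_mono[OF _ varpi_nonneg[OF n]])
        qed
        also have "\<dots> = ?e ?m" using varpi_sum by (simp only: sum_distrib_right[symmetric] mult_1)
        finally show ?thesis .
      qed
      then show "\<forall>\<^sub>F m in sequentially. cmod (char (\<nu> m) th - b (m + m0)) \<le> ?e (m + m0)" by simp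
      have "?e \<longlonglongrightarrow> 1 - 1" by (intro tendsto_diff small_step_power_upper K tendsto_const)
      then have "?e \<longlonglongrightarrow> 0" by simp
      then show "(\<lambda>m. ?e (m + m0)) \<longlonglongrightarrow> 0" by (rule LIMSEQ_ignore_initial_segment)
    qed
    from tendsto_add[OF this b] show ?thesis by simp
  qed
  have wc: "weak_conv_m \<nu> L" by (rule levy_continuity[OF \<nu> L.real_distribution_axioms clim])
  have "(\<lambda>m. \<Sum>n<N. varpi n * measure (P.rho (h m) (Mr m) (R * Suc m) n) {x<..}) \<longlonglongrightarrow> measure L {x<..}"
    if "isCont (cdf L) x" for x
    using weak_conv_tail[OF \<nu> L.real_distribution_axioms wc that] unfolding \<nu>_meas by (rule LIMSEQ_offset)
  then show ?thesis unfolding L_def[symmetric] h_def[symmetric]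
    using rt m0' by (intro exI[of _ m0] exI[of _ Mr] conjI allI impI)
qed

lemma stopped_tail_bounds:
  assumes irr: "irreducible_mat N Gen" and fin: "AE \<omega> in M. first_pos V \<omega> < \<infinity>"
    and a: "\<alpha> > 0" "\<alpha> \<in> interior (strip_I N mu nu)"
    and z: "spectral_abscissa (map_mat complex_of_real (A_mat N Gen mu nu phi \<alpha>)) = 0"
  shows "\<exists>c B d C. c > 0 \<and> d > 0 \<and> (\<forall>R>0. \<forall>w\<ge>0.
     measure M {\<omega>\<in>space M. W (min (tau \<omega>) (real R)) \<omega> > w} \<le> C * exp (- \<alpha> * w) \<and>
     c * exp (- \<alpha> * w) \<le> measure M {\<omega>\<in>space M. W (min (tau \<omega>) (real R)) \<omega> > w} + B * exp (- d * real R))"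
proof -
  note par = params_of_model[OF irr fin]
  interpret P: mm_params N Gen mu nu phi by (rule par)
  have aS: "\<alpha> \<in> P.S" using a(2) interior_subset by blast
  obtain e where e: "e > 0" "ball \<alpha> e \<subseteq> P.S" using a(2) by (auto simp: mem_interior)
  have s: "\<alpha> + e/2 \<in> P.S" "\<alpha> < \<alpha> + e/2" using e by (auto simp: subset_iff dist_real_def)
  obtain hv where hv: "\<And>i. i < N \<Longrightarrow> hv i > 0" "\<And>i. i < N \<Longrightarrow> (\<Sum>j<N. P.A \<alpha> i j * hv j) = 0"
    using P.perron_zero[OF aS z] by blast
  obtain C K h1 where up: "K \<ge> 0" "h1 > 0" "\<And>h M u j n x. P.tails h M u \<Longrightarrow> h \<le> h1 \<Longrightarrow> n < N \<Longrightarrow>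
     u j n x \<le> (1 + K * h\<^sup>2) ^ j * (C * exp (\<alpha> * x))"
    using P.tails_upper[OF a(1) aS hv] by blast
  obtain c B d K' h2 where lo: "c > 0" "B \<ge> 0" "d > 0" "K' \<ge> 0" "h2 > 0"
     "\<And>h M u j n x. P.tails h M u \<Longrightarrow> h \<le> h2 \<Longrightarrow> n < N \<Longrightarrow> x \<le> 0 \<Longrightarrow> d * h \<le> 1 \<and>
     (1 - K' * h\<^sup>2) ^ j * (c * exp (\<alpha> * x)) \<le> u j n x + B * (1 - d * h) ^ j"
    using P.tails_lower[OF a(1) aS hv s] by blast
  have main: "measure M {\<omega>\<in>space M. W (min (tau \<omega>) (real R)) \<omega> > w} \<le> (\<bar>C\<bar> * exp \<alpha>) * exp (- \<alpha> * w)"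
     "(c * exp (- \<alpha>)) * exp (- \<alpha> * w) \<le> measure M {\<omega>\<in>space M. W (min (tau \<omega>) (real R)) \<omega> > w} + B * exp (- d * real R)"
    if R: "R > 0" and w: "w \<ge> 0" for R w
  proof -
    define L where "L = distr M borel (\<lambda>\<omega>. W (min (tau \<omega>) (real R)) \<omega>)"
    interpret L: real_distribution L unfolding L_def by (intro real_distribution_distr) simp
    have Lm: "measure M {\<omega>\<in>space M. W (min (tau \<omega>) (real R)) \<omega> > w} = measure L {w<..}"
      unfolding L_def by (subst measure_distr) (auto intro!: arg_cong[where f="measure M"])
    obtain m0 Mr where m0: "\<And>m. m \<ge> m0 \<Longrightarrow> P.roots (1 / real (Suc m)) (Mr m)" "\<And>m. m \<ge> m0 \<Longrightarrow> 1 / real (Suc m) \<le> min h1 h2"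
      and lim: "\<And>x. isCont (cdf L) x \<Longrightarrow> (\<lambda>m. \<Sum>n<N. varpi n * measure (P.rho (1 / real (Suc m)) (Mr m) (R * Suc m) n) {x<..}) \<longlonglongrightarrow> measure L {x<..}"
      using stopped_approximation[OF irr fin R, of "min h1 h2"] up(2) lo(5) unfolding L_def by auto
    have set: "{z. - x + z > 0} = {x<..}" for x :: real by auto
    show "measure M {\<omega>\<in>space M. W (min (tau \<omega>) (real R)) \<omega> > w} \<le> (\<bar>C\<bar> * exp \<alpha>) * exp (- \<alpha> * w)"
    proof -
      obtain x where x: "w - 1 < x" "x < w" "isCont (cdf L) x" using L.continuity_point_between[of "w - 1" w] by auto
      have b: "(\<Sum>n<N. varpi n * measure (P.rho (1 / real (Suc m)) (Mr m) (R * Suc m) n) {x<..}) \<le> (1 + K * (1 / real (Suc m))\<^sup>2) ^ (R * Suc m) * (C * exp (- \<alpha> * x))" if m: "m \<ge> m0" for m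
      proof -
        have "(\<Sum>n<N. varpi n * measure (P.rho (1 / real (Suc m)) (Mr m) (R * Suc m) n) {x<..}) \<le> (\<Sum>n<N. varpi n * ((1 + K * (1 / real (Suc m))\<^sup>2) ^ (R * Suc m) * (C * exp (- \<alpha> * x))))"
        proof (intro sum_mono mult_left_mono)
          fix n assume "n \<in> {..<N}" then have n: "n < N" by simp
          show "measure (P.rho (1 / real (Suc m)) (Mr m) (R * Suc m) n) {x<..} \<le> (1 + K * (1 / real (Suc m))\<^sup>2) ^ (R * Suc m) * (C * exp (- \<alpha> * x))"
            using up(3)[OF P.rho_tails[OF m0(1)[OF m]] _ n, of "R * Suc m" "- x"] m0(2)[OF m] unfolding set by simp
          show "0 \<le> varpi n" by (rule varpi_nonneg[OF n])
        qed
        also have "\<dots> = (1 + K * (1 / real (Suc m))\<^sup>2) ^ (R * Suc m) * (C * exp (- \<alpha> * x))"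
          using varpi_sum by (simp only: sum_distrib_right[symmetric] mult_1)
        finally show ?thesis .
      qed
      have "measure L {w<..} \<le> measure L {x<..}" using x by (intro L.finite_measure_mono) auto
      also have "\<dots> \<le> 1 * (C * exp (- \<alpha> * x))"
        by (rule LIMSEQ_le[OF lim[OF x(3)] tendsto_mult[OF small_step_power_upper[OF up(1)] tendsto_const]]) (use b in blast)
      also have "\<dots> \<le> \<bar>C\<bar> * exp (\<alpha> + - \<alpha> * w)"
      proof -
        have "\<alpha> * (w - x) \<le> \<alpha> * 1" using x a(1) by (intro mult_left_mono) auto
        then have "- \<alpha> * x \<le> \<alpha> + - \<alpha> * w" by (simp add: algebra_simps)
        then show ?thesis unfolding mult_1 by (intro mult_mono) auto
      qed
      finally show ?thesis unfolding Lm exp_add by (simp only: mult.assoc)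
    qed
    show "(c * exp (- \<alpha>)) * exp (- \<alpha> * w) \<le> measure M {\<omega>\<in>space M. W (min (tau \<omega>) (real R)) \<omega> > w} + B * exp (- d * real R)"
    proof -
      obtain x where x: "w < x" "x < w + 1" "isCont (cdf L) x" using L.continuity_point_between[of w "w + 1"] by auto
      have x0: "- x \<le> 0" using x w by simp
      define E where "E = c * exp (- \<alpha> * x)"
      have E0: "E \<ge> 0" using lo(1) by (simp add: E_def)
      have b: "(1 - K' * (1 / real (Suc m))\<^sup>2) ^ (R * Suc m) * E \<le> (\<Sum>n<N. varpi n * measure (P.rho (1 / real (Suc m)) (Mr m) (R * Suc m) n) {x<..}) + B * exp (- d * real R)" if m: "m \<ge> m0" for m
      proof -
        let ?h = "1 / real (Suc m)"
        have t: "(1 - K' * ?h\<^sup>2) ^ (R * Suc m) * E \<le> measure (P.rho ?h (Mr m) (R * Suc m) n) {x<..} + B * exp (- d * real R)" if n: "n < N" for n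
        proof -
          have hle: "?h \<le> h2" using m0(2)[OF m] by linarith
          have l: "d * ?h \<le> 1" "(1 - K' * ?h\<^sup>2) ^ (R * Suc m) * (c * exp (\<alpha> * - x)) \<le> measure (P.rho ?h (Mr m) (R * Suc m) n) {x<..} + B * (1 - d * ?h) ^ (R * Suc m)"
            using lo(6)[OF P.rho_tails[OF m0(1)[OF m]] hle n x0, of "R * Suc m"] unfolding set by blast+
          have "(1 - d * ?h) ^ (R * Suc m) \<le> exp (- (d * ?h)) ^ (R * Suc m)"
            using l(1) exp_ge_add_one_self[of "- (d * ?h)"] by (intro power_mono) auto
          also have "\<dots> = exp (real (R * Suc m) * (- (d * ?h)))" by (simp only: exp_of_nat_mult)
          also have "real (R * Suc m) * (- (d * ?h)) = - d * real R" unfolding of_nat_mult by (simp del: of_nat_Suc)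
          finally have "B * (1 - d * ?h) ^ (R * Suc m) \<le> B * exp (- d * real R)" by (rule mult_left_mono[OF _ lo(2)])
          then show ?thesis using l(2) unfolding E_def mult_minus_right mult_minus_left by linarith
        qed
        have "(1 - K' * ?h\<^sup>2) ^ (R * Suc m) * E = (\<Sum>n<N. varpi n * ((1 - K' * ?h\<^sup>2) ^ (R * Suc m) * E))"
          using varpi_sum by (simp only: sum_distrib_right[symmetric] mult_1)
        also have "\<dots> \<le> (\<Sum>n<N. varpi n * (measure (P.rho ?h (Mr m) (R * Suc m) n) {x<..} + B * exp (- d * real R)))"
          using t varpi_nonneg by (intro sum_mono mult_left_mono) auto
        also have "\<dots> = (\<Sum>n<N. varpi n * measure (P.rho ?h (Mr m) (R * Suc m) n) {x<..}) + B * exp (- d * real R)"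
          using varpi_sum by (simp only: distrib_left sum.distrib sum_distrib_right[symmetric] mult_1)
        finally show ?thesis .
      qed
      have "\<forall>\<^sub>F m in sequentially. (1 - K' * real R / real (Suc m)) * E \<le> (\<Sum>n<N. varpi n * measure (P.rho (1 / real (Suc m)) (Mr m) (R * Suc m) n) {x<..}) + B * exp (- d * real R)"
        using small_step_power_lower[OF lo(4), of R] eventually_ge_at_top[of m0]
      proof eventually_elim
        case (elim m)
        show ?case by (rule order_trans[OF mult_right_mono[OF elim(1) E0] b[OF elim(2)]])
      qed
      then have "(1 - 0) * E \<le> measure L {x<..} + B * exp (- d * real R)"
        by (intro tendsto_le[OF sequentially_bot tendsto_add[OF lim[OF x(3)] tendsto_const]
              tendsto_mult[OF tendsto_diff[OF tendsto_const LIMSEQ_Suc[OF lim_const_over_n[of "K' * real R"]]] tendsto_const]])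
      moreover have "measure L {x<..} \<le> measure L {w<..}" using x by (intro L.finite_measure_mono) auto
      moreover have "c * exp (- \<alpha> + - \<alpha> * w) \<le> E"
      proof -
        have "\<alpha> * x \<le> \<alpha> * (w + 1)" using x a(1) by (intro mult_left_mono) auto
        then have "- \<alpha> + - \<alpha> * w \<le> - \<alpha> * x" by (simp add: algebra_simps)
        then show ?thesis unfolding E_def using lo(1) by (intro mult_left_mono) auto
      qed
      ultimately show ?thesis unfolding Lm exp_add by (simp only: mult.assoc diff_0_right mult_1)
    qed
  qed
  have "c * exp (- \<alpha>) > 0" using lo(1) by simp
  then show ?thesis using main lo(3) by blast
qed

lemma tail_bounds:
  assumes irr: "irreducible_mat N Gen" and fin: "AE \<omega> in M. first_pos V \<omega> < \<infinity>"
    and a: "\<alpha> > 0" "\<alpha> \<in> interior (strip_I N mu nu)"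
    and z: "spectral_abscissa (map_mat complex_of_real (A_mat N Gen mu nu phi \<alpha>)) = 0"
  shows "\<exists>c C. c > 0 \<and> (\<forall>w\<ge>0. c * exp (- \<alpha> * w) \<le> measure M {\<omega>\<in>space M. W (tau \<omega>) \<omega> > w} \<and>
     measure M {\<omega>\<in>space M. W (tau \<omega>) \<omega> > w} \<le> C * exp (- \<alpha> * w))"
proof -
  obtain c B d C where k: "c > 0" "d > 0"
    and up: "\<And>R w. R > 0 \<Longrightarrow> w \<ge> 0 \<Longrightarrow> measure M {\<omega>\<in>space M. W (min (tau \<omega>) (real R)) \<omega> > w} \<le> C * exp (- \<alpha> * w)"
    and lo: "\<And>R w. R > 0 \<Longrightarrow> w \<ge> 0 \<Longrightarrow> c * exp (- \<alpha> * w) \<le> measure M {\<omega>\<in>space M. W (min (tau \<omega>) (real R)) \<omega> > w} + B * exp (- d * real R)"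
    using stopped_tail_bounds[OF irr fin a z] by blast
  define q where "q R = measure M {\<omega>\<in>space M. real R < tau \<omega>}" for R
  have q: "q \<longlonglongrightarrow> 0" unfolding q_def[abs_def] by (rule survival_prob_limit[OF fin])
  have cmp: "measure M {\<omega>\<in>space M. W (tau \<omega>) \<omega> > w} \<le> measure M {\<omega>\<in>space M. W (min (tau \<omega>) (real R)) \<omega> > w} + q R"
    "measure M {\<omega>\<in>space M. W (min (tau \<omega>) (real R)) \<omega> > w} \<le> measure M {\<omega>\<in>space M. W (tau \<omega>) \<omega> > w} + q R" for R w
  proof -
    have u: "measure M A \<le> measure M B + measure M D" if "A \<subseteq> B \<union> D" "B \<in> sets M" "D \<in> sets M" for A B D
      by (rule order_trans[OF finite_measure_mono[OF that(1) sets.Un[OF that(2,3)]] measure_Un_le[OF that(2,3)]])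
    show "measure M {\<omega>\<in>space M. W (tau \<omega>) \<omega> > w} \<le> measure M {\<omega>\<in>space M. W (min (tau \<omega>) (real R)) \<omega> > w} + q R"
      unfolding q_def by (rule u, (auto simp: min_def not_le)[1]) measurable
    show "measure M {\<omega>\<in>space M. W (min (tau \<omega>) (real R)) \<omega> > w} \<le> measure M {\<omega>\<in>space M. W (tau \<omega>) \<omega> > w} + q R"
      unfolding q_def by (rule u, (auto simp: min_def not_le split: if_splits)[1]) measurable
  qed
  have e: "(\<lambda>R. exp (- d * real R)) \<longlonglongrightarrow> 0"
  proof -
    have "(\<lambda>R. exp (- d) ^ R) \<longlonglongrightarrow> 0" using k(2) by (intro LIMSEQ_power_zero) simp
    then show ?thesis by (simp add: exp_of_nat_mult[symmetric] mult.commute)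
  qed
  have "measure M {\<omega>\<in>space M. W (tau \<omega>) \<omega> > w} \<le> C * exp (- \<alpha> * w)"
    "c * exp (- \<alpha> * w) \<le> measure M {\<omega>\<in>space M. W (tau \<omega>) \<omega> > w}" if w: "w \<ge> 0" for w
  proof -
    let ?p = "measure M {\<omega>\<in>space M. W (tau \<omega>) \<omega> > w}"
    have "?p \<le> C * exp (- \<alpha> * w) + 0"
    proof (rule LIMSEQ_le_const[OF tendsto_add[OF tendsto_const q]])
      show "\<exists>N. \<forall>n\<ge>N. ?p \<le> C * exp (- \<alpha> * w) + q n"
      proof (intro exI[of _ 1] allI impI)
        fix n :: nat assume "1 \<le> n" then have "n > 0" by simp
        then show "?p \<le> C * exp (- \<alpha> * w) + q n" using cmp(1)[of w n] up[OF _ w, of n] by linarith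
      qed
    qed
    then show "?p \<le> C * exp (- \<alpha> * w)" by simp
    have "c * exp (- \<alpha> * w) \<le> (?p + 0) + B * 0"
    proof (rule LIMSEQ_le_const[OF tendsto_add[OF tendsto_add[OF tendsto_const q] tendsto_mult[OF tendsto_const e]]])
      show "\<exists>N. \<forall>n\<ge>N. c * exp (- \<alpha> * w) \<le> (?p + q n) + B * exp (- d * real n)"
      proof (intro exI[of _ 1] allI impI)
        fix n :: nat assume "1 \<le> n" then have "n > 0" by simp
        then show "c * exp (- \<alpha> * w) \<le> (?p + q n) + B * exp (- d * real n)" using cmp(2)[of w n] lo[OF _ w, of n] by linarith
      qed
    qed
    then show "c * exp (- \<alpha> * w) \<le> ?p" by simp
  qed
  then show ?thesis using k(1) by blast
qed

end

section \<open>Reflection\<close>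

lemma Liminf_Limsup_exponential_tail:
  fixes p :: "real \<Rightarrow> real"
  assumes c: "c > 0" and lo: "\<And>w. w \<ge> 0 \<Longrightarrow> c * exp (- \<alpha> * w) \<le> p w" and up: "\<And>w. w \<ge> 0 \<Longrightarrow> p w \<le> C * exp (- \<alpha> * w)"
  shows "0 < Liminf at_top (\<lambda>w. ereal (exp (\<alpha> * w) * p w)) \<and>
    Liminf at_top (\<lambda>w. ereal (exp (\<alpha> * w) * p w)) \<le> Limsup at_top (\<lambda>w. ereal (exp (\<alpha> * w) * p w)) \<and>
    Limsup at_top (\<lambda>w. ereal (exp (\<alpha> * w) * p w)) < \<infinity>"
proof (intro conjI)
  have cancel: "exp (\<alpha> * w) * (k * exp (- \<alpha> * w)) = k" for k w :: real by (simp add: exp_minus)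
  have "ereal c \<le> Liminf at_top (\<lambda>w. ereal (exp (\<alpha> * w) * p w))"
  proof (rule Liminf_bounded)
    show "\<forall>\<^sub>F w in at_top. ereal c \<le> ereal (exp (\<alpha> * w) * p w)"
      using eventually_ge_at_top[of 0]
    proof eventually_elim
      case (elim w)
      show ?case using mult_left_mono[OF lo[OF elim] exp_ge_zero[of "\<alpha> * w"]] unfolding cancel by simp
    qed
  qed
  moreover have "0 < ereal c" using c by simp
  ultimately show "0 < Liminf at_top (\<lambda>w. ereal (exp (\<alpha> * w) * p w))" by (rule less_le_trans[rotated])
  have "Limsup at_top (\<lambda>w. ereal (exp (\<alpha> * w) * p w)) \<le> ereal C"
  proof (rule Limsup_bounded)
    show "\<forall>\<^sub>F w in at_top. ereal (exp (\<alpha> * w) * p w) \<le> ereal C"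
      using eventually_ge_at_top[of 0]
    proof eventually_elim
      case (elim w)
      show ?case using mult_left_mono[OF up[OF elim] exp_ge_zero[of "\<alpha> * w"]] unfolding cancel by simp
    qed
  qed
  then show "Limsup at_top (\<lambda>w. ereal (exp (\<alpha> * w) * p w)) < \<infinity>" by (rule le_less_trans) simp
qed (rule Liminf_le_Limsup, simp)

abbreviation neg_distr :: "real measure \<Rightarrow> real measure" where
  "neg_distr Q \<equiv> distr Q borel uminus"

context
  fixes Q :: "real measure"
  assumes Q: "prob_space Q" "sets Q = sets borel"
begin

lemma uminus_measurable: "uminus \<in> measurable Q borel"
  unfolding measurable_cong_sets[OF Q(2) refl] by simp

lemma neg_distr_prob_space: "prob_space (neg_distr Q)"
  by (rule prob_space.prob_space_distr[OF Q(1) uminus_measurable])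

lemma char_neg_distr: "char (neg_distr Q) t = char Q (- t)"
  unfolding char_def by (subst integral_distr[OF uminus_measurable]) simp_all

lemma mgf_neg_distr: "mgf (neg_distr Q) s = mgf Q (- s)"
  unfolding mgf_def by (subst integral_distr[OF uminus_measurable]) simp_all

lemma integrable_neg_distr: "integrable (neg_distr Q) (\<lambda>x. exp (s * x)) \<longleftrightarrow> integrable Q (\<lambda>x. exp (- s * x))"
  by (subst integrable_distr_eq[OF uminus_measurable]) simp_all

end

lemma cadlag_uminus:
  fixes f :: "real \<Rightarrow> real"
  assumes "cadlag f" shows "cadlag (\<lambda>t. - f t)"
  unfolding cadlag_def
proof (intro conjI allI impI)
  fix t :: real
  show "continuous (at_right t) (\<lambda>t. - f t)" if "0 \<le> t"
    using assms that by (auto simp: cadlag_def intro: continuous_minus)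
  assume "0 < t"
  then obtain l where "(f \<longlongrightarrow> l) (at_left t)" using assms by (auto simp: cadlag_def)
  then have "((\<lambda>t. - f t) \<longlongrightarrow> - l) (at_left t)" by (rule tendsto_minus)
  then show "\<exists>l. ((\<lambda>t. - f t) \<longlongrightarrow> l) (at_left t)" ..
qed

context mm_process
begin

lemma reflected_model:
  "mm_model M N varpi Gen (\<lambda>n. neg_distr (mu n)) (\<lambda>n th. psi n (- th)) (\<lambda>n n'. neg_distr (nu n n')) phi J (\<lambda>t \<omega>. - W t \<omega>) V"
proof -
  note m = model[unfolded mm_model_def]
  have mu: "prob_space (mu n)" "sets (mu n) = sets borel" "continuous_on UNIV (psi n)" "psi n 0 = 0" "\<And>th. char (mu n) th = exp (psi n th)" if "n < N" for n
    using m that by blast+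
  have nu: "prob_space (nu n n')" "sets (nu n n') = sets borel" "Gen $$ (n,n') = 0 \<Longrightarrow> nu n n' = return borel 0" if "n < N" "n' < N" "n \<noteq> n'" for n n'
    using m that by blast+
  have wv: "cadlag (\<lambda>t. W t \<omega>)" "cadlag (\<lambda>t. V t \<omega>)" "W 0 \<omega> = 0" "V 0 \<omega> = 0" if "\<omega> \<in> space M" for \<omega> using m that by blast+
  have V_meas: "V t \<in> borel_measurable M" for t using m by blast
  have cond: "mm_levy_cond M J W V psi nu phi" using m by blast
  have 1: "prob_space (neg_distr (mu n)) \<and> sets (neg_distr (mu n)) = sets borel \<and> continuous_on UNIV (\<lambda>th. psi n (- th)) \<and> psi n (- 0) = 0 \<and>
      (\<forall>th. char (neg_distr (mu n)) th = exp (psi n (- th)))" if n: "n < N" for n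
  proof (intro conjI allI)
    show "continuous_on UNIV (\<lambda>th. psi n (- th))"
      by (rule continuous_on_compose2[OF mu(3)[OF n]]) (auto intro: continuous_intros)
    show "psi n (- 0) = 0" using mu(4)[OF n] by simp
    show "char (neg_distr (mu n)) th = exp (psi n (- th))" for th unfolding char_neg_distr[OF mu(1,2)[OF n]] by (rule mu(5)[OF n])
  qed (use neg_distr_prob_space[OF mu(1,2)[OF n]] in auto)
  have 2: "prob_space (neg_distr (nu n n')) \<and> sets (neg_distr (nu n n')) = sets borel \<and> (Gen $$ (n,n') = 0 \<longrightarrow> neg_distr (nu n n') = return borel 0)"
    if n: "n < N" "n' < N" "n \<noteq> n'" for n n'
    using neg_distr_prob_space[OF nu(1,2)[OF n]] nu(3)[OF n] by (auto simp: distr_return)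
  have 3: "mm_levy_cond M J (\<lambda>t \<omega>. - W t \<omega>) V (\<lambda>n th. psi n (- th)) (\<lambda>n n'. neg_distr (nu n n')) phi"
    unfolding mm_levy_cond_def Let_def
  proof (intro allI impI, elim conjE)
    fix k :: nat and s th et :: "nat \<Rightarrow> real" and mm :: nat and r :: "nat \<Rightarrow> real" and c :: "nat \<Rightarrow> nat"
    assume s: "s 0 = 0" "\<forall>j<k. s j \<le> s (Suc j)" and r: "\<forall>l<mm. 0 \<le> r l"
    let ?B = "{\<omega>\<in>space M. \<forall>l<mm. J (r l) \<omega> = c l}"
    have s0: "0 \<le> s j" if "j \<le> k" for j using that
    proof (induction j)
      case 0 then show ?case using s(1) by simp
    next
      case (Suc j) then have "0 \<le> s j" "s j \<le> s (Suc j)" using s(2) by auto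
      then show ?case by linarith
    qed
    have jump: "char (neg_distr (nu (left_lim (\<lambda>u. J u \<omega>) t) (J t \<omega>))) y = char (nu (left_lim (\<lambda>u. J u \<omega>) t) (J t \<omega>)) (- y)"
      if w: "\<omega> \<in> space M" and t: "t \<in> trans_times (\<lambda>u. J u \<omega>) a b" and a: "0 \<le> a" for \<omega> t a b y
    proof -
      have t0: "t > 0" "left_lim (\<lambda>u. J u \<omega>) t \<noteq> J t \<omega>" using t a by (auto simp: trans_times_def)
      have "left_lim (\<lambda>u. J u \<omega>) t < N"
        by (rule left_lim_less[where j="\<lambda>u. J u \<omega>" and q="\<lambda>n. psi n 0" and Q="Qmax 0" and phi=phi and P=Pmax and a="chi 0"])
          (rule J_cadlag J_less Re_psi Qmax phi_nonneg Pmax chi_le chi_refl w t0 | assumption)+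
      moreover have "J t \<omega> < N" by (rule J_less[OF w]) (use t0 in simp)
      ultimately have "prob_space (nu (left_lim (\<lambda>u. J u \<omega>) t) (J t \<omega>))" "sets (nu (left_lim (\<lambda>u. J u \<omega>) t) (J t \<omega>)) = sets borel"
        using nu t0(2) by blast+
      then show ?thesis by (rule char_neg_distr)
    qed
    have "(\<integral>\<omega>. indicator ?B \<omega> * exp (\<i> * complex_of_real (\<Sum>j\<in>{1..k}. th j * (- W (s j) \<omega> - - W (s (j - 1)) \<omega>) + et j * (V (s j) \<omega> - V (s (j - 1)) \<omega>))) \<partial>M)
      = (\<integral>\<omega>. indicator ?B \<omega> * exp (\<i> * complex_of_real (\<Sum>j\<in>{1..k}. - th j * (W (s j) \<omega> - W (s (j - 1)) \<omega>) + et j * (V (s j) \<omega> - V (s (j - 1)) \<omega>))) \<partial>M)"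
      by (simp only: minus_diff_minus mult_minus_left mult_minus_right)
    also have "\<dots> = (\<integral>\<omega>. indicator ?B \<omega> * (\<Prod>j\<in>{1..k}.
                exp (integral {s (j - 1)..s j} (\<lambda>u. psi (J u \<omega>) (- th j) + complex_of_real (phi (J u \<omega>)) * (exp (\<i> * complex_of_real (et j)) - 1)))
                * (\<Prod>tau\<in>trans_times (\<lambda>u. J u \<omega>) (s (j - 1)) (s j). char (nu (left_lim (\<lambda>u. J u \<omega>) tau) (J tau \<omega>)) (- th j))) \<partial>M)"
      by (rule cond[unfolded mm_levy_cond_def Let_def, THEN spec[of _ k], THEN spec[of _ s], THEN spec[of _ "\<lambda>j. - th j"],
          THEN spec[of _ et], THEN spec[of _ mm], THEN spec[of _ r], THEN spec[of _ c], THEN mp]) (intro conjI s r)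
    also have "\<dots> = (\<integral>\<omega>. indicator ?B \<omega> * (\<Prod>j\<in>{1..k}.
                exp (integral {s (j - 1)..s j} (\<lambda>u. psi (J u \<omega>) (- th j) + complex_of_real (phi (J u \<omega>)) * (exp (\<i> * complex_of_real (et j)) - 1)))
                * (\<Prod>tau\<in>trans_times (\<lambda>u. J u \<omega>) (s (j - 1)) (s j). char (neg_distr (nu (left_lim (\<lambda>u. J u \<omega>) tau) (J tau \<omega>))) (th j))) \<partial>M)"
    proof (rule Bochner_Integration.integral_cong[OF refl], rule arg_cong2[where f="(*)", OF refl], rule prod.cong[OF refl], rule arg_cong2[where f="(*)", OF refl], rule prod.cong[OF refl])
      fix \<omega> j t assume a: "\<omega> \<in> space M" "j \<in> {1..k}" "t \<in> trans_times (\<lambda>u. J u \<omega>) (s (j - 1)) (s j)"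
      have "0 \<le> s (j - 1)" by (rule s0) (use a(2) in auto)
      from jump[OF a(1,3) this, of "th j"]
      show "char (nu (left_lim (\<lambda>u. J u \<omega>) t) (J t \<omega>)) (- th j) = char (neg_distr (nu (left_lim (\<lambda>u. J u \<omega>) t) (J t \<omega>))) (th j)" ..
    qed
    finally show "(\<integral>\<omega>. indicator ?B \<omega> * exp (\<i> * complex_of_real (\<Sum>j\<in>{1..k}. th j * (- W (s j) \<omega> - - W (s (j - 1)) \<omega>) + et j * (V (s j) \<omega> - V (s (j - 1)) \<omega>))) \<partial>M)
      = (\<integral>\<omega>. indicator ?B \<omega> * (\<Prod>j\<in>{1..k}.
                exp (integral {s (j - 1)..s j} (\<lambda>u. psi (J u \<omega>) (- th j) + complex_of_real (phi (J u \<omega>)) * (exp (\<i> * complex_of_real (et j)) - 1)))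
                * (\<Prod>tau\<in>trans_times (\<lambda>u. J u \<omega>) (s (j - 1)) (s j). char (neg_distr (nu (left_lim (\<lambda>u. J u \<omega>) tau) (J tau \<omega>))) (th j))) \<partial>M)" .
  qed
  show ?thesis unfolding mm_model_def
  proof (intro conjI)
    show "\<forall>n<N. prob_space (neg_distr (mu n)) \<and> sets (neg_distr (mu n)) = sets borel \<and> continuous_on UNIV (\<lambda>th. psi n (- th)) \<and> psi n (- 0) = 0 \<and>
      (\<forall>th. char (neg_distr (mu n)) th = exp (psi n (- th)))" using 1 by blast
    show "\<forall>n<N. \<forall>n'<N. n \<noteq> n' \<longrightarrow> prob_space (neg_distr (nu n n')) \<and> sets (neg_distr (nu n n')) = sets borel \<and> (Gen $$ (n,n') = 0 \<longrightarrow> neg_distr (nu n n') = return borel 0)"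
      using 2 by blast
    show "\<forall>t. (\<lambda>\<omega>. - W t \<omega>) \<in> borel_measurable M \<and> V t \<in> borel_measurable M" using W_meas V_meas by simp
    show "\<forall>\<omega>\<in>space M. - W 0 \<omega> = 0 \<and> V 0 \<omega> = 0 \<and> cadlag (\<lambda>t. - W t \<omega>) \<and> cadlag (\<lambda>t. V t \<omega>)"
    proof (intro ballI conjI)
      fix \<omega> assume w: "\<omega> \<in> space M"
      show "- W 0 \<omega> = 0" using wv(3)[OF w] by simp
      show "V 0 \<omega> = 0" by (rule wv(4)[OF w])
      show "cadlag (\<lambda>t. - W t \<omega>)" by (rule cadlag_uminus[OF wv(1)[OF w]])
      show "cadlag (\<lambda>t. V t \<omega>)" by (rule wv(2)[OF w])
    qed
  qed (use m 3 in blast)+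
qed

lemma strip_reflected: "strip_I N (\<lambda>n. neg_distr (mu n)) (\<lambda>n n'. neg_distr (nu n n')) = uminus ` strip_I N mu nu"
proof -
  note m = model[unfolded mm_model_def]
  have mu: "prob_space (mu n)" "sets (mu n) = sets borel" if "n < N" for n
    using m that by blast+
  have nu: "prob_space (nu n n')" "sets (nu n n') = sets borel" if "n < N" "n' < N" "n \<noteq> n'" for n n'
    using m that by blast+
  have "s \<in> strip_I N (\<lambda>n. neg_distr (mu n)) (\<lambda>n n'. neg_distr (nu n n')) \<longleftrightarrow> - s \<in> strip_I N mu nu" for s
    unfolding strip_I_def mem_Collect_eq
    by (intro arg_cong2[where f="(\<and>)"] all_cong1 imp_cong refl integrable_neg_distr mu nu)
  moreover have "- s \<in> strip_I N mu nu \<longleftrightarrow> s \<in> uminus ` strip_I N mu nu" for s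
  proof
    assume "- s \<in> strip_I N mu nu"
    from imageI[OF this, of uminus] show "s \<in> uminus ` strip_I N mu nu" by simp
  qed auto
  ultimately show ?thesis by blast
qed

lemma A_mat_reflected: "A_mat N Gen (\<lambda>n. neg_distr (mu n)) (\<lambda>n n'. neg_distr (nu n n')) phi s = A_mat N Gen mu nu phi (- s)"
proof -
  note m = model[unfolded mm_model_def]
  have mu: "mgf (neg_distr (mu n)) s = mgf (mu n) (- s)" if "n < N" for n
    by (rule mgf_neg_distr) (use m that in blast)+
  have nu: "mgf (neg_distr (nu n n')) s = mgf (nu n n') (- s)" if "n < N" "n' < N" "n \<noteq> n'" for n n'
    by (rule mgf_neg_distr) (use m that in blast)+
  show ?thesis unfolding A_mat_def by (rule eq_matI) (simp_all add: mu nu)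
qed

end

theorem theorem1:
  fixes M :: "'a measure" and N :: nat and varpi :: "nat \<Rightarrow> real" and Gen :: "real mat"
    and mu :: "nat \<Rightarrow> real measure" and psi :: "nat \<Rightarrow> real \<Rightarrow> complex"
    and nu :: "nat \<Rightarrow> nat \<Rightarrow> real measure" and phi :: "nat \<Rightarrow> real"
    and J :: "real \<Rightarrow> 'a \<Rightarrow> nat" and W V :: "real \<Rightarrow> 'a \<Rightarrow> real"
  assumes model: "mm_model M N varpi Gen mu psi nu phi J W V"
    and T_fin: "AE \<omega> in M. first_pos V \<omega> < \<infinity>"
    and irred: "irreducible_mat N Gen"
  shows
    "(\<forall>\<alpha>. \<alpha> > 0 \<and> \<alpha> \<in> interior (strip_I N mu nu) \<and>
        spectral_abscissa (map_mat complex_of_real (A_mat N Gen mu nu phi \<alpha>)) = 0 \<longrightarrow>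
      0 < Liminf at_top (\<lambda>w. ereal (exp (\<alpha> * w) *
              measure M {\<omega>\<in>space M. W (real_of_ereal (first_pos V \<omega>)) \<omega> > w})) \<and>
      Liminf at_top (\<lambda>w. ereal (exp (\<alpha> * w) *
              measure M {\<omega>\<in>space M. W (real_of_ereal (first_pos V \<omega>)) \<omega> > w}))
        \<le> Limsup at_top (\<lambda>w. ereal (exp (\<alpha> * w) *
              measure M {\<omega>\<in>space M. W (real_of_ereal (first_pos V \<omega>)) \<omega> > w})) \<and>
      Limsup at_top (\<lambda>w. ereal (exp (\<alpha> * w) *
              measure M {\<omega>\<in>space M. W (real_of_ereal (first_pos V \<omega>)) \<omega> > w})) < \<infinity>) \<and>
    (\<forall>\<beta>. \<beta> > 0 \<and> - \<beta> \<in> interior (strip_I N mu nu) \<and>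
        spectral_abscissa (map_mat complex_of_real (A_mat N Gen mu nu phi (- \<beta>))) = 0 \<longrightarrow>
      0 < Liminf at_top (\<lambda>w. ereal (exp (\<beta> * w) *
              measure M {\<omega>\<in>space M. W (real_of_ereal (first_pos V \<omega>)) \<omega> < - w})) \<and>
      Liminf at_top (\<lambda>w. ereal (exp (\<beta> * w) *
              measure M {\<omega>\<in>space M. W (real_of_ereal (first_pos V \<omega>)) \<omega> < - w}))
        \<le> Limsup at_top (\<lambda>w. ereal (exp (\<beta> * w) *
              measure M {\<omega>\<in>space M. W (real_of_ereal (first_pos V \<omega>)) \<omega> < - w})) \<and>
      Limsup at_top (\<lambda>w. ereal (exp (\<beta> * w) *
              measure M {\<omega>\<in>space M. W (real_of_ereal (first_pos V \<omega>)) \<omega> < - w})) < \<infinity>)"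
proof (intro conjI[of "All _"] allI impI, goal_cases)
  case (1 \<alpha>)
  then have a: "\<alpha> > 0" "\<alpha> \<in> interior (strip_I N mu nu)" "spectral_abscissa (map_mat complex_of_real (A_mat N Gen mu nu phi \<alpha>)) = 0" by blast+
  interpret mm_process M N varpi Gen mu psi nu phi J W V
    using model by (intro mm_process.intro mm_process_axioms.intro) (auto simp: mm_model_def)
  obtain c C where "c > 0" "\<And>w. w \<ge> 0 \<Longrightarrow> c * exp (- \<alpha> * w) \<le> measure M {\<omega>\<in>space M. W (tau \<omega>) \<omega> > w}"
     "\<And>w. w \<ge> 0 \<Longrightarrow> measure M {\<omega>\<in>space M. W (tau \<omega>) \<omega> > w} \<le> C * exp (- \<alpha> * w)"
    using tail_bounds[OF irred T_fin a] by blast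
  then show ?case unfolding tau_def by (rule Liminf_Limsup_exponential_tail)
next
  case (2 \<beta>)
  interpret W: mm_process M N varpi Gen mu psi nu phi J W V
    using model by (intro mm_process.intro mm_process_axioms.intro) (auto simp: mm_model_def)
  interpret R: mm_process M N varpi Gen "\<lambda>n. neg_distr (mu n)" "\<lambda>n th. psi n (- th)" "\<lambda>n n'. neg_distr (nu n n')" phi J "\<lambda>t \<omega>. - W t \<omega>" V
    by (intro mm_process.intro mm_process_axioms.intro W.prob_space_axioms W.reflected_model)
  have a: "\<beta> > 0" "- \<beta> \<in> interior (strip_I N mu nu)" "spectral_abscissa (map_mat complex_of_real (A_mat N Gen mu nu phi (- \<beta>))) = 0"
    using 2 by blast+
  have "- (- \<beta>) \<in> uminus ` interior (strip_I N mu nu)" by (rule imageI[OF a(2)])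
  then have i: "\<beta> \<in> interior (strip_I N (\<lambda>n. neg_distr (mu n)) (\<lambda>n n'. neg_distr (nu n n')))"
    unfolding W.strip_reflected interior_negations by simp
  have swap: "(- x > w) = (x < - w)" for x w :: real by auto
  obtain c C where "c > 0" "\<And>w. w \<ge> 0 \<Longrightarrow> c * exp (- \<beta> * w) \<le> measure M {\<omega>\<in>space M. - W (R.tau \<omega>) \<omega> > w}"
     "\<And>w. w \<ge> 0 \<Longrightarrow> measure M {\<omega>\<in>space M. - W (R.tau \<omega>) \<omega> > w} \<le> C * exp (- \<beta> * w)"
    using R.tail_bounds[OF irred T_fin a(1) i] a(3) unfolding W.A_mat_reflected by blast
  then show ?case unfolding R.tau_def swap by (rule Liminf_Limsup_exponential_tail)
qed

end
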